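(* Let $\mathbb K$ be a field. For every nc rational function $\mathfrak R$ of $x_1,\ldots,x_d$ over $\mathbb K$, $$edom^{st}(\mathfrak R)=dom(\mathfrak R).$$ Moreover, for every $n\in\mathbb N$, $$edom^{st}_n(\mathfrak R)=dom_n(\mathfrak R)=\{\underline X\in(\mathbb K^{n\times n})^d: I_s\otimes\underline X\in\Omega_{sn}(\mathcal R)\},$$ whenever $s\in\mathbb N$ and $\mathcal R$ is a minimal nc Fornasini--Marchesini realization of $\mathfrak R$ centred at a point of $dom_s(\mathfrak R)$.
   Context: Rational functions. Nc rational expressions in $x_1,\ldots,x_d$ over $\mathbb K$ are obtained from nc polynomials by successive additions, multiplications and inversions; $dom_n(R)$ is the set of $d$-tuples of $n\times n$ matrices over $\mathbb K$ at which all inverses in $R$ exist, $dom(R)=\coprod_n dom_n(R)$. $R_1,R_2$ are equivalent if they agree on $dom(R_1)\cap dom(R_2)$. A nc rational function $\mathfrak R$ is an equivalence class of expressions with nonempty domain; $dom(\mathfrak R)=\bigcup_{R\in\mathfrak R}dom(R)$, $dom_n(\mathfrak R)$ is its part of $n\times n$ matrices, and $\mathfrak R(\underline X)=R(\underline X)$ for any $R\in\mathfrak R$ with $\underline X\in dom(R)$. Stable extended domain. Let $\underline\Xi=(\Xi_1,\ldots,\Xi_d)$ be the $d$-tuple of $n\times n$ generic matrices (entries are $dn^2$ independent commuting variables). If $dom_n(\mathfrak R)\ne\emptyset$, put $\mathfrak R[n]=R(\underline\Xi)$ for any $R\in\mathfrak R$ with $dom_n(R)\neq\emptyset$; this is an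 $n\times n$ matrix of commutative rational functions, independent of $R$. $edom_n(\mathfrak R)\subseteq(\mathbb K^{n\times n})^d$ is the intersection of the domains of all entries of $\mathfrak R[n]$ (the domain of a commutative rational function is the set of points where its reduced denominator does not vanish), and $edom_n(\mathfrak R)=\emptyset$ if $dom_n(\mathfrak R)=\emptyset$. $edom^{st}_n(\mathfrak R)=\{\underline X\in(\mathbb K^{n\times n})^d: I_m\otimes\underline X\in edom_{mn}(\mathfrak R)\text{ for every }m\in\mathbb N\}$ and $edom^{st}(\mathfrak R)=\coprod_n edom^{st}_n(\mathfrak R)$. Realizations. A nc Fornasini--Marchesini realization $\mathcal R$ centred at $\underline Y=(Y_1,\ldots,Y_d)\in(\mathbb K^{s\times s})^d$, described by $(L;D,C,\underline{\mathbf A},\underline{\mathbf B})$, consists of an integer $L\ge0$, linear maps $\mathbf A_k:\mathbb K^{s\times s}\to\mathbb K^{L\times L}$, $\mathbf B_k:\mathbb K^{s\times s}\to\mathbb K^{L\times s}$ ($1\le k\le d$), and matrices $C\in\mathbb K^{s\times L}$, $D\in\mathbb K^{s\times s}$. A linear map $\mathbf T$ on $\mathbb K^{s\times s}$ is extended to $X=[X_{ij}]\in\mathbb K^{sm\times sm}$ with $s\times s$ blocks by $(X)\mathbf T=[\mathbf T(X_{ij})]$. For $\underline X\in(\mathbb K^{sm\times sm})^d$ put $\Lambda_{\underline{\mathbf A},\underline Y}(\underline X)=I_{Lm}-\sum_k(X_k-I_m\otimes Y_k)\mathbf A_k$, $\Omega_{sm}(\mathcal R)=\{\underline X\in(\mathbb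 K^{sm\times sm})^d:\det\Lambda_{\underline{\mathbf A},\underline Y}(\underline X)\ne0\}$ and, on this set, $\mathcal R(\underline X)=I_m\otimes D+(I_m\otimes C)\Lambda_{\underline{\mathbf A},\underline Y}(\underline X)^{-1}\sum_k(X_k-I_m\otimes Y_k)\mathbf B_k$. $\mathcal R$ is a realization of $\mathfrak R$ if $dom_{sm}(\mathfrak R)\subseteq\Omega_{sm}(\mathcal R)$ and $\mathfrak R=\mathcal R$ on $dom_{sm}(\mathfrak R)$ for all $m\in\mathbb N$; it is minimal if $L$ is smallest possible among realizations of $\mathfrak R$ centred at $\underline Y$. Here $\otimes$ is the Kronecker product $P\otimes Q=[p_{ij}Q]$ and $I_s\otimes\underline X=(I_s\otimes X_k)_k$. *)

theory Defs
  imports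
    "Jordan_Normal_Form.Determinant"
    "Jordan_Normal_Form.Gauss_Jordan_Elimination"
    "HOL-Computational_Algebra.Fraction_Field"
    "HOL-Library.Poly_Mapping"
    "HOL-Library.Nat_Bijection"
begin

text \<open>
  Conventions: variables are \<open>Var 0, \<dots>, Var (d - 1)\<close>; a \<open>d\<close>-tuple of \<open>n \<times> n\<close> matrices is a
  list of length \<open>d\<close>; matrix sizes \<open>n\<close>, \<open>m\<close>, \<open>s\<close> are positive, whereas the state dimension \<open>L\<close>
  of a realization may be 0. Matrix indices start at 0.
\<close>

definition mat_tuples :: "nat \<Rightarrow> nat \<Rightarrow> 'a mat list set" where
  "mat_tuples d n = {X. length X = d \<and> set X \<subseteq> carrier_mat n n}"

definition kronecker :: "'a::times mat \<Rightarrow> 'a mat \<Rightarrow> 'a mat" where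
  "kronecker P Q = mat (dim_row P * dim_row Q) (dim_col P * dim_col Q)
     (\<lambda>(i, j). P $$ (i div dim_row Q, j div dim_col Q) * Q $$ (i mod dim_row Q, j mod dim_col Q))"

definition amplify :: "nat \<Rightarrow> 'a::semiring_1 mat list \<Rightarrow> 'a mat list" where
  "amplify m X = map (kronecker (1\<^sub>m m)) X"

definition mat_sum :: "nat \<Rightarrow> nat \<Rightarrow> (nat \<Rightarrow> 'a::comm_monoid_add mat) \<Rightarrow> nat \<Rightarrow> 'a mat" where
  "mat_sum nr nc M d = mat nr nc (\<lambda>ij. \<Sum>k<d. M k $$ ij)"


section \<open>Noncommutative rational expressions and functions\<close>

datatype 'a ncexpr =
    Const 'a
  | Var nat
  | Add "'a ncexpr" "'a ncexpr"
  | Mult "'a ncexpr" "'a ncexpr"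
  | Inv "'a ncexpr"

primrec nc_vars :: "'a ncexpr \<Rightarrow> nat set" where
  "nc_vars (Const c) = {}"
| "nc_vars (Var k) = {k}"
| "nc_vars (Add r1 r2) = nc_vars r1 \<union> nc_vars r2"
| "nc_vars (Mult r1 r2) = nc_vars r1 \<union> nc_vars r2"
| "nc_vars (Inv r) = nc_vars r"

text \<open>
  Evaluation yields \<open>None\<close> iff some inverse fails to exist. The embedding \<open>\<phi>\<close> of the scalars is
  the identity for evaluation over the ground field, and the inclusion into the field of
  commutative rational functions for evaluation at generic matrices.
\<close>

primrec nc_eval :: "('a \<Rightarrow> 'b::field) \<Rightarrow> nat \<Rightarrow> 'b mat list \<Rightarrow> 'a ncexpr \<Rightarrow> 'b mat option" where
  "nc_eval \<phi> n X (Const c) = Some (\<phi> c \<cdot>\<^sub>m 1\<^sub>m n)"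
| "nc_eval \<phi> n X (Var k) = Some (X ! k)"
| "nc_eval \<phi> n X (Add r1 r2) =
     Option.bind (nc_eval \<phi> n X r1) (\<lambda>M1. map_option (\<lambda>M2. M1 + M2) (nc_eval \<phi> n X r2))"
| "nc_eval \<phi> n X (Mult r1 r2) =
     Option.bind (nc_eval \<phi> n X r1) (\<lambda>M1. map_option (\<lambda>M2. M1 * M2) (nc_eval \<phi> n X r2))"
| "nc_eval \<phi> n X (Inv r) = Option.bind (nc_eval \<phi> n X r) mat_inverse"

definition expr_dom :: "nat \<Rightarrow> nat \<Rightarrow> 'a::field ncexpr \<Rightarrow> 'a mat list set" where
  "expr_dom d n r = {X \<in> mat_tuples d n. nc_eval (\<lambda>c. c) n X r \<noteq> None}"

definition nondegenerate_exprs :: "nat \<Rightarrow> 'a::field ncexpr set" where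
  "nondegenerate_exprs d = {r. nc_vars r \<subseteq> {..<d} \<and> (\<exists>n\<ge>1. expr_dom d n r \<noteq> {})}"

definition nc_equiv :: "nat \<Rightarrow> ('a::field ncexpr \<times> 'a ncexpr) set" where
  "nc_equiv d = {(r1, r2). r1 \<in> nondegenerate_exprs d \<and> r2 \<in> nondegenerate_exprs d \<and>
     (\<forall>n\<ge>1. \<forall>X \<in> expr_dom d n r1 \<inter> expr_dom d n r2.
        nc_eval (\<lambda>c. c) n X r1 = nc_eval (\<lambda>c. c) n X r2)}"

definition nc_rat_funs :: "nat \<Rightarrow> 'a::field ncexpr set set" where
  "nc_rat_funs d = nondegenerate_exprs d // nc_equiv d"

definition nc_dom_n :: "nat \<Rightarrow> nat \<Rightarrow> 'a::field ncexpr set \<Rightarrow> 'a mat list set" where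
  "nc_dom_n d n F = (\<Union>r\<in>F. expr_dom d n r)"

definition nc_dom :: "nat \<Rightarrow> 'a::field ncexpr set \<Rightarrow> (nat \<times> 'a mat list) set" where
  "nc_dom d F = (SIGMA n:{1..}. nc_dom_n d n F)"

definition nc_value :: "nat \<Rightarrow> nat \<Rightarrow> 'a::field ncexpr set \<Rightarrow> 'a mat list \<Rightarrow> 'a mat" where
  "nc_value d n F X =
     (THE M. \<exists>r\<in>F. X \<in> expr_dom d n r \<and> nc_eval (\<lambda>c. c) n X r = Some M)"


section \<open>Commutative rational functions and generic matrices\<close>

type_synonym 'a cpoly = "(nat \<Rightarrow>\<^sub>0 nat) \<Rightarrow>\<^sub>0 'a"

definition cpoly_eval :: "(nat \<Rightarrow> 'a::comm_semiring_1) \<Rightarrow> 'a cpoly \<Rightarrow> 'a" where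
  "cpoly_eval x p = (\<Sum>mon\<in>Poly_Mapping.keys p. Poly_Mapping.lookup p mon *
     (\<Prod>v\<in>Poly_Mapping.keys mon. x v ^ Poly_Mapping.lookup mon v))"

definition cpoly_const :: "'a::zero \<Rightarrow> 'a cpoly" where
  "cpoly_const c = Poly_Mapping.single 0 c"

definition cpoly_var :: "nat \<Rightarrow> 'a::zero_neq_one cpoly" where
  "cpoly_var v = Poly_Mapping.single (Poly_Mapping.single v 1) 1"

text \<open>
  \<open>x\<close> lies in the domain of \<open>f\<close> iff the denominator of \<open>f\<close> in lowest terms does not vanish at \<open>x\<close>.
  The representation in lowest terms is unique up to units, i.e. nonzero constants.
  The constant \<^const>\<open>coprime\<close> is not available for this type, so coprimality is spelled out.
\<close>

definition in_crat_dom :: "(nat \<Rightarrow> 'a::field) \<Rightarrow> 'a cpoly fract \<Rightarrow> bool" where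
  "in_crat_dom x f \<longleftrightarrow> (\<exists>p q. q \<noteq> 0 \<and> f = Fract p q \<and>
     (\<forall>c. c dvd p \<longrightarrow> c dvd q \<longrightarrow> c dvd 1) \<and> cpoly_eval x q \<noteq> 0)"

text \<open>The variable standing for entry \<open>(i, j)\<close> of the \<open>k\<close>-th generic matrix.\<close>

definition entry_var :: "nat \<Rightarrow> nat \<Rightarrow> nat \<Rightarrow> nat" where
  "entry_var k i j = prod_encode (k, prod_encode (i, j))"

definition generic_mats :: "nat \<Rightarrow> nat \<Rightarrow> 'a::field cpoly fract mat list" where
  "generic_mats d n =
     map (\<lambda>k. mat n n (\<lambda>(i, j). Fract (cpoly_var (entry_var k i j)) 1)) [0..<d]"

text \<open>
  The point of affine space given by a matrix tuple. Variables that are no entries of the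
  generic matrices do not occur in the functions to be evaluated, and are sent to 0.
\<close>

definition entries_point :: "nat \<Rightarrow> nat \<Rightarrow> 'a::zero mat list \<Rightarrow> nat \<Rightarrow> 'a" where
  "entries_point d n X v =
     (case prod_decode v of (k, w) \<Rightarrow> case prod_decode w of (i, j) \<Rightarrow>
        if k < d \<and> i < n \<and> j < n then (X ! k) $$ (i, j) else 0)"

text \<open>Meaningful only if \<open>nc_dom_n d n F \<noteq> {}\<close>.\<close>

definition nc_generic_value :: "nat \<Rightarrow> nat \<Rightarrow> 'a::field ncexpr set \<Rightarrow> 'a cpoly fract mat" where
  "nc_generic_value d n F = (THE M. \<exists>r\<in>F. expr_dom d n r \<noteq> {} \<and>
     nc_eval (\<lambda>c. Fract (cpoly_const c) 1) n (generic_mats d n) r = Some M)"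

definition nc_edom_n :: "nat \<Rightarrow> nat \<Rightarrow> 'a::field ncexpr set \<Rightarrow> 'a mat list set" where
  "nc_edom_n d n F =
     (if nc_dom_n d n F = {} then {}
      else {X \<in> mat_tuples d n. \<forall>i<n. \<forall>j<n.
              in_crat_dom (entries_point d n X) (nc_generic_value d n F $$ (i, j))})"

definition nc_edom_st_n :: "nat \<Rightarrow> nat \<Rightarrow> 'a::field ncexpr set \<Rightarrow> 'a mat list set" where
  "nc_edom_st_n d n F =
     {X \<in> mat_tuples d n. \<forall>m\<ge>1. amplify m X \<in> nc_edom_n d (m * n) F}"

definition nc_edom_st :: "nat \<Rightarrow> 'a::field ncexpr set \<Rightarrow> (nat \<times> 'a mat list) set" where
  "nc_edom_st d F = (SIGMA n:{1..}. nc_edom_st_n d n F)"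


section \<open>Fornasini--Marchesini realizations\<close>

definition linear_mat_map :: "nat \<Rightarrow> nat \<Rightarrow> nat \<Rightarrow> ('a::field mat \<Rightarrow> 'a mat) \<Rightarrow> bool" where
  "linear_mat_map s nr nc T \<longleftrightarrow>
     (\<forall>M \<in> carrier_mat s s. T M \<in> carrier_mat nr nc) \<and>
     (\<forall>M \<in> carrier_mat s s. \<forall>N \<in> carrier_mat s s. T (M + N) = T M + T N) \<and>
     (\<forall>c. \<forall>M \<in> carrier_mat s s. T (c \<cdot>\<^sub>m M) = c \<cdot>\<^sub>m T M)"

definition mat_block :: "nat \<Rightarrow> 'a mat \<Rightarrow> nat \<Rightarrow> nat \<Rightarrow> 'a mat" where
  "mat_block s M p q = mat s s (\<lambda>(i, j). M $$ (p * s + i, q * s + j))"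

text \<open>
  \<open>T\<close>, mapping \<open>s \<times> s\<close> matrices to \<open>nr \<times> nc\<close> matrices, applied to each of the \<open>m\<^sup>2\<close> blocks of \<open>M\<close>.
\<close>

definition blockwise ::
  "nat \<Rightarrow> nat \<Rightarrow> nat \<Rightarrow> nat \<Rightarrow> ('a mat \<Rightarrow> 'a mat) \<Rightarrow> 'a mat \<Rightarrow> 'a mat" where
  "blockwise s nr nc m T M = mat (nr * m) (nc * m)
     (\<lambda>(i, j). T (mat_block s M (i div nr) (j div nc)) $$ (i mod nr, j mod nc))"

datatype 'a fm_real = FM
  (fm_L: nat)
  (fm_D: "'a mat")
  (fm_C: "'a mat")
  (fm_A: "nat \<Rightarrow> 'a mat \<Rightarrow> 'a mat")
  (fm_B: "nat \<Rightarrow> 'a mat \<Rightarrow> 'a mat")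

definition is_fm_real :: "nat \<Rightarrow> nat \<Rightarrow> 'a::field fm_real \<Rightarrow> bool" where
  "is_fm_real d s R \<longleftrightarrow>
     fm_D R \<in> carrier_mat s s \<and> fm_C R \<in> carrier_mat s (fm_L R) \<and>
     (\<forall>k<d. linear_mat_map s (fm_L R) (fm_L R) (fm_A R k) \<and>
            linear_mat_map s (fm_L R) s (fm_B R k))"

definition fm_pencil ::
  "nat \<Rightarrow> nat \<Rightarrow> 'a::field mat list \<Rightarrow> 'a fm_real \<Rightarrow> nat \<Rightarrow> 'a mat list \<Rightarrow> 'a mat" where
  "fm_pencil d s Y R m X = 1\<^sub>m (fm_L R * m) -
     mat_sum (fm_L R * m) (fm_L R * m)
       (\<lambda>k. blockwise s (fm_L R) (fm_L R) m (fm_A R k) (X ! k - kronecker (1\<^sub>m m) (Y ! k))) d"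

definition fm_domain ::
  "nat \<Rightarrow> nat \<Rightarrow> 'a::field mat list \<Rightarrow> 'a fm_real \<Rightarrow> nat \<Rightarrow> 'a mat list set" where
  "fm_domain d s Y R m = {X \<in> mat_tuples d (s * m). det (fm_pencil d s Y R m X) \<noteq> 0}"

definition fm_value ::
  "nat \<Rightarrow> nat \<Rightarrow> 'a::field mat list \<Rightarrow> 'a fm_real \<Rightarrow> nat \<Rightarrow> 'a mat list \<Rightarrow> 'a mat" where
  "fm_value d s Y R m X = kronecker (1\<^sub>m m) (fm_D R) +
     kronecker (1\<^sub>m m) (fm_C R) * the (mat_inverse (fm_pencil d s Y R m X)) *
     mat_sum (fm_L R * m) (s * m)
       (\<lambda>k. blockwise s (fm_L R) s m (fm_B R k) (X ! k - kronecker (1\<^sub>m m) (Y ! k))) d"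

definition fm_realizes ::
  "nat \<Rightarrow> nat \<Rightarrow> 'a::field mat list \<Rightarrow> 'a fm_real \<Rightarrow> 'a ncexpr set \<Rightarrow> bool" where
  "fm_realizes d s Y R F \<longleftrightarrow> is_fm_real d s R \<and>
     (\<forall>m\<ge>1. nc_dom_n d (s * m) F \<subseteq> fm_domain d s Y R m \<and>
        (\<forall>X \<in> nc_dom_n d (s * m) F. nc_value d (s * m) F X = fm_value d s Y R m X))"

definition fm_minimal ::
  "nat \<Rightarrow> nat \<Rightarrow> 'a::field mat list \<Rightarrow> 'a fm_real \<Rightarrow> 'a ncexpr set \<Rightarrow> bool" where
  "fm_minimal d s Y R F \<longleftrightarrow> fm_realizes d s Y R F \<and>
     (\<forall>R'. fm_realizes d s Y R' F \<longrightarrow> fm_L R \<le> fm_L R')"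

end

theory Submission
  imports Defs
begin


section \<open>Block indices\<close>

text \<open>The hard inclusion: a pole of the resolvent at a point could be hidden in the value of
  the function by cancellation. What is known is only that values are regular at
  \<open>t = 0\<close> along polynomial curves through amplifications of the point. Amplifications
  can be joined by block triangular curves whose corner block is \<open>t\<close> times a matrix
  unit; the value along them contains products of several resolvents with coefficients of the
  realization in between. Controllability and observability, phrased through such products, bring a
  single resolvent to light. The other factors depend on \<open>t\<close> as well; replacing
  \<open>t\<close> by \<open>t^j\<close> in the middle resolvent alone, with \<open>j\<close>
  arbitrary, separates its leading coefficient from them, and they are read off at
  \<open>t = 1\<close>, where the pencil is the identity. The field may be finite, so polynomial
  identities cannot be checked at its points; matrices representing \<open>K[t]/(g)\<close> serve as
  points instead. A second obstacle is the order of coordinates: the resolvent is a pencil in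
  \<open>X\<close> over the field at \<open>X \<otimes> I\<close>, while the statement concerns
  \<open>I \<otimes> X\<close>.\<close>

lemma block_index_less:
  fixes P M n x :: nat
  assumes "P < M" "x < n"
  shows "P * n + x < M * n"
proof -
  have "P * n + x < Suc P * n" using assms by simp
  also have "\<dots> \<le> M * n" using assms by (intro mult_right_mono) auto
  finally show ?thesis .
qed

lemma block_index_div_mod [simp]:
  fixes P n x :: nat
  assumes "x < n"
  shows "(P * n + x) div n = P" "(P * n + x) mod n = x"
  using assms by auto

lemma block_indexE:
  fixes i M n :: nat
  assumes "i < M * n"
  obtains P x where "P < M" "x < n" "i = P * n + x"
proof
  have "0 < n" using assms by (cases n) auto
  then show "i mod n < n" by simp
  show "i div n < M" using assms by (simp add: less_mult_imp_div_less)
  show "i = i div n * n + i mod n" by simp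
qed

lemma sum_block_index:
  "(\<Sum>i<M * n. f i) = (\<Sum>P<M. \<Sum>x<n. f (P * n + x :: nat))"
proof -
  have "(\<Sum>x\<in>{P * n..<P * n + n}. f x) = (\<Sum>x<n. f (P * n + x))" for P
    by (rule sum.reindex_bij_witness[of _ "\<lambda>x. P * n + x" "\<lambda>x. x - P * n"]) auto
  then show ?thesis
    by (simp flip: sum.nat_group)
qed

lemma mult_mat_index:
  assumes "A \<in> carrier_mat n m" "B \<in> carrier_mat m k" "i < n" "j < k"
  shows "(A * B) $$ (i, j) = (\<Sum>l<m. A $$ (i, l) * B $$ (l, j))"
  using assms by (auto simp: scalar_prod_def lessThan_atLeast0 intro!: sum.cong)

lemma mult_mat_block_index:
  assumes "A \<in> carrier_mat n (M * m)" "B \<in> carrier_mat (M * m) k" "i < n" "j < k"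
  shows "(A * B) $$ (i, j) = (\<Sum>Q<M. \<Sum>x<m. A $$ (i, Q * m + x) * B $$ (Q * m + x, j))"
  using assms by (simp only: mult_mat_index[OF assms] sum_block_index)

lemma eq_mat_blockI:
  assumes "A \<in> carrier_mat (M * n) (M' * n')" "B \<in> carrier_mat (M * n) (M' * n')"
    and "\<And>P x Q y. P < M \<Longrightarrow> x < n \<Longrightarrow> Q < M' \<Longrightarrow> y < n' \<Longrightarrow>
      A $$ (P * n + x, Q * n' + y) = B $$ (P * n + x, Q * n' + y)"
  shows "A = B"
  using assms by (intro eq_matI) (auto elim!: block_indexE)


section \<open>Affine systems\<close>

text \<open>
  Matrices consisting of \<open>M \<times> M\<close> blocks of size \<open>nr \<times> nc\<close>, where block \<open>(P, Q)\<close> depends affinely on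
  the \<open>s \<times> s\<close> blocks \<open>(P, Q)\<close> of a tuple \<open>T\<close> of square matrices of size \<open>s * M\<close>; the constant part
  \<open>G\<close> enters the diagonal blocks only.
\<close>

definition aff_entry :: "('a \<Rightarrow> 'b::comm_ring_1) \<Rightarrow> nat \<Rightarrow> nat \<Rightarrow> (nat \<Rightarrow> nat \<Rightarrow> 'a) \<Rightarrow>
    (nat \<Rightarrow> nat \<Rightarrow> nat \<Rightarrow> nat \<Rightarrow> nat \<Rightarrow> 'a) \<Rightarrow> 'b mat list \<Rightarrow> nat \<Rightarrow> nat \<Rightarrow> nat \<Rightarrow> nat \<Rightarrow> 'b" where
  "aff_entry \<phi> d s G a T P \<alpha> Q \<beta> = (if P = Q then \<phi> (G \<alpha> \<beta>) else 0) +
     (\<Sum>k<d. \<Sum>x<s. \<Sum>y<s. (T ! k) $$ (P * s + x, Q * s + y) * \<phi> (a k x y \<alpha> \<beta>))"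

definition aff :: "('a \<Rightarrow> 'b::comm_ring_1) \<Rightarrow> nat \<Rightarrow> nat \<Rightarrow> nat \<Rightarrow> nat \<Rightarrow> nat \<Rightarrow> (nat \<Rightarrow> nat \<Rightarrow> 'a) \<Rightarrow>
    (nat \<Rightarrow> nat \<Rightarrow> nat \<Rightarrow> nat \<Rightarrow> nat \<Rightarrow> 'a) \<Rightarrow> 'b mat list \<Rightarrow> 'b mat" where
  "aff \<phi> d s nr nc M G a T = mat (M * nr) (M * nc)
     (\<lambda>(i, j). aff_entry \<phi> d s G a T (i div nr) (i mod nr) (j div nc) (j mod nc))"

text \<open>This is \<open>I_M \<otimes> G\<close> after embedding the scalars. Coefficients are
  plain functions of indices, so that one system can be evaluated over several rings.\<close>

definition block_diag :: "('a \<Rightarrow> 'b::zero) \<Rightarrow> nat \<Rightarrow> nat \<Rightarrow> nat \<Rightarrow> (nat \<Rightarrow> nat \<Rightarrow> 'a) \<Rightarrow> 'b mat" where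
  "block_diag \<phi> nr nc M G = mat (M * nr) (M * nc)
     (\<lambda>(i, j). if i div nr = j div nc then \<phi> (G (i mod nr) (j mod nc)) else 0)"

text \<open>
  The common shape of linearizations of expressions (block size \<open>s = 1\<close>) and of
  Fornasini--Marchesini realizations: the value at \<open>T\<close> is \<open>D + C \<Lambda>(T)\<inverse> \<B>(T)\<close> with \<open>\<Lambda>\<close> and \<open>\<B>\<close> affine.
\<close>

datatype 'a sys = Sys
  (sys_L: nat)
  (sys_G: "nat \<Rightarrow> nat \<Rightarrow> 'a")
  (sys_a: "nat \<Rightarrow> nat \<Rightarrow> nat \<Rightarrow> nat \<Rightarrow> nat \<Rightarrow> 'a")
  (sys_B: "nat \<Rightarrow> nat \<Rightarrow> 'a")
  (sys_b: "nat \<Rightarrow> nat \<Rightarrow> nat \<Rightarrow> nat \<Rightarrow> nat \<Rightarrow> 'a")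
  (sys_C: "nat \<Rightarrow> nat \<Rightarrow> 'a")
  (sys_D: "nat \<Rightarrow> nat \<Rightarrow> 'a")

context
  fixes \<phi> :: "'a \<Rightarrow> 'b::comm_ring_1" and d s M :: nat and S :: "'a sys"
begin

definition lam :: "'b mat list \<Rightarrow> 'b mat" where
  "lam = aff \<phi> d s (sys_L S) (sys_L S) M (sys_G S) (sys_a S)"

definition rhs :: "'b mat list \<Rightarrow> 'b mat" where
  "rhs = aff \<phi> d s (sys_L S) s M (sys_B S) (sys_b S)"

definition diagC :: "'b mat" where
  "diagC = block_diag \<phi> s (sys_L S) M (sys_C S)"

definition diagD :: "'b mat" where
  "diagD = block_diag \<phi> s s M (sys_D S)"

definition den :: "'b mat list \<Rightarrow> 'b" where
  "den T = det (lam T)"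

text \<open>The value multiplied by \<open>den\<close>, with the adjugate in place of the inverse.
  It makes sense over every commutative ring, in particular over polynomial rings, and specializes
  without any condition.\<close>

definition num :: "'b mat list \<Rightarrow> 'b mat" where
  "num T = den T \<cdot>\<^sub>m diagD + diagC * (adj_mat (lam T) * rhs T)"

lemma aff_carrier [simp]: "aff \<phi> d s nr nc M G a T \<in> carrier_mat (M * nr) (M * nc)"
  by (simp add: aff_def)

lemma block_diag_carrier [simp]: "block_diag \<phi> nr nc M G \<in> carrier_mat (M * nr) (M * nc)"
  by (simp add: block_diag_def)

lemma sys_carrier [simp]:
  "lam T \<in> carrier_mat (M * sys_L S) (M * sys_L S)"
  "rhs T \<in> carrier_mat (M * sys_L S) (M * s)"
  "diagC \<in> carrier_mat (M * s) (M * sys_L S)"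
  "diagD \<in> carrier_mat (M * s) (M * s)"
  by (simp_all add: lam_def rhs_def diagC_def diagD_def)

lemma adj_lam_carrier [simp]: "adj_mat (lam T) \<in> carrier_mat (M * sys_L S) (M * sys_L S)"
  by (rule adj_mat(1)) simp

lemma num_carrier [simp]: "num T \<in> carrier_mat (M * s) (M * s)"
  unfolding num_def
  by (rule add_carrier_mat, rule mult_carrier_mat[OF sys_carrier(3) mult_carrier_mat[OF adj_lam_carrier sys_carrier(2)]])

end

lemma sys_dims [simp]:
  "dim_row (aff \<phi> d s nr nc M G a T) = M * nr" "dim_col (aff \<phi> d s nr nc M G a T) = M * nc"
  "dim_row (block_diag \<psi> nr nc M G) = M * nr" "dim_col (block_diag \<psi> nr nc M G) = M * nc"
  "dim_row (lam \<phi> d s M S T) = M * sys_L S" "dim_col (lam \<phi> d s M S T) = M * sys_L S"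
  "dim_row (rhs \<phi> d s M S T) = M * sys_L S" "dim_col (rhs \<phi> d s M S T) = M * s"
  "dim_row (diagC \<psi> s M S) = M * s" "dim_col (diagC \<psi> s M S) = M * sys_L S"
  "dim_row (diagD \<psi> s M S) = M * s" "dim_col (diagD \<psi> s M S) = M * s"
  "dim_row (num \<phi> d s M S T) = M * s" "dim_col (num \<phi> d s M S T) = M * s"
  by (simp_all add: aff_def block_diag_def lam_def rhs_def diagC_def diagD_def carrier_matD[OF num_carrier])

lemma aff_index [simp]:
  assumes "P < M" "\<alpha> < nr" "Q < M" "\<beta> < nc"
  shows "aff \<phi> d s nr nc M G a T $$ (P * nr + \<alpha>, Q * nc + \<beta>) = aff_entry \<phi> d s G a T P \<alpha> Q \<beta>"
  using assms by (simp add: aff_def block_index_less)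

lemma block_diag_index [simp]:
  assumes "P < M" "\<alpha> < nr" "Q < M" "\<beta> < nc"
  shows "block_diag \<phi> nr nc M G $$ (P * nr + \<alpha>, Q * nc + \<beta>) = (if P = Q then \<phi> (G \<alpha> \<beta>) else 0)"
  using assms by (simp add: block_diag_def block_index_less)

text \<open>The value over a field.\<close>

definition is_val :: "('a \<Rightarrow> 'b::field) \<Rightarrow> nat \<Rightarrow> nat \<Rightarrow> nat \<Rightarrow> 'a sys \<Rightarrow> 'b mat list \<Rightarrow> 'b mat \<Rightarrow> bool" where
  "is_val \<phi> d s M S T V \<longleftrightarrow> den \<phi> d s M S T \<noteq> 0 \<and>
     (\<exists>U \<in> carrier_mat (M * sys_L S) (M * s). lam \<phi> d s M S T * U = rhs \<phi> d s M S T \<and>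
        V = diagD \<phi> s M S + diagC \<phi> s M S * U)"

text \<open>Multiplying the equation for \<open>U\<close> by the adjugate gives \<open>den\<close>
  times \<open>U\<close>; nothing has to be inverted.\<close>

lemma num_eq_if_solution:
  fixes U :: "'b::comm_ring_1 mat"
  assumes U: "U \<in> carrier_mat (M * sys_L S) (M * s)" and eq: "lam \<phi> d s M S T * U = rhs \<phi> d s M S T"
  shows "num \<phi> d s M S T = den \<phi> d s M S T \<cdot>\<^sub>m (diagD \<phi> s M S + diagC \<phi> s M S * U)"
proof -
  let ?l = "lam \<phi> d s M S T" and ?n = "M * sys_L S"
  note l = sys_carrier(1)[of \<phi> d s M S T]
  have "adj_mat ?l * rhs \<phi> d s M S T = (adj_mat ?l * ?l) * U"
    by (subst assoc_mult_mat[OF adj_lam_carrier l U]) (simp add: eq)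
  also have "\<dots> = den \<phi> d s M S T \<cdot>\<^sub>m U"
    using U by (simp add: adj_mat(3)[OF l] den_def mult_smult_assoc_mat[OF one_carrier_mat])
  finally have "num \<phi> d s M S T = den \<phi> d s M S T \<cdot>\<^sub>m diagD \<phi> s M S +
      den \<phi> d s M S T \<cdot>\<^sub>m (diagC \<phi> s M S * U)"
    using U by (simp add: num_def mult_smult_distrib[OF sys_carrier(3)])
  then show ?thesis
    using U by (simp add: add_smult_distrib_left_mat[OF sys_carrier(4) mult_carrier_mat[OF sys_carrier(3) U]])
qed

text \<open>Cramer's rule. It trades the existence of a solution for an identity between
  \<open>num\<close> and \<open>den\<close>, which can be transported along ring
  homomorphisms.\<close>

lemma is_val_iff:
  fixes T :: "'b::field mat list"
  shows "is_val \<phi> d s M S T V \<longleftrightarrow> den \<phi> d s M S T \<noteq> 0 \<and> V \<in> carrier_mat (M * s) (M * s) \<and>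
    num \<phi> d s M S T = den \<phi> d s M S T \<cdot>\<^sub>m V" (is "?L \<longleftrightarrow> ?R")
proof
  assume ?L
  then obtain U where U: "U \<in> carrier_mat (M * sys_L S) (M * s)"
      "lam \<phi> d s M S T * U = rhs \<phi> d s M S T" "V = diagD \<phi> s M S + diagC \<phi> s M S * U"
    and "den \<phi> d s M S T \<noteq> 0"
    unfolding is_val_def by auto
  moreover have "V \<in> carrier_mat (M * s) (M * s)"
    using U(1) by (auto simp: U(3) intro!: add_carrier_mat mult_carrier_mat)
  ultimately show ?R using num_eq_if_solution[OF U(1,2)] by simp
next
  assume R: ?R
  let ?l = "lam \<phi> d s M S T" and ?n = "M * sys_L S" and ?\<delta> = "den \<phi> d s M S T"
  note l = sys_carrier(1)[of \<phi> d s M S T]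
  define U where "U = inverse ?\<delta> \<cdot>\<^sub>m (adj_mat ?l * rhs \<phi> d s M S T)"
  have U: "U \<in> carrier_mat ?n (M * s)"
    unfolding U_def by (rule smult_carrier_mat, rule mult_carrier_mat[OF adj_lam_carrier sys_carrier(2)])
  have "?l * U = inverse ?\<delta> \<cdot>\<^sub>m ((?l * adj_mat ?l) * rhs \<phi> d s M S T)"
    unfolding U_def
    by (subst mult_smult_distrib[OF l mult_carrier_mat[OF adj_lam_carrier sys_carrier(2)]],
        subst assoc_mult_mat[OF l adj_lam_carrier sys_carrier(2)]) simp
  also have "\<dots> = rhs \<phi> d s M S T"
    using R by (simp add: adj_mat(2)[OF l] den_def[symmetric] mult_smult_assoc_mat[OF one_carrier_mat sys_carrier(2)]
        left_mult_one_mat[OF sys_carrier(2)]) (auto intro!: eq_matI)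
  finally have eq: "?l * U = rhs \<phi> d s M S T" .
  have "?\<delta> \<cdot>\<^sub>m V = ?\<delta> \<cdot>\<^sub>m (diagD \<phi> s M S + diagC \<phi> s M S * U)"
    using R num_eq_if_solution[OF U eq] by simp
  then have "inverse ?\<delta> \<cdot>\<^sub>m (?\<delta> \<cdot>\<^sub>m V) = inverse ?\<delta> \<cdot>\<^sub>m (?\<delta> \<cdot>\<^sub>m (diagD \<phi> s M S + diagC \<phi> s M S * U))"
    by simp
  moreover have "inverse ?\<delta> \<cdot>\<^sub>m (?\<delta> \<cdot>\<^sub>m W) = W" for W
    using R by (auto intro!: eq_matI)
  ultimately have "V = diagD \<phi> s M S + diagC \<phi> s M S * U" by simp
  then show ?L using R U eq unfolding is_val_def by blast
qed

lemma is_val_unique: "is_val \<phi> d s M S T V \<Longrightarrow> is_val \<phi> d s M S T W \<Longrightarrow> V = W"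
proof -
  assume a: "is_val \<phi> d s M S T V" "is_val \<phi> d s M S T W"
  then have "inverse (den \<phi> d s M S T) \<cdot>\<^sub>m (den \<phi> d s M S T \<cdot>\<^sub>m V) =
      inverse (den \<phi> d s M S T) \<cdot>\<^sub>m (den \<phi> d s M S T \<cdot>\<^sub>m W)"
    by (simp add: is_val_iff)
  moreover have "inverse (den \<phi> d s M S T) \<cdot>\<^sub>m (den \<phi> d s M S T \<cdot>\<^sub>m W) = W" for W
    using a by (auto simp: is_val_iff intro!: eq_matI)
  ultimately show "V = W" by simp
qed

lemma is_val_exists: "den \<phi> d s M S T \<noteq> 0 \<Longrightarrow> \<exists>V. is_val \<phi> d s M S T V"
  by (rule exI[of _ "inverse (den \<phi> d s M S T) \<cdot>\<^sub>m num \<phi> d s M S T"], unfold is_val_iff)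
    (intro conjI smult_carrier_mat num_carrier eq_matI, auto)


subsection \<open>Ring homomorphisms\<close>

lemma mat_tuplesD:
  assumes "T \<in> mat_tuples d n"
  shows "length T = d" "k < d \<Longrightarrow> T ! k \<in> carrier_mat n n"
  using assms by (auto simp: mat_tuples_def)

context comm_ring_hom
begin

lemma mat_hom_adj:
  assumes A: "A \<in> carrier_mat n n"
  shows "adj_mat (map_mat hom A) = map_mat hom (adj_mat A)"
proof (rule eq_matI)
  fix i j assume ij: "i < dim_row (map_mat hom (adj_mat A))" "j < dim_col (map_mat hom (adj_mat A))"
  have "mat_delete (map_mat hom A) j i = map_mat hom (mat_delete A j i)"
    using A ij by (auto intro!: eq_matI simp: mat_delete_def adj_mat_def)
  then show "adj_mat (map_mat hom A) $$ (i, j) = map_mat hom (adj_mat A) $$ (i, j)"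
    using A ij by (simp add: adj_mat_def cofactor_def hom_distribs)
qed (auto simp: adj_mat_def)

lemma map_mat_tuples: "T \<in> mat_tuples d n \<Longrightarrow> map (map_mat hom) T \<in> mat_tuples d n"
  by (auto simp: mat_tuples_def)

lemma aff_entry_hom:
  assumes T: "T \<in> mat_tuples d (s * M)" and "P < M" "Q < M"
  shows "aff_entry (\<lambda>c. hom (\<phi> c)) d s G a (map (map_mat hom) T) P \<alpha> Q \<beta> =
    hom (aff_entry \<phi> d s G a T P \<alpha> Q \<beta>)"
proof -
  have "(map (map_mat hom) T ! k) $$ (P * s + x, Q * s + y) = hom ((T ! k) $$ (P * s + x, Q * s + y))"
    if "k < d" "x < s" "y < s" for k x y
  proof -
    have "T ! k \<in> carrier_mat (M * s) (M * s)"
      using mat_tuplesD(2)[OF T \<open>k < d\<close>] by (simp add: mult.commute)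
    then show ?thesis
      using that mat_tuplesD(1)[OF T] block_index_less[of P M x s] block_index_less[of Q M y s] assms
      by auto
  qed
  then show ?thesis by (simp add: aff_entry_def hom_distribs)
qed

lemma aff_hom:
  assumes T: "T \<in> mat_tuples d (s * M)"
  shows "aff (\<lambda>c. hom (\<phi> c)) d s nr nc M G a (map (map_mat hom) T) = map_mat hom (aff \<phi> d s nr nc M G a T)"
  by (rule eq_mat_blockI[of _ M nr M nc])
    (auto simp: aff_entry_hom[OF T] block_index_less carrier_matD[OF aff_carrier])

lemma block_diag_hom:
  "block_diag (\<lambda>c. hom (\<phi> c)) nr nc M G = map_mat hom (block_diag \<phi> nr nc M G)"
  by (rule eq_mat_blockI[of _ M nr M nc])
    (auto simp: block_index_less)

lemma den_hom:
  assumes T: "T \<in> mat_tuples d (s * M)"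
  shows "den (\<lambda>c. hom (\<phi> c)) d s M S (map (map_mat hom) T) = hom (den \<phi> d s M S T)"
  by (simp add: den_def lam_def aff_hom[OF T])

text \<open>Numerators and denominators are polynomial in the entries of the tuple, hence commute
  with every specialization: generic matrices to a curve, a curve to a point.\<close>

lemma num_hom:
  assumes T: "T \<in> mat_tuples d (s * M)"
  shows "num (\<lambda>c. hom (\<phi> c)) d s M S (map (map_mat hom) T) = map_mat hom (num \<phi> d s M S T)"
proof -
  let ?l = "lam \<phi> d s M S T"
  note c = sys_carrier(1,2)[of \<phi> d s M S T] sys_carrier(3,4)[of \<phi> s M S]
  have lam: "lam (\<lambda>c. hom (\<phi> c)) d s M S (map (map_mat hom) T) = map_mat hom ?l"
    and rhs: "rhs (\<lambda>c. hom (\<phi> c)) d s M S (map (map_mat hom) T) = map_mat hom (rhs \<phi> d s M S T)"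
    by (simp_all add: lam_def rhs_def aff_hom[OF T])
  have C: "diagC (\<lambda>c. hom (\<phi> c)) s M S = map_mat hom (diagC \<phi> s M S)"
    and D: "diagD (\<lambda>c. hom (\<phi> c)) s M S = map_mat hom (diagD \<phi> s M S)"
    by (simp_all add: diagC_def diagD_def block_diag_hom)
  have p: "adj_mat ?l * rhs \<phi> d s M S T \<in> carrier_mat (M * sys_L S) (M * s)"
    by (rule mult_carrier_mat[OF adj_lam_carrier c(2)])
  have smult: "map_mat hom (x \<cdot>\<^sub>m A) = hom x \<cdot>\<^sub>m map_mat hom A" for x A
    by (auto intro!: eq_matI simp: hom_distribs)
  have "map_mat hom (num \<phi> d s M S T) = map_mat hom (den \<phi> d s M S T \<cdot>\<^sub>m diagD \<phi> s M S) +
      map_mat hom (diagC \<phi> s M S * (adj_mat ?l * rhs \<phi> d s M S T))"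
    unfolding num_def using mult_carrier_mat[OF c(3) p] c(4)
    by (intro eq_matI) (auto simp: hom_distribs)
  also have "\<dots> = hom (den \<phi> d s M S T) \<cdot>\<^sub>m map_mat hom (diagD \<phi> s M S) +
      map_mat hom (diagC \<phi> s M S) * (map_mat hom (adj_mat ?l) * map_mat hom (rhs \<phi> d s M S T))"
    by (simp add: mat_hom_mult[OF c(3) p] mat_hom_mult[OF adj_lam_carrier c(2)] smult)
  finally show ?thesis
    by (simp add: num_def den_hom[OF T] lam rhs C D mat_hom_adj[OF c(1)])
qed

end


lemma smult_smult_mat_assoc: "a \<cdot>\<^sub>m (b \<cdot>\<^sub>m A) = (a * b) \<cdot>\<^sub>m (A :: 'a::comm_ring_1 mat)"
  by (rule eq_matI) (auto simp: mult.assoc)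

section \<open>Matrix representations of the polynomial ring\<close>

text \<open>Each entry is replaced by its image under \<open>\<rho>\<close>; the index inside these images is the outer one.\<close>

definition rep_mat :: "nat \<Rightarrow> ('b \<Rightarrow> 'a mat) \<Rightarrow> 'b mat \<Rightarrow> 'a mat" where
  "rep_mat e \<rho> A = mat (e * dim_row A) (e * dim_col A)
     (\<lambda>(i, j). \<rho> (A $$ (i mod dim_row A, j mod dim_col A)) $$ (i div dim_row A, j div dim_col A))"

text \<open>A unital ring homomorphism into matrices: elements of the ring are seen as matrices over
  the ground field. That it maps 0 to 0 follows from additivity.\<close>

locale mat_rep =
  fixes e :: nat and \<rho> :: "'b::comm_ring_1 \<Rightarrow> 'a::field mat"
  assumes carrier [simp]: "\<rho> x \<in> carrier_mat e e"
    and one: "\<rho> 1 = 1\<^sub>m e"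
    and add: "\<rho> (x + y) = \<rho> x + \<rho> y"
    and mult: "\<rho> (x * y) = \<rho> x * \<rho> y"
begin

lemma dims [simp]: "dim_row (\<rho> x) = e" "dim_col (\<rho> x) = e"
  using carrier_matD[OF carrier[of x]] by auto

lemma add_index: "a < e \<Longrightarrow> b < e \<Longrightarrow> \<rho> (x + y) $$ (a, b) = \<rho> x $$ (a, b) + \<rho> y $$ (a, b)"
  by (simp add: add)

lemma zero_index: "a < e \<Longrightarrow> b < e \<Longrightarrow> \<rho> 0 $$ (a, b) = 0"
  using add_index[of a b 0 0] by (metis add_cancel_right_right add.right_neutral)

lemma sum_index: "a < e \<Longrightarrow> b < e \<Longrightarrow> \<rho> (\<Sum>i\<in>I. f i) $$ (a, b) = (\<Sum>i\<in>I. \<rho> (f i) $$ (a, b))"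
  by (induction I rule: infinite_finite_induct) (auto simp: zero_index add_index)

lemma mult_index: "a < e \<Longrightarrow> b < e \<Longrightarrow> \<rho> (x * y) $$ (a, b) = (\<Sum>c<e. \<rho> x $$ (a, c) * \<rho> y $$ (c, b))"
  by (simp only: mult mult_mat_index[OF carrier carrier])

lemma rep_mat_carrier [simp]: "A \<in> carrier_mat n m \<Longrightarrow> rep_mat e \<rho> A \<in> carrier_mat (e * n) (e * m)"
  by (auto simp: rep_mat_def)

lemma rep_mat_index [simp]:
  assumes "A \<in> carrier_mat n m" "a < e" "i < n" "b < e" "j < m"
  shows "rep_mat e \<rho> A $$ (a * n + i, b * m + j) = \<rho> (A $$ (i, j)) $$ (a, b)"
  using assms by (auto simp: rep_mat_def block_index_less)

lemma rep_mat_mult: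
  assumes A: "A \<in> carrier_mat n l" and B: "B \<in> carrier_mat l m"
  shows "rep_mat e \<rho> (A * B) = rep_mat e \<rho> A * rep_mat e \<rho> B"
proof (rule eq_mat_blockI[of _ e n e m])
  have AB: "A * B \<in> carrier_mat n m" using A B by simp
  show "rep_mat e \<rho> (A * B) \<in> carrier_mat (e * n) (e * m)" using AB by simp
  show "rep_mat e \<rho> A * rep_mat e \<rho> B \<in> carrier_mat (e * n) (e * m)"
    by (rule mult_carrier_mat[OF rep_mat_carrier[OF A] rep_mat_carrier[OF B]])
  fix a i b j assume *: "a < e" "i < n" "b < e" "j < m"
  have "rep_mat e \<rho> (A * B) $$ (a * n + i, b * m + j) = \<rho> (\<Sum>k<l. A $$ (i, k) * B $$ (k, j)) $$ (a, b)"
    using * by (simp add: rep_mat_index[OF AB] mult_mat_index[OF A B])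
  also have "\<dots> = (\<Sum>k<l. \<Sum>c<e. \<rho> (A $$ (i, k)) $$ (a, c) * \<rho> (B $$ (k, j)) $$ (c, b))"
    using * by (simp add: sum_index mult_index)
  also have "\<dots> = (\<Sum>c<e. \<Sum>k<l. \<rho> (A $$ (i, k)) $$ (a, c) * \<rho> (B $$ (k, j)) $$ (c, b))"
    by (rule sum.swap)
  also have "\<dots> = (rep_mat e \<rho> A * rep_mat e \<rho> B) $$ (a * n + i, b * m + j)"
    using * by (subst mult_mat_block_index[OF rep_mat_carrier[OF A] rep_mat_carrier[OF B]])
      (auto simp: block_index_less rep_mat_index[OF A] rep_mat_index[OF B])
  finally show "rep_mat e \<rho> (A * B) $$ (a * n + i, b * m + j) =
      (rep_mat e \<rho> A * rep_mat e \<rho> B) $$ (a * n + i, b * m + j)" .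
qed

lemma rep_mat_add:
  assumes A: "A \<in> carrier_mat n m" and B: "B \<in> carrier_mat n m"
  shows "rep_mat e \<rho> (A + B) = rep_mat e \<rho> A + rep_mat e \<rho> B"
proof (rule eq_mat_blockI[of _ e n e m])
  fix a i b j assume *: "a < e" "i < n" "b < e" "j < m"
  then have "a * n + i < e * n" "b * m + j < e * m" by (simp_all add: block_index_less)
  then show "rep_mat e \<rho> (A + B) $$ (a * n + i, b * m + j) =
      (rep_mat e \<rho> A + rep_mat e \<rho> B) $$ (a * n + i, b * m + j)"
    using * A B rep_mat_carrier[OF A] rep_mat_carrier[OF B]
    by (simp add: rep_mat_index[OF add_carrier_mat[OF B]] rep_mat_index[OF A] rep_mat_index[OF B] add_index
        del: rep_mat_carrier)
qed (use A B in auto)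

lemma rep_mat_one: "rep_mat e \<rho> (1\<^sub>m n) = 1\<^sub>m (e * n)"
proof (rule eq_mat_blockI[of _ e n e n])
  fix a i b j assume *: "a < e" "i < n" "b < e" "j < n"
  have "a * n + i = b * n + j \<longleftrightarrow> a = b \<and> i = j"
    using * by (metis block_index_div_mod)
  then show "rep_mat e \<rho> (1\<^sub>m n) $$ (a * n + i, b * n + j) = 1\<^sub>m (e * n) $$ (a * n + i, b * n + j)"
    using * by (auto simp: block_index_less zero_index one)
qed auto

lemma mat_tuples_rep:
  "T \<in> mat_tuples d n \<Longrightarrow> map (rep_mat e \<rho>) T \<in> mat_tuples d (e * n)"
  by (auto simp: mat_tuples_def)

end

section \<open>Representations linear over the ground field\<close>

locale scalar_mat_rep = mat_rep e \<rho> for e and \<rho> :: "'b::comm_ring_1 \<Rightarrow> 'a::field mat" +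
  fixes \<phi> :: "'a \<Rightarrow> 'b"
  assumes scalar: "\<rho> (\<phi> c) = c \<cdot>\<^sub>m 1\<^sub>m e"
begin

text \<open>The coefficients of the system come from the field and act as scalars under \<rho>, so
  they pass through. Because the index inside the images is the outer one, the \<open>s\<close> by
  \<open>s\<close> blocks of the tuple stay contiguous and only their number grows from
  \<open>M\<close> to \<open>e * M\<close>.\<close>

lemma rep_mat_aff:
  assumes T: "T \<in> mat_tuples d (s * M)"
  shows "rep_mat e \<rho> (aff \<phi> d s nr nc M G a T) = aff (\<lambda>c. c) d s nr nc (e * M) G a (map (rep_mat e \<rho>) T)"
proof (rule eq_mat_blockI[of _ e "M * nr" e "M * nc"])
  fix p i q j assume *: "p < e" "i < M * nr" "q < e" "j < M * nc"
  obtain P \<alpha> where P: "P < M" "\<alpha> < nr" and i: "i = P * nr + \<alpha>" using * by (elim block_indexE)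
  obtain Q \<beta> where Q: "Q < M" "\<beta> < nc" and j: "j = Q * nc + \<beta>" using * by (elim block_indexE)
  have scalar_index: "\<rho> (\<phi> c) $$ (p, q) = (if p = q then c else 0)" for c
    using * by (simp add: scalar)
  have tm: "\<rho> ((T ! k) $$ (P * s + x, Q * s + y) * \<phi> c) $$ (p, q) =
      (map (rep_mat e \<rho>) T ! k) $$ ((p * M + P) * s + x, (q * M + Q) * s + y) * c"
    if "k < d" "x < s" "y < s" for k x y c
  proof -
    have Tk: "T ! k \<in> carrier_mat (M * s) (M * s)" "k < length T"
      using mat_tuplesD[OF T] that by (auto simp: mult.commute)
    have "\<rho> ((T ! k) $$ (P * s + x, Q * s + y) * \<phi> c) $$ (p, q) =
        (\<Sum>r<e. \<rho> ((T ! k) $$ (P * s + x, Q * s + y)) $$ (p, r) * (if r = q then c else 0))"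
      using * by (auto simp add: mult_index scalar intro!: sum.cong)
    also have "\<dots> = \<rho> ((T ! k) $$ (P * s + x, Q * s + y)) $$ (p, q) * c"
      using * by (simp add: if_distrib cong: if_cong)
    also have "\<rho> ((T ! k) $$ (P * s + x, Q * s + y)) $$ (p, q) =
        rep_mat e \<rho> (T ! k) $$ (p * (M * s) + (P * s + x), q * (M * s) + (Q * s + y))"
      using * P Q that by (subst rep_mat_index[OF Tk(1)]) (auto simp: block_index_less)
    finally show ?thesis using Tk(2) by (simp add: algebra_simps)
  qed
  have "rep_mat e \<rho> (aff \<phi> d s nr nc M G a T) $$ (p * (M * nr) + i, q * (M * nc) + j) =
      \<rho> (aff_entry \<phi> d s G a T P \<alpha> Q \<beta>) $$ (p, q)"
    using * P Q by (subst rep_mat_index[OF aff_carrier]) (auto simp: i j)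
  also have "\<dots> = aff_entry (\<lambda>c. c) d s G a (map (rep_mat e \<rho>) T) (p * M + P) \<alpha> (q * M + Q) \<beta>"
  proof -
    have "p * M + P = q * M + Q \<longleftrightarrow> p = q \<and> P = Q"
      using P Q by (metis block_index_div_mod)
    then show ?thesis
      using * tm by (auto simp: aff_entry_def add_index sum_index zero_index scalar)
  qed
  also have "\<dots> = aff (\<lambda>c. c) d s nr nc (e * M) G a (map (rep_mat e \<rho>) T) $$
      ((p * M + P) * nr + \<alpha>, (q * M + Q) * nc + \<beta>)"
    using * P Q by (subst aff_index) (auto simp: block_index_less)
  finally show "rep_mat e \<rho> (aff \<phi> d s nr nc M G a T) $$ (p * (M * nr) + i, q * (M * nc) + j) =
      aff (\<lambda>c. c) d s nr nc (e * M) G a (map (rep_mat e \<rho>) T) $$ (p * (M * nr) + i, q * (M * nc) + j)"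
    by (simp add: i j algebra_simps)
qed (auto simp: mult.assoc)

lemma rep_mat_block_diag:
  "rep_mat e \<rho> (block_diag \<phi> nr nc M G) = block_diag (\<lambda>c. c) nr nc (e * M) G"
proof (rule eq_mat_blockI[of _ e "M * nr" e "M * nc"])
  fix p i q j assume *: "p < e" "i < M * nr" "q < e" "j < M * nc"
  obtain P \<alpha> where P: "P < M" "\<alpha> < nr" and i: "i = P * nr + \<alpha>" using * by (elim block_indexE)
  obtain Q \<beta> where Q: "Q < M" "\<beta> < nc" and j: "j = Q * nc + \<beta>" using * by (elim block_indexE)
  have "p * M + P = q * M + Q \<longleftrightarrow> p = q \<and> P = Q"
    using P Q by (metis block_index_div_mod)
  moreover have "p * (M * nr) + i = (p * M + P) * nr + \<alpha>" "q * (M * nc) + j = (q * M + Q) * nc + \<beta>"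
    by (simp_all add: i j algebra_simps)
  moreover have "block_diag (\<lambda>c. c) nr nc (e * M) G $$ ((p * M + P) * nr + \<alpha>, (q * M + Q) * nc + \<beta>) =
      (if p * M + P = q * M + Q then G \<alpha> \<beta> else 0)"
    using * P Q by (subst block_diag_index) (auto simp: block_index_less)
  moreover have "rep_mat e \<rho> (block_diag \<phi> nr nc M G) $$ (p * (M * nr) + i, q * (M * nc) + j) =
      \<rho> (if P = Q then \<phi> (G \<alpha> \<beta>) else 0) $$ (p, q)"
    using * P Q by (subst rep_mat_index[OF block_diag_carrier]) (auto simp: i j)
  ultimately show "rep_mat e \<rho> (block_diag \<phi> nr nc M G) $$ (p * (M * nr) + i, q * (M * nc) + j) =
      block_diag (\<lambda>c. c) nr nc (e * M) G $$ (p * (M * nr) + i, q * (M * nc) + j)"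
    using * by (auto simp: zero_index scalar)
qed (auto simp: mult.assoc)

text \<open>If \<open>\<rho>\<close> inverts the denominator, the image of a tuple lies in the domain over the ground field.\<close>

lemma is_val_rep:
  assumes T: "T \<in> mat_tuples d (s * M)" and r: "\<rho> (r * den \<phi> d s M S T) = 1\<^sub>m e"
  shows "is_val (\<lambda>c. c) d s (e * M) S (map (rep_mat e \<rho>) T) (rep_mat e \<rho> (r \<cdot>\<^sub>m num \<phi> d s M S T))"
proof -
  let ?l = "lam \<phi> d s M S T" and ?R = "rep_mat e \<rho>" and ?L = "sys_L S" and ?\<delta> = "den \<phi> d s M S T"
  let ?rhs = "rhs \<phi> d s M S T" and ?T = "map (rep_mat e \<rho>) T"
  note l = sys_carrier(1)[of \<phi> d s M S T] and b = sys_carrier(2)[of \<phi> d s M S T]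
  note C = sys_carrier(3)[of \<phi> s M S] and D = sys_carrier(4)[of \<phi> s M S]
  have lam: "lam (\<lambda>c. c) d s (e * M) S ?T = ?R ?l" and rhs: "rhs (\<lambda>c. c) d s (e * M) S ?T = ?R ?rhs"
    by (simp_all add: lam_def rhs_def rep_mat_aff[OF T])
  have dC: "diagC (\<lambda>c. c) s (e * M) S = ?R (diagC \<phi> s M S)"
    and dD: "diagD (\<lambda>c. c) s (e * M) S = ?R (diagD \<phi> s M S)"
    by (simp_all add: diagC_def diagD_def rep_mat_block_diag)
  have absorb: "?R ((r * ?\<delta>) \<cdot>\<^sub>m A) = ?R A" if A: "A \<in> carrier_mat n m" for A n m
  proof (rule eq_mat_blockI[of _ e n e m])
    fix p i q j assume *: "p < e" "i < n" "q < e" "j < m"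
    have "\<rho> (r * ?\<delta> * x) = \<rho> x" for x
      using left_mult_one_mat[OF carrier[of x]] by (simp add: mult[of "r * ?\<delta>"] r)
    then show "?R ((r * ?\<delta>) \<cdot>\<^sub>m A) $$ (p * n + i, q * m + j) = ?R A $$ (p * n + i, q * m + j)"
      using * A rep_mat_index[OF smult_carrier_mat[OF A], of p i q j] by (simp add: rep_mat_index[OF A])
  qed (use A in auto)
  \<comment> \<open>Hence \<open>r\<close> times the adjugate represents an inverse of the
    represented pencil.\<close>
  have "?R ?l * ?R (r \<cdot>\<^sub>m adj_mat ?l) = ?R ((r * ?\<delta>) \<cdot>\<^sub>m 1\<^sub>m (M * ?L))"
    unfolding den_def
    by (subst rep_mat_mult[OF l smult_carrier_mat[OF adj_lam_carrier], symmetric],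
        subst mult_smult_distrib[OF l adj_lam_carrier])
      (simp add: adj_mat(2)[OF l] smult_smult_mat_assoc)
  then have "?R ?l * ?R (r \<cdot>\<^sub>m adj_mat ?l) = 1\<^sub>m (e * (M * ?L))"
    by (simp only: absorb[OF one_carrier_mat] rep_mat_one)
  then have "det (?R ?l) * det (?R (r \<cdot>\<^sub>m adj_mat ?l)) = 1"
    by (metis det_mult[OF rep_mat_carrier[OF l] rep_mat_carrier[OF smult_carrier_mat[OF adj_lam_carrier]]] det_one)
  then have nz: "den (\<lambda>c. c) d s (e * M) S ?T \<noteq> 0"
    unfolding den_def lam by auto
  define U where "U = r \<cdot>\<^sub>m (adj_mat ?l * ?rhs)"
  have ab: "adj_mat ?l * ?rhs \<in> carrier_mat (M * ?L) (M * s)"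
    by (rule mult_carrier_mat[OF adj_lam_carrier b])
  have U: "U \<in> carrier_mat (M * ?L) (M * s)" unfolding U_def by (rule smult_carrier_mat[OF ab])
  have "?l * U = (r * ?\<delta>) \<cdot>\<^sub>m ?rhs"
    unfolding U_def
    by (subst mult_smult_distrib[OF l ab], subst assoc_mult_mat[OF l adj_lam_carrier b, symmetric])
      (simp add: adj_mat(2)[OF l] den_def mult_smult_assoc_mat[OF one_carrier_mat b]
        left_mult_one_mat[OF b] smult_smult_mat_assoc)
  then have eq: "?R ?l * ?R U = ?R ?rhs"
    by (simp add: rep_mat_mult[OF l U, symmetric] absorb[OF b])
  have "?R (r \<cdot>\<^sub>m num \<phi> d s M S T) = ?R ((r * ?\<delta>) \<cdot>\<^sub>m diagD \<phi> s M S + diagC \<phi> s M S * U)"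
    unfolding num_def U_def
    by (subst add_smult_distrib_left_mat[OF smult_carrier_mat[OF D] mult_carrier_mat[OF C ab]])
      (simp add: mult_smult_distrib[OF C ab] smult_smult_mat_assoc)
  also have "\<dots> = ?R (diagD \<phi> s M S) + ?R (diagC \<phi> s M S) * ?R U"
    by (simp add: rep_mat_add[OF smult_carrier_mat[OF D] mult_carrier_mat[OF C U]] absorb[OF D]
        rep_mat_mult[OF C U])
  finally show ?thesis
    unfolding is_val_def using nz rep_mat_carrier[OF U] eq
    by (intro conjI bexI[of _ "?R U"]) (auto simp: lam rhs dC dD mult.assoc)
qed

end

text \<open>Multiplication on \<open>K[t]/(g)\<close> in the basis of the powers of \<open>t\<close>.\<close>

definition quot_rep :: "'a::field poly \<Rightarrow> 'a poly \<Rightarrow> 'a mat" where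
  "quot_rep g f = mat (degree g) (degree g) (\<lambda>(a, b). coeff ((f * monom 1 b) mod g) a)"

lemma mod_sum_poly: "(\<Sum>i\<in>I. f i) mod (g::'a::field poly) = (\<Sum>i\<in>I. f i mod g)"
  by (induction I rule: infinite_finite_induct) (auto simp: poly_mod_add_left)

text \<open>Multiplicativity is associativity of multiplication in the quotient ring, seen after
  expanding \<open>y * t^b mod g\<close> in the basis of powers of \<open>t\<close>.\<close>

lemma quot_rep_scalar_mat_rep:
  assumes g: "degree g \<ge> 1"
  shows "scalar_mat_rep (degree g) (quot_rep g) (\<lambda>c. [:c:])"
proof
  have small: "monom 1 b mod g = monom 1 b" if "b < degree g" for b
    using that by (simp add: mod_poly_less degree_monom_eq)
  show "quot_rep g x \<in> carrier_mat (degree g) (degree g)" for x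
    by (simp add: quot_rep_def)
  show "quot_rep g 1 = 1\<^sub>m (degree g)"
    by (rule eq_matI) (auto simp: quot_rep_def small)
  show "quot_rep g (x + y) = quot_rep g x + quot_rep g y" for x y
    by (rule eq_matI) (auto simp: quot_rep_def algebra_simps poly_mod_add_left)
  show "quot_rep g [:c:] = c \<cdot>\<^sub>m 1\<^sub>m (degree g)" for c
    by (rule eq_matI) (auto simp: quot_rep_def mod_smult_left small)
  show "quot_rep g (x * y) = quot_rep g x * quot_rep g y" for x y
  proof (rule eq_matI)
    fix a b assume "a < dim_row (quot_rep g x * quot_rep g y)" "b < dim_col (quot_rep g x * quot_rep g y)"
    then have ab: "a < degree g" "b < degree g" by (auto simp: quot_rep_def)
    define r where "r = (y * monom 1 b) mod g"
    have "degree r < degree g"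
      unfolding r_def using g degree_mod_less[of g "y * monom 1 b"] by fastforce
    then have r: "r = (\<Sum>c<degree g. smult (coeff r c) (monom 1 c))"
      by (intro poly_eqI) (auto simp: coeff_sum coeff_eq_0 if_distrib sum.delta cong: if_cong)
    have "(x * r) mod g = (\<Sum>c<degree g. smult (coeff r c) ((x * monom 1 c) mod g))"
      by (subst arg_cong[OF r, of "(*) x"]) (simp add: sum_distrib_left mod_sum_poly mod_smult_left)
    moreover have "(x * y * monom 1 b) mod g = (x * r) mod g"
      unfolding r_def by (simp add: mod_mult_right_eq mult.assoc)
    ultimately have "coeff ((x * y * monom 1 b) mod g) a =
        (\<Sum>c<degree g. coeff r c * coeff ((x * monom 1 c) mod g) a)"
      by (simp add: coeff_sum)
    then show "quot_rep g (x * y) $$ (a, b) = (quot_rep g x * quot_rep g y) $$ (a, b)"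
      using ab by (subst mult_mat_index[of _ "degree g" "degree g" _ "degree g"])
        (auto simp: quot_rep_def r_def mult.commute)
  qed (auto simp: quot_rep_def)
qed


section \<open>Systems with the same values\<close>

text \<open>Faithfulness on the quotient ring: column 0 of the matrix, the image of the basis vector
  1, already lists the coefficients of \<open>x mod g\<close>.\<close>

lemma quot_rep_eqD:
  assumes g: "degree g \<ge> 1" and eq: "quot_rep g x = quot_rep g y"
  shows "g dvd x - (y :: 'a::field poly)"
proof -
  have "coeff (x mod g) a = coeff (y mod g) a" for a
  proof (cases "a < degree g")
    case True
    then have "quot_rep g x $$ (a, 0) = quot_rep g y $$ (a, 0)" by (simp add: eq)
    then show ?thesis using True g by (simp add: quot_rep_def)
  next
    case False
    have "coeff (f mod g) a = 0" for f
    proof (cases "f mod g = 0")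
      case nz: False
      have "g \<noteq> 0" using g by auto
      then have "degree (f mod g) < a" using nz degree_mod_less[of g f] False by simp
      then show ?thesis by (rule coeff_eq_0)
    qed simp
    then show ?thesis by simp
  qed
  then have "x mod g = y mod g" by (rule poly_eqI)
  then show ?thesis by (simp add: mod_eq_dvd_iff)
qed

text \<open>
  Over a finite field there may be no points at which given polynomials do not vanish. Points over
  an algebra \<open>K[t]/(g)\<close> in which they become invertible, seen as larger matrices over \<open>K\<close>, take
  their role; \<open>g = 1 + t h\<close> makes \<open>h\<close> invertible.
\<close>

lemma num_den_eq_if_agree:
  fixes T :: "'a::field poly mat list"
  assumes T: "T \<in> mat_tuples d n" and n: "n = s\<^sub>1 * M\<^sub>1" "n = s\<^sub>2 * M\<^sub>2"
    and nz: "den (\<lambda>c. [:c:]) d s\<^sub>1 M\<^sub>1 S\<^sub>1 T \<noteq> 0" "den (\<lambda>c. [:c:]) d s\<^sub>2 M\<^sub>2 S\<^sub>2 T \<noteq> 0"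
    and agree: "\<And>e X V W. 1 \<le> e \<Longrightarrow> X \<in> mat_tuples d (e * n) \<Longrightarrow>
      is_val (\<lambda>c. c) d s\<^sub>1 (e * M\<^sub>1) S\<^sub>1 X V \<Longrightarrow> is_val (\<lambda>c. c) d s\<^sub>2 (e * M\<^sub>2) S\<^sub>2 X W \<Longrightarrow> V = W"
    and ij: "i < n" "j < n"
  shows "num (\<lambda>c. [:c:]) d s\<^sub>1 M\<^sub>1 S\<^sub>1 T $$ (i, j) * den (\<lambda>c. [:c:]) d s\<^sub>2 M\<^sub>2 S\<^sub>2 T =
    num (\<lambda>c. [:c:]) d s\<^sub>2 M\<^sub>2 S\<^sub>2 T $$ (i, j) * den (\<lambda>c. [:c:]) d s\<^sub>1 M\<^sub>1 S\<^sub>1 T"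
    (is "?N1 $$ _ * ?d2 = ?N2 $$ _ * ?d1")
proof (rule ccontr)
  define h where "h = ?N1 $$ (i, j) * ?d2 - ?N2 $$ (i, j) * ?d1"
  \<comment> \<open>Modulo \<open>g\<close> the product of \<open>h\<close> and both denominators
    has the inverse \<open>-t\<close>, while the factor \<open>t\<close> makes \<open>g\<close> of
    larger degree than \<open>h\<close>.\<close>
  define g where "g = 1 + [:0, 1:] * (h * ?d1 * ?d2)"
  assume "\<not> ?thesis"
  then have "h \<noteq> 0" by (simp add: h_def)
  then have nz': "h * ?d1 * ?d2 \<noteq> 0" using nz by simp
  have deg: "degree g = Suc (degree (h * ?d1 * ?d2))"
    unfolding g_def using nz' by (subst degree_add_eq_right) (auto simp: degree_mult_eq simp del: mult_eq_0_iff)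
  then interpret scalar_mat_rep "degree g" "quot_rep g" "\<lambda>c. [:c:]"
    by (intro quot_rep_scalar_mat_rep) simp
  have unit: "quot_rep g x = 1\<^sub>m (degree g)" if "x = 1 - g" for x
  proof -
    have "quot_rep g x = quot_rep g 1"
      unfolding that quot_rep_def by (rule eq_matI) (auto simp: left_diff_distrib poly_mod_diff_left)
    then show ?thesis by (simp add: one)
  qed
  \<comment> \<open>Inverses of the two denominators modulo \<open>g\<close>: both products equal
    \<open>-t * h * d1 * d2 = 1 - g\<close>.\<close>
  define r1 r2 where "r1 = - [:0, 1:] * h * ?d2" and "r2 = - [:0, 1:] * h * ?d1"
  have r: "r1 * ?d1 = 1 - g" "r2 * ?d2 = 1 - g" by (simp_all add: r1_def r2_def g_def algebra_simps)
  let ?T = "map (rep_mat (degree g) (quot_rep g)) T"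
  have v1: "is_val (\<lambda>c. c) d s\<^sub>1 (degree g * M\<^sub>1) S\<^sub>1 ?T (rep_mat (degree g) (quot_rep g) (r1 \<cdot>\<^sub>m ?N1))"
    by (rule is_val_rep) (use T n unit r in auto)
  have v2: "is_val (\<lambda>c. c) d s\<^sub>2 (degree g * M\<^sub>2) S\<^sub>2 ?T (rep_mat (degree g) (quot_rep g) (r2 \<cdot>\<^sub>m ?N2))"
    by (rule is_val_rep) (use T n unit r in auto)
  have "rep_mat (degree g) (quot_rep g) (r1 \<cdot>\<^sub>m ?N1) = rep_mat (degree g) (quot_rep g) (r2 \<cdot>\<^sub>m ?N2)"
    by (rule agree[OF _ _ v1 v2]) (use deg mat_tuples_rep[OF T] in auto)
  moreover have N: "?N1 \<in> carrier_mat n n" "?N2 \<in> carrier_mat n n"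
    using n by (metis num_carrier mult.commute)+
  moreover have "(r1 \<cdot>\<^sub>m ?N1) $$ (i, j) = r1 * ?N1 $$ (i, j)" "(r2 \<cdot>\<^sub>m ?N2) $$ (i, j) = r2 * ?N2 $$ (i, j)"
    using ij n by (simp_all add: mult.commute)
  ultimately have "quot_rep g (r1 * ?N1 $$ (i, j)) $$ (a, b) = quot_rep g (r2 * ?N2 $$ (i, j)) $$ (a, b)"
    if "a < degree g" "b < degree g" for a b
    using rep_mat_index[OF smult_carrier_mat[OF N(1)], of a i b j r1]
      rep_mat_index[OF smult_carrier_mat[OF N(2)], of a i b j r2] that ij
    by simp
  then have "quot_rep g (r1 * ?N1 $$ (i, j)) = quot_rep g (r2 * ?N2 $$ (i, j))"
    by (intro eq_matI) auto
  \<comment> \<open>Multiplying by both denominators cancels the inverses and makes the difference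
    \<open>h\<close> reappear modulo \<open>g\<close>.\<close>
  then have "quot_rep g ((?d1 * ?d2) * (r1 * ?N1 $$ (i, j))) = quot_rep g ((?d1 * ?d2) * (r2 * ?N2 $$ (i, j)))"
    by (simp only: mult)
  then have "g dvd ?d1 * ?d2 * (r1 * ?N1 $$ (i, j)) - ?d1 * ?d2 * (r2 * ?N2 $$ (i, j))"
    by (intro quot_rep_eqD) (use deg in auto)
  also have "\<dots> = (r1 * ?d1) * (?d2 * ?N1 $$ (i, j)) - (r2 * ?d2) * (?d1 * ?N2 $$ (i, j))"
    by (simp add: algebra_simps)
  \<comment> \<open>Since \<open>1 - g\<close> is 1 modulo \<open>g\<close>, this says that
    \<open>g\<close> divides \<open>h\<close>, which the degrees forbid.\<close>
  also have "\<dots> = (1 - g) * h" unfolding r h_def by (simp add: algebra_simps)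
  finally have "g dvd h - g * h" by (simp add: left_diff_distrib)
  then have "g dvd (h - g * h) + g * h" by (rule dvd_add) simp
  then have "g dvd h" by simp
  then have "degree g \<le> degree h" using \<open>h \<noteq> 0\<close> by (rule dvd_imp_degree_le)
  moreover have "degree h \<le> degree (h * ?d1 * ?d2)"
    using nz \<open>h \<noteq> 0\<close> by (simp add: degree_mult_eq)
  ultimately show False using deg by simp
qed


section \<open>Linearization of rational expressions\<close>

text \<open>The pencil \<open>G \<otimes> 1 + \<Sum>k. A k \<otimes> X k\<close> with \<open>N\<close> columns, applied to a family of \<open>N\<close> vectors.\<close>

definition act :: "('a \<Rightarrow> 'b::field) \<Rightarrow> nat \<Rightarrow> nat \<Rightarrow> nat \<Rightarrow> (nat \<Rightarrow> nat \<Rightarrow> 'a) \<Rightarrow> (nat \<Rightarrow> nat \<Rightarrow> nat \<Rightarrow> 'a) \<Rightarrow>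
    'b mat list \<Rightarrow> (nat \<Rightarrow> nat \<Rightarrow> 'b) \<Rightarrow> nat \<Rightarrow> nat \<Rightarrow> 'b" where
  "act \<phi> d n N G A X u \<alpha> p = (\<Sum>\<beta><N. \<phi> (G \<alpha> \<beta>) * u \<beta> p +
     (\<Sum>k<d. \<phi> (A k \<alpha> \<beta>) * (\<Sum>q<n. (X ! k) $$ (p, q) * u \<beta> q)))"

definition blocks :: "nat \<Rightarrow> (nat \<Rightarrow> nat \<Rightarrow> 'a) \<Rightarrow> (nat \<Rightarrow> nat \<Rightarrow> 'a) \<Rightarrow> (nat \<Rightarrow> nat \<Rightarrow> 'a) \<Rightarrow> (nat \<Rightarrow> nat \<Rightarrow> 'a) \<Rightarrow>
    nat \<Rightarrow> nat \<Rightarrow> 'a" where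
  "blocks N F11 F12 F21 F22 \<alpha> \<beta> = (if \<alpha> < N then if \<beta> < N then F11 \<alpha> \<beta> else F12 \<alpha> (\<beta> - N)
     else if \<beta> < N then F21 (\<alpha> - N) \<beta> else F22 (\<alpha> - N) (\<beta> - N))"

lemma sum_lessThan_add: "(\<Sum>i<N + M. f i) = (\<Sum>i<N. f i) + (\<Sum>i<M. f (N + i :: nat))"
  by (induction M) (auto simp: add.assoc)

lemma act_blocks:
  "act \<phi> d n (N + M) (blocks N G11 G12 G21 G22) (\<lambda>k. blocks N (A11 k) (A12 k) (A21 k) (A22 k)) X u \<alpha> p =
    (if \<alpha> < N then act \<phi> d n N G11 A11 X u \<alpha> p + act \<phi> d n M G12 A12 X (\<lambda>\<beta>. u (N + \<beta>)) \<alpha> p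
     else act \<phi> d n N G21 A21 X u (\<alpha> - N) p + act \<phi> d n M G22 A22 X (\<lambda>\<beta>. u (N + \<beta>)) (\<alpha> - N) p)"
  unfolding act_def sum_lessThan_add by (simp add: blocks_def)

lemma act_cong:
  assumes "\<And>\<beta> q. \<beta> < N \<Longrightarrow> q < n \<Longrightarrow> u \<beta> q = v \<beta> q" "p < n"
  shows "act \<phi> d n N G A X u \<alpha> p = act \<phi> d n N G A X v \<alpha> p"
  using assms by (simp add: act_def)

lemma act_const:
  assumes "\<phi> 0 = 0"
  shows "act \<phi> d n N G (\<lambda>_ _ _. 0) X u \<alpha> p = (\<Sum>\<beta><N. \<phi> (G \<alpha> \<beta>) * u \<beta> p)"
  using assms by (simp add: act_def)

datatype 'a pencil = Pencil
  (pN: nat)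
  (pG: "nat \<Rightarrow> nat \<Rightarrow> 'a")
  (pA: "nat \<Rightarrow> nat \<Rightarrow> nat \<Rightarrow> 'a")
  (pb: "nat \<Rightarrow> 'a")
  (pc: "nat \<Rightarrow> 'a")

text \<open>Direct sum of the two pencils, driven by the same input and with added outputs.\<close>

definition pen_add :: "'a::zero pencil \<Rightarrow> 'a pencil \<Rightarrow> 'a pencil" where
  "pen_add P Q = Pencil (pN P + pN Q)
     (blocks (pN P) (pG P) (\<lambda>_ _. 0) (\<lambda>_ _. 0) (pG Q))
     (\<lambda>k. blocks (pN P) (pA P k) (\<lambda>_ _. 0) (\<lambda>_ _. 0) (pA Q k))
     (\<lambda>\<alpha>. if \<alpha> < pN P then pb P \<alpha> else pb Q (\<alpha> - pN P))
     (\<lambda>\<alpha>. if \<alpha> < pN P then pc P \<alpha> else pc Q (\<alpha> - pN P))"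

text \<open>Series connection: the corner \<open>- b1 c2\<close> feeds the output of
  \<open>Q\<close> into \<open>P\<close> as its input, so the output is
  \<open>c1 P^-1 b1 c2 Q^-1 b2\<close>.\<close>

definition pen_mult :: "'a::ring pencil \<Rightarrow> 'a pencil \<Rightarrow> 'a pencil" where
  "pen_mult P Q = Pencil (pN P + pN Q)
     (blocks (pN P) (pG P) (\<lambda>\<alpha> \<beta>. - (pb P \<alpha> * pc Q \<beta>)) (\<lambda>_ _. 0) (pG Q))
     (\<lambda>k. blocks (pN P) (pA P k) (\<lambda>_ _. 0) (\<lambda>_ _. 0) (pA Q k))
     (\<lambda>\<alpha>. if \<alpha> < pN P then 0 else pb Q (\<alpha> - pN P))
     (\<lambda>\<alpha>. if \<alpha> < pN P then pc P \<alpha> else 0)"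

text \<open>
  The additional copy of \<open>P\<close> makes nonsingularity of the pencil of an expression equivalent to the
  existence of \<^emph>\<open>all\<close> inverses in it.
\<close>

definition pen_inv :: "'a::ring_1 pencil \<Rightarrow> 'a pencil" where
  "pen_inv P = (let N = pN P in Pencil (N + (N + 1))
     (blocks N (pG P) (\<lambda>_ _. 0) (\<lambda>_ _. 0) (blocks N (pG P) (\<lambda>\<alpha> _. pb P \<alpha>) (\<lambda>_ \<beta>. pc P \<beta>) (\<lambda>_ _. 0)))
     (\<lambda>k. blocks N (pA P k) (\<lambda>_ _. 0) (\<lambda>_ _. 0) (blocks N (pA P k) (\<lambda>_ _. 0) (\<lambda>_ _. 0) (\<lambda>_ _. 0)))
     (\<lambda>\<alpha>. if \<alpha> = N + N then -1 else 0)
     (\<lambda>\<alpha>. if \<alpha> = N + N then 1 else 0))"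

text \<open>For a variable the pencil is the unipotent matrix with rows \<open>(1, -x)\<close> and
  \<open>(0, 1)\<close>, whose inverse has \<open>x\<close> in the corner picked by \<open>c\<close>
  and \<open>b\<close>.\<close>

primrec linearize :: "'a::field ncexpr \<Rightarrow> 'a pencil" where
  "linearize (Const a) = Pencil 1 (\<lambda>_ _. 1) (\<lambda>_ _ _. 0) (\<lambda>_. 1) (\<lambda>_. a)"
| "linearize (Var k) = Pencil 2 (\<lambda>\<alpha> \<beta>. if \<alpha> = \<beta> then 1 else 0)
     (\<lambda>l \<alpha> \<beta>. if l = k \<and> \<alpha> = 0 \<and> \<beta> = 1 then -1 else 0)
     (\<lambda>\<alpha>. if \<alpha> = 1 then 1 else 0) (\<lambda>\<alpha>. if \<alpha> = 0 then 1 else 0)"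
| "linearize (Add r1 r2) = pen_add (linearize r1) (linearize r2)"
| "linearize (Mult r1 r2) = pen_mult (linearize r1) (linearize r2)"
| "linearize (Inv r) = pen_inv (linearize r)"

definition lin_sys :: "'a::field ncexpr \<Rightarrow> 'a sys" where
  "lin_sys r = (let P = linearize r in
     Sys (pN P) (pG P) (\<lambda>k _ _. pA P k) (\<lambda>\<alpha> _. pb P \<alpha>) (\<lambda>_ _ _ _ _. 0) (\<lambda>_ \<alpha>. pc P \<alpha>) (\<lambda>_ _. 0))"

lemma left_inverse_solve:
  fixes V W :: "'b::comm_ring_1 mat"
  assumes V: "V \<in> carrier_mat n n" and W: "W \<in> carrier_mat n n" and WV: "W * V = 1\<^sub>m n"
    and z: "\<And>p. p < n \<Longrightarrow> (\<Sum>q<n. V $$ (p, q) * z q) = w p" and p: "p < n"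
  shows "z p = (\<Sum>q<n. W $$ (p, q) * w q)"
proof -
  have "(\<Sum>q<n. W $$ (p, q) * w q) = (\<Sum>q<n. \<Sum>q'<n. W $$ (p, q) * V $$ (q, q') * z q')"
    by (intro sum.cong refl) (simp only: z[symmetric] lessThan_iff sum_distrib_left mult.assoc)
  also have "\<dots> = (\<Sum>q'<n. (\<Sum>q<n. W $$ (p, q) * V $$ (q, q')) * z q')"
    unfolding sum_distrib_right by (rule sum.swap)
  also have "\<dots> = (\<Sum>q'<n. if q' = p then z q' else 0)"
  proof (rule sum.cong)
    fix q' assume "q' \<in> {..<n}"
    then show "(\<Sum>q<n. W $$ (p, q) * V $$ (q, q')) * z q' = (if q' = p then z q' else 0)"
      using p by (simp add: mult_mat_index[OF W V p, symmetric] WV del: index_mult_mat)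
  qed simp
  also have "\<dots> = z p" using p by simp
  finally show ?thesis by simp
qed

lemma zero_eq_negD: "0 = - a \<Longrightarrow> a = (0 :: 'a::ab_group_add)" and neg_eq_negD: "- b = - a \<Longrightarrow> a = (b :: 'a::ab_group_add)"
  by simp_all

section \<open>The pencil of an expression at one point\<close>

context
  fixes \<phi> :: "'a::field \<Rightarrow> 'b::field" and d n :: nat and X :: "'b mat list"
  assumes hom: "comm_ring_hom \<phi>"
begin

interpretation comm_ring_hom \<phi> by (rule hom)

definition "pact P = act \<phi> d n (pN P) (pG P) (pA P) X"

definition nonsing :: "'a pencil \<Rightarrow> bool" where
  "nonsing P \<longleftrightarrow> (\<forall>u. (\<forall>\<alpha><pN P. \<forall>p<n. pact P u \<alpha> p = 0) \<longrightarrow> (\<forall>\<alpha><pN P. \<forall>p<n. u \<alpha> p = 0))"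

text \<open>The transfer relation: whenever a state \<open>u\<close> answers to an input
  \<open>w\<close>, its output is \<open>V\<close> applied to \<open>w\<close>. No inverse of the
  pencil occurs, so the rules for sums, products and inverses are obtained by chasing
  states.\<close>

definition pvalue :: "'a pencil \<Rightarrow> 'b mat \<Rightarrow> bool" where
  "pvalue P V \<longleftrightarrow> V \<in> carrier_mat n n \<and>
     (\<forall>u w. (\<forall>\<alpha><pN P. \<forall>p<n. pact P u \<alpha> p = \<phi> (pb P \<alpha>) * w p) \<longrightarrow>
        (\<forall>p<n. (\<Sum>\<alpha><pN P. \<phi> (pc P \<alpha>) * u \<alpha> p) = (\<Sum>q<n. V $$ (p, q) * w q)))"

lemma pvalueD:
  assumes "pvalue P V" "\<And>\<alpha> p. \<alpha> < pN P \<Longrightarrow> p < n \<Longrightarrow> pact P u \<alpha> p = \<phi> (pb P \<alpha>) * w p" "p < n"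
  shows "(\<Sum>\<alpha><pN P. \<phi> (pc P \<alpha>) * u \<alpha> p) = (\<Sum>q<n. V $$ (p, q) * w q)"
  using assms unfolding pvalue_def by blast

definition pmat :: "'a pencil \<Rightarrow> 'b mat" where
  "pmat P = aff \<phi> d 1 (pN P) (pN P) n (pG P) (\<lambda>k _ _. pA P k) X"

lemma pmat_carrier [simp]: "pmat P \<in> carrier_mat (n * pN P) (n * pN P)"
  by (simp add: pmat_def)

text \<open>Families of vectors are packed with the matrix index \<open>p\<close> outside and the
  state index \<alpha> inside, as in the block layout of \<open>aff\<close>.\<close>

lemma pact_eq_pmat:
  assumes "\<alpha> < pN P" "p < n"
  shows "pact P u \<alpha> p = (pmat P *\<^sub>v vec (n * pN P) (\<lambda>i. u (i mod pN P) (i div pN P))) $ (p * pN P + \<alpha>)"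
proof -
  let ?N = "pN P"
  have "(pmat P *\<^sub>v vec (n * ?N) (\<lambda>i. u (i mod ?N) (i div ?N))) $ (p * ?N + \<alpha>) =
      (\<Sum>i<n * ?N. pmat P $$ (p * ?N + \<alpha>, i) * u (i mod ?N) (i div ?N))"
    using assms by (auto simp: scalar_prod_def pmat_def block_index_less lessThan_atLeast0 intro!: sum.cong)
  also have "\<dots> = (\<Sum>q<n. \<Sum>\<beta><?N. ((if p = q then \<phi> (pG P \<alpha> \<beta>) else 0) +
      (\<Sum>k<d. (X ! k) $$ (p, q) * \<phi> (pA P k \<alpha> \<beta>))) * u \<beta> q)"
    using assms by (subst sum_block_index) (auto simp: pmat_def aff_entry_def)
  also have "\<dots> = (\<Sum>\<beta><?N. \<Sum>q<n. ((if p = q then \<phi> (pG P \<alpha> \<beta>) else 0) +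
      (\<Sum>k<d. (X ! k) $$ (p, q) * \<phi> (pA P k \<alpha> \<beta>))) * u \<beta> q)"
    by (rule sum.swap)
  also have "\<dots> = pact P u \<alpha> p"
  proof -
    have "(\<Sum>q<n. (if p = q then \<phi> (pG P \<alpha> \<beta>) else 0) * u \<beta> q) = \<phi> (pG P \<alpha> \<beta>) * u \<beta> p" for \<beta>
      using assms by (simp add: if_distrib[of "\<lambda>x. x * _"] cong: if_cong)
    moreover have "(\<Sum>q<n. (\<Sum>k<d. (X ! k) $$ (p, q) * \<phi> (pA P k \<alpha> \<beta>)) * u \<beta> q) =
        (\<Sum>k<d. \<phi> (pA P k \<alpha> \<beta>) * (\<Sum>q<n. (X ! k) $$ (p, q) * u \<beta> q))" for \<beta>
      unfolding sum_distrib_left sum_distrib_right by (subst sum.swap) (simp add: ac_simps)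
    ultimately show ?thesis by (simp add: pact_def act_def distrib_right sum.distrib)
  qed
  finally show ?thesis by simp
qed

lemma nonsing_iff_det: "nonsing P \<longleftrightarrow> det (pmat P) \<noteq> 0"
proof
  assume ns: "nonsing P"
  show "det (pmat P) \<noteq> 0"
  proof
    assume "det (pmat P) = 0"
    then obtain v where v: "v \<in> carrier_vec (n * pN P)" "v \<noteq> 0\<^sub>v (n * pN P)" "pmat P *\<^sub>v v = 0\<^sub>v (n * pN P)"
      using det_0_iff_vec_prod_zero_field[OF pmat_carrier] by blast
    define u where "u \<alpha> p = v $ (p * pN P + \<alpha>)" for \<alpha> p
    have vu: "vec (n * pN P) (\<lambda>i. u (i mod pN P) (i div pN P)) = v"
      using v(1) by (intro eq_vecI) (simp_all add: u_def)
    have "pact P u \<alpha> p = 0" if "\<alpha> < pN P" "p < n" for \<alpha> p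
      using that by (simp add: pact_eq_pmat vu v(3) block_index_less)
    then have "\<forall>\<alpha><pN P. \<forall>p<n. u \<alpha> p = 0" using ns by (simp add: nonsing_def)
    then have "v $ i = 0" if "i < n * pN P" for i
      using that by (elim block_indexE) (simp add: u_def)
    then have "v = 0\<^sub>v (n * pN P)"
      using v(1) by (intro eq_vecI) simp_all
    then show False using v(2) by simp
  qed
next
  assume "det (pmat P) \<noteq> 0"
  then have inj: "v = 0\<^sub>v (n * pN P)" if "v \<in> carrier_vec (n * pN P)" "pmat P *\<^sub>v v = 0\<^sub>v (n * pN P)" for v
    using det_0_iff_vec_prod_zero_field[OF pmat_carrier] that by blast
  show "nonsing P" unfolding nonsing_def
  proof (intro allI impI)
    fix u \<alpha> p assume u: "\<forall>\<alpha><pN P. \<forall>p<n. pact P u \<alpha> p = 0" and *: "\<alpha> < pN P" "p < n"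
    let ?v = "vec (n * pN P) (\<lambda>i. u (i mod pN P) (i div pN P))"
    have "?v = 0\<^sub>v (n * pN P)"
    proof (rule inj)
      show "pmat P *\<^sub>v ?v = 0\<^sub>v (n * pN P)"
      proof (rule eq_vecI)
        fix i assume "i < dim_vec (0\<^sub>v (n * pN P))"
        then have "i < n * pN P" by simp
        then obtain q \<beta> where i: "q < n" "\<beta> < pN P" "i = q * pN P + \<beta>" by (elim block_indexE)
        have "(pmat P *\<^sub>v ?v) $ i = pact P u \<beta> q"
          unfolding i(3) by (rule pact_eq_pmat[OF i(2,1), symmetric])
        also have "\<dots> = 0" using u i(1,2) by blast
        also have "0 = 0\<^sub>v (n * pN P) $ i" using \<open>i < n * pN P\<close> by simp
        finally show "(pmat P *\<^sub>v ?v) $ i = 0\<^sub>v (n * pN P) $ i" .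
      qed (simp add: pmat_def)
    qed simp
    moreover have "p * pN P + \<alpha> < n * pN P" using * by (intro block_index_less)
    ultimately have "?v $ (p * pN P + \<alpha>) = 0" by simp
    moreover have "?v $ (p * pN P + \<alpha>) = u \<alpha> p"
      using * \<open>p * pN P + \<alpha> < n * pN P\<close> by (subst index_vec) simp_all
    ultimately show "u \<alpha> p = 0" by simp
  qed
qed

text \<open>A square pencil without kernel is onto; the adjugate divided by the determinant gives
  the solution. It is used to complete states in products and inverses.\<close>

lemma nonsing_solvable:
  assumes "nonsing P"
  obtains u where "\<And>\<alpha> p. \<alpha> < pN P \<Longrightarrow> p < n \<Longrightarrow> pact P u \<alpha> p = f \<alpha> p"
proof -
  let ?m = "n * pN P"
  have det: "det (pmat P) \<noteq> 0" using assms nonsing_iff_det by simp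
  define g where "g = vec ?m (\<lambda>i. inverse (det (pmat P)) * f (i mod pN P) (i div pN P))"
  define v where "v = adj_mat (pmat P) *\<^sub>v g"
  define u where "u \<alpha> p = v $ (p * pN P + \<alpha>)" for \<alpha> p
  note adj = adj_mat[OF pmat_carrier]
  have v: "v \<in> carrier_vec ?m" unfolding v_def by (rule mult_mat_vec_carrier[OF adj(1)]) (simp add: g_def)
  have "pmat P *\<^sub>v v = (pmat P * adj_mat (pmat P)) *\<^sub>v g"
    unfolding v_def by (rule assoc_mult_mat_vec[OF pmat_carrier adj(1), symmetric]) (simp add: g_def)
  also have "\<dots> = det (pmat P) \<cdot>\<^sub>v g"
    by (subst adj(2)) (auto simp: g_def intro!: eq_vecI)
  finally have pv: "pmat P *\<^sub>v v = det (pmat P) \<cdot>\<^sub>v g" .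
  have vu: "vec ?m (\<lambda>i. u (i mod pN P) (i div pN P)) = v"
    using v by (intro eq_vecI) (auto simp: u_def)
  have "pact P u \<alpha> p = f \<alpha> p" if "\<alpha> < pN P" "p < n" for \<alpha> p
    using that det by (simp add: pact_eq_pmat vu pv g_def block_index_less)
  then show ?thesis by (rule that)
qed

text \<open>Induction on the expression. Definedness is tracked as an equivalence with
  nonsingularity, not merely an implication: this makes the domain of an expression the locus where
  a single determinant does not vanish.\<close>

lemma linearize_correct:
  assumes X: "X \<in> mat_tuples d n" and "nc_vars r \<subseteq> {..<d}"
  shows "(nc_eval \<phi> n X r = None \<longrightarrow> \<not> nonsing (linearize r)) \<and>
    (\<forall>V. nc_eval \<phi> n X r = Some V \<longrightarrow> nonsing (linearize r) \<and> pvalue (linearize r) V)"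
  using assms(2)
proof (induction r)
  case (Const a)
  have a: "pact (linearize (Const a)) u \<alpha> p = u 0 p" for u \<alpha> p
    by (simp add: pact_def act_def)
  have "(\<Sum>q<n. \<phi> a * (if p = q then 1 else 0) * w q) = (\<Sum>q<n. if q = p then \<phi> a * w q else 0)" for p w
    by (intro sum.cong) auto
  then have "(\<Sum>q<n. \<phi> a * (if p = q then 1 else 0) * w q) = \<phi> a * w p" if "p < n" for p w
    using that by simp
  then show ?case using a by (auto simp: nonsing_def pvalue_def)
next
  case (Var k)
  then have k: "k < d" by simp
  have a: "pact (linearize (Var k)) u \<alpha> p =
      (if \<alpha> = 0 then u 0 p - (\<Sum>q<n. (X ! k) $$ (p, q) * u 1 q) else u 1 p)"
    if "\<alpha> < 2" for u \<alpha> p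
  proof -
    have "(\<Sum>l<d. \<phi> (if l = k then - 1 else 0) * (\<Sum>q<n. (X ! l) $$ (p, q) * u 1 q)) =
        - (\<Sum>q<n. (X ! k) $$ (p, q) * u 1 q)"
    proof -
      have "\<phi> (if l = k then - 1 else 0) * (\<Sum>q<n. (X ! l) $$ (p, q) * u 1 q) =
          (if l = k then - (\<Sum>q<n. (X ! l) $$ (p, q) * u 1 q) else 0)" for l
        by (simp add: hom_distribs sum_negf)
      then show ?thesis using k by (simp only: sum.delta finite_lessThan lessThan_iff if_True)
    qed
    moreover have "\<alpha> = 0 \<or> \<alpha> = 1" using that by auto
    ultimately show ?thesis by (auto simp: pact_def act_def numeral_2_eq_2)
  qed
  have "X ! k \<in> carrier_mat n n" using mat_tuplesD[OF X] k by auto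
  moreover have "nonsing (linearize (Var k))"
    unfolding nonsing_def
  proof (intro allI impI)
    fix u \<alpha> p
    assume u: "\<forall>\<alpha><pN (linearize (Var k)). \<forall>p<n. pact (linearize (Var k)) u \<alpha> p = 0"
      and *: "\<alpha> < pN (linearize (Var k))" "p < n"
    have u1: "u 1 q = 0" if "q < n" for q using u[rule_format, of 1 q] that a[of 1 u q] by simp
    have "u 0 p = 0" using u[rule_format, of 0 p] * a[of 0 u p] u1 by simp
    then show "u \<alpha> p = 0" using * u1 by (cases "\<alpha> = 0") (auto simp: less_Suc_eq numeral_2_eq_2)
  qed
  moreover have "(\<Sum>\<alpha><pN (linearize (Var k)). \<phi> (pc (linearize (Var k)) \<alpha>) * u \<alpha> p) = (\<Sum>q<n. (X ! k) $$ (p, q) * w q)"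
    if "\<forall>\<alpha><pN (linearize (Var k)). \<forall>p<n. pact (linearize (Var k)) u \<alpha> p = \<phi> (pb (linearize (Var k)) \<alpha>) * w p" "p < n"
    for u w p
  proof -
    have u1: "u 1 q = w q" if "q < n" for q
      using \<open>\<forall>\<alpha><_. _\<close>[rule_format, of 1 q] that a[of 1 u q] by simp
    show ?thesis using that(1)[rule_format, of 0 p] that(2) a[of 0 u p] u1
      by (simp add: numeral_2_eq_2)
  qed
  ultimately show ?case by (auto simp: pvalue_def)
next
  case (Add r1 r2)
  define P where "P = linearize r1"
  define Q where "Q = linearize r2"
  define R where "R = pen_add P Q"
  have N: "pN R = pN P + pN Q" by (simp add: R_def pen_add_def)
  have a: "pact R u \<alpha> p = (if \<alpha> < pN P then pact P u \<alpha> p else pact Q (\<lambda>\<beta>. u (pN P + \<beta>)) (\<alpha> - pN P) p)"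
    for u \<alpha> p by (simp add: R_def pen_add_def pact_def act_blocks act_const)
  have ns: "nonsing R \<longleftrightarrow> nonsing P \<and> nonsing Q"
  proof
    assume R: "nonsing R"
    have "nonsing P" unfolding nonsing_def
    proof (intro allI impI)
      fix u \<alpha> p assume u: "\<forall>\<alpha><pN P. \<forall>p<n. pact P u \<alpha> p = 0" and *: "\<alpha> < pN P" "p < n"
      let ?v = "\<lambda>\<alpha> p. if \<alpha> < pN P then u \<alpha> p else 0"
      have "pact P ?v \<alpha> p = pact P u \<alpha> p" if "p < n" for \<alpha> p unfolding pact_def by (rule act_cong) (use that in auto)
      moreover have "pact Q (\<lambda>\<beta>. ?v (pN P + \<beta>)) \<alpha> p = 0" for \<alpha> p by (simp add: pact_def act_def)
      ultimately have "\<forall>\<alpha><pN R. \<forall>p<n. pact R ?v \<alpha> p = 0" using u by (simp add: a)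
      then have "\<forall>\<alpha><pN R. \<forall>p<n. ?v \<alpha> p = 0" using R unfolding nonsing_def by blast
      moreover have "\<alpha> < pN R" using * N by simp
      ultimately have "?v \<alpha> p = 0" using *(2) by blast
      then show "u \<alpha> p = 0" using *(1) by simp
    qed
    moreover have "nonsing Q" unfolding nonsing_def
    proof (intro allI impI)
      fix u \<alpha> p assume u: "\<forall>\<alpha><pN Q. \<forall>p<n. pact Q u \<alpha> p = 0" and *: "\<alpha> < pN Q" "p < n"
      let ?v = "\<lambda>\<alpha> p. if \<alpha> < pN P then 0 else u (\<alpha> - pN P) p"
      have "pact P ?v \<alpha> p = 0" if "p < n" for \<alpha> p
        using act_cong[where u = ?v and v = "\<lambda>_ _. 0" and p = p] that by (simp add: pact_def act_def)
      then have "\<forall>\<alpha><pN R. \<forall>p<n. pact R ?v \<alpha> p = 0" using u N by (auto simp: a)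
      then have "\<forall>\<alpha><pN R. \<forall>p<n. ?v \<alpha> p = 0" using R unfolding nonsing_def by blast
      moreover have "pN P + \<alpha> < pN R" using * N by simp
      ultimately have "?v (pN P + \<alpha>) p = 0" using *(2) by blast
      then show "u \<alpha> p = 0" by simp
    qed
    ultimately show "nonsing P \<and> nonsing Q" by simp
  next
    assume PQ: "nonsing P \<and> nonsing Q"
    show "nonsing R" unfolding nonsing_def
    proof (intro allI impI)
      fix u \<alpha> p assume u: "\<forall>\<alpha><pN R. \<forall>p<n. pact R u \<alpha> p = 0" and *: "\<alpha> < pN R" "p < n"
      have "\<forall>\<alpha><pN P. \<forall>p<n. pact P u \<alpha> p = 0" using u by (auto simp: a N dest: trans_less_add1 split: if_splits)
      then have 1: "\<forall>\<alpha><pN P. \<forall>p<n. u \<alpha> p = 0" using PQ unfolding nonsing_def by blast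
      have "pact Q (\<lambda>\<beta>. u (pN P + \<beta>)) \<alpha> p = 0" if "\<alpha> < pN Q" "p < n" for \<alpha> p
        using u[rule_format, of "pN P + \<alpha>" p] that by (simp add: a N)
      then have 2: "\<forall>\<alpha><pN Q. \<forall>p<n. u (pN P + \<alpha>) p = 0"
        using PQ unfolding nonsing_def by blast
      show "u \<alpha> p = 0"
      proof (cases "\<alpha> < pN P")
        case True
        then show ?thesis using 1 *(2) by blast
      next
        case False
        then have "\<alpha> - pN P < pN Q" "\<alpha> = pN P + (\<alpha> - pN P)" using *(1) N by simp_all
        then show ?thesis using 2 *(2) by metis
      qed
    qed
  qed
  have "pvalue R (V + W)" if V: "pvalue P V" and W: "pvalue Q W" for V W
    unfolding pvalue_def
  proof (intro conjI allI impI)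
    show "V + W \<in> carrier_mat n n" using that by (auto simp: pvalue_def)
    fix u w p assume u: "\<forall>\<alpha><pN R. \<forall>p<n. pact R u \<alpha> p = \<phi> (pb R \<alpha>) * w p" and p: "p < n"
    have "pact P u \<alpha> p = \<phi> (pb P \<alpha>) * w p" if "\<alpha> < pN P" "p < n" for \<alpha> p
      using u[rule_format, of \<alpha> p] that unfolding a N by (simp add: R_def pen_add_def)
    then have 1: "(\<Sum>\<alpha><pN P. \<phi> (pc P \<alpha>) * u \<alpha> p) = (\<Sum>q<n. V $$ (p, q) * w q)"
      using V p unfolding pvalue_def by blast
    have "pact Q (\<lambda>\<beta>. u (pN P + \<beta>)) \<alpha> p = \<phi> (pb Q \<alpha>) * w p" if "\<alpha> < pN Q" "p < n" for \<alpha> p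
      using u[rule_format, of "pN P + \<alpha>" p] that unfolding a N by (simp add: R_def pen_add_def)
    then have "\<forall>\<alpha><pN Q. \<forall>p<n. pact Q (\<lambda>\<beta>. u (pN P + \<beta>)) \<alpha> p = \<phi> (pb Q \<alpha>) * w p" by blast
    then have 2: "(\<Sum>\<alpha><pN Q. \<phi> (pc Q \<alpha>) * u (pN P + \<alpha>) p) = (\<Sum>q<n. W $$ (p, q) * w q)"
      using W p unfolding pvalue_def by fast
    have VW: "V \<in> carrier_mat n n" "W \<in> carrier_mat n n" using that by (auto simp: pvalue_def)
    have "(\<Sum>\<alpha><pN R. \<phi> (pc R \<alpha>) * u \<alpha> p) = (\<Sum>q<n. V $$ (p, q) * w q) + (\<Sum>q<n. W $$ (p, q) * w q)"
      unfolding N sum_lessThan_add by (simp add: R_def pen_add_def 1[symmetric] 2[symmetric])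
    then show "(\<Sum>\<alpha><pN R. \<phi> (pc R \<alpha>) * u \<alpha> p) = (\<Sum>q<n. (V + W) $$ (p, q) * w q)"
      using VW p by (simp add: distrib_right sum.distrib)
  qed
  note val = this
  have IH: "nc_eval \<phi> n X r1 = None \<Longrightarrow> \<not> nonsing P" "nc_eval \<phi> n X r2 = None \<Longrightarrow> \<not> nonsing Q"
    "\<And>V. nc_eval \<phi> n X r1 = Some V \<Longrightarrow> nonsing P \<and> pvalue P V"
    "\<And>V. nc_eval \<phi> n X r2 = Some V \<Longrightarrow> nonsing Q \<and> pvalue Q V"
    using Add unfolding P_def Q_def by auto
  show ?case
  proof (cases "nc_eval \<phi> n X r1")
    case None
    then show ?thesis using IH(1) ns by (auto simp: P_def Q_def R_def)
  next
    case V: (Some V)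
    show ?thesis
    proof (cases "nc_eval \<phi> n X r2")
      case None
      then show ?thesis using IH(2) ns by (auto simp: P_def Q_def R_def)
    next
      case W: (Some W)
      note PQ = IH(3)[OF V] IH(4)[OF W]
      have "nonsing R" using ns PQ by simp
      moreover have "pvalue R (V + W)" by (rule val[OF conjunct2[OF PQ(1)] conjunct2[OF PQ(2)]])
      ultimately show ?thesis using V W by (simp add: P_def Q_def R_def)
    qed
  qed
next
  case (Mult r1 r2)
  define P where "P = linearize r1"
  define Q where "Q = linearize r2"
  define R where "R = pen_mult P Q"
  let ?c = "\<lambda>u p. \<Sum>\<alpha><pN Q. \<phi> (pc Q \<alpha>) * u (pN P + \<alpha>) p"
  have N: "pN R = pN P + pN Q" by (simp add: R_def pen_mult_def)
  have a: "pact R u \<alpha> p = (if \<alpha> < pN P then pact P u \<alpha> p - \<phi> (pb P \<alpha>) * ?c u p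
      else pact Q (\<lambda>\<beta>. u (pN P + \<beta>)) (\<alpha> - pN P) p)"
    for u \<alpha> p by (simp add: R_def pen_mult_def pact_def act_blocks act_const hom_distribs sum_negf sum_distrib_left mult.assoc)
  have nsP: "nonsing P" if R: "nonsing R" unfolding nonsing_def
  proof (intro allI impI)
    fix u \<alpha> p assume u: "\<forall>\<alpha><pN P. \<forall>p<n. pact P u \<alpha> p = 0" and *: "\<alpha> < pN P" "p < n"
    let ?v = "\<lambda>\<alpha> p. if \<alpha> < pN P then u \<alpha> p else 0"
    have "pact P ?v \<alpha> p = pact P u \<alpha> p" if "p < n" for \<alpha> p unfolding pact_def by (rule act_cong) (use that in auto)
    moreover have "pact Q (\<lambda>\<beta>. ?v (pN P + \<beta>)) \<alpha> p = 0" for \<alpha> p by (simp add: pact_def act_def)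
      ultimately have "\<forall>\<alpha><pN R. \<forall>p<n. pact R ?v \<alpha> p = 0" using u by (simp add: a)
    then have "\<forall>\<alpha><pN R. \<forall>p<n. ?v \<alpha> p = 0" using R unfolding nonsing_def by blast
      moreover have "\<alpha> < pN R" using * N by simp
      ultimately have "?v \<alpha> p = 0" using *(2) by blast
      then show "u \<alpha> p = 0" using *(1) by simp
  qed
  have nsQ: "nonsing Q" if R: "nonsing R" unfolding nonsing_def
  proof (intro allI impI)
    fix u \<alpha> p assume u: "\<forall>\<alpha><pN Q. \<forall>p<n. pact Q u \<alpha> p = 0" and *: "\<alpha> < pN Q" "p < n"
    \<comment> \<open>A kernel vector of \<open>Q\<close> alone is no kernel vector of the
      triangular pencil: it also drives \<open>P\<close>. The state of \<open>P\<close> that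
      compensates exists since \<open>P\<close> is already known to be nonsingular.\<close>
    obtain u1 where u1: "\<And>\<alpha> p. \<alpha> < pN P \<Longrightarrow> p < n \<Longrightarrow>
        pact P u1 \<alpha> p = \<phi> (pb P \<alpha>) * (\<Sum>\<beta><pN Q. \<phi> (pc Q \<beta>) * u \<beta> p)"
      using nonsing_solvable[OF nsP[OF R], of "\<lambda>\<alpha> p. \<phi> (pb P \<alpha>) * (\<Sum>\<beta><pN Q. \<phi> (pc Q \<beta>) * u \<beta> p)"] by blast
    let ?v = "\<lambda>\<alpha> p. if \<alpha> < pN P then u1 \<alpha> p else u (\<alpha> - pN P) p"
    have "pact P ?v \<alpha> p = pact P u1 \<alpha> p" if "p < n" for \<alpha> p unfolding pact_def by (rule act_cong) (use that in auto)
    then have "\<forall>\<alpha><pN R. \<forall>p<n. pact R ?v \<alpha> p = 0" using u u1 N by (auto simp: a)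
    then have "\<forall>\<alpha><pN R. \<forall>p<n. ?v \<alpha> p = 0" using R unfolding nonsing_def by blast
    moreover have "pN P + \<alpha> < pN R" using * N by simp
      ultimately have "?v (pN P + \<alpha>) p = 0" using *(2) by blast
      then show "u \<alpha> p = 0" by simp
  qed
  have nsR: "nonsing R" if PQ: "nonsing P" "nonsing Q" unfolding nonsing_def
  proof (intro allI impI)
    fix u \<alpha> p assume u: "\<forall>\<alpha><pN R. \<forall>p<n. pact R u \<alpha> p = 0" and *: "\<alpha> < pN R" "p < n"
    have "pact Q (\<lambda>\<beta>. u (pN P + \<beta>)) \<alpha> p = 0" if "\<alpha> < pN Q" "p < n" for \<alpha> p
      using u[rule_format, of "pN P + \<alpha>" p] that by (simp add: a N)
    then have 1: "\<forall>\<alpha><pN Q. \<forall>p<n. u (pN P + \<alpha>) p = 0"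
      using PQ unfolding nonsing_def by blast
    then have "\<forall>\<alpha><pN P. \<forall>p<n. pact P u \<alpha> p = 0" using u by (auto simp: a N split: if_splits)
    then have 2: "\<forall>\<alpha><pN P. \<forall>p<n. u \<alpha> p = 0" using PQ unfolding nonsing_def by blast
    show "u \<alpha> p = 0"
    proof (cases "\<alpha> < pN P")
      case True
      then show ?thesis using 2 *(2) by blast
    next
      case False
      then have "\<alpha> - pN P < pN Q" "\<alpha> = pN P + (\<alpha> - pN P)" using *(1) N by simp_all
      then show ?thesis using 1 *(2) by metis
    qed
  qed
  have "pvalue R (V * W)" if V: "pvalue P V" and W: "pvalue Q W" for V W
    unfolding pvalue_def
  proof (intro conjI allI impI)
    have VW: "V \<in> carrier_mat n n" "W \<in> carrier_mat n n" using that by (auto simp: pvalue_def)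
    then show "V * W \<in> carrier_mat n n" by simp
    fix u w p assume u: "\<forall>\<alpha><pN R. \<forall>p<n. pact R u \<alpha> p = \<phi> (pb R \<alpha>) * w p" and p: "p < n"
    have "pact Q (\<lambda>\<beta>. u (pN P + \<beta>)) \<alpha> p = \<phi> (pb Q \<alpha>) * w p" if "\<alpha> < pN Q" "p < n" for \<alpha> p
      using u[rule_format, of "pN P + \<alpha>" p] that unfolding a N by (simp add: R_def pen_mult_def)
    then have "\<forall>\<alpha><pN Q. \<forall>p<n. pact Q (\<lambda>\<beta>. u (pN P + \<beta>)) \<alpha> p = \<phi> (pb Q \<alpha>) * w p" by blast
    then have 2: "?c u p = (\<Sum>q<n. W $$ (p, q) * w q)" if "p < n" for p
      using W that unfolding pvalue_def by fast
    have "pact P u \<alpha> p = \<phi> (pb P \<alpha>) * ?c u p" if "\<alpha> < pN P" "p < n" for \<alpha> p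
      using u[rule_format, of \<alpha> p] that unfolding a N by (simp add: R_def pen_mult_def)
    then have "(\<Sum>\<alpha><pN P. \<phi> (pc P \<alpha>) * u \<alpha> p) = (\<Sum>q<n. V $$ (p, q) * ?c u q)"
      by (rule pvalueD[OF V _ p, where w = "?c u"])
    also have "\<dots> = (\<Sum>q<n. V $$ (p, q) * (\<Sum>q'<n. W $$ (q, q') * w q'))"
      by (intro sum.cong refl) (simp only: 2 lessThan_iff)
    also have "\<dots> = (\<Sum>q<n. \<Sum>q'<n. V $$ (p, q) * W $$ (q, q') * w q')"
      by (simp only: sum_distrib_left mult.assoc)
    also have "\<dots> = (\<Sum>q'<n. (\<Sum>q<n. V $$ (p, q) * W $$ (q, q')) * w q')"
      unfolding sum_distrib_right by (rule sum.swap)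
    also have "\<dots> = (\<Sum>q<n. (V * W) $$ (p, q) * w q)"
      by (intro sum.cong refl) (simp only: mult_mat_index[OF VW p] lessThan_iff)
    finally show "(\<Sum>\<alpha><pN R. \<phi> (pc R \<alpha>) * u \<alpha> p) = (\<Sum>q<n. (V * W) $$ (p, q) * w q)"
      unfolding N sum_lessThan_add by (simp add: R_def pen_mult_def)
  qed
  note val = this
  have IH: "nc_eval \<phi> n X r1 = None \<Longrightarrow> \<not> nonsing P" "nc_eval \<phi> n X r2 = None \<Longrightarrow> \<not> nonsing Q"
    "\<And>V. nc_eval \<phi> n X r1 = Some V \<Longrightarrow> nonsing P \<and> pvalue P V"
    "\<And>V. nc_eval \<phi> n X r2 = Some V \<Longrightarrow> nonsing Q \<and> pvalue Q V"
    using Mult unfolding P_def Q_def by auto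
  show ?case
  proof (cases "nc_eval \<phi> n X r1")
    case None
    then show ?thesis using IH(1) nsP by (auto simp: P_def Q_def R_def)
  next
    case V: (Some V)
    show ?thesis
    proof (cases "nc_eval \<phi> n X r2")
      case None
      then show ?thesis using IH(2) nsQ by (auto simp: P_def Q_def R_def)
    next
      case W: (Some W)
      note PQ = IH(3)[OF V] IH(4)[OF W]
      have "nonsing R" by (rule nsR[OF conjunct1[OF PQ(1)] conjunct1[OF PQ(2)]])
      moreover have "pvalue R (V * W)" by (rule val[OF conjunct2[OF PQ(1)] conjunct2[OF PQ(2)]])
      ultimately show ?thesis using V W by (simp add: P_def Q_def R_def)
    qed
  qed
next
  case (Inv r)
  define P where "P = linearize r"
  define R where "R = pen_inv P"
  let ?N = "pN P"
  have bR: "pb R \<alpha> = (if \<alpha> = ?N + ?N then -1 else 0)" and cR: "pc R \<alpha> = (if \<alpha> = ?N + ?N then 1 else 0)" for \<alpha>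
    by (simp_all add: R_def pen_inv_def Let_def)
  have NR: "pN R = ?N + (?N + 1)" by (simp add: R_def pen_inv_def Let_def)
  \<comment> \<open>The unknowns are \<open>u1\<close>, \<open>u2\<close> and \<open>z\<close>,
    subject to \<open>P u1 = 0\<close>, \<open>P u2 + b z = 0\<close> and \<open>c u2 = - w\<close>.
    The second equation forces \<open>c u2 = - V z\<close>, so that \<open>V z = w\<close> and the
    output \<open>z\<close> is the inverse of \<open>V\<close> applied to \<open>w\<close>. The
    first equation records nonsingularity of \<open>P\<close>.\<close>
  let ?u2 = "\<lambda>u \<beta>. u (?N + \<beta>)" and ?z = "\<lambda>u. u (?N + ?N)"
  have a: "pact R u \<alpha> p = (if \<alpha> < ?N then pact P u \<alpha> p
      else if \<alpha> - ?N < ?N then pact P (?u2 u) (\<alpha> - ?N) p + \<phi> (pb P (\<alpha> - ?N)) * ?z u p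
      else \<Sum>\<beta><?N. \<phi> (pc P \<beta>) * ?u2 u \<beta> p)"
    for u \<alpha> p unfolding pact_def R_def pen_inv_def Let_def pencil.sel act_blocks by (simp add: act_const)
  have nsP: "nonsing P" if R: "nonsing R" unfolding nonsing_def
  proof (intro allI impI)
    fix u \<alpha> p assume u: "\<forall>\<alpha><?N. \<forall>p<n. pact P u \<alpha> p = 0" and *: "\<alpha> < ?N" "p < n"
    let ?v = "\<lambda>\<alpha> p. if \<alpha> < ?N then u \<alpha> p else 0"
    have "pact P ?v \<alpha> p = pact P u \<alpha> p" if "p < n" for \<alpha> p unfolding pact_def by (rule act_cong) (use that in auto)
    moreover have "pact P (\<lambda>\<beta>. ?v (?N + \<beta>)) \<alpha> p = 0" for \<alpha> p by (simp add: pact_def act_def)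
      ultimately have "\<forall>\<alpha><pN R. \<forall>p<n. pact R ?v \<alpha> p = 0" using u by (simp add: a)
    then have "\<forall>\<alpha><pN R. \<forall>p<n. ?v \<alpha> p = 0" using R unfolding nonsing_def by blast
      moreover have "\<alpha> < pN R" using * NR by simp
      ultimately have "?v \<alpha> p = 0" using *(2) by blast
      then show "u \<alpha> p = 0" using *(1) by simp
  qed
  have IH: "nc_eval \<phi> n X r = None \<Longrightarrow> \<not> nonsing P"
    "nc_eval \<phi> n X r = Some V \<Longrightarrow> nonsing P \<and> pvalue P V" for V
    using Inv unfolding P_def by auto
  show ?case
  proof (cases "nc_eval \<phi> n X r")
    case None
    then show ?thesis using IH nsP unfolding linearize.simps P_def[symmetric] R_def[symmetric] by auto
  next
    case (Some V)
    have P: "nonsing P" "pvalue P V" using IH Some by auto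
    have V: "V \<in> carrier_mat n n" using P by (simp add: pvalue_def)
    have neg: "pact P (\<lambda>\<alpha> p. - u \<alpha> p) \<alpha> p = - pact P u \<alpha> p" for u \<alpha> p
      by (simp add: pact_def act_def sum_negf sum.distrib sum_subtractf)
    have eqV: "(\<Sum>\<beta><?N. \<phi> (pc P \<beta>) * u \<beta> p) = - (\<Sum>q<n. V $$ (p, q) * z q)"
      if "\<And>\<alpha> p. \<alpha> < ?N \<Longrightarrow> p < n \<Longrightarrow> pact P u \<alpha> p + \<phi> (pb P \<alpha>) * z p = 0" "p < n" for u z p
    proof -
      have "\<forall>\<alpha><?N. \<forall>p<n. pact P (\<lambda>\<alpha> p. - u \<alpha> p) \<alpha> p = \<phi> (pb P \<alpha>) * z p"
        unfolding neg using that(1) by (intro allI impI minus_unique)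
      then have "(\<Sum>\<beta><?N. \<phi> (pc P \<beta>) * - u \<beta> p) = (\<Sum>q<n. V $$ (p, q) * z q)"
        using P(2) that(2) unfolding pvalue_def by fast
      then have "- (\<Sum>\<beta><?N. \<phi> (pc P \<beta>) * u \<beta> p) = (\<Sum>q<n. V $$ (p, q) * z q)" by (simp add: sum_negf)
      then show ?thesis by (metis minus_minus)
    qed
    show ?thesis
    proof (cases "mat_inverse V")
      case inv: None
      have "V \<notin> Units (ring_mat TYPE('b) n ())" by (rule mat_inverse(1)[OF V inv])
      then have "det V = 0" using det_non_zero_imp_unit[OF V, of "()"] by blast
      then obtain z where z: "z \<in> carrier_vec n" "z \<noteq> 0\<^sub>v n" "V *\<^sub>v z = 0\<^sub>v n"
        using det_0_iff_vec_prod_zero_field[OF V] by blast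
      \<comment> \<open>A kernel vector \<open>z\<close> of \<open>V\<close> extends to a kernel
        vector of the whole pencil: for this \<open>u2\<close> the last equation reads
        \<open>c u2 = - V z = 0\<close>.\<close>
      obtain u2 where u2: "\<And>\<alpha> p. \<alpha> < ?N \<Longrightarrow> p < n \<Longrightarrow> pact P u2 \<alpha> p = - (\<phi> (pb P \<alpha>) * z $ p)"
        using nonsing_solvable[OF P(1), of "\<lambda>\<alpha> p. - (\<phi> (pb P \<alpha>) * z $ p)"] by blast
      have c: "(\<Sum>\<beta><?N. \<phi> (pc P \<beta>) * u2 \<beta> p) = 0" if "p < n" for p
      proof -
        have "(\<Sum>q<n. V $$ (p, q) * z $ q) = (V *\<^sub>v z) $ p"
          using that V z(1) by (auto simp: scalar_prod_def lessThan_atLeast0 intro!: sum.cong)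
        then show ?thesis using eqV[of u2 "\<lambda>q. z $ q" p] u2 that z(3) by simp
      qed
      let ?v = "\<lambda>\<alpha> p. if \<alpha> < ?N then 0 else if \<alpha> < ?N + ?N then u2 (\<alpha> - ?N) p else z $ p"
      have "pact P ?v \<alpha> p = 0" if "p < n" for \<alpha> p
        using act_cong[where u = ?v and v = "\<lambda>_ _. 0" and p = p] that by (simp add: pact_def act_def)
      moreover have "pact P (?u2 ?v) \<alpha> p = pact P u2 \<alpha> p" if "p < n" for \<alpha> p
        unfolding pact_def by (rule act_cong) (use that in auto)
      moreover have "(\<Sum>\<beta><?N. \<phi> (pc P \<beta>) * ?u2 ?v \<beta> p) = (\<Sum>\<beta><?N. \<phi> (pc P \<beta>) * u2 \<beta> p)" for p
        by (intro sum.cong) auto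
      ultimately have all: "\<forall>\<alpha><pN R. \<forall>p<n. pact R ?v \<alpha> p = 0"
        unfolding a using u2 c by (auto split: if_splits)
      obtain p where p: "p < n" "z $ p \<noteq> 0"
        using z(1,2) by (metis carrier_vecD eq_vecI index_zero_vec)
      have "\<not> nonsing R"
      proof
        assume "nonsing R"
        then have "\<forall>\<alpha><pN R. \<forall>p<n. ?v \<alpha> p = 0" using all unfolding nonsing_def by blast
        moreover have "?N + ?N < pN R" using NR by simp
        ultimately have "?v (?N + ?N) p = 0" using p(1) by blast
        then show False using p(2) by simp
      qed
      then show ?thesis using Some inv unfolding linearize.simps P_def[symmetric] R_def[symmetric] by simp
    next
      case inv: (Some W)
      have W: "V * W = 1\<^sub>m n" "W * V = 1\<^sub>m n" "W \<in> carrier_mat n n"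
        using mat_inverse(2)[OF V inv] by auto
      note solve = left_inverse_solve[OF V W(3) W(2)]
      have nsN: "v \<alpha> p = 0" if "\<And>\<alpha> p. \<alpha> < ?N \<Longrightarrow> p < n \<Longrightarrow> pact P v \<alpha> p = 0" "\<alpha> < ?N" "p < n" for v \<alpha> p
        using P(1) that unfolding nonsing_def by blast
      have "nonsing R" unfolding nonsing_def
      proof (intro allI impI)
        fix u \<alpha> p assume u: "\<forall>\<alpha><pN R. \<forall>p<n. pact R u \<alpha> p = 0" and *: "\<alpha> < pN R" "p < n"
        have 0: "pact P u \<alpha> p = 0" if "\<alpha> < ?N" "p < n" for \<alpha> p
          using u[rule_format, of \<alpha> p] that unfolding a NR by simp
        have u1: "u \<alpha> p = 0" if "\<alpha> < ?N" "p < n" for \<alpha> p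
          by (rule nsN[of u]) (use 0 that in \<open>blast+\<close>)
        have 2: "pact P (?u2 u) \<alpha> p + \<phi> (pb P \<alpha>) * ?z u p = 0" if "\<alpha> < ?N" "p < n" for \<alpha> p
          using u[rule_format, of "?N + \<alpha>" p] that unfolding a NR by simp
        have 3: "(\<Sum>\<beta><?N. \<phi> (pc P \<beta>) * ?u2 u \<beta> p) = 0" if "p < n" for p
          using u[rule_format, of "?N + ?N" p] that unfolding a NR by simp
        have zz: "(\<Sum>q<n. V $$ (p, q) * ?z u q) = 0" if "p < n" for p
        proof -
          have "(\<Sum>\<beta><?N. \<phi> (pc P \<beta>) * ?u2 u \<beta> p) = - (\<Sum>q<n. V $$ (p, q) * ?z u q)"
            by (rule eqV[of "?u2 u" "?z u", OF _ that]) (rule 2)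
          then show ?thesis unfolding 3[OF that] by (rule zero_eq_negD)
        qed
        have z: "?z u p = 0" if "p < n" for p
        proof -
          have "?z u p = (\<Sum>q<n. W $$ (p, q) * (\<lambda>_. 0) q)"
            by (rule solve[where z = "?z u" and w = "\<lambda>_. 0", OF _ that]) (rule zz)
          then show ?thesis by (simp only: mult_zero_right sum.neutral_const)
        qed
        have 4: "pact P (?u2 u) \<alpha> p = 0" if "\<alpha> < ?N" "p < n" for \<alpha> p
        proof -
          have "\<phi> (pb P \<alpha>) * ?z u p = 0" by (subst z[OF that(2)]) simp
          then show ?thesis using 2[OF that] by (metis add.right_neutral)
        qed
        have u2: "?u2 u \<alpha> p = 0" if "\<alpha> < ?N" "p < n" for \<alpha> p
          by (rule nsN[of "?u2 u"]) (use 4 that in \<open>blast+\<close>)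
        consider "\<alpha> < ?N" | \<beta> where "\<beta> < ?N" "\<alpha> = ?N + \<beta>" | "\<alpha> = ?N + ?N"
        proof -
          have "\<alpha> < ?N \<or> \<alpha> - ?N < ?N \<and> \<alpha> = ?N + (\<alpha> - ?N) \<or> \<alpha> = ?N + ?N" using * NR by linarith
          then show ?thesis using that by blast
        qed
        then show "u \<alpha> p = 0"
        proof cases
          case 1
          then show ?thesis using u1 *(2) by simp
        next
          case 2
          then show ?thesis using u2[of \<beta> p] *(2) by simp
        next
          case 3
          then show ?thesis using z[of p] *(2) by simp
        qed
      qed
      moreover have "pvalue R W" unfolding pvalue_def
      proof (intro conjI allI impI)
        show "W \<in> carrier_mat n n" by (rule W(3))
        fix u w p assume u: "\<forall>\<alpha><pN R. \<forall>p<n. pact R u \<alpha> p = \<phi> (pb R \<alpha>) * w p" and p: "p < n"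
        have 2: "pact P (?u2 u) \<alpha> p + \<phi> (pb P \<alpha>) * ?z u p = 0" if "\<alpha> < ?N" "p < n" for \<alpha> p
          using u[rule_format, of "?N + \<alpha>" p] that unfolding a NR by (simp add: bR)
        have 3: "(\<Sum>\<beta><?N. \<phi> (pc P \<beta>) * ?u2 u \<beta> p) = - w p" if "p < n" for p
          using u[rule_format, of "?N + ?N" p] that unfolding a NR by (simp add: bR hom_uminus)
        have zz: "(\<Sum>q<n. V $$ (p, q) * ?z u q) = w p" if "p < n" for p
        proof -
          have "(\<Sum>\<beta><?N. \<phi> (pc P \<beta>) * ?u2 u \<beta> p) = - (\<Sum>q<n. V $$ (p, q) * ?z u q)"
            by (rule eqV[of "?u2 u" "?z u", OF _ that]) (rule 2)
          then show ?thesis unfolding 3[OF that] by (rule neg_eq_negD)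
        qed
        have "?z u p = (\<Sum>q<n. W $$ (p, q) * w q)" by (rule solve[where z = "?z u" and w = w, OF _ p]) (rule zz)
        moreover have "(\<Sum>\<alpha><pN R. \<phi> (pc R \<alpha>) * u \<alpha> p) = ?z u p"
          unfolding NR sum_lessThan_add by (simp add: cR)
        ultimately show "(\<Sum>\<alpha><pN R. \<phi> (pc R \<alpha>) * u \<alpha> p) = (\<Sum>q<n. W $$ (p, q) * w q)" by simp
      qed
      ultimately show ?thesis using Some inv unfolding linearize.simps P_def[symmetric] R_def[symmetric] by simp
    qed
  qed
qed

end


section \<open>Evaluation of an expression as the value of a system\<close>

lemma nc_eval_carrier:
  assumes "X \<in> mat_tuples d n" "nc_vars r \<subseteq> {..<d}" "nc_eval \<phi> n X r = Some V"
  shows "V \<in> carrier_mat n n"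
  using assms(2,3)
proof (induction r arbitrary: V)
  case (Var k)
  then show ?case using mat_tuplesD(2)[OF assms(1), of k] by auto
next
  case (Inv r)
  then obtain W where "W \<in> carrier_mat n n" "mat_inverse W = Some V"
    by (auto simp: bind_eq_Some_conv)
  then show ?case using mat_inverse(2) by blast
qed (auto simp: bind_eq_Some_conv)

text \<open>The target field is arbitrary, so the same system describes evaluation at points, at
  generic matrices and along curves over a field of fractions.\<close>

lemma nc_eval_iff_is_val:
  fixes \<phi> :: "'a::field \<Rightarrow> 'b::field"
  assumes hom: "comm_ring_hom \<phi>" and X: "X \<in> mat_tuples d n" and vars: "nc_vars r \<subseteq> {..<d}"
  shows "nc_eval \<phi> n X r = Some V \<longleftrightarrow> is_val \<phi> d 1 n (lin_sys r) X V"
proof -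
  interpret comm_ring_hom \<phi> by (rule hom)
  let ?P = "linearize r" and ?S = "lin_sys r"
  note correct = linearize_correct[OF hom X vars]
  have L: "sys_L ?S = pN ?P" by (simp add: lin_sys_def Let_def)
  have lam: "lam \<phi> d 1 n ?S X = pmat \<phi> d n X ?P"
    by (simp add: lam_def pmat_def[OF hom] lin_sys_def Let_def)
  have den: "den \<phi> d 1 n ?S X \<noteq> 0 \<longleftrightarrow> nonsing \<phi> d n X ?P"
    unfolding den_def lam by (simp only: nonsing_iff_det[OF hom])
  have val: "W = V" if W: "is_val \<phi> d 1 n ?S X W" and V: "pvalue \<phi> d n X ?P V" for V W
  proof -
    let ?N = "pN ?P"
    obtain U where U: "U \<in> carrier_mat (n * ?N) n" "lam \<phi> d 1 n ?S X * U = rhs \<phi> d 1 n ?S X"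
        and W': "W = diagD \<phi> 1 n ?S + diagC \<phi> 1 n ?S * U"
      using W unfolding is_val_def L by auto
    have V': "V \<in> carrier_mat n n" using V by (simp add: pvalue_def[OF hom])
    have W'': "W \<in> carrier_mat n n" using W by (simp add: is_val_iff)
    show "W = V"
    proof (rule eq_matI)
      fix i j assume "i < dim_row V" "j < dim_col V"
      then have ij: "i < n" "j < n" using V' by auto
      \<comment> \<open>Column \<open>j\<close> of the solution matrix, read as the state that
        answers to the unit vector \<open>j\<close> as input.\<close>
      define u where "u \<alpha> p = U $$ (p * ?N + \<alpha>, j)" for \<alpha> p
      have "pact \<phi> d n X ?P u \<alpha> p = \<phi> (pb ?P \<alpha>) * (if p = j then 1 else 0)" if *: "\<alpha> < ?N" "p < n" for \<alpha> p
      proof -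
        have "vec (n * ?N) (\<lambda>i. u (i mod ?N) (i div ?N)) = col U j"
          using U(1) ij by (intro eq_vecI) (simp_all add: u_def)
        then have "pact \<phi> d n X ?P u \<alpha> p = (pmat \<phi> d n X ?P *\<^sub>v col U j) $ (p * ?N + \<alpha>)"
          using pact_eq_pmat[OF hom *, of d X u] by simp
        also have "\<dots> = (lam \<phi> d 1 n ?S X * U) $$ (p * ?N + \<alpha>, j)"
          using * ij U(1) lam L by (simp add: pmat_def[OF hom] block_index_less)
        also have "\<dots> = aff \<phi> d 1 ?N 1 n (sys_B ?S) (sys_b ?S) X $$ (p * ?N + \<alpha>, j * 1 + 0)"
          by (simp only: U(2) rhs_def L mult_1_right add_0_right)
        also have "\<dots> = aff_entry \<phi> d 1 (sys_B ?S) (sys_b ?S) X p \<alpha> j 0"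
          by (rule aff_index) (use * ij in auto)
        also have "\<dots> = \<phi> (pb ?P \<alpha>) * (if p = j then 1 else 0)"
          by (simp add: aff_entry_def lin_sys_def Let_def)
        finally show ?thesis .
      qed
      then have "(\<Sum>\<alpha><?N. \<phi> (pc ?P \<alpha>) * u \<alpha> i) = (\<Sum>q<n. V $$ (i, q) * (if q = j then 1 else 0))"
        by (rule pvalueD[OF hom V _ ij(1), where w = "\<lambda>p. if p = j then 1 else 0"])
      also have "\<dots> = (\<Sum>q<n. if q = j then V $$ (i, q) else 0)" by (intro sum.cong) simp_all
      also have "\<dots> = V $$ (i, j)" using ij by simp
      finally have V1: "(\<Sum>\<alpha><?N. \<phi> (pc ?P \<alpha>) * u \<alpha> i) = V $$ (i, j)" .
      have C: "diagC \<phi> 1 n ?S \<in> carrier_mat n (n * ?N)"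
        using sys_carrier(3)[of \<phi> 1 n ?S] by (simp add: L)
      have Ce: "diagC \<phi> 1 n ?S $$ (i, Q * ?N + \<alpha>) = (if i = Q then \<phi> (pc ?P \<alpha>) else 0)" if "Q < n" "\<alpha> < ?N" for Q \<alpha>
      proof -
        have "diagC \<phi> 1 n ?S $$ (i, Q * ?N + \<alpha>) = block_diag \<phi> 1 ?N n (sys_C ?S) $$ (i * 1 + 0, Q * ?N + \<alpha>)"
          by (simp only: diagC_def L mult_1_right add_0_right)
        also have "\<dots> = (if i = Q then \<phi> (sys_C ?S 0 \<alpha>) else 0)"
          by (rule block_diag_index) (use that ij in auto)
        finally show ?thesis by (simp add: lin_sys_def Let_def)
      qed
      have De: "diagD \<phi> 1 n ?S $$ (i, j) = 0"
      proof -
        have "diagD \<phi> 1 n ?S $$ (i, j) = block_diag \<phi> 1 1 n (sys_D ?S) $$ (i * 1 + 0, j * 1 + 0)"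
          by (simp only: diagD_def mult_1_right add_0_right)
        also have "\<dots> = (if i = j then \<phi> (sys_D ?S 0 0) else 0)"
          by (rule block_diag_index) (use ij in auto)
        finally show ?thesis by (simp add: lin_sys_def Let_def)
      qed
      have "(diagC \<phi> 1 n ?S * U) $$ (i, j) = (\<Sum>Q<n. \<Sum>\<alpha><?N. (if i = Q then \<phi> (pc ?P \<alpha>) else 0) * u \<alpha> Q)"
        unfolding mult_mat_block_index[OF C U(1) ij] by (intro sum.cong refl) (simp only: Ce u_def lessThan_iff)
      also have "\<dots> = (\<Sum>Q<n. if Q = i then \<Sum>\<alpha><?N. \<phi> (pc ?P \<alpha>) * u \<alpha> i else 0)"
        by (intro sum.cong refl) auto
      also have "\<dots> = V $$ (i, j)" using ij V1 by simp
      finally show "W $$ (i, j) = V $$ (i, j)"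
        unfolding W' using ij C U(1) De by (simp del: index_mult_mat(1))
    qed (use V' W'' in auto)
  qed
  show ?thesis
  proof
    assume V: "nc_eval \<phi> n X r = Some V"
    then have "nonsing \<phi> d n X ?P" "pvalue \<phi> d n X ?P V" using correct by auto
    moreover obtain W where "is_val \<phi> d 1 n ?S X W" using is_val_exists[of \<phi> d 1 n ?S X] den calculation(1) by blast
    ultimately show "is_val \<phi> d 1 n ?S X V" using val by blast
  next
    assume V: "is_val \<phi> d 1 n ?S X V"
    then have "nonsing \<phi> d n X ?P" using den by (simp add: is_val_iff)
    then obtain W where W: "nc_eval \<phi> n X r = Some W" using correct by (cases "nc_eval \<phi> n X r") auto
    then have "pvalue \<phi> d n X ?P W" using correct by auto
    then show "nc_eval \<phi> n X r = Some V" using val[OF V] W by simp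
  qed
qed

text \<open>Unital algebra homomorphisms between matrix rings are compatible with evaluation.\<close>

lemma mat_inverse_eq_Some_iff:
  assumes "A \<in> carrier_mat n n"
  shows "mat_inverse A = Some B \<longleftrightarrow> B \<in> carrier_mat n n \<and> A * B = (1\<^sub>m n :: 'b::field mat)"
proof
  assume "mat_inverse A = Some B"
  then show "B \<in> carrier_mat n n \<and> A * B = 1\<^sub>m n" using mat_inverse(2)[OF assms] by blast
next
  assume B: "B \<in> carrier_mat n n \<and> A * B = 1\<^sub>m n"
  then have BA: "B * A = 1\<^sub>m n" using mat_mult_left_right_inverse[OF assms] by blast
  have "mat_inverse A \<noteq> None"
  proof
    assume "mat_inverse A = None"
    then have "A \<notin> Units (ring_mat TYPE('b) n ())" by (rule mat_inverse(1)[OF assms])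
    then have "det A = 0" using det_non_zero_imp_unit[OF assms, of "()"] by blast
    moreover have "det A * det B = 1" using B det_mult[OF assms, of B] by simp
    ultimately show False by simp
  qed
  then obtain C where C: "mat_inverse A = Some C" by blast
  then have "C \<in> carrier_mat n n" "A * C = 1\<^sub>m n" using mat_inverse(2)[OF assms] by blast+
  then have "C = (B * A) * C" using BA by simp
  also have "\<dots> = B * (A * C)" using B assms \<open>C \<in> _\<close> by (simp add: assoc_mult_mat[of _ n n])
  also have "\<dots> = B" using B right_mult_one_mat[of B n n] \<open>A * C = 1\<^sub>m n\<close> by metis
  finally show "mat_inverse A = Some B" using C by simp
qed

text \<open>A unital homomorphism maps inverses to inverses, so definedness passes from the source
  to the image by induction on the expression.\<close>

lemma nc_eval_hom:
  fixes \<phi> :: "'a::field \<Rightarrow> 'b::field" and \<psi> :: "'a \<Rightarrow> 'c::field"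
  assumes X: "X \<in> mat_tuples d n" and vars: "nc_vars r \<subseteq> {..<d}"
    and carrier: "\<And>A. A \<in> carrier_mat n n \<Longrightarrow> h A \<in> carrier_mat m m"
    and scalar: "\<And>c. h (\<phi> c \<cdot>\<^sub>m 1\<^sub>m n) = \<psi> c \<cdot>\<^sub>m 1\<^sub>m m"
    and one: "h (1\<^sub>m n) = 1\<^sub>m m"
    and add: "\<And>A B. A \<in> carrier_mat n n \<Longrightarrow> B \<in> carrier_mat n n \<Longrightarrow> h (A + B) = h A + h B"
    and mult: "\<And>A B. A \<in> carrier_mat n n \<Longrightarrow> B \<in> carrier_mat n n \<Longrightarrow> h (A * B) = h A * h B"
    and V: "nc_eval \<phi> n X r = Some V"
  shows "nc_eval \<psi> m (map h X) r = Some (h V)"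
  using vars V
proof (induction r arbitrary: V)
  case (Const c)
  then show ?case using scalar by auto
next
  case (Var k)
  then show ?case using mat_tuplesD[OF X] by auto
next
  case (Add r1 r2)
  then obtain V1 V2 where *: "nc_eval \<phi> n X r1 = Some V1" "nc_eval \<phi> n X r2 = Some V2" "V = V1 + V2"
    by (auto simp: bind_eq_Some_conv)
  then have "V1 \<in> carrier_mat n n" "V2 \<in> carrier_mat n n"
    using nc_eval_carrier[OF X] Add.prems by auto
  then show ?case using * Add by (simp add: add)
next
  case (Mult r1 r2)
  then obtain V1 V2 where *: "nc_eval \<phi> n X r1 = Some V1" "nc_eval \<phi> n X r2 = Some V2" "V = V1 * V2"
    by (auto simp: bind_eq_Some_conv)
  then have "V1 \<in> carrier_mat n n" "V2 \<in> carrier_mat n n"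
    using nc_eval_carrier[OF X] Mult.prems by auto
  then show ?case using * Mult by (simp add: mult)
next
  case (Inv r)
  then obtain W where *: "nc_eval \<phi> n X r = Some W" "mat_inverse W = Some V"
    by (auto simp: bind_eq_Some_conv)
  have W: "W \<in> carrier_mat n n" using nc_eval_carrier[OF X _ *(1)] Inv.prems by simp
  then have V: "V \<in> carrier_mat n n" "W * V = 1\<^sub>m n" using *(2) by (simp_all add: mat_inverse_eq_Some_iff)
  have "h W * h V = 1\<^sub>m m" using mult[OF W V(1)] V(2) one by simp
  then have "mat_inverse (h W) = Some (h V)" using carrier[OF V(1)] by (simp add: mat_inverse_eq_Some_iff[OF carrier[OF W]])
  then show ?case using Inv * by simp
qed


section \<open>Commutative polynomials\<close>

definition monom_val :: "(nat \<Rightarrow> 'b::comm_semiring_1) \<Rightarrow> (nat \<Rightarrow>\<^sub>0 nat) \<Rightarrow> 'b" where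
  "monom_val x mm = (\<Prod>v\<in>Poly_Mapping.keys mm. x v ^ Poly_Mapping.lookup mm v)"

text \<open>Evaluation in an algebra over the coefficients. With values in univariate polynomials it
  restricts a polynomial to a curve.\<close>

definition cpoly_subst :: "('a::zero \<Rightarrow> 'b::comm_semiring_1) \<Rightarrow> (nat \<Rightarrow> 'b) \<Rightarrow> 'a cpoly \<Rightarrow> 'b" where
  "cpoly_subst \<phi> x p =
     (\<Sum>mm\<in>Poly_Mapping.keys p. \<phi> (Poly_Mapping.lookup p mm) * monom_val x mm)"

lemma cpoly_eval_eq_subst: "cpoly_eval x = cpoly_subst (\<lambda>c. c) x"
  by (simp add: fun_eq_iff cpoly_eval_def cpoly_subst_def monom_val_def)

lemma monom_val_superset:
  assumes "finite V" "Poly_Mapping.keys mm \<subseteq> V"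
  shows "monom_val x mm = (\<Prod>v\<in>V. x v ^ Poly_Mapping.lookup mm v)"
  unfolding monom_val_def
  by (rule prod.mono_neutral_left) (use assms in \<open>auto simp: in_keys_iff\<close>)

lemma monom_val_add: "monom_val x (mm + mm') = monom_val x mm * monom_val x mm'"
proof -
  let ?V = "Poly_Mapping.keys mm \<union> Poly_Mapping.keys mm'"
  have "finite ?V" "Poly_Mapping.keys (mm + mm') \<subseteq> ?V" "Poly_Mapping.keys mm \<subseteq> ?V" "Poly_Mapping.keys mm' \<subseteq> ?V"
    using keys_add[of mm mm'] by auto
  then show ?thesis
    by (simp add: monom_val_superset[of ?V] lookup_add power_add prod.distrib)
qed

lemma monom_val_0 [simp]: "monom_val x 0 = 1"
  by (simp add: monom_val_def)

lemma monom_val_single [simp]: "monom_val x (Poly_Mapping.single v n) = x v ^ n"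
  by (simp add: monom_val_def)

lemma poly_mapping_sum_single:
  "(p :: 'k \<Rightarrow>\<^sub>0 'a::comm_monoid_add) = (\<Sum>k\<in>Poly_Mapping.keys p. Poly_Mapping.single k (Poly_Mapping.lookup p k))"
proof (rule poly_mapping_eqI)
  fix k
  have "Poly_Mapping.lookup (Poly_Mapping.single l (Poly_Mapping.lookup p l)) k =
      (if l = k then Poly_Mapping.lookup p k else 0)" for l
    by (auto simp: lookup_single when_def)
  then show "Poly_Mapping.lookup p k =
      Poly_Mapping.lookup (\<Sum>k\<in>Poly_Mapping.keys p. Poly_Mapping.single k (Poly_Mapping.lookup p k)) k"
    by (simp add: lookup_sum in_keys_iff)
qed

context comm_ring_hom
begin

lemma cpoly_subst_superset:
  assumes "finite K" "Poly_Mapping.keys p \<subseteq> K"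
  shows "cpoly_subst hom x p = (\<Sum>mm\<in>K. hom (Poly_Mapping.lookup p mm) * monom_val x mm)"
  unfolding cpoly_subst_def
  by (rule sum.mono_neutral_left) (use assms in \<open>auto simp: in_keys_iff\<close>)

lemma cpoly_subst_add: "cpoly_subst hom x (p + q) = cpoly_subst hom x p + cpoly_subst hom x q"
proof -
  let ?V = "Poly_Mapping.keys p \<union> Poly_Mapping.keys q"
  have "finite ?V" "Poly_Mapping.keys (p + q) \<subseteq> ?V" "Poly_Mapping.keys p \<subseteq> ?V" "Poly_Mapping.keys q \<subseteq> ?V"
    using keys_add[of p q] by auto
  then show ?thesis
    by (simp add: cpoly_subst_superset[of ?V] lookup_add hom_add distrib_right sum.distrib)
qed

lemma cpoly_subst_0 [simp]: "cpoly_subst hom x 0 = 0"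
  by (simp add: cpoly_subst_def)

lemma cpoly_subst_sum: "cpoly_subst hom x (\<Sum>i\<in>I. f i) = (\<Sum>i\<in>I. cpoly_subst hom x (f i))"
  by (induction I rule: infinite_finite_induct) (auto simp: cpoly_subst_add)

lemma cpoly_subst_single [simp]: "cpoly_subst hom x (Poly_Mapping.single mm c) = hom c * monom_val x mm"
  by (simp add: cpoly_subst_def)

lemma cpoly_subst_mult: "cpoly_subst hom x (p * q) = cpoly_subst hom x p * cpoly_subst hom x q"
proof -
  let ?s = "\<lambda>p. \<Sum>k\<in>Poly_Mapping.keys p. Poly_Mapping.single k (Poly_Mapping.lookup p k)"
  have "p * q = ?s p * ?s q"
    using poly_mapping_sum_single[of p] poly_mapping_sum_single[of q] by simp
  also have "\<dots> = (\<Sum>k\<in>Poly_Mapping.keys p. \<Sum>l\<in>Poly_Mapping.keys q.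
      Poly_Mapping.single (k + l) (Poly_Mapping.lookup p k * Poly_Mapping.lookup q l))"
    by (simp add: sum_product mult_single)
  finally have "cpoly_subst hom x (p * q) = (\<Sum>k\<in>Poly_Mapping.keys p. \<Sum>l\<in>Poly_Mapping.keys q.
      (hom (Poly_Mapping.lookup p k) * monom_val x k) * (hom (Poly_Mapping.lookup q l) * monom_val x l))"
    by (simp add: cpoly_subst_sum monom_val_add hom_mult ac_simps)
  then show ?thesis by (simp add: cpoly_subst_def sum_product)
qed

lemma cpoly_subst_hom: "comm_ring_hom (cpoly_subst hom x)"
  by unfold_locales (simp_all add: cpoly_subst_add cpoly_subst_mult flip: single_one)

lemma cpoly_subst_const [simp]: "cpoly_subst hom x (cpoly_const c) = hom c"
  by (simp add: cpoly_const_def)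

lemma cpoly_subst_var [simp]: "cpoly_subst hom x (cpoly_var v) = x v"
  by (simp add: cpoly_var_def)

end

lemma comm_ring_hom_id: "comm_ring_hom (\<lambda>c. c :: 'a::comm_ring_1)"
  by unfold_locales auto

lemma comm_ring_hom_const_poly: "comm_ring_hom (\<lambda>c. [:c:] :: 'a::comm_ring_1 poly)"
  by unfold_locales (auto simp: one_pCons)

lemma comm_ring_hom_poly: "comm_ring_hom (\<lambda>p. poly p (t :: 'a::comm_ring_1))"
  by unfold_locales auto

lemma comm_ring_hom_cpoly_const: "comm_ring_hom (cpoly_const :: 'a::comm_ring_1 \<Rightarrow> _)"
  by unfold_locales (auto simp: cpoly_const_def single_add mult_single)

lemma comm_ring_hom_Fract: "comm_ring_hom (\<lambda>p. Fract p (1 :: 'a::idom))"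
  by unfold_locales (auto simp: One_fract_def Zero_fract_def)

lemma comm_ring_hom_compose:
  assumes "comm_ring_hom f" "comm_ring_hom g"
  shows "comm_ring_hom (\<lambda>c. f (g c))"
proof -
  interpret f: comm_ring_hom f by fact
  interpret g: comm_ring_hom g by fact
  show ?thesis by unfold_locales (auto simp: f.hom_add g.hom_add f.hom_mult g.hom_mult)
qed

lemma cpoly_subst_compose:
  assumes "comm_ring_hom f"
  shows "f (cpoly_subst \<phi> x p) = cpoly_subst (\<lambda>c. f (\<phi> c)) (\<lambda>v. f (x v)) p"
proof -
  interpret comm_ring_hom f by fact
  show ?thesis by (simp add: cpoly_subst_def monom_val_def hom_distribs)
qed

lemma cpoly_subst_ident: "cpoly_subst cpoly_const cpoly_var p = (p :: 'a::comm_ring_1 cpoly)"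
proof -
  have pow: "cpoly_var v ^ n = Poly_Mapping.single (Poly_Mapping.single v n) (1 :: 'a)" for v n
    by (induction n) (auto simp: cpoly_var_def mult_single simp flip: single_add single_one)
  have prod: "(\<Prod>v\<in>V. Poly_Mapping.single (f v) (1 :: 'a)) = Poly_Mapping.single (\<Sum>v\<in>V. f v) 1"
    if "finite V" for V and f :: "nat \<Rightarrow> nat \<Rightarrow>\<^sub>0 nat"
    using that by (induction V) (auto simp: mult_single simp flip: single_one)
  have "monom_val cpoly_var mm = Poly_Mapping.single mm (1 :: 'a)" for mm
    unfolding monom_val_def pow by (subst prod) (simp_all flip: poly_mapping_sum_single)
  then have "cpoly_subst cpoly_const cpoly_var p =
      (\<Sum>mm\<in>Poly_Mapping.keys p. Poly_Mapping.single mm (Poly_Mapping.lookup p mm))"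
    by (simp add: cpoly_subst_def cpoly_const_def mult_single)
  then show ?thesis by (simp flip: poly_mapping_sum_single)
qed

text \<open>The total degree.\<close>

definition homogenize :: "'a::comm_ring_1 cpoly \<Rightarrow> 'a cpoly poly" where
  "homogenize = cpoly_subst (\<lambda>c. [:cpoly_const c:]) (\<lambda>v. monom (cpoly_var v) 1)"

lemma homogenize_hom: "comm_ring_hom (homogenize :: 'a::comm_ring_1 cpoly \<Rightarrow> _)"
  unfolding homogenize_def
  by (intro comm_ring_hom.cpoly_subst_hom comm_ring_hom_compose[OF comm_ring_hom_const_poly comm_ring_hom_cpoly_const])

lemma poly_homogenize_1: "poly (homogenize p) 1 = p"
  using cpoly_subst_compose[OF comm_ring_hom_poly[of 1], of "\<lambda>c. [:cpoly_const c:]" "\<lambda>v. monom (cpoly_var v) 1" p]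
  by (simp add: homogenize_def poly_monom cpoly_subst_ident)

lemma poly_homogenize_0:
  "poly (homogenize p) 0 = cpoly_const (cpoly_eval (\<lambda>_. 0) (p :: 'a::comm_ring_1 cpoly))"
proof -
  have "cpoly_const (cpoly_eval (\<lambda>_. 0) p) = cpoly_subst (\<lambda>c. cpoly_const c) (\<lambda>_. cpoly_const (0::'a)) p"
    unfolding cpoly_eval_eq_subst by (rule cpoly_subst_compose[OF comm_ring_hom_cpoly_const])
  then show ?thesis
    using cpoly_subst_compose[OF comm_ring_hom_poly[of 0], of "\<lambda>c. [:cpoly_const c:]" "\<lambda>v. monom (cpoly_var v) 1" p]
    by (simp add: homogenize_def poly_monom) (simp add: cpoly_const_def)
qed

text \<open>A homogenization that does not depend on the new variable takes the same value at 1 and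
  at 0; the first is the polynomial and the second its constant term.\<close>

lemma dvd_1_if_degree_homogenize_0:
  fixes c :: "'a::field cpoly"
  assumes "degree (homogenize c) = 0" "c \<noteq> 0"
  shows "c dvd 1"
proof -
  obtain a where a: "homogenize c = [:a:]" using assms(1) by (meson degree_eq_zeroE)
  define u where "u = cpoly_eval (\<lambda>_. 0) c"
  have "c = cpoly_const u" using poly_homogenize_1[of c] poly_homogenize_0[of c] by (simp add: a u_def)
  moreover from this have "u \<noteq> 0" using assms(2) by (auto simp: cpoly_const_def)
  ultimately have "c * cpoly_const (inverse u) = 1" by (simp add: cpoly_const_def mult_single)
  then show ?thesis by (metis dvd_triv_left)
qed

text \<open>A representation of minimal total degree is in lowest terms.\<close>

lemma in_crat_dom_iff:
  "in_crat_dom x f \<longleftrightarrow> (\<exists>p q. q \<noteq> 0 \<and> f = Fract p q \<and> cpoly_eval x q \<noteq> 0)"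
proof
  assume "\<exists>p q. q \<noteq> 0 \<and> f = Fract p q \<and> cpoly_eval x q \<noteq> 0"
  then have ex: "\<exists>q p. q \<noteq> 0 \<and> f = Fract p q \<and> cpoly_eval x q \<noteq> 0" by blast
  define Q where "Q q \<longleftrightarrow> (\<exists>p. q \<noteq> 0 \<and> f = Fract p q \<and> cpoly_eval x q \<noteq> 0)" for q
  interpret e: comm_ring_hom "cpoly_subst (\<lambda>c. c) x"
    by (rule comm_ring_hom.cpoly_subst_hom[OF comm_ring_hom_id])
  interpret h: comm_ring_hom "homogenize :: 'a cpoly \<Rightarrow> _" by (rule homogenize_hom)
  obtain q where q: "Q q" and min: "\<And>q'. Q q' \<Longrightarrow> degree (homogenize q) \<le> degree (homogenize q')"
    using ex arg_min_nat_lemma[of Q _ "\<lambda>q. degree (homogenize q)"] unfolding Q_def by blast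
  then obtain p where p: "q \<noteq> 0" "f = Fract p q" "cpoly_eval x q \<noteq> 0" unfolding Q_def by blast
  \<comment> \<open>Cancelling a common factor leaves a denominator that still does not vanish at
    \<open>x\<close>, since it divides one that does not. By minimality its degree cannot drop, so
    the factor is constant; no unique factorization is invoked.\<close>
  have "c dvd 1" if c: "c dvd p" "c dvd q" for c
  proof -
    obtain p' q' where pq: "p = c * p'" "q = c * q'" using c by (auto elim!: dvdE)
    then have nz: "c \<noteq> 0" "q' \<noteq> 0" using p(1) by auto
    have "Q q'" unfolding Q_def using p nz pq
      by (auto intro!: exI[of _ p'] simp: mult_fract_cancel cpoly_eval_eq_subst e.hom_mult)
    then have "degree (homogenize q) \<le> degree (homogenize q')" by (rule min)
    moreover have "homogenize c \<noteq> 0" "homogenize q' \<noteq> 0"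
      using nz poly_homogenize_1[of c] poly_homogenize_1[of q'] by auto
    then have "degree (homogenize q) = degree (homogenize c) + degree (homogenize q')"
      unfolding pq h.hom_mult by (rule degree_mult_eq)
    ultimately show ?thesis using dvd_1_if_degree_homogenize_0 nz by auto
  qed
  then show "in_crat_dom x f" unfolding in_crat_dom_def using p by blast
qed (auto simp: in_crat_dom_def)

text \<open>Kronecker's substitution.\<close>

lemma digits_inject:
  fixes f g :: "nat \<Rightarrow> nat"
  assumes "\<And>v. f v < B" "\<And>v. g v < B" "(\<Sum>v<V. B ^ v * f v) = (\<Sum>v<V. B ^ v * g v)" "v < V"
  shows "f v = g v"
  using assms
proof (induction V arbitrary: f g v)
  case (Suc V)
  have s: "(\<Sum>v<Suc V. B ^ v * h v) = h 0 + B * (\<Sum>v<V. B ^ v * h (Suc v))" for h :: "nat \<Rightarrow> nat"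
    by (simp add: sum.lessThan_Suc_shift sum_distrib_left mult.assoc del: sum.lessThan_Suc)
  have m: "(h 0 + B * S) mod B = h 0" "(h 0 + B * S) div B = S" if "\<And>v. h v < B" for h :: "nat \<Rightarrow> nat" and S
    using that[of 0] by auto
  note eq = Suc.prems(3)[unfolded s]
  have "f 0 = g 0" using m(1)[of f] m(1)[of g] Suc.prems(1,2) eq by metis
  have "(\<Sum>v<V. B ^ v * f (Suc v)) = (\<Sum>v<V. B ^ v * g (Suc v))"
    using m(2)[of f] m(2)[of g] Suc.prems(1,2) eq by metis
  then have "f (Suc w) = g (Suc w)" if "w < V" for w
    using Suc.IH[of "\<lambda>v. f (Suc v)" "\<lambda>v. g (Suc v)" w] Suc.prems(1,2) that by simp
  then show ?case using \<open>f 0 = g 0\<close> Suc.prems(4) by (cases v) auto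
qed simp

text \<open>The variable \<open>v\<close> goes to \<open>t^(B^v)\<close> with \<open>B\<close> above
  all exponents of \<open>h\<close>, so distinct monomials of \<open>h\<close> become distinct
  powers of \<open>t\<close> and cannot cancel. Field values would not do: over a finite field a
  nonzero polynomial may vanish everywhere.\<close>

lemma cpoly_subst_neq_0_exists:
  fixes h :: "'a::field cpoly"
  assumes "h \<noteq> 0"
  obtains y :: "nat \<Rightarrow> 'a poly" where "cpoly_subst (\<lambda>c. [:c:]) y h \<noteq> 0"
proof -
  let ?K = "Poly_Mapping.keys h"
  define B where "B = Suc (Max (insert 0 (\<Union>mm\<in>?K. Poly_Mapping.lookup mm ` Poly_Mapping.keys mm)))"
  define V where "V = Suc (Max (insert 0 (\<Union>mm\<in>?K. Poly_Mapping.keys mm)))"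
  define w where "w mm = (\<Sum>v<V. B ^ v * Poly_Mapping.lookup mm v)" for mm
  have keysV: "Poly_Mapping.keys mm \<subseteq> {..<V}" if "mm \<in> ?K" for mm
    using that unfolding V_def by (auto simp: less_Suc_eq_le intro!: Max_ge)
  have B: "Poly_Mapping.lookup mm v < B" if "mm \<in> ?K" for mm v
  proof (cases "v \<in> Poly_Mapping.keys mm")
    case True
    then show ?thesis using that unfolding B_def by (auto simp: less_Suc_eq_le intro!: Max_ge)
  qed (simp add: in_keys_iff B_def)
  have inj: "mm = mm'" if m: "mm \<in> ?K" "mm' \<in> ?K" "w mm = w mm'" for mm mm'
  proof (rule poly_mapping_eqI)
    fix v
    show "Poly_Mapping.lookup mm v = Poly_Mapping.lookup mm' v"
    proof (cases "v < V")
      case True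
      then show ?thesis
        using digits_inject[of "Poly_Mapping.lookup mm" B "Poly_Mapping.lookup mm'" V v] m B by (simp add: w_def)
    next
      case False
      then have "v \<notin> Poly_Mapping.keys mm" "v \<notin> Poly_Mapping.keys mm'" using keysV m by auto
      then show ?thesis by (simp add: in_keys_iff)
    qed
  qed
  define y where "y v = monom (1::'a) (B ^ v)" for v
  have mm: "monom_val y mm = monom 1 (w mm)" if "mm \<in> ?K" for mm
  proof -
    have "(\<Prod>v\<in>W. y v ^ Poly_Mapping.lookup mm v) = monom 1 (\<Sum>v\<in>W. B ^ v * Poly_Mapping.lookup mm v)"
      if "finite W" for W
      using that by induction (auto simp: y_def monom_power mult_monom)
    then show ?thesis unfolding w_def by (subst monom_val_superset[of "{..<V}"]) (use that keysV in auto)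
  qed
  obtain mm0 where mm0: "mm0 \<in> ?K" using assms by (metis all_not_in_conv keys_eq_empty)
  have "coeff (cpoly_subst (\<lambda>c. [:c:]) y h) (w mm0) =
      (\<Sum>mm\<in>?K. if mm = mm0 then Poly_Mapping.lookup h mm else 0)"
    unfolding cpoly_subst_def coeff_sum
    by (intro sum.cong refl) (use mm0 inj in \<open>auto simp: mm\<close>)
  also have "\<dots> \<noteq> 0" using mm0 by (simp add: in_keys_iff)
  finally have "cpoly_subst (\<lambda>c. [:c:]) y h \<noteq> 0" by auto
  then show ?thesis by (rule that)
qed


declare One_nat_def [simp del]

section \<open>Amplification\<close>

lemma mat_tuples_dims:
  assumes "T \<in> mat_tuples d n"
  shows "length T = d" "k < d \<Longrightarrow> dim_row (T ! k) = n" "k < d \<Longrightarrow> dim_col (T ! k) = n"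
  using mat_tuplesD(1)[OF assms] mat_tuplesD(2)[OF assms, of k] by auto

lemma mat_tuples_eqI:
  assumes "T \<in> mat_tuples d n" "T' \<in> mat_tuples d n"
    and "\<And>k i j. k < d \<Longrightarrow> i < n \<Longrightarrow> j < n \<Longrightarrow> (T ! k) $$ (i, j) = (T' ! k) $$ (i, j)"
  shows "T = T'"
  using assms(3) mat_tuples_dims[OF assms(1)] mat_tuples_dims[OF assms(2)]
  by (intro nth_equalityI eq_matI) simp_all

lemma kronecker_carrier [simp]:
  "A \<in> carrier_mat n n' \<Longrightarrow> B \<in> carrier_mat m m' \<Longrightarrow> kronecker A B \<in> carrier_mat (n * m) (n' * m')"
  by (auto simp: kronecker_def)

lemma kronecker_index [simp]:
  assumes "A \<in> carrier_mat n n'" "B \<in> carrier_mat m m'" "p < n" "i < m" "q < n'" "j < m'"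
  shows "kronecker A B $$ (p * m + i, q * m' + j) = A $$ (p, q) * B $$ (i, j)"
  using assms by (auto simp: kronecker_def block_index_less)

lemma kronecker_mult:
  fixes A :: "'a::comm_semiring_1 mat"
  assumes A: "A \<in> carrier_mat n n" and B: "B \<in> carrier_mat m m" and C: "C \<in> carrier_mat n n" and D: "D \<in> carrier_mat m m"
  shows "kronecker (A * C) (B * D) = kronecker A B * kronecker C D"
proof (rule eq_mat_blockI[of _ n m n m])
  show "kronecker A B * kronecker C D \<in> carrier_mat (n * m) (n * m)"
    by (rule mult_carrier_mat[OF kronecker_carrier[OF A B] kronecker_carrier[OF C D]])
  fix p i q j assume *: "p < n" "i < m" "q < n" "j < m"
  have AC: "A * C \<in> carrier_mat n n" and BD: "B * D \<in> carrier_mat m m" using assms by auto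
  have "kronecker (A * C) (B * D) $$ (p * m + i, q * m + j) =
      (\<Sum>l<n. A $$ (p, l) * C $$ (l, q)) * (\<Sum>y<m. B $$ (i, y) * D $$ (y, j))"
    unfolding kronecker_index[OF AC BD *] mult_mat_index[OF A C *(1,3)] mult_mat_index[OF B D *(2,4)] ..
  also have "\<dots> = (\<Sum>l<n. \<Sum>y<m. (A $$ (p, l) * B $$ (i, y)) * (C $$ (l, q) * D $$ (y, j)))"
    by (simp add: sum_product ac_simps)
  also have "\<dots> = (kronecker A B * kronecker C D) $$ (p * m + i, q * m + j)"
    unfolding mult_mat_block_index[OF kronecker_carrier[OF A B] kronecker_carrier[OF C D]
        block_index_less[OF *(1,2)] block_index_less[OF *(3,4)]]
    by (intro sum.cong refl) (simp add: kronecker_index[OF A B *(1,2)] kronecker_index[OF C D _ _ *(3,4)])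
  finally show "kronecker (A * C) (B * D) $$ (p * m + i, q * m + j) =
      (kronecker A B * kronecker C D) $$ (p * m + i, q * m + j)" .
qed (use assms in auto)

lemma kronecker_add:
  fixes A :: "'a::comm_semiring_1 mat"
  assumes "A \<in> carrier_mat n n" "A' \<in> carrier_mat n n" "B \<in> carrier_mat m m" "B' \<in> carrier_mat m m"
  shows "kronecker (A + A') B = kronecker A B + kronecker A' B"
    and "kronecker A (B + B') = kronecker A B + kronecker A B'"
proof -
  have A: "A + A' \<in> carrier_mat n n" and B: "B + B' \<in> carrier_mat m m" using assms by auto
  note k = kronecker_index[OF A assms(3)] kronecker_index[OF assms(1) B]
    kronecker_index[OF assms(1,3)] kronecker_index[OF assms(2,3)] kronecker_index[OF assms(1,4)]
  note c = kronecker_carrier[OF assms(1,3)] kronecker_carrier[OF assms(2,3)] kronecker_carrier[OF assms(1,4)]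
  show "kronecker (A + A') B = kronecker A B + kronecker A' B"
    by (rule eq_mat_blockI[of _ n m n m])
      (use kronecker_carrier[OF A assms(3)] c assms in \<open>auto simp: k block_index_less distrib_right c[THEN carrier_matD(1)] c[THEN carrier_matD(2)]\<close>)
  show "kronecker A (B + B') = kronecker A B + kronecker A B'"
    by (rule eq_mat_blockI[of _ n m n m])
      (use kronecker_carrier[OF assms(1) B] c assms in \<open>auto simp: k block_index_less distrib_left c[THEN carrier_matD(1)] c[THEN carrier_matD(2)]\<close>)
qed

lemma kronecker_scalar:
  "kronecker (1\<^sub>m n) (c \<cdot>\<^sub>m 1\<^sub>m m) = (c :: 'a::comm_semiring_1) \<cdot>\<^sub>m 1\<^sub>m (n * m)"
  "kronecker (c \<cdot>\<^sub>m 1\<^sub>m n) (1\<^sub>m m) = c \<cdot>\<^sub>m 1\<^sub>m (n * m)"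
proof -
  have "(p * m + i = q * m + j) = (p = q \<and> i = j)" if "i < m" "j < m" for p q i j
    using that by (metis block_index_div_mod)
  then show "kronecker (1\<^sub>m n) (c \<cdot>\<^sub>m 1\<^sub>m m) = c \<cdot>\<^sub>m 1\<^sub>m (n * m)"
    "kronecker (c \<cdot>\<^sub>m 1\<^sub>m n) (1\<^sub>m m) = c \<cdot>\<^sub>m 1\<^sub>m (n * m)"
    by (auto simp: block_index_less kronecker_index[of _ n n _ m m] intro!: eq_mat_blockI[of _ n m n m])
qed

lemma kronecker_one: "kronecker (1\<^sub>m n) (1\<^sub>m m) = (1\<^sub>m (n * m) :: 'a::comm_semiring_1 mat)"
proof -
  have "1 \<cdot>\<^sub>m A = (A :: 'a mat)" for A by (rule eq_matI) auto
  then show ?thesis using kronecker_scalar(1)[of n "1 :: 'a" m] by simp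
qed

lemma amplify_tuples: "X \<in> mat_tuples d n \<Longrightarrow> amplify m X \<in> mat_tuples d (m * n)"
  by (auto simp: amplify_def mat_tuples_def)

lemma nc_eval_amplify:
  assumes "X \<in> mat_tuples d n" "nc_vars r \<subseteq> {..<d}" "nc_eval (\<lambda>c. c) n X r = Some V"
  shows "nc_eval (\<lambda>c. c) (m * n) (amplify m X) r = Some (kronecker (1\<^sub>m m) V)"
  unfolding amplify_def
  by (rule nc_eval_hom[OF assms(1,2) _ _ _ _ _ assms(3)])
    (auto simp: kronecker_scalar kronecker_one kronecker_add(2)[of "1\<^sub>m m" m "1\<^sub>m m" _ n] kronecker_mult[of "1\<^sub>m m" m _ n "1\<^sub>m m", simplified])

text \<open>The other order of the factors: here every \<open>m\<close> by \<open>m\<close> block is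
  a scalar matrix. The two orders differ by a reordering of the coordinates.\<close>

definition amplify_right :: "nat \<Rightarrow> 'a::semiring_1 mat list \<Rightarrow> 'a mat list" where
  "amplify_right m X = map (\<lambda>A. kronecker A (1\<^sub>m m)) X"

lemma amplify_right_tuples: "X \<in> mat_tuples d n \<Longrightarrow> amplify_right m X \<in> mat_tuples d (n * m)"
  by (auto simp: amplify_right_def mat_tuples_def)

lemma nc_eval_amplify_right:
  assumes "X \<in> mat_tuples d n" "nc_vars r \<subseteq> {..<d}" "nc_eval (\<lambda>c. c) n X r = Some V"
  shows "nc_eval (\<lambda>c. c) (n * m) (amplify_right m X) r = Some (kronecker V (1\<^sub>m m))"
  unfolding amplify_right_def
  by (rule nc_eval_hom[OF assms(1,2) _ _ _ _ _ assms(3)])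
    (auto simp: kronecker_scalar kronecker_one kronecker_add(1)[of _ n _ "1\<^sub>m m" m "1\<^sub>m m"] kronecker_mult[of _ n "1\<^sub>m m" m _ "1\<^sub>m m", simplified])


section \<open>Equivalence of expressions\<close>

definition line :: "nat \<Rightarrow> nat \<Rightarrow> 'a::field mat list \<Rightarrow> 'a mat list \<Rightarrow> 'a poly mat list" where
  "line d n X Y = map (\<lambda>k. mat n n (\<lambda>(i, j). [:(X ! k) $$ (i, j), (Y ! k) $$ (i, j) - (X ! k) $$ (i, j):])) [0..<d]"

definition eval_at :: "'a::comm_ring_1 \<Rightarrow> 'a poly mat list \<Rightarrow> 'a mat list" where
  "eval_at t = map (map_mat (\<lambda>p. poly p t))"

lemma line_tuples: "line d n X Y \<in> mat_tuples d n"
  by (auto simp: line_def mat_tuples_def)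

lemma eval_at_tuples: "T \<in> mat_tuples d n \<Longrightarrow> eval_at t T \<in> mat_tuples d n"
  by (auto simp: eval_at_def mat_tuples_def)

lemma eval_at_line:
  assumes "X \<in> mat_tuples d n" "Y \<in> mat_tuples d n"
  shows "eval_at 0 (line d n X Y) = X" "eval_at 1 (line d n X Y) = Y"
  by (rule mat_tuples_eqI[OF eval_at_tuples[OF line_tuples]]; use assms in \<open>simp add: eval_at_def line_def\<close>)+

lemma poly_den:
  assumes "T \<in> mat_tuples d (s * M)"
  shows "poly (den (\<lambda>c. [:c:]) d s M S T) t = den (\<lambda>c. c) d s M S (eval_at t T)"
  using comm_ring_hom.den_hom[OF comm_ring_hom_poly[of t] assms, of "\<lambda>c. [:c:]" S] by (simp add: eval_at_def)

lemma poly_num: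
  assumes "T \<in> mat_tuples d (s * M)" "i < M * s" "j < M * s"
  shows "poly (num (\<lambda>c. [:c:]) d s M S T $$ (i, j)) t = num (\<lambda>c. c) d s M S (eval_at t T) $$ (i, j)"
  using comm_ring_hom.num_hom[OF comm_ring_hom_poly[of t] assms(1), of "\<lambda>c. [:c:]" S] assms(2,3)
  by (simp add: eval_at_def)

text \<open>Denominator and numerator of the linearization: the prefix \<open>k\<close> stands for
  points over the field, \<open>p\<close> for polynomial curves, and below \<open>c\<close> for
  generic matrices.\<close>

abbreviation "kden d n r \<equiv> den (\<lambda>c. c) d 1 n (lin_sys r)"
abbreviation "knum d n r \<equiv> num (\<lambda>c. c) d 1 n (lin_sys r)"
abbreviation "pden d n r \<equiv> den (\<lambda>c. [:c:]) d 1 n (lin_sys r)"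
abbreviation "pnum d n r \<equiv> num (\<lambda>c. [:c:]) d 1 n (lin_sys r)"

lemma nc_eval_iff:
  assumes "X \<in> mat_tuples d n" "nc_vars r \<subseteq> {..<d}"
  shows "nc_eval (\<lambda>c. c) n X r = Some V \<longleftrightarrow> is_val (\<lambda>c. c) d 1 n (lin_sys r) X V"
  by (rule nc_eval_iff_is_val[OF comm_ring_hom_id assms])

text \<open>This is where the equivalence in the linearization pays off: a domain of an expression
  is a principal open set.\<close>

lemma expr_dom_iff:
  assumes "X \<in> mat_tuples d n" "nc_vars r \<subseteq> {..<d}"
  shows "X \<in> expr_dom d n r \<longleftrightarrow> kden d n r X \<noteq> 0"
proof -
  have "X \<in> expr_dom d n r \<longleftrightarrow> (\<exists>V. is_val (\<lambda>c. c) d 1 n (lin_sys r) X V)"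
    using assms(1) by (auto simp: expr_dom_def nc_eval_iff[OF assms, symmetric])
  then show ?thesis using is_val_exists[of "\<lambda>c. c" d 1 n "lin_sys r" X] by (auto simp: is_val_iff)
qed

lemma nondegenerate_vars: "r \<in> nondegenerate_exprs d \<Longrightarrow> nc_vars r \<subseteq> {..<d}"
  by (simp add: nondegenerate_exprs_def)

lemma nc_equiv_nondegenerate:
  "(r1, r2) \<in> nc_equiv d \<Longrightarrow> r1 \<in> nondegenerate_exprs d \<and> r2 \<in> nondegenerate_exprs d"
  by (auto simp: nc_equiv_def)

lemma nc_equivD:
  assumes "(r1, r2) \<in> nc_equiv d" "1 \<le> n" "nc_eval (\<lambda>c. c) n X r1 = Some V" "nc_eval (\<lambda>c. c) n X r2 = Some W"
    "X \<in> mat_tuples d n"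
  shows "V = W"
proof -
  have "X \<in> expr_dom d n r1 \<inter> expr_dom d n r2" using assms by (auto simp: expr_dom_def)
  then have "nc_eval (\<lambda>c. c) n X r1 = nc_eval (\<lambda>c. c) n X r2" using assms(1,2) unfolding nc_equiv_def by blast
  then show ?thesis using assms by simp
qed

text \<open>Equality of two rational functions of \<open>t\<close>, cross-multiplied. The points of
  size \<open>e * n\<close> at which equivalence is applied are the matrix points of a quotient of
  \<open>K[t]\<close>.\<close>

lemma nc_equiv_num_den:
  assumes eq: "(r1, r2) \<in> nc_equiv d" and n: "1 \<le> n" and T: "T \<in> mat_tuples d n"
    and nz: "pden d n r1 T \<noteq> 0" "pden d n r2 T \<noteq> 0" and ij: "i < n" "j < n"
  shows "pnum d n r1 T $$ (i, j) * pden d n r2 T = pnum d n r2 T $$ (i, j) * pden d n r1 T"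
proof (rule num_den_eq_if_agree[OF T _ _ nz _ ij])
  note vars = nc_equiv_nondegenerate[OF eq, THEN conjunct1, THEN nondegenerate_vars]
    nc_equiv_nondegenerate[OF eq, THEN conjunct2, THEN nondegenerate_vars]
  fix e X V W
  assume e: "1 \<le> e" and X: "X \<in> mat_tuples d (e * n)"
    and V: "is_val (\<lambda>c. c) d 1 (e * n) (lin_sys r1) X V" and W: "is_val (\<lambda>c. c) d 1 (e * n) (lin_sys r2) X W"
  have "1 \<le> e * n" using e n by (simp add: One_nat_def Suc_le_eq)
  then show "V = W"
    by (rule nc_equivD[OF eq _ V[folded nc_eval_iff[OF X vars(1)]] W[folded nc_eval_iff[OF X vars(2)]] X])
qed simp_all

lemma nc_equiv_sym: "(r1, r2) \<in> nc_equiv d \<Longrightarrow> (r2, r1) \<in> nc_equiv d"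
  by (auto simp: nc_equiv_def)

text \<open>The middle expression may be undefined at the point where the outer two are compared.
  The point and some point of the domain of \<open>r2\<close> are amplified to a common size and
  joined by a line; along it no denominator vanishes identically, so \<open>r2\<close> can be
  eliminated, and \<open>t = 0\<close> gives the claim.\<close>

lemma nc_equiv_trans:
  assumes eq: "(r1, r2) \<in> nc_equiv d" "(r2, r3) \<in> nc_equiv d"
  shows "(r1, r3) \<in> nc_equiv d"
proof -
  have nd: "r1 \<in> nondegenerate_exprs d" "r2 \<in> nondegenerate_exprs d" "r3 \<in> nondegenerate_exprs d"
    using eq by (auto simp: nc_equiv_def)
  note vars = nd[THEN nondegenerate_vars]
  obtain s Y where s: "1 \<le> s" and Y: "Y \<in> expr_dom d s r2"
    using nd(2) unfolding nondegenerate_exprs_def by blast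
  have Yt: "Y \<in> mat_tuples d s" using Y by (simp add: expr_dom_def)
  have agree: "nc_eval (\<lambda>c. c) n X r1 = nc_eval (\<lambda>c. c) n X r3"
    if n: "1 \<le> n" and X: "X \<in> expr_dom d n r1 \<inter> expr_dom d n r3" for n X
  proof -
    have Xt: "X \<in> mat_tuples d n" using X by (simp add: expr_dom_def)
    obtain V W U where V: "nc_eval (\<lambda>c. c) n X r1 = Some V" and W: "nc_eval (\<lambda>c. c) n X r3 = Some W"
        and U: "nc_eval (\<lambda>c. c) s Y r2 = Some U"
      using X Y unfolding expr_dom_def by auto
    \<comment> \<open>A common multiple of both sizes, so that both points have amplifications of
      this size.\<close>
    define N where "N = s * n"
    have N: "1 \<le> N" using n s by (simp add: N_def One_nat_def Suc_le_eq)
    define X' Y' where "X' = amplify s X" and "Y' = amplify n Y"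
    have t: "X' \<in> mat_tuples d N" "Y' \<in> mat_tuples d N"
      using amplify_tuples[OF Xt, of s] amplify_tuples[OF Yt, of n] by (simp_all add: X'_def Y'_def N_def mult.commute)
    have ev: "nc_eval (\<lambda>c. c) N X' r1 = Some (kronecker (1\<^sub>m s) V)" "nc_eval (\<lambda>c. c) N X' r3 = Some (kronecker (1\<^sub>m s) W)"
      "nc_eval (\<lambda>c. c) N Y' r2 = Some (kronecker (1\<^sub>m n) U)"
      using nc_eval_amplify[OF Xt vars(1) V, of s] nc_eval_amplify[OF Xt vars(3) W, of s]
        nc_eval_amplify[OF Yt vars(2) U, of n] by (simp_all add: X'_def Y'_def N_def mult.commute)
    note v = ev(1)[unfolded nc_eval_iff[OF t(1) vars(1)] is_val_iff] ev(2)[unfolded nc_eval_iff[OF t(1) vars(3)] is_val_iff]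
      ev(3)[unfolded nc_eval_iff[OF t(2) vars(2)] is_val_iff]
    define T where "T = line d N X' Y'"
    have T: "T \<in> mat_tuples d (1 * N)" by (simp add: T_def line_tuples)
    note evT = eval_at_line[OF t, folded T_def]
    have "poly (pden d N r1 T) 0 \<noteq> 0" "poly (pden d N r3 T) 0 \<noteq> 0" "poly (pden d N r2 T) 1 \<noteq> 0"
      using v by (simp_all add: poly_den[OF T] evT)
    then have nz: "pden d N r1 T \<noteq> 0" "pden d N r3 T \<noteq> 0" "pden d N r2 T \<noteq> 0" by auto
    have T': "T \<in> mat_tuples d N" using T by simp
    have entries: "V $$ (i, j) = W $$ (i, j)" if ij: "i < n" "j < n" for i j
    proof -
      have "1 * n \<le> N" unfolding N_def by (rule mult_le_mono1[OF s])
      then have ijN: "i < N" "j < N" using ij by simp_all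
      have "pden d N r2 T * (pnum d N r1 T $$ (i, j) * pden d N r3 T) =
          (pnum d N r1 T $$ (i, j) * pden d N r2 T) * pden d N r3 T" by (simp only: ac_simps)
      also have "\<dots> = (pnum d N r2 T $$ (i, j) * pden d N r1 T) * pden d N r3 T"
        by (simp only: nc_equiv_num_den[OF eq(1) N T' nz(1,3) ijN])
      also have "\<dots> = (pnum d N r2 T $$ (i, j) * pden d N r3 T) * pden d N r1 T" by (simp only: ac_simps)
      also have "\<dots> = (pnum d N r3 T $$ (i, j) * pden d N r2 T) * pden d N r1 T"
        by (simp only: nc_equiv_num_den[OF eq(2) N T' nz(3,2) ijN])
      also have "\<dots> = pden d N r2 T * (pnum d N r3 T $$ (i, j) * pden d N r1 T)" by (simp only: ac_simps)
      finally have "pden d N r2 T * (pnum d N r1 T $$ (i, j) * pden d N r3 T) =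
          pden d N r2 T * (pnum d N r3 T $$ (i, j) * pden d N r1 T)" .
      then have "pnum d N r1 T $$ (i, j) * pden d N r3 T = pnum d N r3 T $$ (i, j) * pden d N r1 T"
        using nz by simp
      then have "poly (pnum d N r1 T $$ (i, j)) 0 * poly (pden d N r3 T) 0 =
          poly (pnum d N r3 T $$ (i, j)) 0 * poly (pden d N r1 T) 0"
        by (simp only: poly_mult[symmetric])
      then have "knum d N r1 X' $$ (i, j) * kden d N r3 X' = knum d N r3 X' $$ (i, j) * kden d N r1 X'"
        using ijN by (simp add: poly_den[OF T] poly_num[OF T] evT)
      moreover have "knum d N r1 X' $$ (i, j) = kden d N r1 X' * kronecker (1\<^sub>m s) V $$ (i, j)"
        "knum d N r3 X' $$ (i, j) = kden d N r3 X' * kronecker (1\<^sub>m s) W $$ (i, j)"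
      proof -
        have "dim_row (kronecker (1\<^sub>m s) V) = N" "dim_col (kronecker (1\<^sub>m s) V) = N"
          "dim_row (kronecker (1\<^sub>m s) W) = N" "dim_col (kronecker (1\<^sub>m s) W) = N"
          using v by auto
        then show "knum d N r1 X' $$ (i, j) = kden d N r1 X' * kronecker (1\<^sub>m s) V $$ (i, j)"
          "knum d N r3 X' $$ (i, j) = kden d N r3 X' * kronecker (1\<^sub>m s) W $$ (i, j)"
          using v ijN by simp_all
      qed
      ultimately have "kronecker (1\<^sub>m s) V $$ (i, j) = kronecker (1\<^sub>m s) W $$ (i, j)" using v by simp
      moreover have "V \<in> carrier_mat n n" "W \<in> carrier_mat n n"
        using nc_eval_carrier[OF Xt vars(1) V] nc_eval_carrier[OF Xt vars(3) W] .
      ultimately show ?thesis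
        using kronecker_index[of "1\<^sub>m s" s s V n n 0 i 0 j, OF one_carrier_mat _ _ ij(1) _ ij(2)]
          kronecker_index[of "1\<^sub>m s" s s W n n 0 i 0 j, OF one_carrier_mat _ _ ij(1) _ ij(2)] s by simp
    qed
    have "V = W"
    proof (rule eq_matI)
      show "V $$ (i, j) = W $$ (i, j)" if "i < dim_row W" "j < dim_col W" for i j
        using that nc_eval_carrier[OF Xt vars(3) W] by (intro entries) simp_all
    qed (use nc_eval_carrier[OF Xt vars(1) V] nc_eval_carrier[OF Xt vars(3) W] in simp_all)
    then show ?thesis using V W by simp
  qed
  show ?thesis unfolding nc_equiv_def mem_Collect_eq prod.case
    by (intro conjI allI impI ballI nd) (rule agree)
qed

lemma nc_rat_fun_equiv:
  assumes F: "F \<in> nc_rat_funs d"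
  shows "r1 \<in> F \<Longrightarrow> r2 \<in> F \<Longrightarrow> (r1, r2) \<in> nc_equiv d"
    and "r1 \<in> F \<Longrightarrow> (r1, r2) \<in> nc_equiv d \<Longrightarrow> r2 \<in> F"
    and "r1 \<in> F \<Longrightarrow> nc_vars r1 \<subseteq> {..<d}"
proof -
  obtain r0 where r0: "F = nc_equiv d `` {r0}" using F by (auto simp: nc_rat_funs_def quotient_def)
  show "(r1, r2) \<in> nc_equiv d" if "r1 \<in> F" "r2 \<in> F"
    using that nc_equiv_trans[OF nc_equiv_sym] unfolding r0 by blast
  show "r2 \<in> F" if "r1 \<in> F" "(r1, r2) \<in> nc_equiv d"
    using that nc_equiv_trans unfolding r0 by blast
  show "nc_vars r1 \<subseteq> {..<d}" if "r1 \<in> F"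
    using that nc_equiv_nondegenerate nondegenerate_vars unfolding r0 by blast
qed

lemma nc_value_eq:
  assumes F: "F \<in> nc_rat_funs d" and r: "r \<in> F" and n: "1 \<le> n"
    and X: "X \<in> mat_tuples d n" and V: "nc_eval (\<lambda>c. c) n X r = Some V"
  shows "nc_value d n F X = V"
  unfolding nc_value_def
proof (rule the_equality)
  show "\<exists>r\<in>F. X \<in> expr_dom d n r \<and> nc_eval (\<lambda>c. c) n X r = Some V"
    using r X V by (auto simp: expr_dom_def)
  fix W assume "\<exists>r\<in>F. X \<in> expr_dom d n r \<and> nc_eval (\<lambda>c. c) n X r = Some W"
  then obtain r' where r': "r' \<in> F" "nc_eval (\<lambda>c. c) n X r' = Some W" by blast
  show "W = V" by (rule nc_equivD[OF nc_rat_fun_equiv(1)[OF F r'(1) r] n r'(2) V X])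
qed


section \<open>Evaluation at generic matrices\<close>

text \<open>The generic matrices before passing to fractions; at this level they can still be
  specialized.\<close>

definition gens :: "nat \<Rightarrow> nat \<Rightarrow> 'a::field cpoly mat list" where
  "gens d n = map (\<lambda>k. mat n n (\<lambda>(i, j). cpoly_var (entry_var k i j))) [0..<d]"

abbreviation "cden d n r \<equiv> den cpoly_const d 1 n (lin_sys r) (gens d n)"
abbreviation "cnum d n r \<equiv> num cpoly_const d 1 n (lin_sys r) (gens d n)"

lemma gens_tuples: "gens d n \<in> mat_tuples d n"
  by (auto simp: gens_def mat_tuples_def)

lemma generic_mats_eq: "generic_mats d n = map (map_mat (\<lambda>p. Fract p 1)) (gens d n)"
  by (auto simp: generic_mats_def gens_def intro!: eq_matI)

text \<open>Universal property of the generic matrices: every tuple over a commutative algebra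
  arises from them by substitution, and numerators and denominators follow.\<close>

lemma subst_gens:
  fixes T :: "'b::comm_ring_1 mat list"
  assumes \<phi>: "comm_ring_hom (\<phi> :: 'a::field \<Rightarrow> 'b)" and T: "T \<in> mat_tuples d n"
    and y: "\<And>k i j. k < d \<Longrightarrow> i < n \<Longrightarrow> j < n \<Longrightarrow> y (entry_var k i j) = (T ! k) $$ (i, j)"
  shows "map (map_mat (cpoly_subst \<phi> y)) (gens d n) = T"
    and "cpoly_subst \<phi> y (cden d n r) = den \<phi> d 1 n (lin_sys r) T"
    and "i < n \<Longrightarrow> j < n \<Longrightarrow> cpoly_subst \<phi> y (cnum d n r $$ (i, j)) = num \<phi> d 1 n (lin_sys r) T $$ (i, j)"
proof -
  interpret \<phi>: comm_ring_hom \<phi> by (rule \<phi>)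
  interpret \<sigma>: comm_ring_hom "cpoly_subst \<phi> y" by (rule \<phi>.cpoly_subst_hom)
  show eq: "map (map_mat (cpoly_subst \<phi> y)) (gens d n) = T"
    by (rule mat_tuples_eqI[OF \<sigma>.map_mat_tuples[OF gens_tuples] T]) (simp add: gens_def y)
  have g: "gens d n \<in> mat_tuples d (1 * n)" by (simp add: gens_tuples)
  show "cpoly_subst \<phi> y (cden d n r) = den \<phi> d 1 n (lin_sys r) T"
    using \<sigma>.den_hom[OF g, of cpoly_const "lin_sys r"] by (simp add: eq)
  have "num \<phi> d 1 n (lin_sys r) T = map_mat (cpoly_subst \<phi> y) (cnum d n r)"
    using \<sigma>.num_hom[OF g, of cpoly_const "lin_sys r"] by (simp add: eq)
  then show "cpoly_subst \<phi> y (cnum d n r $$ (i, j)) = num \<phi> d 1 n (lin_sys r) T $$ (i, j)" if "i < n" "j < n"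
    using that by simp
qed

lemma entries_point_entry_var:
  "k < d \<Longrightarrow> i < n \<Longrightarrow> j < n \<Longrightarrow> entries_point d n T (entry_var k i j) = (T ! k) $$ (i, j)"
  by (simp add: entries_point_def entry_var_def)

lemma nc_eval_generic_iff:
  assumes "nc_vars r \<subseteq> {..<d}"
  shows "nc_eval (\<lambda>c. Fract (cpoly_const c) 1) n (generic_mats d n) r = Some M \<longleftrightarrow>
    cden d n r \<noteq> 0 \<and> M \<in> carrier_mat n n \<and> (\<forall>i<n. \<forall>j<n. M $$ (i, j) = Fract (cnum d n r $$ (i, j)) (cden d n r))"
proof -
  interpret f: comm_ring_hom "\<lambda>p. Fract p (1 :: 'a cpoly)" by (rule comm_ring_hom_Fract)
  have g: "gens d n \<in> mat_tuples d (1 * n)" by (simp add: gens_tuples)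
  have G: "generic_mats d n \<in> mat_tuples d n"
    by (auto simp: generic_mats_def mat_tuples_def)
  have h: "comm_ring_hom (\<lambda>c :: 'a. Fract (cpoly_const c) 1)"
    by (rule comm_ring_hom_compose[OF comm_ring_hom_Fract comm_ring_hom_cpoly_const])
  have d: "den (\<lambda>c. Fract (cpoly_const c) 1) d 1 n (lin_sys r) (generic_mats d n) = Fract (cden d n r) 1"
    unfolding generic_mats_eq by (rule f.den_hom[OF g])
  have m: "num (\<lambda>c. Fract (cpoly_const c) 1) d 1 n (lin_sys r) (generic_mats d n) = map_mat (\<lambda>p. Fract p 1) (cnum d n r)"
    unfolding generic_mats_eq by (rule f.num_hom[OF g])
  have z: "Fract (cden d n r) 1 \<noteq> 0 \<longleftrightarrow> cden d n r \<noteq> 0"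
    by (simp only: Zero_fract_def eq_fract(1)[OF one_neq_zero one_neq_zero] mult_1_right)
  have e: "Fract a 1 = Fract c 1 * x \<longleftrightarrow> x = Fract a c" if "c \<noteq> 0" for a c :: "'a cpoly" and x
  proof (cases x)
    case (Fract p q)
    have "Fract a 1 = Fract c 1 * x \<longleftrightarrow> a * q = c * p" using Fract(2) unfolding Fract(1) by (simp add: eq_fract)
    also have "\<dots> \<longleftrightarrow> p * c = a * q" by (metis mult.commute)
    also have "\<dots> \<longleftrightarrow> x = Fract a c" using Fract(2) that unfolding Fract(1) by (simp add: eq_fract)
    finally show ?thesis .
  qed
  have "map_mat (\<lambda>p. Fract p 1) (cnum d n r) = Fract (cden d n r) 1 \<cdot>\<^sub>m M \<longleftrightarrow>
      (\<forall>i<n. \<forall>j<n. M $$ (i, j) = Fract (cnum d n r $$ (i, j)) (cden d n r))"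
    if "cden d n r \<noteq> 0" "M \<in> carrier_mat n n"
    unfolding mat_eq_iff e[OF that(1), symmetric] using that(2) by simp
  then show ?thesis
    unfolding nc_eval_iff_is_val[OF h G assms] is_val_iff d m z by (simp cong: conj_cong)
qed

lemma cden_neq_0:
  assumes "X \<in> expr_dom d n r" "nc_vars r \<subseteq> {..<d}"
  shows "cden d n r \<noteq> 0" "cpoly_eval (entries_point d n X) (cden d n r) \<noteq> 0"
proof -
  have X: "X \<in> mat_tuples d n" using assms(1) by (simp add: expr_dom_def)
  have "cpoly_eval (entries_point d n X) (cden d n r) = kden d n r X"
    unfolding cpoly_eval_eq_subst
    by (rule subst_gens(2)[OF comm_ring_hom_id X]) (rule entries_point_entry_var)
  then show "cpoly_eval (entries_point d n X) (cden d n r) \<noteq> 0"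
    using assms expr_dom_iff[OF X assms(2)] by simp
  then show "cden d n r \<noteq> 0" by (auto simp: cpoly_eval_def)
qed

text \<open>If the difference were nonzero, Kronecker's substitution would produce a curve along
  which the difference and both denominators remain nonzero, against the comparison along
  curves.\<close>

lemma nc_equiv_generic:
  assumes eq: "(r1, r2) \<in> nc_equiv d" and n: "1 \<le> n" and nz: "cden d n r1 \<noteq> 0" "cden d n r2 \<noteq> 0"
    and ij: "i < n" "j < n"
  shows "cnum d n r1 $$ (i, j) * cden d n r2 = cnum d n r2 $$ (i, j) * cden d n r1"
proof (rule ccontr)
  define h where "h = cnum d n r1 $$ (i, j) * cden d n r2 - cnum d n r2 $$ (i, j) * cden d n r1"
  assume "\<not> ?thesis"
  then have "h * cden d n r1 * cden d n r2 \<noteq> 0" using nz by (simp add: h_def)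
  then obtain y :: "nat \<Rightarrow> 'a poly" where y: "cpoly_subst (\<lambda>c. [:c:]) y (h * cden d n r1 * cden d n r2) \<noteq> 0"
    by (rule cpoly_subst_neq_0_exists)
  interpret p: comm_ring_hom "\<lambda>c. [:c:] :: 'a poly" by (rule comm_ring_hom_const_poly)
  interpret \<sigma>: comm_ring_hom "cpoly_subst (\<lambda>c. [:c:]) y" by (rule p.cpoly_subst_hom)
  define T where "T = map (\<lambda>k. mat n n (\<lambda>(i, j). y (entry_var k i j))) [0..<d]"
  have T: "T \<in> mat_tuples d n" by (auto simp: T_def mat_tuples_def)
  note s = subst_gens[OF comm_ring_hom_const_poly T, of y]
  have sub: "cpoly_subst (\<lambda>c. [:c:]) y (cden d n r) = pden d n r T"
    "cpoly_subst (\<lambda>c. [:c:]) y (cnum d n r $$ (i, j)) = pnum d n r T $$ (i, j)" for r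
    using s(2)[of r] s(3)[of i j r] ij by (simp_all add: T_def)
  have "pden d n r1 T \<noteq> 0" "pden d n r2 T \<noteq> 0" "cpoly_subst (\<lambda>c. [:c:]) y h \<noteq> 0"
    using y by (simp_all add: \<sigma>.hom_mult sub)
  moreover have "cpoly_subst (\<lambda>c. [:c:]) y h = 0"
    using nc_equiv_num_den[OF eq n T calculation(1,2) ij] by (simp add: h_def hom_distribs \<sigma>.hom_minus \<sigma>.hom_mult sub)
  ultimately show False by simp
qed

text \<open>Shows that the definite description in \<open>nc_generic_value\<close> has a unique
  referent, and computes it from any expression with a point in this size.\<close>

lemma nc_generic_value_eq:
  assumes F: "F \<in> nc_rat_funs d" and r: "r \<in> F" and n: "1 \<le> n" and dom: "expr_dom d n r \<noteq> {}"
    and ij: "i < n" "j < n"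
  shows "nc_generic_value d n F $$ (i, j) = Fract (cnum d n r $$ (i, j)) (cden d n r)"
proof -
  define M where "M = mat n n (\<lambda>ij. Fract (cnum d n r $$ ij) (cden d n r))"
  note vars = nc_rat_fun_equiv(3)[OF F]
  have nz: "cden d n r' \<noteq> 0" if "r' \<in> F" "expr_dom d n r' \<noteq> {}" for r'
    using that cden_neq_0(1)[OF _ vars] by blast
  have "nc_generic_value d n F = M"
    unfolding nc_generic_value_def
  proof (rule the_equality)
    show "\<exists>r\<in>F. expr_dom d n r \<noteq> {} \<and> nc_eval (\<lambda>c. Fract (cpoly_const c) 1) n (generic_mats d n) r = Some M"
      using r dom nz by (intro bexI[of _ r]) (auto simp: nc_eval_generic_iff[OF vars[OF r]] M_def)
    fix M' assume "\<exists>r\<in>F. expr_dom d n r \<noteq> {} \<and> nc_eval (\<lambda>c. Fract (cpoly_const c) 1) n (generic_mats d n) r = Some M'"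
    then obtain r' where r': "r' \<in> F" "expr_dom d n r' \<noteq> {}"
        "nc_eval (\<lambda>c. Fract (cpoly_const c) 1) n (generic_mats d n) r' = Some M'" by blast
    note M' = r'(3)[unfolded nc_eval_generic_iff[OF vars[OF r'(1)]]]
    show "M' = M"
    proof (rule eq_matI)
      fix i j assume "i < dim_row M" "j < dim_col M"
      then have ij: "i < n" "j < n" by (simp_all add: M_def)
      have "Fract (cnum d n r' $$ (i, j)) (cden d n r') = Fract (cnum d n r $$ (i, j)) (cden d n r)"
        by (rule iffD2[OF eq_fract(1)[OF nz[OF r'(1,2)] nz[OF r dom]]
            nc_equiv_generic[OF nc_rat_fun_equiv(1)[OF F r'(1) r] n nz[OF r'(1,2)] nz[OF r dom] ij]])
      then show "M' $$ (i, j) = M $$ (i, j)" using M' ij by (simp add: M_def)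
    qed (use M' in \<open>auto simp: M_def\<close>)
  qed
  then show ?thesis using ij by (simp add: M_def)
qed

text \<open>An expression defined at \<open>X\<close> supplies a denominator that does not vanish
  there, which suffices since lowest terms can then be reached by cancellation.\<close>

lemma nc_dom_subset_edom:
  assumes F: "F \<in> nc_rat_funs d" and n: "1 \<le> n"
  shows "nc_dom_n d n F \<subseteq> nc_edom_n d n F"
proof
  fix X assume "X \<in> nc_dom_n d n F"
  then obtain r where r: "r \<in> F" "X \<in> expr_dom d n r" by (auto simp: nc_dom_n_def)
  have dom: "expr_dom d n r \<noteq> {}" using r by blast
  have "in_crat_dom (entries_point d n X) (nc_generic_value d n F $$ (i, j))" if ij: "i < n" "j < n" for i j
    unfolding in_crat_dom_iff nc_generic_value_eq[OF F r(1) n dom ij]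
    using cden_neq_0[OF r(2) nc_rat_fun_equiv(3)[OF F r(1)]] by blast
  moreover have "nc_dom_n d n F \<noteq> {}" "X \<in> mat_tuples d n" using r by (auto simp: nc_dom_n_def expr_dom_def)
  ultimately show "X \<in> nc_edom_n d n F" unfolding nc_edom_n_def by simp
qed

lemma nc_dom_subset_edom_st:
  assumes F: "F \<in> nc_rat_funs d" and n: "1 \<le> n"
  shows "nc_dom_n d n F \<subseteq> nc_edom_st_n d n F"
proof
  fix X assume "X \<in> nc_dom_n d n F"
  then obtain r V where r: "r \<in> F" and X: "X \<in> mat_tuples d n" and V: "nc_eval (\<lambda>c. c) n X r = Some V"
    by (auto simp: nc_dom_n_def expr_dom_def)
  have "amplify m X \<in> nc_edom_n d (m * n) F" if "1 \<le> m" for m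
  proof -
    have "amplify m X \<in> expr_dom d (m * n) r"
      using nc_eval_amplify[OF X nc_rat_fun_equiv(3)[OF F r] V, of m] amplify_tuples[OF X, of m] by (simp add: expr_dom_def)
    then have "amplify m X \<in> nc_dom_n d (m * n) F" using r by (auto simp: nc_dom_n_def)
    moreover have "1 \<le> m * n" using that n by (simp add: One_nat_def Suc_le_eq)
    ultimately show ?thesis using nc_dom_subset_edom[OF F] by blast
  qed
  then show "X \<in> nc_edom_st_n d n F" using X by (simp add: nc_edom_st_n_def)
qed

lemma in_crat_domE:
  assumes "in_crat_dom x f"
  obtains p q where "q \<noteq> 0" "f = Fract p q" "cpoly_eval x q \<noteq> 0"
  using assms by (auto simp: in_crat_dom_def)

text \<open>Regularity of the generic value at a point is inherited by curves through this point.\<close>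

lemma nc_edom_curve:
  assumes F: "F \<in> nc_rat_funs d" and r: "r \<in> F" and n: "1 \<le> n" and dom: "expr_dom d n r \<noteq> {}"
    and T: "T \<in> mat_tuples d n" and X: "eval_at 0 T \<in> nc_edom_n d n F"
    and nz: "pden d n r T \<noteq> 0" and ij: "i < n" "j < n"
  shows "\<exists>q p. poly q 0 \<noteq> 0 \<and> q * pnum d n r T $$ (i, j) = pden d n r T * p"
proof -
  have "\<forall>i<n. \<forall>j<n. in_crat_dom (entries_point d n (eval_at 0 T)) (nc_generic_value d n F $$ (i, j))"
    using X unfolding nc_edom_n_def by (simp split: if_splits)
  then have "in_crat_dom (entries_point d n (eval_at 0 T)) (nc_generic_value d n F $$ (i, j))"
    using ij by simp
  then have "in_crat_dom (entries_point d n (eval_at 0 T)) (Fract (cnum d n r $$ (i, j)) (cden d n r))"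
    by (rule subst[OF nc_generic_value_eq[OF F r n dom ij], where P = "in_crat_dom _"])
  then obtain p q where pq: "q \<noteq> 0" "Fract (cnum d n r $$ (i, j)) (cden d n r) = Fract p q"
      "cpoly_eval (entries_point d n (eval_at 0 T)) q \<noteq> 0"
    by (rule in_crat_domE)
  obtain X' where "X' \<in> expr_dom d n r" using dom[folded ex_in_conv] by (rule exE)
  then have nzc: "cden d n r \<noteq> 0" by (rule cden_neq_0(1)[OF _ nc_rat_fun_equiv(3)[OF F r]])
  have eq: "cnum d n r $$ (i, j) * q = p * cden d n r" by (rule iffD1[OF eq_fract(1)[OF nzc pq(1)] pq(2)])
  let ?y = "entries_point d n T"
  interpret p: comm_ring_hom "\<lambda>c. [:c:] :: 'a poly" by (rule comm_ring_hom_const_poly)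
  interpret \<sigma>: comm_ring_hom "cpoly_subst (\<lambda>c. [:c:]) ?y" by (rule p.cpoly_subst_hom)
  have y: "?y (entry_var k i j) = (T ! k) $$ (i, j)" if "k < d" "i < n" "j < n" for k i j
    using that by (rule entries_point_entry_var)
  have s: "cpoly_subst (\<lambda>c. [:c:]) ?y (cden d n r) = pden d n r T"
    by (rule subst_gens(2)[OF comm_ring_hom_const_poly T]) (rule y)
  have s': "cpoly_subst (\<lambda>c. [:c:]) ?y (cnum d n r $$ (i, j)) = pnum d n r T $$ (i, j)"
    by (rule subst_gens(3)[OF comm_ring_hom_const_poly T _ ij]) (rule y)
  have "cpoly_subst (\<lambda>c. [:c:]) ?y (cnum d n r $$ (i, j)) * cpoly_subst (\<lambda>c. [:c:]) ?y q =
      cpoly_subst (\<lambda>c. [:c:]) ?y p * cpoly_subst (\<lambda>c. [:c:]) ?y (cden d n r)"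
    by (simp only: eq flip: \<sigma>.hom_mult)
  then have "cpoly_subst (\<lambda>c. [:c:]) ?y q * pnum d n r T $$ (i, j) = pden d n r T * cpoly_subst (\<lambda>c. [:c:]) ?y p"
    by (simp add: s s' mult.commute)
  moreover have "poly (cpoly_subst (\<lambda>c. [:c:]) ?y q) 0 = cpoly_eval (entries_point d n (eval_at 0 T)) q"
  proof -
    have "(\<lambda>v. poly (?y v) 0) = entries_point d n (eval_at 0 T)"
    proof (rule ext)
      fix v
      obtain k w where v: "prod_decode v = (k, w)" by (cases "prod_decode v")
      obtain i j where w: "prod_decode w = (i, j)" by (cases "prod_decode w")
      show "poly (?y v) 0 = entries_point d n (eval_at 0 T) v"
        by (simp add: entries_point_def v w eval_at_def mat_tuples_dims[OF T])
    qed
    then show ?thesis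
      using cpoly_subst_compose[OF comm_ring_hom_poly[of 0], of "\<lambda>c. [:c:]" ?y q] by (simp add: cpoly_eval_eq_subst)
  qed
  ultimately have "poly (cpoly_subst (\<lambda>c. [:c:]) ?y q) 0 \<noteq> 0 \<and> cpoly_subst (\<lambda>c. [:c:]) ?y q * pnum d n r T $$ (i, j) =
      pden d n r T * cpoly_subst (\<lambda>c. [:c:]) ?y p" using pq(3) by simp
  then show ?thesis by (intro exI)
qed


section \<open>Fornasini--Marchesini realizations as affine systems\<close>

definition unit_mat :: "nat \<Rightarrow> nat \<Rightarrow> nat \<Rightarrow> 'a::zero_neq_one mat" where
  "unit_mat s x y = mat s s (\<lambda>(i, j). if i = x \<and> j = y then 1 else 0)"

lemma unit_mat_carrier [simp]: "unit_mat s x y \<in> carrier_mat s s"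
  by (simp add: unit_mat_def)

lemma linear_mat_map_expand:
  fixes T :: "'a::field mat \<Rightarrow> 'a mat"
  assumes T: "linear_mat_map s nr nc T" and A: "A \<in> carrier_mat s s" and *: "\<alpha> < nr" "\<beta> < nc"
  shows "T A $$ (\<alpha>, \<beta>) = (\<Sum>x<s. \<Sum>y<s. A $$ (x, y) * T (unit_mat s x y) $$ (\<alpha>, \<beta>))"
proof -
  have T': "\<And>M. M \<in> carrier_mat s s \<Longrightarrow> T M \<in> carrier_mat nr nc"
    "\<And>M N. M \<in> carrier_mat s s \<Longrightarrow> N \<in> carrier_mat s s \<Longrightarrow> T (M + N) = T M + T N"
    "\<And>c M. M \<in> carrier_mat s s \<Longrightarrow> T (c \<cdot>\<^sub>m M) = c \<cdot>\<^sub>m T M"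
    using T unfolding linear_mat_map_def by blast+
  \<comment> \<open>The matrix \<open>A\<close> truncated to the positions in \<open>I\<close>; the
    formula is proved by adding one position at a time.\<close>
  define R where "R I = mat s s (\<lambda>ij. if ij \<in> I then A $$ ij else 0)" for I
  have R: "R I \<in> carrier_mat s s" for I by (simp add: R_def)
  have "T (R I) $$ (\<alpha>, \<beta>) = (\<Sum>(x, y)\<in>I. A $$ (x, y) * T (unit_mat s x y) $$ (\<alpha>, \<beta>))"
    if "I \<subseteq> {..<s} \<times> {..<s}" for I
    using finite_subset[OF that finite_cartesian_product[OF finite_lessThan finite_lessThan]] that
  proof (induction I)
    case empty
    have "R {} = 0 \<cdot>\<^sub>m R {}" by (rule eq_matI) (auto simp: R_def)
    then have "T (R {}) = 0 \<cdot>\<^sub>m T (R {})" using T'(3)[OF R] by metis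
    then have "T (R {}) $$ (\<alpha>, \<beta>) = 0 * T (R {}) $$ (\<alpha>, \<beta>)"
      using T'(1)[OF R, of "{}"] * by (metis carrier_matD(1) carrier_matD(2) index_smult_mat(1))
    then show ?case by simp
  next
    case (insert p I)
    obtain x y where p: "p = (x, y)" by (cases p)
    have "R (insert p I) = A $$ (x, y) \<cdot>\<^sub>m unit_mat s x y + R I"
      using insert by (intro eq_matI) (auto simp: R_def unit_mat_def p)
    then have "T (R (insert p I)) = A $$ (x, y) \<cdot>\<^sub>m T (unit_mat s x y) + T (R I)"
      by (simp add: T'(2)[OF smult_carrier_mat[OF unit_mat_carrier] R] T'(3)[OF unit_mat_carrier])
    then have "T (R (insert p I)) $$ (\<alpha>, \<beta>) = A $$ (x, y) * T (unit_mat s x y) $$ (\<alpha>, \<beta>) + T (R I) $$ (\<alpha>, \<beta>)"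
      using * carrier_matD[OF T'(1)[OF R[of I]]] carrier_matD[OF T'(1)[OF unit_mat_carrier[of s x y]]] by simp
    then show ?case using insert p by simp
  qed
  from this[of "{..<s} \<times> {..<s}"] have "T (R ({..<s} \<times> {..<s})) $$ (\<alpha>, \<beta>) =
      (\<Sum>x<s. \<Sum>y<s. A $$ (x, y) * T (unit_mat s x y) $$ (\<alpha>, \<beta>))"
    by (simp add: sum.cartesian_product)
  moreover have "R ({..<s} \<times> {..<s}) = A" using A by (intro eq_matI) (auto simp: R_def)
  ultimately show ?thesis by simp
qed

definition fm_sys :: "nat \<Rightarrow> nat \<Rightarrow> 'a::field mat list \<Rightarrow> 'a fm_real \<Rightarrow> 'a sys" where
  "fm_sys d s Y R = Sys (fm_L R)
     (\<lambda>\<alpha> \<beta>. (if \<alpha> = \<beta> then 1 else 0) + (\<Sum>k<d. fm_A R k (Y ! k) $$ (\<alpha>, \<beta>)))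
     (\<lambda>k x y \<alpha> \<beta>. - fm_A R k (unit_mat s x y) $$ (\<alpha>, \<beta>))
     (\<lambda>\<alpha> j. - (\<Sum>k<d. fm_B R k (Y ! k) $$ (\<alpha>, j)))
     (\<lambda>k x y \<alpha> j. fm_B R k (unit_mat s x y) $$ (\<alpha>, j))
     (\<lambda>i \<alpha>. fm_C R $$ (i, \<alpha>)) (\<lambda>i j. fm_D R $$ (i, j))"

lemma fm_sys_simps [simp]:
  "sys_L (fm_sys d s Y R) = fm_L R"
  "sys_G (fm_sys d s Y R) = (\<lambda>\<alpha> \<beta>. (if \<alpha> = \<beta> then 1 else 0) + (\<Sum>k<d. fm_A R k (Y ! k) $$ (\<alpha>, \<beta>)))"
  "sys_a (fm_sys d s Y R) = (\<lambda>k x y \<alpha> \<beta>. - fm_A R k (unit_mat s x y) $$ (\<alpha>, \<beta>))"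
  "sys_B (fm_sys d s Y R) = (\<lambda>\<alpha> j. - (\<Sum>k<d. fm_B R k (Y ! k) $$ (\<alpha>, j)))"
  "sys_b (fm_sys d s Y R) = (\<lambda>k x y \<alpha> j. fm_B R k (unit_mat s x y) $$ (\<alpha>, j))"
  "sys_C (fm_sys d s Y R) = (\<lambda>i \<alpha>. fm_C R $$ (i, \<alpha>))"
  "sys_D (fm_sys d s Y R) = (\<lambda>i j. fm_D R $$ (i, j))"
  by (simp_all add: fm_sys_def)

context
  fixes d s :: nat and Y :: "'a::field mat list" and R :: "'a fm_real"
  assumes R: "is_fm_real d s R" and Y: "Y \<in> mat_tuples d s"
begin

lemma fm_linear:
  "k < d \<Longrightarrow> linear_mat_map s (fm_L R) (fm_L R) (fm_A R k)"
  "k < d \<Longrightarrow> linear_mat_map s (fm_L R) s (fm_B R k)"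
  "fm_C R \<in> carrier_mat s (fm_L R)" "fm_D R \<in> carrier_mat s s"
  using R by (auto simp: is_fm_real_def)

lemma fm_map_carrier:
  assumes "k < d" "M \<in> carrier_mat s s"
  shows "fm_A R k M \<in> carrier_mat (fm_L R) (fm_L R)" "fm_B R k M \<in> carrier_mat (fm_L R) s"
  using fm_linear(1,2)[OF assms(1)] assms(2) by (auto simp: linear_mat_map_def)

lemma blockwise_expand:
  assumes T: "linear_mat_map s nr nc T" and X: "X \<in> carrier_mat (s * M) (s * M)" and y: "y \<in> carrier_mat s s"
    and *: "P < M" "\<alpha> < nr" "Q < M" "\<beta> < nc"
  shows "blockwise s nr nc M T (X - kronecker (1\<^sub>m M) y) $$ (P * nr + \<alpha>, Q * nc + \<beta>) =
    (\<Sum>x<s. \<Sum>z<s. X $$ (P * s + x, Q * s + z) * T (unit_mat s x z) $$ (\<alpha>, \<beta>)) -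
    (if P = Q then T y $$ (\<alpha>, \<beta>) else 0)"
proof -
  let ?Z = "X - kronecker (1\<^sub>m M) y"
  have K: "kronecker (1\<^sub>m M) y \<in> carrier_mat (M * s) (M * s)" using y by simp
  have b: "mat_block s ?Z P Q \<in> carrier_mat s s" by (simp add: mat_block_def)
  have e: "mat_block s ?Z P Q $$ (x, z) = X $$ (P * s + x, Q * s + z) - (if P = Q then y $$ (x, z) else 0)"
    if "x < s" "z < s" for x z
    using that * K block_index_less[of P M x s] block_index_less[of Q M z s]
      kronecker_index[OF one_carrier_mat y *(1) that(1) *(3) that(2)]
    by (simp add: mat_block_def carrier_matD[OF K])
  have "blockwise s nr nc M T ?Z $$ (P * nr + \<alpha>, Q * nc + \<beta>) = T (mat_block s ?Z P Q) $$ (\<alpha>, \<beta>)"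
    using * block_index_less[OF *(1,2)] block_index_less[OF *(3,4)] by (simp add: blockwise_def mult.commute)
  also have "\<dots> = (\<Sum>x<s. \<Sum>z<s. mat_block s ?Z P Q $$ (x, z) * T (unit_mat s x z) $$ (\<alpha>, \<beta>))"
    by (rule linear_mat_map_expand[OF T b *(2,4)])
  also have "\<dots> = (\<Sum>x<s. \<Sum>z<s. X $$ (P * s + x, Q * s + z) * T (unit_mat s x z) $$ (\<alpha>, \<beta>) -
      (if P = Q then y $$ (x, z) * T (unit_mat s x z) $$ (\<alpha>, \<beta>) else 0))"
    by (intro sum.cong refl) (simp add: e left_diff_distrib)
  also have "\<dots> = (\<Sum>x<s. \<Sum>z<s. X $$ (P * s + x, Q * s + z) * T (unit_mat s x z) $$ (\<alpha>, \<beta>)) -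
      (if P = Q then T y $$ (\<alpha>, \<beta>) else 0)"
    by (simp add: sum_subtractf linear_mat_map_expand[OF T y *(2,4)])
  finally show ?thesis .
qed

lemma mat_sum_blockwise:
  assumes T: "\<And>k. k < d \<Longrightarrow> linear_mat_map s nr nc (T k)" and X: "X \<in> mat_tuples d (s * M)"
    and *: "P < M" "\<alpha> < nr" "Q < M" "\<beta> < nc"
  shows "mat_sum (nr * M) (nc * M) (\<lambda>k. blockwise s nr nc M (T k) (X ! k - kronecker (1\<^sub>m M) (Y ! k))) d $$
      (P * nr + \<alpha>, Q * nc + \<beta>) =
    (\<Sum>k<d. \<Sum>x<s. \<Sum>z<s. (X ! k) $$ (P * s + x, Q * s + z) * T k (unit_mat s x z) $$ (\<alpha>, \<beta>)) -
    (if P = Q then \<Sum>k<d. T k (Y ! k) $$ (\<alpha>, \<beta>) else 0)"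
proof -
  have "mat_sum (nr * M) (nc * M) (\<lambda>k. blockwise s nr nc M (T k) (X ! k - kronecker (1\<^sub>m M) (Y ! k))) d $$
      (P * nr + \<alpha>, Q * nc + \<beta>) =
      (\<Sum>k<d. blockwise s nr nc M (T k) (X ! k - kronecker (1\<^sub>m M) (Y ! k)) $$ (P * nr + \<alpha>, Q * nc + \<beta>))"
    using block_index_less[OF *(1,2)] block_index_less[OF *(3,4)] by (simp add: mat_sum_def mult.commute)
  also have "\<dots> = (\<Sum>k<d. (\<Sum>x<s. \<Sum>z<s. (X ! k) $$ (P * s + x, Q * s + z) * T k (unit_mat s x z) $$ (\<alpha>, \<beta>)) -
      (if P = Q then T k (Y ! k) $$ (\<alpha>, \<beta>) else 0))"
    by (intro sum.cong refl blockwise_expand T * mat_tuplesD(2)[OF X] mat_tuplesD(2)[OF Y]) simp_all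
  finally show ?thesis by (simp add: sum_subtractf)
qed

lemma lam_fm_sys:
  assumes X: "X \<in> mat_tuples d (s * M)"
  shows "lam (\<lambda>c. c) d s M (fm_sys d s Y R) X = fm_pencil d s Y R M X"
proof (rule eq_mat_blockI[of _ M "fm_L R" M "fm_L R"])
  fix P \<alpha> Q \<beta> assume *: "P < M" "\<alpha> < fm_L R" "Q < M" "\<beta> < fm_L R"
  have "P * fm_L R + \<alpha> = Q * fm_L R + \<beta> \<longleftrightarrow> P = Q \<and> \<alpha> = \<beta>"
    using * by (metis block_index_div_mod)
  then have "fm_pencil d s Y R M X $$ (P * fm_L R + \<alpha>, Q * fm_L R + \<beta>) = (if P = Q \<and> \<alpha> = \<beta> then 1 else 0) -
      mat_sum (fm_L R * M) (fm_L R * M) (\<lambda>k. blockwise s (fm_L R) (fm_L R) M (fm_A R k) (X ! k - kronecker (1\<^sub>m M) (Y ! k))) d $$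
        (P * fm_L R + \<alpha>, Q * fm_L R + \<beta>)"
    using block_index_less[OF *(1,2)] block_index_less[OF *(3,4)]
    by (simp add: fm_pencil_def mat_sum_def mult.commute)
  note e' = this
  have e: "mat_sum (fm_L R * M) (fm_L R * M) (\<lambda>k. blockwise s (fm_L R) (fm_L R) M (fm_A R k) (X ! k - kronecker (1\<^sub>m M) (Y ! k))) d $$
        (P * fm_L R + \<alpha>, Q * fm_L R + \<beta>) =
      (\<Sum>k<d. \<Sum>x<s. \<Sum>z<s. (X ! k) $$ (P * s + x, Q * s + z) * fm_A R k (unit_mat s x z) $$ (\<alpha>, \<beta>)) -
      (if P = Q then \<Sum>k<d. fm_A R k (Y ! k) $$ (\<alpha>, \<beta>) else 0)"
    by (rule mat_sum_blockwise[OF _ X *]) (rule fm_linear(1))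
  show "lam (\<lambda>c. c) d s M (fm_sys d s Y R) X $$ (P * fm_L R + \<alpha>, Q * fm_L R + \<beta>) =
      fm_pencil d s Y R M X $$ (P * fm_L R + \<alpha>, Q * fm_L R + \<beta>)"
    unfolding e' e
    by (simp add: lam_def aff_index[OF *] aff_entry_def sum_negf)
qed (auto simp: fm_pencil_def mat_sum_def mult.commute intro!: carrier_matI)

lemma rhs_fm_sys:
  assumes X: "X \<in> mat_tuples d (s * M)"
  shows "rhs (\<lambda>c. c) d s M (fm_sys d s Y R) X =
    mat_sum (fm_L R * M) (s * M) (\<lambda>k. blockwise s (fm_L R) s M (fm_B R k) (X ! k - kronecker (1\<^sub>m M) (Y ! k))) d"
proof (rule eq_mat_blockI[of _ M "fm_L R" M s])
  fix P \<alpha> Q \<beta> assume *: "P < M" "\<alpha> < fm_L R" "Q < M" "\<beta> < s"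
  have e: "mat_sum (fm_L R * M) (s * M) (\<lambda>k. blockwise s (fm_L R) s M (fm_B R k) (X ! k - kronecker (1\<^sub>m M) (Y ! k))) d $$
        (P * fm_L R + \<alpha>, Q * s + \<beta>) =
      (\<Sum>k<d. \<Sum>x<s. \<Sum>z<s. (X ! k) $$ (P * s + x, Q * s + z) * fm_B R k (unit_mat s x z) $$ (\<alpha>, \<beta>)) -
      (if P = Q then \<Sum>k<d. fm_B R k (Y ! k) $$ (\<alpha>, \<beta>) else 0)"
    by (rule mat_sum_blockwise[OF _ X *]) (rule fm_linear(2))
  show "rhs (\<lambda>c. c) d s M (fm_sys d s Y R) X $$ (P * fm_L R + \<alpha>, Q * s + \<beta>) =
      mat_sum (fm_L R * M) (s * M) (\<lambda>k. blockwise s (fm_L R) s M (fm_B R k) (X ! k - kronecker (1\<^sub>m M) (Y ! k))) d $$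
        (P * fm_L R + \<alpha>, Q * s + \<beta>)"
    unfolding e
    by (simp add: rhs_def aff_index[OF *] aff_entry_def)
qed (auto simp: mat_sum_def mult.commute)

lemma diag_fm_sys:
  "diagC (\<lambda>c. c) s M (fm_sys d s Y R) = kronecker (1\<^sub>m M) (fm_C R)"
  "diagD (\<lambda>c. c) s M (fm_sys d s Y R) = kronecker (1\<^sub>m M) (fm_D R)"
proof -
  show "diagC (\<lambda>c. c) s M (fm_sys d s Y R) = kronecker (1\<^sub>m M) (fm_C R)"
    by (rule eq_mat_blockI[of _ M s M "fm_L R"])
      (use kronecker_carrier[OF one_carrier_mat fm_linear(3)] in
        \<open>auto simp: diagC_def kronecker_index[OF one_carrier_mat fm_linear(3)]\<close>)
  show "diagD (\<lambda>c. c) s M (fm_sys d s Y R) = kronecker (1\<^sub>m M) (fm_D R)"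
    by (rule eq_mat_blockI[of _ M s M s])
      (use kronecker_carrier[OF one_carrier_mat fm_linear(4)] in
        \<open>auto simp: diagD_def kronecker_index[OF one_carrier_mat fm_linear(4)]\<close>)
qed

lemma fm_domain_iff:
  "X \<in> fm_domain d s Y R M \<longleftrightarrow> X \<in> mat_tuples d (s * M) \<and> den (\<lambda>c. c) d s M (fm_sys d s Y R) X \<noteq> 0"
  by (auto simp: fm_domain_def den_def lam_fm_sys)

lemma fm_value_is_val:
  assumes "X \<in> fm_domain d s Y R M"
  shows "is_val (\<lambda>c. c) d s M (fm_sys d s Y R) X (fm_value d s Y R M X)"
proof -
  let ?S = "fm_sys d s Y R" and ?p = "fm_pencil d s Y R M X" and ?m = "M * fm_L R"
  have X: "X \<in> mat_tuples d (s * M)" and nz: "den (\<lambda>c. c) d s M ?S X \<noteq> 0" using assms fm_domain_iff by auto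
  have p: "?p \<in> carrier_mat ?m ?m" using sys_carrier(1)[of "\<lambda>c. c" d s M ?S X] lam_fm_sys[OF X] by simp
  have "?p \<in> Units (ring_mat TYPE('a) ?m ())"
    by (rule det_non_zero_imp_unit[OF p]) (use nz in \<open>simp add: den_def lam_fm_sys[OF X]\<close>)
  then obtain W where W: "mat_inverse ?p = Some W" using mat_inverse(1)[OF p, of "()"] by (cases "mat_inverse ?p") auto
  have W': "?p * W = 1\<^sub>m ?m" "W \<in> carrier_mat ?m ?m" using mat_inverse(2)[OF p W] by auto
  let ?b = "rhs (\<lambda>c. c) d s M ?S X"
  have b: "?b \<in> carrier_mat ?m (M * s)" using sys_carrier(2)[of "\<lambda>c. c" d s M ?S X] by simp
  have C: "diagC (\<lambda>c. c) s M ?S \<in> carrier_mat (M * s) ?m" using sys_carrier(3)[of "\<lambda>c. c" s M ?S] by simp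
  have "?p * (W * ?b) = ?b" using W' b p by (simp flip: assoc_mult_mat[OF p W'(2) b])
  moreover have "fm_value d s Y R M X = diagD (\<lambda>c. c) s M ?S + diagC (\<lambda>c. c) s M ?S * (W * ?b)"
    unfolding fm_value_def W diag_fm_sys[symmetric] rhs_fm_sys[OF X, symmetric] option.sel
    by (simp add: assoc_mult_mat[OF C W'(2) b])
  ultimately show ?thesis
    unfolding is_val_def using nz mult_carrier_mat[OF W'(2) b]
    by (intro conjI bexI[of _ "W * ?b"]) (simp_all add: lam_fm_sys[OF X])
qed

end

text \<open>Being a realization, tested on a single expression. Existence of realizations and the
  regularity of the resolvent are obtained for one expression and its own domain;
  \<open>fm_realizes\<close> amounts to this for all members of the class.\<close>

definition realizes_expr :: "nat \<Rightarrow> nat \<Rightarrow> 'a::field mat list \<Rightarrow> 'a fm_real \<Rightarrow> 'a ncexpr \<Rightarrow> bool" where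
  "realizes_expr d s Y R r \<longleftrightarrow> is_fm_real d s R \<and> (\<forall>m\<ge>1. \<forall>X \<in> expr_dom d (s * m) r.
     \<exists>V. nc_eval (\<lambda>c. c) (s * m) X r = Some V \<and> is_val (\<lambda>c. c) d s m (fm_sys d s Y R) X V)"

lemma fm_realizes_iff:
  assumes F: "F \<in> nc_rat_funs d" and Y: "Y \<in> mat_tuples d s" and s: "1 \<le> s"
  shows "fm_realizes d s Y R F \<longleftrightarrow> is_fm_real d s R \<and> (\<forall>r\<in>F. realizes_expr d s Y R r)"
proof (cases "is_fm_real d s R")
  case R: True
  have val: "nc_value d (s * m) F X = V" if "r \<in> F" "1 \<le> m" "X \<in> expr_dom d (s * m) r" "nc_eval (\<lambda>c. c) (s * m) X r = Some V" for r m X V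
    by (rule nc_value_eq[OF F that(1) _ _ that(4)]) (use that s in \<open>auto simp: expr_dom_def One_nat_def Suc_le_eq\<close>)
  show ?thesis
  proof
    assume rl: "fm_realizes d s Y R F"
    have "\<exists>V. nc_eval (\<lambda>c. c) (s * m) X r = Some V \<and> is_val (\<lambda>c. c) d s m (fm_sys d s Y R) X V"
      if h: "r \<in> F" "1 \<le> m" "X \<in> expr_dom d (s * m) r" for r m X
    proof -
      obtain V where V: "nc_eval (\<lambda>c. c) (s * m) X r = Some V" using h(3) by (auto simp: expr_dom_def)
      have X: "X \<in> nc_dom_n d (s * m) F" using h by (auto simp: nc_dom_n_def)
      have "X \<in> fm_domain d s Y R m" "nc_value d (s * m) F X = fm_value d s Y R m X"
        using rl X h(2) unfolding fm_realizes_def by blast+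
      then show ?thesis using fm_value_is_val[OF R Y] val[OF h V] V by auto
    qed
    then show "is_fm_real d s R \<and> (\<forall>r\<in>F. realizes_expr d s Y R r)" using R unfolding realizes_expr_def by blast
  next
    assume rl: "is_fm_real d s R \<and> (\<forall>r\<in>F. realizes_expr d s Y R r)"
    have "X \<in> fm_domain d s Y R m \<and> nc_value d (s * m) F X = fm_value d s Y R m X"
      if m: "1 \<le> m" and X: "X \<in> nc_dom_n d (s * m) F" for m X
    proof -
      obtain r where r: "r \<in> F" "X \<in> expr_dom d (s * m) r" using X by (auto simp: nc_dom_n_def)
      then obtain V where V: "nc_eval (\<lambda>c. c) (s * m) X r = Some V" "is_val (\<lambda>c. c) d s m (fm_sys d s Y R) X V"
        using rl m unfolding realizes_expr_def by blast
      have "X \<in> fm_domain d s Y R m"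
        using V(2) r(2) by (auto simp: fm_domain_iff[OF R Y] is_val_iff expr_dom_def)
      then show ?thesis
        using val[OF r(1) m r(2) V(1)] is_val_unique[OF V(2) fm_value_is_val[OF R Y]] by simp
    qed
    then show "fm_realizes d s Y R F" unfolding fm_realizes_def using R by blast
  qed
qed (simp add: fm_realizes_def)


section \<open>Controllability and observability\<close>

text \<open>Generated by the columns of the images of matrix units under \<open>B\<close>, and
  closed under the images of matrix units under \<open>A\<close>; the minus sign undoes the one in
  \<open>sys_a\<close>.\<close>

inductive reach :: "nat \<Rightarrow> nat \<Rightarrow> 'a::field sys \<Rightarrow> (nat \<Rightarrow> 'a) \<Rightarrow> bool" for d s S where
  base: "k < d \<Longrightarrow> x < s \<Longrightarrow> y < s \<Longrightarrow> j < s \<Longrightarrow> reach d s S (\<lambda>\<alpha>. sys_b S k x y \<alpha> j)"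
| step: "reach d s S h \<Longrightarrow> k < d \<Longrightarrow> x < s \<Longrightarrow> y < s \<Longrightarrow>
    reach d s S (\<lambda>\<alpha>. - (\<Sum>\<beta><sys_L S. sys_a S k x y \<alpha> \<beta> * h \<beta>))"

inductive coreach :: "nat \<Rightarrow> nat \<Rightarrow> 'a::field sys \<Rightarrow> (nat \<Rightarrow> 'a) \<Rightarrow> bool" for d s S where
  base: "i < s \<Longrightarrow> coreach d s S (\<lambda>\<alpha>. sys_C S i \<alpha>)"
| step: "coreach d s S g \<Longrightarrow> k < d \<Longrightarrow> x < s \<Longrightarrow> y < s \<Longrightarrow>
    coreach d s S (\<lambda>\<beta>. - (\<Sum>\<alpha><sys_L S. g \<alpha> * sys_a S k x y \<alpha> \<beta>))"

text \<open>Spanning of the state space, expressed through functionals: only the zero functional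
  kills all reachable vectors. This form needs no spans and dualizes literally.\<close>

definition controllable :: "nat \<Rightarrow> nat \<Rightarrow> 'a::field sys \<Rightarrow> bool" where
  "controllable d s S \<longleftrightarrow> (\<forall>l. (\<forall>h. reach d s S h \<longrightarrow> (\<Sum>\<alpha><sys_L S. l \<alpha> * h \<alpha>) = 0) \<longrightarrow> (\<forall>\<alpha><sys_L S. l \<alpha> = 0))"

definition observable :: "nat \<Rightarrow> nat \<Rightarrow> 'a::field sys \<Rightarrow> bool" where
  "observable d s S \<longleftrightarrow> (\<forall>l. (\<forall>g. coreach d s S g \<longrightarrow> (\<Sum>\<alpha><sys_L S. g \<alpha> * l \<alpha>) = 0) \<longrightarrow> (\<forall>\<alpha><sys_L S. l \<alpha> = 0))"


section \<open>Poles of the resolvent along curves\<close>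

text \<open>Divisibility in the local ring of the affine line at the origin.\<close>

definition dvd0 :: "'a::field poly \<Rightarrow> 'a poly \<Rightarrow> bool" where
  "dvd0 e f \<longleftrightarrow> (\<exists>q p. poly q 0 \<noteq> 0 \<and> q * f = e * p)"

lemma dvd0_cancel: "dvd0 (c * e) (c * f) \<Longrightarrow> c \<noteq> 0 \<Longrightarrow> dvd0 e f"
  by (auto simp: dvd0_def mult.left_commute)

lemma dvd0_mult_left_imp: "dvd0 (c * e) f \<Longrightarrow> dvd0 e f"
proof -
  assume "dvd0 (c * e) f"
  then obtain q p where "poly q 0 \<noteq> 0" "q * f = e * (c * p)" by (auto simp: dvd0_def ac_simps)
  then show "dvd0 e f" unfolding dvd0_def by blast
qed

text \<open>A polynomial not vanishing at 0 is prime to \<open>t\<close>, so the factors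
  \<open>t\<close> can be moved to \<open>f\<close> one at a time.\<close>

lemma power_dvd_cancel:
  assumes "poly q 0 \<noteq> (0 :: 'a::field)" "[:0, 1:] ^ j dvd q * f"
  shows "[:0, 1:] ^ j dvd f"
  using assms(2)
proof (induction j arbitrary: f)
  case (Suc j)
  have "[:0, 1:] dvd q * f" using Suc.prems unfolding power_Suc by (rule dvd_mult_left)
  then have "poly f 0 = 0" using poly_eq_0_iff_dvd[of "q * f" 0] assms(1) by simp
  then obtain f' where f: "f = [:0, 1:] * f'" using poly_eq_0_iff_dvd[of f 0] by (auto elim: dvdE)
  have "[:0, 1:] * [:0, 1:] ^ j dvd [:0, 1:] * (q * f')" using Suc.prems by (simp only: f power_Suc mult.left_commute)
  then have "[:0, 1:] ^ j dvd q * f'" unfolding dvd_mult_cancel_left by simp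
  then have "[:0, 1:] ^ j dvd f'" by (rule Suc.IH)
  then show ?case unfolding f power_Suc by (rule mult_dvd_mono[OF dvd_refl])
qed simp

lemma dvd0_power_imp_dvd:
  assumes "dvd0 ([:0, 1:] ^ j) (f :: 'a::field poly)"
  shows "[:0, 1:] ^ j dvd f"
proof -
  obtain q p where "poly q 0 \<noteq> 0" "q * f = [:0, 1:] ^ j * p" using assms by (auto simp: dvd0_def)
  then show ?thesis using power_dvd_cancel[of q j f] by simp
qed

lemma zero_if_all_powers_dvd:
  assumes "\<And>j. [:0, 1:] ^ j dvd (f :: 'a::field poly)"
  shows "f = 0"
proof (rule ccontr)
  assume "f \<noteq> 0"
  then have "degree ([:0, 1 :: 'a:] ^ Suc (degree f)) \<le> degree f" using assms by (intro dvd_imp_degree_le)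
  then show False by (simp add: degree_power_eq)
qed

section \<open>Solving with the adjugate, and block triangular tuples\<close>

lemma mult_vec_block_index:
  assumes A: "A \<in> carrier_mat (M * n) (M' * n')" and "P < M" "\<alpha> < n"
  shows "(A *\<^sub>v vec (M' * n') (\<lambda>i. h (i div n') (i mod n'))) $ (P * n + \<alpha>) =
    (\<Sum>Q<M'. \<Sum>\<beta><n'. A $$ (P * n + \<alpha>, Q * n' + \<beta>) * h Q \<beta>)"
proof -
  have "P * n + \<alpha> < M * n" using assms(2,3) by (rule block_index_less)
  then have "(A *\<^sub>v vec (M' * n') (\<lambda>i. h (i div n') (i mod n'))) $ (P * n + \<alpha>) =
      (\<Sum>i<M' * n'. A $$ (P * n + \<alpha>, i) * h (i div n') (i mod n'))"
    using A by (auto simp: scalar_prod_def lessThan_atLeast0 intro!: sum.cong)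
  then show ?thesis by (simp add: sum_block_index)
qed

text \<open>Pencil times adjugate is \<open>den\<close> times the identity, applied to the family of
  vectors \<open>h\<close>: it provides solutions for arbitrary right-hand sides up to the factor
  \<open>den\<close>.\<close>

lemma adj_lam_solves:
  assumes "P < M" "\<alpha> < sys_L S"
  shows "(\<Sum>Q<M. \<Sum>\<beta><sys_L S. aff_entry \<phi> d s (sys_G S) (sys_a S) T P \<alpha> Q \<beta> *
      (\<Sum>R<M. \<Sum>\<gamma><sys_L S. adj_mat (lam \<phi> d s M S T) $$ (Q * sys_L S + \<beta>, R * sys_L S + \<gamma>) * h R \<gamma>)) =
    den \<phi> d s M S T * h P \<alpha>"
proof -
  let ?L = "sys_L S" and ?l = "lam \<phi> d s M S T"
  let ?h = "vec (M * ?L) (\<lambda>i. h (i div ?L) (i mod ?L))"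
  let ?k = "\<lambda>Q \<beta>. \<Sum>R<M. \<Sum>\<gamma><?L. adj_mat ?l $$ (Q * ?L + \<beta>, R * ?L + \<gamma>) * h R \<gamma>"
  note l = sys_carrier(1)[of \<phi> d s M S T]
  have k: "adj_mat ?l *\<^sub>v ?h = vec (M * ?L) (\<lambda>i. ?k (i div ?L) (i mod ?L))"
  proof (rule eq_vecI)
    fix i assume "i < dim_vec (vec (M * ?L) (\<lambda>i. ?k (i div ?L) (i mod ?L)))"
    then have "i < M * ?L" by simp
    then obtain Q \<beta> where i: "Q < M" "\<beta> < ?L" "i = Q * ?L + \<beta>" by (rule block_indexE)
    show "(adj_mat ?l *\<^sub>v ?h) $ i = vec (M * ?L) (\<lambda>i. ?k (i div ?L) (i mod ?L)) $ i"
      unfolding i(3) mult_vec_block_index[OF adj_lam_carrier i(1,2)]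
      by (subst index_vec) (use i in \<open>simp_all add: block_index_less\<close>)
  qed (simp add: carrier_matD[OF adj_lam_carrier])
  have "(\<Sum>Q<M. \<Sum>\<beta><?L. aff_entry \<phi> d s (sys_G S) (sys_a S) T P \<alpha> Q \<beta> * ?k Q \<beta>) =
      (\<Sum>Q<M. \<Sum>\<beta><?L. ?l $$ (P * ?L + \<alpha>, Q * ?L + \<beta>) * ?k Q \<beta>)"
    using assms by (intro sum.cong refl) (simp add: lam_def)
  also have "\<dots> = (?l *\<^sub>v (adj_mat ?l *\<^sub>v ?h)) $ (P * ?L + \<alpha>)"
    unfolding k by (rule mult_vec_block_index[OF l assms, symmetric])
  also have "?l *\<^sub>v (adj_mat ?l *\<^sub>v ?h) = (?l * adj_mat ?l) *\<^sub>v ?h"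
    by (rule assoc_mult_mat_vec[OF l adj_lam_carrier, symmetric]) simp
  also have "\<dots> = den \<phi> d s M S T \<cdot>\<^sub>v ?h"
    unfolding adj_mat(2)[OF l] den_def[symmetric] by (rule eq_vecI) auto
  also have "(den \<phi> d s M S T \<cdot>\<^sub>v ?h) $ (P * ?L + \<alpha>) = den \<phi> d s M S T * h P \<alpha>"
    using assms by (simp add: block_index_less)
  finally show ?thesis .
qed

text \<open>Block triangular matrices form an algebra, and such a matrix is invertible as soon as
  its diagonal blocks are. So definedness depends on the diagonal blocks only, whatever the corner
  \<open>Z\<close> is.\<close>

lemma nc_eval_block_triangular:
  fixes X1 X2 :: "'a::field mat list"
  assumes X1: "X1 \<in> mat_tuples d n1" and X2: "X2 \<in> mat_tuples d n2"
    and Z: "\<And>k. k < d \<Longrightarrow> Z k \<in> carrier_mat n1 n2"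
    and X: "X = map (\<lambda>k. four_block_mat (X1 ! k) (Z k) (0\<^sub>m n2 n1) (X2 ! k)) [0..<d]"
    and vars: "nc_vars r \<subseteq> {..<d}"
    and "nc_eval (\<lambda>c. c) n1 X1 r = Some V1" "nc_eval (\<lambda>c. c) n2 X2 r = Some V2"
  shows "\<exists>W \<in> carrier_mat n1 n2. nc_eval (\<lambda>c. c) (n1 + n2) X r = Some (four_block_mat V1 W (0\<^sub>m n2 n1) V2)"
  using vars assms(6,7)
proof (induction r arbitrary: V1 V2)
  case (Const c)
  have "c \<cdot>\<^sub>m 1\<^sub>m (n1 + n2) = four_block_mat (c \<cdot>\<^sub>m 1\<^sub>m n1) (0\<^sub>m n1 n2) (0\<^sub>m n2 n1) (c \<cdot>\<^sub>m 1\<^sub>m n2)"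
    by (rule eq_matI) auto
  then show ?case using Const by (intro bexI[of _ "0\<^sub>m n1 n2"]) auto
next
  case (Var k)
  then show ?case using Z[of k] by (intro bexI[of _ "Z k"]) (auto simp: X)
next
  case (Add r1 r2)
  then obtain A1 B1 A2 B2 where ev: "nc_eval (\<lambda>c. c) n1 X1 r1 = Some A1" "nc_eval (\<lambda>c. c) n1 X1 r2 = Some B1" "V1 = A1 + B1"
      "nc_eval (\<lambda>c. c) n2 X2 r1 = Some A2" "nc_eval (\<lambda>c. c) n2 X2 r2 = Some B2" "V2 = A2 + B2"
    by (auto simp: bind_eq_Some_conv)
  obtain W1 where W1: "W1 \<in> carrier_mat n1 n2" "nc_eval (\<lambda>c. c) (n1 + n2) X r1 = Some (four_block_mat A1 W1 (0\<^sub>m n2 n1) A2)"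
    using Add.IH(1)[OF _ ev(1,4)] Add.prems(1) by auto
  obtain W2 where W2: "W2 \<in> carrier_mat n1 n2" "nc_eval (\<lambda>c. c) (n1 + n2) X r2 = Some (four_block_mat B1 W2 (0\<^sub>m n2 n1) B2)"
    using Add.IH(2)[OF _ ev(2,5)] Add.prems(1) by auto
  have c: "A1 \<in> carrier_mat n1 n1" "B1 \<in> carrier_mat n1 n1" "A2 \<in> carrier_mat n2 n2" "B2 \<in> carrier_mat n2 n2"
    using nc_eval_carrier[OF X1 _ ev(1)] nc_eval_carrier[OF X1 _ ev(2)] nc_eval_carrier[OF X2 _ ev(4)]
      nc_eval_carrier[OF X2 _ ev(5)] Add.prems(1) by auto
  have "four_block_mat A1 W1 (0\<^sub>m n2 n1) A2 + four_block_mat B1 W2 (0\<^sub>m n2 n1) B2 =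
      four_block_mat (A1 + B1) (W1 + W2) (0\<^sub>m n2 n1) (A2 + B2)"
    using add_four_block_mat[OF c(1) W1(1) zero_carrier_mat c(3) c(2) W2(1) zero_carrier_mat c(4)] by simp
  then show ?case using W1 W2 ev by (intro bexI[of _ "W1 + W2"]) auto
next
  case (Mult r1 r2)
  then obtain A1 B1 A2 B2 where ev: "nc_eval (\<lambda>c. c) n1 X1 r1 = Some A1" "nc_eval (\<lambda>c. c) n1 X1 r2 = Some B1" "V1 = A1 * B1"
      "nc_eval (\<lambda>c. c) n2 X2 r1 = Some A2" "nc_eval (\<lambda>c. c) n2 X2 r2 = Some B2" "V2 = A2 * B2"
    by (auto simp: bind_eq_Some_conv)
  obtain W1 where W1: "W1 \<in> carrier_mat n1 n2" "nc_eval (\<lambda>c. c) (n1 + n2) X r1 = Some (four_block_mat A1 W1 (0\<^sub>m n2 n1) A2)"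
    using Mult.IH(1)[OF _ ev(1,4)] Mult.prems(1) by auto
  obtain W2 where W2: "W2 \<in> carrier_mat n1 n2" "nc_eval (\<lambda>c. c) (n1 + n2) X r2 = Some (four_block_mat B1 W2 (0\<^sub>m n2 n1) B2)"
    using Mult.IH(2)[OF _ ev(2,5)] Mult.prems(1) by auto
  have c: "A1 \<in> carrier_mat n1 n1" "B1 \<in> carrier_mat n1 n1" "A2 \<in> carrier_mat n2 n2" "B2 \<in> carrier_mat n2 n2"
    using nc_eval_carrier[OF X1 _ ev(1)] nc_eval_carrier[OF X1 _ ev(2)] nc_eval_carrier[OF X2 _ ev(4)]
      nc_eval_carrier[OF X2 _ ev(5)] Mult.prems(1) by auto
  have "four_block_mat A1 W1 (0\<^sub>m n2 n1) A2 * four_block_mat B1 W2 (0\<^sub>m n2 n1) B2 =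
      four_block_mat (A1 * B1) (A1 * W2 + W1 * B2) (0\<^sub>m n2 n1) (A2 * B2)"
    using c W1(1) W2(1)
    by (subst mult_four_block_mat[OF c(1) W1(1) zero_carrier_mat c(3) c(2) W2(1) zero_carrier_mat c(4)]) simp
  moreover have "A1 * W2 + W1 * B2 \<in> carrier_mat n1 n2" using c W1(1) W2(1) by simp
  ultimately show ?case using W1 W2 ev by (intro bexI[of _ "A1 * W2 + W1 * B2"]) auto
next
  case (Inv r)
  then obtain A1 A2 where ev: "nc_eval (\<lambda>c. c) n1 X1 r = Some A1" "mat_inverse A1 = Some V1"
      "nc_eval (\<lambda>c. c) n2 X2 r = Some A2" "mat_inverse A2 = Some V2"
    by (auto simp: bind_eq_Some_conv)
  obtain W where W: "W \<in> carrier_mat n1 n2" "nc_eval (\<lambda>c. c) (n1 + n2) X r = Some (four_block_mat A1 W (0\<^sub>m n2 n1) A2)"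
    using Inv.IH[OF _ ev(1,3)] Inv.prems(1) by auto
  have c: "A1 \<in> carrier_mat n1 n1" "A2 \<in> carrier_mat n2 n2"
    using nc_eval_carrier[OF X1 _ ev(1)] nc_eval_carrier[OF X2 _ ev(3)] Inv.prems(1) by auto
  have V: "V1 \<in> carrier_mat n1 n1" "A1 * V1 = 1\<^sub>m n1" "V2 \<in> carrier_mat n2 n2" "A2 * V2 = 1\<^sub>m n2"
    using ev mat_inverse_eq_Some_iff[OF c(1)] mat_inverse_eq_Some_iff[OF c(2)] by auto
  \<comment> \<open>The corner of the inverse of a block triangular matrix is
    \<open>- V1 W V2\<close>.\<close>
  define Q where "Q = - (W * V2)"
  define U where "U = V1 * Q"
  have WV: "W * V2 \<in> carrier_mat n1 n2" using V W(1) by simp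
  then have Q: "Q \<in> carrier_mat n1 n2" by (simp add: Q_def)
  have U: "U \<in> carrier_mat n1 n2" using V(1) Q by (simp add: U_def)
  have "A1 * U = (A1 * V1) * Q" unfolding U_def by (rule assoc_mult_mat[OF c(1) V(1) Q, symmetric])
  also have "\<dots> = Q" unfolding V(2) by (rule left_mult_one_mat[OF Q])
  finally have "A1 * U + W * V2 = 0\<^sub>m n1 n2"
    using WV by (intro eq_matI) (auto simp: Q_def)
  then have "four_block_mat A1 W (0\<^sub>m n2 n1) A2 * four_block_mat V1 U (0\<^sub>m n2 n1) V2 = 1\<^sub>m (n1 + n2)"
    using c V W(1) U
    by (subst mult_four_block_mat[OF c(1) W(1) zero_carrier_mat c(2) V(1) U zero_carrier_mat V(3)]) simp
  moreover have "four_block_mat A1 W (0\<^sub>m n2 n1) A2 \<in> carrier_mat (n1 + n2) (n1 + n2)"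
    "four_block_mat V1 U (0\<^sub>m n2 n1) V2 \<in> carrier_mat (n1 + n2) (n1 + n2)"
    using c V W(1) U by auto
  ultimately have "mat_inverse (four_block_mat A1 W (0\<^sub>m n2 n1) A2) = Some (four_block_mat V1 U (0\<^sub>m n2 n1) V2)"
    by (simp add: mat_inverse_eq_Some_iff)
  then show ?case using W(2) U by (intro bexI[of _ U]) auto
qed


lemma amplify_one:
  assumes "X \<in> mat_tuples d n"
  shows "amplify 1 X = X"
proof (rule mat_tuples_eqI[of _ d n])
  show "amplify 1 X \<in> mat_tuples d n" using amplify_tuples[OF assms, of 1] by simp
  fix k i j assume *: "k < d" "i < n" "j < n"
  have "kronecker (1\<^sub>m 1) (X ! k) $$ (0 * n + i, 0 * n + j) = (X ! k) $$ (i, j)"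
    using * mat_tuplesD(2)[OF assms *(1)] by (subst kronecker_index[of _ 1 1 _ n n]) simp_all
  then show "(amplify 1 X ! k) $$ (i, j) = (X ! k) $$ (i, j)"
    using * mat_tuples_dims[OF assms] by (simp add: amplify_def)
qed (rule assms)

text \<open>Peels off one copy, so that an amplified point can be extended at the upper left by one
  more block.\<close>

lemma kronecker_Suc:
  assumes A: "A \<in> carrier_mat n n"
  shows "kronecker (1\<^sub>m (Suc K)) A =
    four_block_mat A (0\<^sub>m n (K * n)) (0\<^sub>m (K * n) n) (kronecker (1\<^sub>m K) (A :: 'a::comm_ring_1 mat))"
proof (rule eq_mat_blockI[of _ "Suc K" n "Suc K" n])
  have c: "kronecker (1\<^sub>m K) A \<in> carrier_mat (K * n) (K * n)" using A by simp
  show "kronecker (1\<^sub>m (Suc K)) A \<in> carrier_mat (Suc K * n) (Suc K * n)"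
    by (rule kronecker_carrier[OF one_carrier_mat A])
  show "four_block_mat A (0\<^sub>m n (K * n)) (0\<^sub>m (K * n) n) (kronecker (1\<^sub>m K) A) \<in> carrier_mat (Suc K * n) (Suc K * n)"
    using four_block_carrier_mat[OF A c] unfolding mult_Suc .
  fix P x Q y assume *: "P < Suc K" "x < n" "Q < Suc K" "y < n"
  have l: "P * n + x < n + K * n" "Q * n + y < n + K * n"
    using block_index_less[OF *(1,2)] block_index_less[OF *(3,4)] by simp_all
  show "kronecker (1\<^sub>m (Suc K)) A $$ (P * n + x, Q * n + y) =
      four_block_mat A (0\<^sub>m n (K * n)) (0\<^sub>m (K * n) n) (kronecker (1\<^sub>m K) A) $$ (P * n + x, Q * n + y)"
  proof -
    have 1: "kronecker (1\<^sub>m (Suc K)) A $$ (P * n + x, Q * n + y) = 1\<^sub>m (Suc K) $$ (P, Q) * A $$ (x, y)"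
      by (rule kronecker_index[OF one_carrier_mat A]) (use * in auto)
    have 2: "four_block_mat A (0\<^sub>m n (K * n)) (0\<^sub>m (K * n) n) (kronecker (1\<^sub>m K) A) $$ (P * n + x, Q * n + y) =
      (if P * n + x < n then if Q * n + y < n then A $$ (P * n + x, Q * n + y) else 0\<^sub>m n (K * n) $$ (P * n + x, Q * n + y - n)
       else if Q * n + y < n then 0\<^sub>m (K * n) n $$ (P * n + x - n, Q * n + y)
       else kronecker (1\<^sub>m K) A $$ (P * n + x - n, Q * n + y - n))"
      using l carrier_matD[OF A] carrier_matD[OF c] by (subst index_mat_four_block) auto
    have 3: "kronecker (1\<^sub>m K) A $$ (P' * n + x, Q' * n + y) = 1\<^sub>m K $$ (P', Q') * A $$ (x, y)"
      if "P = Suc P'" "Q = Suc Q'" for P' Q'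
      by (rule kronecker_index[OF one_carrier_mat A]) (use * that in auto)
    show ?thesis
      unfolding 1 2
      by (cases P; cases Q) (use * l 3 in auto)
  qed
qed

lemma sum3_delta:
  fixes f :: "nat \<Rightarrow> nat \<Rightarrow> nat \<Rightarrow> 'b::comm_monoid_add"
  assumes "k0 < d" "x < s" "y < s"
  shows "(\<Sum>k<d. \<Sum>x'<s. \<Sum>y'<s. if k = k0 \<and> x' = x \<and> y' = y then f k x' y' else 0) = f k0 x y"
proof -
  have "(\<Sum>y'<s. if k = k0 \<and> x' = x \<and> y' = y then f k x' y' else 0) = (if k = k0 \<and> x' = x then f k x' y else 0)" for k x'
    using assms(3) by (cases "k = k0 \<and> x' = x") auto
  moreover have "(\<Sum>x'<s. if k = k0 \<and> x' = x then f k x' y else 0) = (if k = k0 then f k x y else 0)" for k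
    using assms(2) by (cases "k = k0") auto
  ultimately show ?thesis using assms(1) by simp
qed

text \<open>
  The tuple \<open>T'\<close> in the upper left corner, \<open>T\<close> in the lower right corner, and \<open>t\<close> in a single
  off-diagonal position, in block row \<open>p\<close> and block column \<open>q\<close>.
\<close>

definition glue :: "nat \<Rightarrow> nat \<Rightarrow> nat \<Rightarrow> nat \<Rightarrow> 'a::field poly mat list \<Rightarrow> 'a poly mat list \<Rightarrow>
    nat \<Rightarrow> nat \<Rightarrow> nat \<Rightarrow> nat \<Rightarrow> nat \<Rightarrow> 'a poly mat list" where
  "glue d s m M T' T k0 p x q y = map (\<lambda>k. four_block_mat (T' ! k)
     (mat (m * s) (M * s) (\<lambda>(i, j). if k = k0 \<and> i = p * s + x \<and> j = q * s + y then [:0, 1:] else 0))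
     (0\<^sub>m (M * s) (m * s)) (T ! k)) [0..<d]"

context
  fixes d s m M k0 p x q y :: nat and T' T :: "'a::field poly mat list"
  assumes T': "T' \<in> mat_tuples d (m * s)" and T: "T \<in> mat_tuples d (M * s)"
    and bounds: "k0 < d" "p < m" "x < s" "q < M" "y < s"
begin

lemma glue_tuples: "glue d s m M T' T k0 p x q y \<in> mat_tuples d ((m + M) * s)"
  using mat_tuplesD(2)[OF T'] mat_tuplesD(2)[OF T]
  by (auto simp: glue_def mat_tuples_def distrib_right intro!: four_block_carrier_mat)

lemma glue_index:
  assumes "k < d" "P < m + M" "Q < m + M" "x' < s" "y' < s"
  shows "(glue d s m M T' T k0 p x q y ! k) $$ (P * s + x', Q * s + y') =
    (if P < m then if Q < m then (T' ! k) $$ (P * s + x', Q * s + y')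
       else if k = k0 \<and> P = p \<and> x' = x \<and> Q - m = q \<and> y' = y then [:0, 1:] else 0
     else if Q < m then 0 else (T ! k) $$ ((P - m) * s + x', (Q - m) * s + y'))"
proof -
  have d': "dim_row (T' ! k) = m * s" "dim_col (T' ! k) = m * s" "dim_row (T ! k) = M * s" "dim_col (T ! k) = M * s"
    using mat_tuples_dims[OF T'] mat_tuples_dims[OF T] assms(1) by auto
  have less: "R * s + z < m * s \<longleftrightarrow> R < m" if "z < s" for R z
    using that block_index_less[of R m z s] block_index_less[of R m z s]
    by (metis add_lessD1 mult_less_cancel2 not_less_iff_gr_or_eq)
  have sub: "R * s + z - m * s = (R - m) * s + z" if "\<not> R < m" for R z
    using that by (simp add: diff_mult_distrib)
  have bnd: "P * s + x' < (m + M) * s" "Q * s + y' < (m + M) * s"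
    using assms by (auto intro: block_index_less)
  have eq: "R * s + z = R' * s + z' \<longleftrightarrow> R = R' \<and> z = z'" if "z < s" "z' < s" for R R' z z'
    using that by (metis block_index_div_mod)
  have "(Q - m) * s + y' < M * s" if "\<not> Q < m"
    using that assms by (intro block_index_less) auto
  moreover have "(P - m) * s + x' < M * s" if "\<not> P < m"
    using that assms by (intro block_index_less) auto
  ultimately show ?thesis
    using assms bnd d' bounds
    by (auto simp: glue_def less sub eq distrib_right)
qed

text \<open>The only contribution of the corner is \<open>t\<close> times one coefficient matrix of
  the system, in one block position. Solving such a triangular pencil thus applies a chosen
  coefficient to a chosen component of a state.\<close>

lemma aff_entry_glue:
  assumes "P < m + M" "Q < m + M"
  shows "aff_entry (\<lambda>c. [:c:]) d s G a (glue d s m M T' T k0 p x q y) P \<alpha> Q \<beta> =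
    (if P < m then if Q < m then aff_entry (\<lambda>c. [:c:]) d s G a T' P \<alpha> Q \<beta>
       else if P = p \<and> Q - m = q then [:0, 1:] * [:a k0 x y \<alpha> \<beta>:] else 0
     else if Q < m then 0 else aff_entry (\<lambda>c. [:c:]) d s G a T (P - m) \<alpha> (Q - m) \<beta>)"
proof -
  have e: "(\<Sum>k<d. \<Sum>x'<s. \<Sum>y'<s. (glue d s m M T' T k0 p x q y ! k) $$ (P * s + x', Q * s + y') * [:a k x' y' \<alpha> \<beta>:]) =
    (\<Sum>k<d. \<Sum>x'<s. \<Sum>y'<s. (if P < m then if Q < m then (T' ! k) $$ (P * s + x', Q * s + y')
       else if k = k0 \<and> P = p \<and> x' = x \<and> Q - m = q \<and> y' = y then [:0, 1:] else 0
     else if Q < m then 0 else (T ! k) $$ ((P - m) * s + x', (Q - m) * s + y')) * [:a k x' y' \<alpha> \<beta>:])"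
    by (intro sum.cong refl) (simp only: glue_index assms lessThan_iff)
  consider "P < m" "Q < m" | "P < m" "\<not> Q < m" | "\<not> P < m" "Q < m" | "\<not> P < m" "\<not> Q < m" by blast
  then show ?thesis
  proof cases
    case 2
    then have "P \<noteq> Q" by auto
    have "(\<Sum>k<d. \<Sum>x'<s. \<Sum>y'<s. (if k = k0 \<and> P = p \<and> x' = x \<and> Q - m = q \<and> y' = y then [:0, 1:] else 0) * [:a k x' y' \<alpha> \<beta>:]) =
        (\<Sum>k<d. \<Sum>x'<s. \<Sum>y'<s. if k = k0 \<and> x' = x \<and> y' = y then
          if P = p \<and> Q - m = q then [:0, 1:] * [:a k x' y' \<alpha> \<beta>:] else 0 else 0)"
      by (intro sum.cong refl) auto
    also have "\<dots> = (if P = p \<and> Q - m = q then [:0, 1:] * [:a k0 x y \<alpha> \<beta>:] else 0)"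
      by (rule sum3_delta[OF bounds(1,3,5)])
    finally show ?thesis unfolding aff_entry_def e using 2 \<open>P \<noteq> Q\<close> by simp
  next
    case 4
    then have "P = Q \<longleftrightarrow> P - m = Q - m" by auto
    then show ?thesis unfolding aff_entry_def e using 4 by simp
  next
    case 1
    then show ?thesis unfolding aff_entry_def e by simp
  next
    case 3
    then show ?thesis unfolding aff_entry_def e by auto
  qed
qed

lemma eval_at_glue:
  "eval_at t (glue d s m M T' T k0 p x q y) = map (\<lambda>k. four_block_mat (eval_at t T' ! k)
     (mat (m * s) (M * s) (\<lambda>(i, j). if k = k0 \<and> i = p * s + x \<and> j = q * s + y then t else 0))
     (0\<^sub>m (M * s) (m * s)) (eval_at t T ! k)) [0..<d]"
proof (rule nth_equalityI)
  fix k assume "k < length (eval_at t (glue d s m M T' T k0 p x q y))"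
  then have k: "k < d" by (simp add: eval_at_def glue_def)
  note dims = mat_tuples_dims(1)[OF T'] mat_tuples_dims(2,3)[OF T' k] mat_tuples_dims(1)[OF T] mat_tuples_dims(2,3)[OF T k]
  show "eval_at t (glue d s m M T' T k0 p x q y) ! k = map (\<lambda>k. four_block_mat (eval_at t T' ! k)
     (mat (m * s) (M * s) (\<lambda>(i, j). if k = k0 \<and> i = p * s + x \<and> j = q * s + y then t else 0))
     (0\<^sub>m (M * s) (m * s)) (eval_at t T ! k)) [0..<d] ! k"
    by (rule eq_matI) (use k dims in \<open>auto simp: eval_at_def glue_def\<close>)
qed (simp add: eval_at_def glue_def)

end


text \<open>\<open>X0\<close> is the point where the resolvent is to be shown regular;
  \<open>Y'\<close> is an end point at which the pencil is the identity and the right-hand side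
  vanishes, such as an amplified centre. Assumption \<open>reg\<close> concerns values only: they
  have no pole at \<open>t = 0\<close> along any curve from an amplification of \<open>X0\<close>
  into the domain of \<open>r\<close>. About the resolvent itself nothing is assumed.\<close>

locale curves =
  fixes d s m :: nat and S :: "'a::field sys" and X0 Y' :: "'a mat list" and r :: "'a ncexpr"
  assumes vars: "nc_vars r \<subseteq> {..<d}" and m: "1 \<le> m"
    and X0: "X0 \<in> mat_tuples d (m * s)" and Y': "Y' \<in> expr_dom d (m * s) r"
    and normG: "\<And>P \<alpha> Q \<beta>. P < m \<Longrightarrow> \<alpha> < sys_L S \<Longrightarrow> Q < m \<Longrightarrow> \<beta> < sys_L S \<Longrightarrow>
      aff_entry (\<lambda>c. c) d s (sys_G S) (sys_a S) Y' P \<alpha> Q \<beta> = (if P = Q \<and> \<alpha> = \<beta> then 1 else 0)"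
    and normB: "\<And>P \<alpha> Q j. P < m \<Longrightarrow> \<alpha> < sys_L S \<Longrightarrow> Q < m \<Longrightarrow> j < s \<Longrightarrow>
      aff_entry (\<lambda>c. c) d s (sys_B S) (sys_b S) Y' P \<alpha> Q j = 0"
    and reg: "\<And>K T i j. 1 \<le> K \<Longrightarrow> T \<in> mat_tuples d (K * m * s) \<Longrightarrow> eval_at 0 T = amplify K X0 \<Longrightarrow>
      eval_at 1 T \<in> expr_dom d (K * m * s) r \<Longrightarrow> i < K * m * s \<Longrightarrow> j < K * m * s \<Longrightarrow>
      den (\<lambda>c. [:c:]) d s (K * m) S T \<noteq> 0 \<and> dvd0 (den (\<lambda>c. [:c:]) d s (K * m) S T) (num (\<lambda>c. [:c:]) d s (K * m) S T $$ (i, j))"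
begin

abbreviation "L \<equiv> sys_L S"
abbreviation "LA \<equiv> aff_entry (\<lambda>c. [:c:]) d s (sys_G S) (sys_a S)"
abbreviation "RB \<equiv> aff_entry (\<lambda>c. [:c:]) d s (sys_B S) (sys_b S)"

definition curve :: "nat \<Rightarrow> 'a poly mat list \<Rightarrow> bool" where
  "curve K T \<longleftrightarrow> T \<in> mat_tuples d (K * m * s) \<and> eval_at 0 T = amplify K X0 \<and> eval_at 1 T \<in> expr_dom d (K * m * s) r"

text \<open>\<open>v\<close> solves the equation of the resolvent for column \<open>(cq, cj)\<close>, up to the factor \<open>e\<close>.\<close>

definition solution :: "nat \<Rightarrow> 'a poly mat list \<Rightarrow> nat \<Rightarrow> nat \<Rightarrow> 'a poly \<Rightarrow> (nat \<Rightarrow> nat \<Rightarrow> 'a poly) \<Rightarrow> bool" where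
  "solution K T cq cj e v \<longleftrightarrow> 1 \<le> K \<and> curve K T \<and> cq < K * m \<and> cj < s \<and>
     (\<forall>P<K * m. \<forall>\<alpha><L. (\<Sum>Q<K * m. \<Sum>\<beta><L. LA T P \<alpha> Q \<beta> * v Q \<beta>) = e * RB T P \<alpha> cq cj)"

lemma solution_scale:
  assumes "solution K T cq cj e v"
  shows "solution K T cq cj (c * e) (\<lambda>Q \<beta>. c * v Q \<beta>)"
proof -
  have "(\<Sum>Q<K * m. \<Sum>\<beta><L. LA T P \<alpha> Q \<beta> * (c * v Q \<beta>)) = c * (\<Sum>Q<K * m. \<Sum>\<beta><L. LA T P \<alpha> Q \<beta> * v Q \<beta>)" for P \<alpha>
    unfolding sum_distrib_left by (intro sum.cong refl mult.left_commute)
  then show ?thesis using assms by (simp add: solution_def mult.assoc)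
qed

text \<open>By Cramer's rule the output of \<open>v\<close> is \<open>e\<close> times an entry of
  the value minus its constant term, and values are regular by \<open>reg\<close>. Both denominators
  are cleared to stay within polynomials.\<close>

lemma solution_regular:
  assumes sol: "solution K T cq cj e v" and P: "P < K * m" and i: "i < s"
  shows "dvd0 e (\<Sum>\<alpha><L. [:sys_C S i \<alpha>:] * v P \<alpha>)"
proof -
  let ?M = "K * m"
  let ?l = "lam (\<lambda>c. [:c:]) d s ?M S T" and ?b = "rhs (\<lambda>c. [:c:]) d s ?M S T" and ?\<delta> = "den (\<lambda>c. [:c:]) d s ?M S T"
  let ?C = "diagC (\<lambda>c. [:c:]) s ?M S" and ?N = "num (\<lambda>c. [:c:]) d s ?M S T"
  note l = sys_carrier(1)[of "\<lambda>c. [:c:]" d s ?M S T] and b = sys_carrier(2)[of "\<lambda>c. [:c:]" d s ?M S T]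
    and C = sys_carrier(3)[of "\<lambda>c. [:c:]" s ?M S]
  have c: "cq < ?M" "cj < s" and K: "1 \<le> K"
    and T: "T \<in> mat_tuples d (K * m * s)" "eval_at 0 T = amplify K X0" "eval_at 1 T \<in> expr_dom d (K * m * s) r"
    and eq: "\<And>P \<alpha>. P < ?M \<Longrightarrow> \<alpha> < L \<Longrightarrow> (\<Sum>Q<?M. \<Sum>\<beta><L. LA T P \<alpha> Q \<beta> * v Q \<beta>) = e * RB T P \<alpha> cq cj"
    using sol unfolding solution_def curve_def by auto
  define col where "col = cq * s + cj"
  have col: "col < ?M * s" and row: "P * s + i < ?M * s" unfolding col_def using c P i by (auto intro: block_index_less)
  let ?v = "vec (?M * L) (\<lambda>i. v (i div L) (i mod L))"
  have bcol: "vec (?M * L) (\<lambda>i. e * ?b $$ (i, col)) = e \<cdot>\<^sub>v Matrix.col ?b col"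
    using col by (intro eq_vecI) auto
  have lv: "?l *\<^sub>v ?v = e \<cdot>\<^sub>v Matrix.col ?b col"
  proof (rule eq_vecI)
    fix k assume "k < dim_vec (e \<cdot>\<^sub>v Matrix.col ?b col)"
    then have "k < ?M * L" by simp
    then obtain Q \<beta> where k: "Q < ?M" "\<beta> < L" "k = Q * L + \<beta>" by (rule block_indexE)
    have "(?l *\<^sub>v ?v) $ k = (\<Sum>Q'<?M. \<Sum>\<beta>'<L. LA T Q \<beta> Q' \<beta>' * v Q' \<beta>')"
      unfolding k(3) mult_vec_block_index[OF l k(1,2)]
      by (intro sum.cong refl) (simp add: lam_def k)
    also have "\<dots> = e * ?b $$ (k, col)"
      unfolding eq[OF k(1,2)] k(3) col_def using k c by (simp add: rhs_def)
    finally show "(?l *\<^sub>v ?v) $ k = (e \<cdot>\<^sub>v Matrix.col ?b col) $ k"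
      using \<open>k < ?M * L\<close> col by simp
  qed simp
  have "?\<delta> \<cdot>\<^sub>v ?v = (adj_mat ?l * ?l) *\<^sub>v ?v"
    unfolding adj_mat(3)[OF l] den_def by (rule eq_vecI) auto
  also have "\<dots> = adj_mat ?l *\<^sub>v (e \<cdot>\<^sub>v Matrix.col ?b col)"
    unfolding lv[symmetric] by (rule assoc_mult_mat_vec[OF adj_lam_carrier l]) simp
  finally have dv: "?\<delta> \<cdot>\<^sub>v ?v = adj_mat ?l *\<^sub>v (e \<cdot>\<^sub>v Matrix.col ?b col)" .
  have entry: "?\<delta> * v P \<alpha> = e * (adj_mat ?l * ?b) $$ (P * L + \<alpha>, col)" if \<alpha>: "\<alpha> < L" for \<alpha>
  proof -
    have ix: "P * L + \<alpha> < ?M * L" using P \<alpha> by (rule block_index_less)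
    have "?\<delta> * v P \<alpha> = (?\<delta> \<cdot>\<^sub>v ?v) $ (P * L + \<alpha>)" using ix \<alpha> by simp
    also have "\<dots> = (\<Sum>k<?M * L. adj_mat ?l $$ (P * L + \<alpha>, k) * (e * ?b $$ (k, col)))"
      unfolding dv using ix col carrier_matD[OF adj_lam_carrier[of "\<lambda>c. [:c:]" d s ?M S T]]
      by (auto simp: scalar_prod_def lessThan_atLeast0 intro!: sum.cong)
    also have "\<dots> = e * (\<Sum>k<?M * L. adj_mat ?l $$ (P * L + \<alpha>, k) * ?b $$ (k, col))"
      unfolding sum_distrib_left by (intro sum.cong refl mult.left_commute)
    also have "\<dots> = e * (adj_mat ?l * ?b) $$ (P * L + \<alpha>, col)"
      by (simp only: mult_mat_index[OF adj_lam_carrier b ix col])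
    finally show ?thesis .
  qed
  have ab: "adj_mat ?l * ?b \<in> carrier_mat (?M * L) (?M * s)" by (rule mult_carrier_mat[OF adj_lam_carrier b])
  have "(?C * (adj_mat ?l * ?b)) $$ (P * s + i, col) =
      (\<Sum>Q<?M. \<Sum>\<alpha><L. (if P = Q then [:sys_C S i \<alpha>:] else 0) * (adj_mat ?l * ?b) $$ (Q * L + \<alpha>, col))"
    unfolding mult_mat_block_index[OF C ab row col]
    by (intro sum.cong refl) (simp add: diagC_def P i)
  also have "\<dots> = (\<Sum>Q<?M. if Q = P then \<Sum>\<alpha><L. [:sys_C S i \<alpha>:] * (adj_mat ?l * ?b) $$ (P * L + \<alpha>, col) else 0)"
    by (intro sum.cong refl) auto
  also have "\<dots> = (\<Sum>\<alpha><L. [:sys_C S i \<alpha>:] * (adj_mat ?l * ?b) $$ (P * L + \<alpha>, col))" using P by simp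
  finally have Cab: "(?C * (adj_mat ?l * ?b)) $$ (P * s + i, col) =
      (\<Sum>\<alpha><L. [:sys_C S i \<alpha>:] * (adj_mat ?l * ?b) $$ (P * L + \<alpha>, col))" .
  define D where "D = diagD (\<lambda>c. [:c:]) s ?M S $$ (P * s + i, col)"
  have num: "?N $$ (P * s + i, col) = ?\<delta> * D + (?C * (adj_mat ?l * ?b)) $$ (P * s + i, col)"
    using row col carrier_matD[OF mult_carrier_mat[OF C ab]] by (simp add: num_def D_def)
  have "?\<delta> * (\<Sum>\<alpha><L. [:sys_C S i \<alpha>:] * v P \<alpha>) = (\<Sum>\<alpha><L. [:sys_C S i \<alpha>:] * (?\<delta> * v P \<alpha>))"
    unfolding sum_distrib_left by (intro sum.cong refl mult.left_commute)
  also have "\<dots> = e * (?C * (adj_mat ?l * ?b)) $$ (P * s + i, col)"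
    unfolding Cab sum_distrib_left by (intro sum.cong refl) (simp only: entry lessThan_iff mult.left_commute)
  finally have main: "?\<delta> * (\<Sum>\<alpha><L. [:sys_C S i \<alpha>:] * v P \<alpha>) = e * (?N $$ (P * s + i, col) - ?\<delta> * D)"
    by (simp add: num)
  have nz: "?\<delta> \<noteq> 0" and "dvd0 ?\<delta> (?N $$ (P * s + i, col))" using reg[OF K T row col] by auto
  then obtain q p where q: "poly q 0 \<noteq> 0" "q * ?N $$ (P * s + i, col) = ?\<delta> * p" by (auto simp: dvd0_def)
  have "?\<delta> * (q * (\<Sum>\<alpha><L. [:sys_C S i \<alpha>:] * v P \<alpha>)) = q * (?\<delta> * (\<Sum>\<alpha><L. [:sys_C S i \<alpha>:] * v P \<alpha>))"
    by (rule mult.left_commute)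
  also have "\<dots> = e * (q * ?N $$ (P * s + i, col)) - e * q * ?\<delta> * D"
    unfolding main by (simp only: right_diff_distrib ac_simps)
  also have "\<dots> = ?\<delta> * (e * (p - q * D))"
    unfolding q(2) by (simp add: algebra_simps)
  finally have "q * (\<Sum>\<alpha><L. [:sys_C S i \<alpha>:] * v P \<alpha>) = e * (p - q * D)" using nz by simp
  then show ?thesis using q(1) unfolding dvd0_def by blast
qed

text \<open>At \<open>t = 0\<close> the corner vanishes and one more copy of \<open>X0\<close>
  appears on the diagonal; at \<open>t = 1\<close> the tuple is block triangular with diagonal
  blocks in the domain of \<open>r\<close>.\<close>

lemma curve_glue:
  assumes T': "curve 1 T'" and T: "curve K T" and b: "k0 < d" "p < m" "x < s" "q < K * m" "y < s"
  shows "curve (Suc K) (glue d s m (K * m) T' T k0 p x q y)"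
proof -
  have t: "T' \<in> mat_tuples d (m * s)" "eval_at 0 T' = X0" "eval_at 1 T' \<in> expr_dom d (m * s) r"
    "T \<in> mat_tuples d (K * m * s)" "eval_at 0 T = amplify K X0" "eval_at 1 T \<in> expr_dom d (K * m * s) r"
    using T' T amplify_one[OF X0] by (auto simp: curve_def)
  note g = glue_tuples[OF t(1,4) b] eval_at_glue[OF t(1,4) b]
  have "eval_at 0 (glue d s m (K * m) T' T k0 p x q y) = amplify (Suc K) X0"
  proof (rule nth_equalityI)
    fix k assume "k < length (eval_at 0 (glue d s m (K * m) T' T k0 p x q y))"
    then have k: "k < d" by (simp add: eval_at_def glue_def)
    have z: "mat (m * s) (K * m * s) (\<lambda>(i, j). if k = k0 \<and> i = p * s + x \<and> j = q * s + y then 0 else (0 :: 'a)) = 0\<^sub>m (m * s) (K * m * s)"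
      by (rule eq_matI) auto
    show "eval_at 0 (glue d s m (K * m) T' T k0 p x q y) ! k = amplify (Suc K) X0 ! k"
      unfolding g(2) t(2,5) using k mat_tuplesD[OF X0] kronecker_Suc[OF mat_tuplesD(2)[OF X0 k], of K] z
      by (simp add: amplify_def mult.assoc)
  qed (use mat_tuplesD(1)[OF X0] in \<open>simp add: eval_at_def glue_def amplify_def\<close>)
  moreover have "eval_at 1 (glue d s m (K * m) T' T k0 p x q y) \<in> expr_dom d (Suc K * m * s) r"
  proof -
    obtain V1 V2 where V: "nc_eval (\<lambda>c. c) (m * s) (eval_at 1 T') r = Some V1" "nc_eval (\<lambda>c. c) (K * m * s) (eval_at 1 T) r = Some V2"
      using t(3,6) unfolding expr_dom_def by auto
    have "\<exists>W \<in> carrier_mat (m * s) (K * m * s). nc_eval (\<lambda>c. c) (m * s + K * m * s) (eval_at 1 (glue d s m (K * m) T' T k0 p x q y)) r =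
        Some (four_block_mat V1 W (0\<^sub>m (K * m * s) (m * s)) V2)"
      by (rule nc_eval_block_triangular[OF eval_at_tuples[OF t(1)] eval_at_tuples[OF t(4)] _ g(2) vars V]) simp
    then show ?thesis
      using eval_at_tuples[OF g(1), of 1] by (auto simp: expr_dom_def distrib_right)
  qed
  ultimately show ?thesis using g(1) by (simp add: curve_def distrib_right)
qed

text \<open>A block triangular system is solved from below: \<open>v\<close> remains the lower part,
  and \<open>u\<close> has to answer to what the corner carries upward, namely \<open>t\<close>
  times the driving term and minus the coefficient applied to component \<open>q\<close> of
  \<open>v\<close>.\<close>

lemma solution_glue:
  assumes sol: "solution K T cq cj e v" and T': "curve 1 T'" and b: "k0 < d" "p < m" "x < s" "q < K * m" "y < s"
    and u: "\<And>P \<alpha>. P < m \<Longrightarrow> \<alpha> < L \<Longrightarrow> (\<Sum>Q<m. \<Sum>\<beta><L. LA T' P \<alpha> Q \<beta> * u Q \<beta>) =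
      (if P = p then [:0, 1:] * (e * (if cq = q then [:sys_b S k0 x y \<alpha> cj:] else 0) -
        (\<Sum>\<beta><L. [:sys_a S k0 x y \<alpha> \<beta>:] * v q \<beta>)) else 0)"
  shows "solution (Suc K) (glue d s m (K * m) T' T k0 p x q y) (m + cq) cj e (\<lambda>Q \<beta>. if Q < m then u Q \<beta> else v (Q - m) \<beta>)"
proof -
  let ?T = "glue d s m (K * m) T' T k0 p x q y" and ?v = "\<lambda>Q \<beta>. if Q < m then u Q \<beta> else v (Q - m) \<beta>"
  have K: "1 \<le> K" and T: "curve K T" and c: "cq < K * m" "cj < s"
    and eq: "\<And>P \<alpha>. P < K * m \<Longrightarrow> \<alpha> < L \<Longrightarrow> (\<Sum>Q<K * m. \<Sum>\<beta><L. LA T P \<alpha> Q \<beta> * v Q \<beta>) = e * RB T P \<alpha> cq cj"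
    using sol unfolding solution_def by auto
  have t: "T' \<in> mat_tuples d (m * s)" "T \<in> mat_tuples d (K * m * s)" using T' T by (auto simp: curve_def)
  note ae = aff_entry_glue[OF t b]
  have "(\<Sum>Q<m + K * m. \<Sum>\<beta><L. LA ?T P \<alpha> Q \<beta> * ?v Q \<beta>) = e * RB ?T P \<alpha> (m + cq) cj"
    if P: "P < m + K * m" and \<alpha>: "\<alpha> < L" for P \<alpha>
  proof -
    have split: "(\<Sum>Q<m + K * m. \<Sum>\<beta><L. LA ?T P \<alpha> Q \<beta> * ?v Q \<beta>) =
        (\<Sum>Q<m. \<Sum>\<beta><L. LA ?T P \<alpha> Q \<beta> * u Q \<beta>) + (\<Sum>Q<K * m. \<Sum>\<beta><L. LA ?T P \<alpha> (m + Q) \<beta> * v Q \<beta>)"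
      unfolding sum_lessThan_add by simp
    show ?thesis
    proof (cases "P < m")
      case True
      have "(\<Sum>Q<m. \<Sum>\<beta><L. LA ?T P \<alpha> Q \<beta> * u Q \<beta>) = (\<Sum>Q<m. \<Sum>\<beta><L. LA T' P \<alpha> Q \<beta> * u Q \<beta>)"
        by (intro sum.cong refl) (use True in \<open>simp add: ae\<close>)
      moreover have "(\<Sum>Q<K * m. \<Sum>\<beta><L. LA ?T P \<alpha> (m + Q) \<beta> * v Q \<beta>) =
          (\<Sum>Q<K * m. if Q = q then \<Sum>\<beta><L. (if P = p then [:0, 1:] * [:sys_a S k0 x y \<alpha> \<beta>:] else 0) * v q \<beta> else 0)"
        by (intro sum.cong refl) (use True in \<open>auto simp: ae simp del: mult_pCons_left mult_pCons_right\<close>)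
      moreover have "\<dots> = (if P = p then [:0, 1:] * (\<Sum>\<beta><L. [:sys_a S k0 x y \<alpha> \<beta>:] * v q \<beta>) else 0)"
        using b(4) by (simp add: sum_distrib_left mult.assoc del: mult_pCons_left mult_pCons_right)
      moreover have "RB ?T P \<alpha> (m + cq) cj = (if P = p \<and> cq = q then [:0, 1:] * [:sys_b S k0 x y \<alpha> cj:] else 0)"
        using True c by (simp add: ae del: mult_pCons_left mult_pCons_right)
      ultimately show ?thesis
        unfolding split u[OF True \<alpha>]
        by (simp add: right_diff_distrib mult.left_commute[of e] del: mult_pCons_left mult_pCons_right)
    next
      case False
      then have P': "P - m < K * m" using P by simp
      have "(\<Sum>Q<m. \<Sum>\<beta><L. LA ?T P \<alpha> Q \<beta> * u Q \<beta>) = 0"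
        using False P by (simp add: ae)
      moreover have "(\<Sum>Q<K * m. \<Sum>\<beta><L. LA ?T P \<alpha> (m + Q) \<beta> * v Q \<beta>) = (\<Sum>Q<K * m. \<Sum>\<beta><L. LA T (P - m) \<alpha> Q \<beta> * v Q \<beta>)"
        by (intro sum.cong refl) (use False P in \<open>simp add: ae\<close>)
      moreover have "RB ?T P \<alpha> (m + cq) cj = RB T (P - m) \<alpha> cq cj" using False P c by (simp add: ae)
      ultimately show ?thesis unfolding split using eq[OF P' \<alpha>] by simp
    qed
  qed
  then show ?thesis
    using curve_glue[OF T' T b] c unfolding solution_def by simp
qed

end


section \<open>The line from the point under study to the end point\<close>

context curves
begin

definition "T1 = line d (m * s) X0 Y'"
definition "rp j p = pcompose p (monom (1 :: 'a) j)"
text \<open>The line run with parameter \<open>t^j\<close>. For \<open>j\<close> at least 1 it has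
  the same end points, but its expansion at 0 contains only powers of \<open>t^j\<close>.\<close>

definition "Tc j = map (map_mat (rp j)) T1"
definition "\<Delta> = den (\<lambda>c. [:c:]) d s m S T1"
text \<open>Entries of the adjugate of the pencil along the line; divided by \<Delta> they are those
  of the resolvent.\<close>

definition "W Q \<beta> R \<gamma> = adj_mat (lam (\<lambda>c. [:c:]) d s m S T1) $$ (Q * L + \<beta>, R * L + \<gamma>)"

lemma rp_hom: "comm_ring_hom (rp j)"
  by unfold_locales (auto simp: rp_def pcompose_add pcompose_mult pcompose_1 pcompose_uminus)

sublocale rp: comm_ring_hom "rp j" for j
  by (rule rp_hom)

lemma rp_const [simp]: "rp j [:c:] = [:c:]"
  by (simp add: rp_def)

lemma rp_one: "rp 1 p = p"
  by (simp add: rp_def monom_altdef pcompose_idR)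

lemma poly_rp: "poly (rp j p) t = poly p (t ^ j)"
  by (simp add: rp_def poly_pcompose poly_monom)

lemma T1: "T1 \<in> mat_tuples d (s * m)" "eval_at 0 T1 = X0" "eval_at 1 T1 = Y'"
  using line_tuples[of d "m * s" X0 Y'] eval_at_line[OF X0, of Y'] Y' by (auto simp: T1_def mult.commute expr_dom_def)

lemma Tc_one: "Tc 1 = T1"
proof -
  have "rp 1 = (\<lambda>p. p)" by (rule ext) (rule rp_one)
  moreover have "map_mat (\<lambda>p. p) = (\<lambda>M :: 'a poly mat. M)" by (intro ext eq_matI) auto
  ultimately show ?thesis by (simp only: Tc_def list.map_ident)
qed

lemma curve_Tc:
  assumes "1 \<le> j"
  shows "curve 1 (Tc j)"
proof -
  have "eval_at t (Tc j) = eval_at (t ^ j) T1" for t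
    by (auto simp: eval_at_def Tc_def poly_rp intro!: eq_matI)
  then show ?thesis
    using assms rp.map_mat_tuples[OF T1(1)] T1(2,3) Y' amplify_one[OF X0]
    by (simp add: curve_def zero_power mult.commute Tc_def[symmetric] del: One_nat_def)
qed

lemma adj_solves:
  assumes "P < m" "\<alpha> < L"
  shows "(\<Sum>Q<m. \<Sum>\<beta><L. LA (Tc j) P \<alpha> Q \<beta> * (\<Sum>R<m. \<Sum>\<gamma><L. rp j (W Q \<beta> R \<gamma>) * h R \<gamma>)) = rp j \<Delta> * h P \<alpha>"
proof -
  have c: "(\<lambda>c. rp j [:c:]) = (\<lambda>c. [:c:])" by simp
  have l: "lam (\<lambda>c. [:c:]) d s m S (Tc j) = map_mat (rp j) (lam (\<lambda>c. [:c:]) d s m S T1)"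
    using rp.aff_hom[OF T1(1), of j "\<lambda>c. [:c:]"] by (simp add: lam_def Tc_def)
  have W: "adj_mat (lam (\<lambda>c. [:c:]) d s m S (Tc j)) $$ (Q * L + \<beta>, R * L + \<gamma>) = rp j (W Q \<beta> R \<gamma>)"
    if "Q < m" "\<beta> < L" "R < m" "\<gamma> < L" for Q \<beta> R \<gamma>
    unfolding l rp.mat_hom_adj[OF sys_carrier(1)] W_def
    using that block_index_less by (subst index_map_mat) (auto simp: carrier_matD[OF adj_lam_carrier])
  have D: "den (\<lambda>c. [:c:]) d s m S (Tc j) = rp j \<Delta>"
    using rp.den_hom[OF T1(1), of j "\<lambda>c. [:c:]" S] by (simp add: Tc_def \<Delta>_def)
  have "(\<Sum>R<m. \<Sum>\<gamma><L. rp j (W Q \<beta> R \<gamma>) * h R \<gamma>) =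
      (\<Sum>R<m. \<Sum>\<gamma><L. adj_mat (lam (\<lambda>c. [:c:]) d s m S (Tc j)) $$ (Q * L + \<beta>, R * L + \<gamma>) * h R \<gamma>)"
    if "Q < m" "\<beta> < L" for Q \<beta>
    using W that by (intro sum.cong refl) simp
  then have "(\<Sum>Q<m. \<Sum>\<beta><L. LA (Tc j) P \<alpha> Q \<beta> * (\<Sum>R<m. \<Sum>\<gamma><L. rp j (W Q \<beta> R \<gamma>) * h R \<gamma>)) =
     (\<Sum>Q<m. \<Sum>\<beta><L. LA (Tc j) P \<alpha> Q \<beta> * (\<Sum>R<m. \<Sum>\<gamma><L. adj_mat (lam (\<lambda>c. [:c:]) d s m S (Tc j)) $$ (Q * L + \<beta>, R * L + \<gamma>) * h R \<gamma>))"
    by (intro sum.cong refl) simp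
  also have "\<dots> = den (\<lambda>c. [:c:]) d s m S (Tc j) * h P \<alpha>"
    by (rule adj_lam_solves[OF assms])
  finally show ?thesis unfolding D .
qed

lemma lam_Y': "lam (\<lambda>c. c) d s m S Y' = 1\<^sub>m (m * L)"
proof (rule eq_mat_blockI[of _ m L m L])
  fix P \<alpha> Q \<beta> assume *: "P < m" "\<alpha> < L" "Q < m" "\<beta> < L"
  have "P * L + \<alpha> = Q * L + \<beta> \<longleftrightarrow> P = Q \<and> \<alpha> = \<beta>"
    using * by (metis block_index_div_mod)
  then show "lam (\<lambda>c. c) d s m S Y' $$ (P * L + \<alpha>, Q * L + \<beta>) = 1\<^sub>m (m * L) $$ (P * L + \<alpha>, Q * L + \<beta>)"
    using * by (simp add: lam_def normG block_index_less)
qed simp_all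

lemma poly_\<Delta>_one: "poly \<Delta> 1 = 1"
  using poly_den[OF T1(1), of S 1] by (simp add: \<Delta>_def T1 den_def lam_Y')

lemma poly_W_one:
  assumes "Q < m" "\<beta> < L" "R < m" "\<gamma> < L"
  shows "poly (W Q \<beta> R \<gamma>) 1 = (if Q = R \<and> \<beta> = \<gamma> then 1 else 0)"
proof -
  interpret ev: comm_ring_hom "\<lambda>p. poly p (1 :: 'a)" by (rule comm_ring_hom_poly)
  let ?l = "lam (\<lambda>c. [:c:]) d s m S T1"
  have "map_mat (\<lambda>p. poly p 1) ?l = 1\<^sub>m (m * L)"
    using ev.aff_hom[OF T1(1), of "\<lambda>c. [:c:]"] lam_Y' T1(3) by (simp add: lam_def eval_at_def)
  then have "map_mat (\<lambda>p. poly p 1) (adj_mat ?l) = adj_mat (1\<^sub>m (m * L))"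
    using ev.mat_hom_adj[OF sys_carrier(1), of "\<lambda>c. [:c:]" d s m S T1] by simp
  also have "\<dots> = 1\<^sub>m (m * L)"
  proof -
    have "adj_mat (1\<^sub>m (m * L)) = adj_mat (1\<^sub>m (m * L)) * (1\<^sub>m (m * L) :: 'a mat)"
      by (rule right_mult_one_mat[OF adj_mat(1)[OF one_carrier_mat], symmetric])
    also have "\<dots> = 1\<^sub>m (m * L)" unfolding adj_mat(3)[OF one_carrier_mat] by (rule eq_matI) auto
    finally show ?thesis .
  qed
  finally have "map_mat (\<lambda>p. poly p 1) (adj_mat ?l) $$ (Q * L + \<beta>, R * L + \<gamma>) = 1\<^sub>m (m * L) $$ (Q * L + \<beta>, R * L + \<gamma>)"
    by simp
  moreover have "Q * L + \<beta> = R * L + \<gamma> \<longleftrightarrow> Q = R \<and> \<beta> = \<gamma>"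
    using assms by (metis block_index_div_mod)
  ultimately show ?thesis
    using block_index_less[OF assms(1,2)] block_index_less[OF assms(3,4)] carrier_matD[OF adj_lam_carrier[of "\<lambda>c. [:c:]" d s m S T1]]
    by (simp add: W_def)
qed

lemma sum2_delta:
  fixes f :: "nat \<Rightarrow> nat \<Rightarrow> 'b::comm_monoid_add"
  assumes "p < m" 
  shows "(\<Sum>P<m. \<Sum>\<alpha><n. if P = p then f P \<alpha> else 0) = (\<Sum>\<alpha><n. f p \<alpha>)"
proof -
  have "(\<Sum>P<m. \<Sum>\<alpha><n. if P = p then f P \<alpha> else 0) = (\<Sum>P<m. if P = p then \<Sum>\<alpha><n. f P \<alpha> else 0)"
    by (intro sum.cong refl) auto
  then show ?thesis using assms by simp
qed

lemma poly_sum_W_one: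
  assumes "Q < m" "\<beta> < L"
  shows "poly (\<Sum>R<m. \<Sum>\<gamma><L. W Q \<beta> R \<gamma> * h R \<gamma>) 1 = poly (h Q \<beta>) 1"
proof -
  have "poly (\<Sum>R<m. \<Sum>\<gamma><L. W Q \<beta> R \<gamma> * h R \<gamma>) 1 = (\<Sum>R<m. \<Sum>\<gamma><L. (if Q = R \<and> \<beta> = \<gamma> then 1 else 0) * poly (h R \<gamma>) 1)"
    unfolding poly_sum poly_mult by (intro sum.cong refl) (simp add: poly_W_one[OF assms])
  also have "\<dots> = (\<Sum>R<m. \<Sum>\<gamma><L. if R = Q then if \<gamma> = \<beta> then poly (h R \<gamma>) 1 else 0 else 0)"
    by (intro sum.cong refl) auto
  also have "\<dots> = poly (h Q \<beta>) 1" unfolding sum2_delta[OF assms(1)] using assms(2) by simp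
  finally show ?thesis .
qed

text \<open>The new upper block is the adjugate along \<open>Tc j\<close> applied to the signal from
  the corner; rescaling the old solution by \<open>rp j \<Delta>\<close> compensates for the missing
  division.\<close>

lemma solution_prepend:
  assumes sol: "solution K T cq cj e v" and j: "1 \<le> j" and b: "k0 < d" "p < m" "x < s" "q < K * m" "y < s"
  defines "h P \<alpha> \<equiv> if P = p then e * (if cq = q then [:sys_b S k0 x y \<alpha> cj:] else 0) -
        (\<Sum>\<beta><L. [:sys_a S k0 x y \<alpha> \<beta>:] * v q \<beta>) else 0"
  defines "v' Q \<beta> \<equiv> if Q < m then \<Sum>R<m. \<Sum>\<gamma><L. rp j (W Q \<beta> R \<gamma>) * ([:0, 1:] * h R \<gamma>) else rp j \<Delta> * v (Q - m) \<beta>"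
  shows "\<exists>T'. solution (Suc K) T' (m + cq) cj (rp j \<Delta> * e) v'"
proof -
  have scaled: "solution K T cq cj (rp j \<Delta> * e) (\<lambda>Q \<beta>. rp j \<Delta> * v Q \<beta>)" using sol by (rule solution_scale)
  have "solution (Suc K) (glue d s m (K * m) (Tc j) T k0 p x q y) (m + cq) cj (rp j \<Delta> * e)
    (\<lambda>Q \<beta>. if Q < m then (\<lambda>Q \<beta>. \<Sum>R<m. \<Sum>\<gamma><L. rp j (W Q \<beta> R \<gamma>) * ([:0, 1:] * h R \<gamma>)) Q \<beta> else (\<lambda>Q \<beta>. rp j \<Delta> * v Q \<beta>) (Q - m) \<beta>)"
  proof (rule solution_glue[OF scaled curve_Tc[OF j] b])
    fix P \<alpha> assume *: "P < m" "\<alpha> < L"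
    have s: "(\<Sum>\<beta><L. [:sys_a S k0 x y \<alpha> \<beta>:] * (rp j \<Delta> * v q \<beta>)) = rp j \<Delta> * (\<Sum>\<beta><L. [:sys_a S k0 x y \<alpha> \<beta>:] * v q \<beta>)"
      unfolding sum_distrib_left by (intro sum.cong refl mult.left_commute)
    show "(\<Sum>Q<m. \<Sum>\<beta><L. LA (Tc j) P \<alpha> Q \<beta> * (\<Sum>R<m. \<Sum>\<gamma><L. rp j (W Q \<beta> R \<gamma>) * ([:0, 1:] * h R \<gamma>))) =
        (if P = p then [:0, 1:] * (rp j \<Delta> * e * (if cq = q then [:sys_b S k0 x y \<alpha> cj:] else 0) -
          (\<Sum>\<beta><L. [:sys_a S k0 x y \<alpha> \<beta>:] * (rp j \<Delta> * v q \<beta>))) else 0)"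
      unfolding adj_solves[OF *] s h_def
      by (cases "P = p") (simp_all add: right_diff_distrib ac_simps del: mult_pCons_left mult_pCons_right)
  qed
  then show ?thesis unfolding v'_def by blast
qed

text \<open>Every step in the generation of a reachable vector is carried out by gluing one more
  block on top. The incoming signal \<open>h\<close> is built from the blocks below and does not
  depend on the exponent \<open>j\<close> of the top block, which stays free. At
  \<open>t = 1\<close> all resolvents are the identity, and \<open>h\<close> becomes the reachable
  vector. The condition \<open>m \<le> cq\<close> keeps the driving column out of the top
  block.\<close>

lemma reach_solutions:
  assumes "reach d s S h0" "p < m"
  shows "\<exists>h. (\<forall>P<m. \<forall>\<alpha><L. poly (h P \<alpha>) 1 = (if P = p then h0 \<alpha> else 0)) \<and>
    (\<forall>j\<ge>1. \<exists>K T cq cj e v. m \<le> cq \<and> solution K T cq cj (rp j \<Delta> * e) v \<and>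
      (\<forall>Q<m. \<forall>\<beta><L. v Q \<beta> = (\<Sum>R<m. \<Sum>\<gamma><L. rp j (W Q \<beta> R \<gamma>) * ([:0, 1:] * h R \<gamma>))))"
  using assms(1)
proof (induction rule: reach.induct)
  case (base k x y c)
  define v where "v Q \<beta> = (\<Sum>R<m. \<Sum>\<gamma><L. W Q \<beta> R \<gamma> * RB T1 R \<gamma> p c)" for Q \<beta>
  \<comment> \<open>The starting solution is driven in column block \<open>p\<close> itself, so that
    the first gluing picks up the coefficient \<open>sys_b\<close>. Its own contribution through
    \<open>sys_a\<close> disappears at \<open>t = 1\<close>, where the right-hand side is
    zero.\<close>
  have sol: "solution 1 T1 p c \<Delta> v"
    using adj_solves[of _ _ 1 "\<lambda>R \<gamma>. RB T1 R \<gamma> p c"] curve_Tc[of 1] base assms(2)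
    unfolding solution_def v_def rp_one Tc_one by simp
  have RB: "poly (RB T1 P \<alpha> p c) 1 = 0" if "P < m" "\<alpha> < L" for P \<alpha>
    using comm_ring_hom.aff_entry_hom[OF comm_ring_hom_poly[of 1] T1(1) that(1) assms(2), of "\<lambda>c. [:c:]" "sys_B S" "sys_b S" \<alpha> c]
      normB[OF that assms(2) base(4)] T1(3) by (simp add: eval_at_def)
  have v1: "poly (v Q \<beta>) 1 = 0" if "Q < m" "\<beta> < L" for Q \<beta>
    unfolding v_def poly_sum_W_one[OF that] using RB that by simp
  define h where "h P \<alpha> = (if P = p then \<Delta> * (if p = p then [:sys_b S k x y \<alpha> c:] else 0) -
        (\<Sum>\<beta><L. [:sys_a S k x y \<alpha> \<beta>:] * v p \<beta>) else 0)" for P \<alpha>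
  have "poly (h P \<alpha>) 1 = (if P = p then sys_b S k x y \<alpha> c else 0)" if "P < m" "\<alpha> < L" for P \<alpha>
    using v1[OF assms(2)] by (simp add: h_def poly_sum poly_\<Delta>_one)
  moreover have "\<exists>K T cq cj e v. m \<le> cq \<and> solution K T cq cj (rp j \<Delta> * e) v \<and>
      (\<forall>Q<m. \<forall>\<beta><L. v Q \<beta> = (\<Sum>R<m. \<Sum>\<gamma><L. rp j (W Q \<beta> R \<gamma>) * ([:0, 1:] * h R \<gamma>)))" if j: "1 \<le> j" for j
  proof -
    have pm: "p < 1 * m" using assms(2) by simp
    obtain T' where T': "solution (Suc 1) T' (m + p) c (rp j \<Delta> * \<Delta>) (\<lambda>Q \<beta>. if Q < m then \<Sum>R<m. \<Sum>\<gamma><L. rp j (W Q \<beta> R \<gamma>) * ([:0, 1:] * h R \<gamma>) else rp j \<Delta> * v (Q - m) \<beta>)"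
      using solution_prepend[OF sol j base(1) assms(2) base(2) pm base(3)] unfolding h_def by blast
    show ?thesis
      by (rule exI[of _ "Suc 1"], rule exI[of _ T'], rule exI[of _ "m + p"], rule exI[of _ c], rule exI[of _ \<Delta>], rule exI, rule conjI[OF _ conjI[OF T']])
        simp_all
  qed
  ultimately show ?case by blast
next
  case (step h0 k x y)
  from step.IH obtain h where h: "\<forall>P<m. \<forall>\<alpha><L. poly (h P \<alpha>) 1 = (if P = p then h0 \<alpha> else 0)"
    and ex': "\<forall>j\<ge>1. \<exists>K T cq cj e v. m \<le> cq \<and> solution K T cq cj (rp j \<Delta> * e) v \<and>
      (\<forall>Q<m. \<forall>\<beta><L. v Q \<beta> = (\<Sum>R<m. \<Sum>\<gamma><L. rp j (W Q \<beta> R \<gamma>) * ([:0, 1:] * h R \<gamma>)))"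
    by (elim exE conjE) (rule that)
  \<comment> \<open>The block that ceases to be the top one is frozen at exponent 1; only the new
    top block has a free exponent.\<close>
  have ex: "\<exists>K T cq cj e v. m \<le> cq \<and> solution K T cq cj (rp 1 \<Delta> * e) v \<and>
      (\<forall>Q<m. \<forall>\<beta><L. v Q \<beta> = (\<Sum>R<m. \<Sum>\<gamma><L. rp 1 (W Q \<beta> R \<gamma>) * ([:0, 1:] * h R \<gamma>)))"
    by (rule ex'[rule_format]) (rule order_refl)
  obtain K T cq cj e v where cq: "m \<le> cq" and sol: "solution K T cq cj (\<Delta> * e) v"
    and v: "\<And>Q \<beta>. Q < m \<Longrightarrow> \<beta> < L \<Longrightarrow> v Q \<beta> = (\<Sum>R<m. \<Sum>\<gamma><L. W Q \<beta> R \<gamma> * ([:0, 1:] * h R \<gamma>))"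
    using ex unfolding rp_one by (elim exE conjE) (rule that, assumption, assumption, simp)
  have v1: "poly (v Q \<beta>) 1 = poly (h Q \<beta>) 1" if "Q < m" "\<beta> < L" for Q \<beta>
    unfolding v[OF that] poly_sum_W_one[OF that] by simp
  define h' where "h' P \<alpha> = (if P = p then \<Delta> * e * (if cq = p then [:sys_b S k x y \<alpha> cj:] else 0) -
        (\<Sum>\<beta><L. [:sys_a S k x y \<alpha> \<beta>:] * v p \<beta>) else 0)" for P \<alpha>
  have "poly (h' P \<alpha>) 1 = (if P = p then - (\<Sum>\<beta><L. sys_a S k x y \<alpha> \<beta> * h0 \<beta>) else 0)" if "P < m" "\<alpha> < L" for P \<alpha>
    using v1[OF assms(2)] h[rule_format, OF assms(2)] cq assms(2) by (simp add: h'_def poly_sum)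
  moreover have "\<exists>K T cq cj e v. m \<le> cq \<and> solution K T cq cj (rp j \<Delta> * e) v \<and>
      (\<forall>Q<m. \<forall>\<beta><L. v Q \<beta> = (\<Sum>R<m. \<Sum>\<gamma><L. rp j (W Q \<beta> R \<gamma>) * ([:0, 1:] * h' R \<gamma>)))" if j: "1 \<le> j" for j
  proof -
    have "1 \<le> K" using sol by (simp add: solution_def)
    then have "m \<le> K * m" by (cases K) simp_all
    with assms(2) have pm: "p < K * m" by (rule less_le_trans)
    obtain T' where T': "solution (Suc K) T' (m + cq) cj (rp j \<Delta> * (\<Delta> * e)) (\<lambda>Q \<beta>. if Q < m then \<Sum>R<m. \<Sum>\<gamma><L. rp j (W Q \<beta> R \<gamma>) * ([:0, 1:] * h' R \<gamma>) else rp j \<Delta> * v (Q - m) \<beta>)"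
      using solution_prepend[OF sol j step(2) assms(2) step(3) pm step(4)] unfolding h'_def by blast
    show ?thesis
      by (rule exI[of _ "Suc K"], rule exI[of _ T'], rule exI[of _ "m + cq"], rule exI[of _ cj], rule exI[of _ "\<Delta> * e"], rule exI, rule conjI[OF _ conjI[OF T']])
        simp_all
  qed
  ultimately show ?case by blast
qed

text \<open>Dual to the previous induction: the solution is prolonged by one block, the induction
  hypothesis is applied to it, and the new adjugate and coefficient are moved over to
  \<open>g\<close>. The term with \<open>sys_b\<close> is absent because \<open>cq\<close> lies
  outside the top block.\<close>

lemma coreach_solutions:
  assumes "coreach d s S g0" "p < m"
  shows "\<exists>g. (\<forall>P<m. \<forall>\<alpha><L. poly (g P \<alpha>) 1 = (if P = p then g0 \<alpha> else 0)) \<and>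
    (\<forall>K T cq cj e v. solution K T cq cj e v \<longrightarrow> m \<le> cq \<longrightarrow> dvd0 e (\<Sum>Q<m. \<Sum>\<beta><L. g Q \<beta> * v Q \<beta>))"
  using assms(1)
proof (induction rule: coreach.induct)
  case (base i)
  define g where "g P \<alpha> = (if P = p then [:sys_C S i \<alpha>:] else 0)" for P \<alpha>
  have "dvd0 e (\<Sum>Q<m. \<Sum>\<beta><L. g Q \<beta> * v Q \<beta>)" if sol: "solution K T cq cj e v" for K T cq cj e v
  proof -
    have "1 \<le> K" using sol by (simp add: solution_def)
    then have "m \<le> K * m" by (cases K) simp_all
    with assms(2) have pm: "p < K * m" by (rule less_le_trans)
    have "(\<Sum>Q<m. \<Sum>\<beta><L. g Q \<beta> * v Q \<beta>) = (\<Sum>Q<m. \<Sum>\<beta><L. if Q = p then [:sys_C S i \<beta>:] * v Q \<beta> else 0)"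
      by (intro sum.cong refl) (simp add: g_def)
    then show ?thesis
      unfolding sum2_delta[OF assms(2)] using solution_regular[OF sol pm base] by simp
  qed
  then show ?case by (intro exI[of _ g]) (simp add: g_def)
next
  case (step g0 k x y)
  obtain g where g: "\<And>P \<alpha>. P < m \<Longrightarrow> \<alpha> < L \<Longrightarrow> poly (g P \<alpha>) 1 = (if P = p then g0 \<alpha> else 0)"
    and dvd: "\<And>K T cq cj e v. solution K T cq cj e v \<Longrightarrow> m \<le> cq \<Longrightarrow> dvd0 e (\<Sum>Q<m. \<Sum>\<beta><L. g Q \<beta> * v Q \<beta>)"
    using step.IH by auto
  \<comment> \<open>The row vector \<open>g\<close> times the adjugate, restricted to the block
    column \<open>p\<close> where the corner entry sits.\<close>
  define z where "z \<gamma> = (\<Sum>Q<m. \<Sum>\<beta><L. g Q \<beta> * W Q \<beta> p \<gamma>)" for \<gamma>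
  define g' where "g' Q \<beta> = (if Q = p then - (\<Sum>\<gamma><L. [:0, 1:] * z \<gamma> * [:sys_a S k x y \<gamma> \<beta>:]) else 0)" for Q \<beta>
  have "poly (z \<gamma>) 1 = g0 \<gamma>" if "\<gamma> < L" for \<gamma>
  proof -
    have "poly (z \<gamma>) 1 = (\<Sum>Q<m. \<Sum>\<beta><L. if Q = p then if \<beta> = \<gamma> then g0 \<beta> else 0 else 0)"
      unfolding z_def poly_sum poly_mult by (intro sum.cong refl) (auto simp: g poly_W_one assms(2) that)
    then show ?thesis unfolding sum2_delta[OF assms(2)] using that by simp
  qed
  then have "poly (g' P \<alpha>) 1 = (if P = p then - (\<Sum>\<gamma><L. g0 \<gamma> * sys_a S k x y \<gamma> \<alpha>) else 0)" for P \<alpha>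
    by (simp add: g'_def poly_sum del: mult_pCons_left mult_pCons_right)
  moreover have "dvd0 e (\<Sum>Q<m. \<Sum>\<beta><L. g' Q \<beta> * v Q \<beta>)" if sol: "solution K T cq cj e v" and cq: "m \<le> cq" for K T cq cj e v
  proof -
    have "1 \<le> K" using sol by (simp add: solution_def)
    then have "m \<le> K * m" by (cases K) simp_all
    with assms(2) have pm: "p < K * m" by (rule less_le_trans)
    have ne: "cq \<noteq> p" using cq assms(2) by simp
    define h where "h P \<alpha> = (if P = p then e * (if cq = p then [:sys_b S k x y \<alpha> cj:] else 0) -
        (\<Sum>\<beta><L. [:sys_a S k x y \<alpha> \<beta>:] * v p \<beta>) else 0)" for P \<alpha>
    obtain T' where T': "solution (Suc K) T' (m + cq) cj (rp 1 \<Delta> * e) (\<lambda>Q \<beta>. if Q < m then \<Sum>R<m. \<Sum>\<gamma><L. rp 1 (W Q \<beta> R \<gamma>) * ([:0, 1:] * h R \<gamma>) else rp 1 \<Delta> * v (Q - m) \<beta>)"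
      using solution_prepend[OF sol order_refl step(2) assms(2) step(3) pm step(4)] unfolding h_def by blast
    \<comment> \<open>The prolonged solution carries the extra factor \<Delta>, which is discarded
      again once the pairing has been rewritten.\<close>
    have "dvd0 (\<Delta> * e) (\<Sum>Q<m. \<Sum>\<beta><L. g Q \<beta> * (\<Sum>R<m. \<Sum>\<gamma><L. W Q \<beta> R \<gamma> * ([:0, 1:] * h R \<gamma>)))"
      using dvd[OF T'] by (simp add: rp_one del: mult_pCons_left mult_pCons_right)
    moreover have "(\<Sum>Q<m. \<Sum>\<beta><L. g Q \<beta> * (\<Sum>R<m. \<Sum>\<gamma><L. W Q \<beta> R \<gamma> * ([:0, 1:] * h R \<gamma>))) = (\<Sum>Q<m. \<Sum>\<beta><L. g' Q \<beta> * v Q \<beta>)"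
    proof -
      have "(\<Sum>R<m. \<Sum>\<gamma><L. W Q \<beta> R \<gamma> * ([:0, 1:] * h R \<gamma>)) = (\<Sum>\<gamma><L. W Q \<beta> p \<gamma> * ([:0, 1:] * h p \<gamma>))" for Q \<beta>
      proof -
        have "(\<Sum>R<m. \<Sum>\<gamma><L. W Q \<beta> R \<gamma> * ([:0, 1:] * h R \<gamma>)) =
            (\<Sum>R<m. \<Sum>\<gamma><L. if R = p then W Q \<beta> R \<gamma> * ([:0, 1:] * h R \<gamma>) else 0)"
          by (intro sum.cong refl) (simp add: h_def)
        then show ?thesis unfolding sum2_delta[OF assms(2)] .
      qed
      then have "(\<Sum>Q<m. \<Sum>\<beta><L. g Q \<beta> * (\<Sum>R<m. \<Sum>\<gamma><L. W Q \<beta> R \<gamma> * ([:0, 1:] * h R \<gamma>))) =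
          (\<Sum>Q<m. \<Sum>\<beta><L. \<Sum>\<gamma><L. g Q \<beta> * W Q \<beta> p \<gamma> * ([:0, 1:] * h p \<gamma>))"
        by (simp only: sum_distrib_left mult.assoc)
      also have "\<dots> = (\<Sum>\<gamma><L. \<Sum>Q<m. \<Sum>\<beta><L. g Q \<beta> * W Q \<beta> p \<gamma> * ([:0, 1:] * h p \<gamma>))"
        by (rule trans[OF sum.cong[OF refl sum.swap] sum.swap])
      also have "\<dots> = (\<Sum>\<gamma><L. z \<gamma> * ([:0, 1:] * h p \<gamma>))"
        by (simp only: z_def sum_distrib_right)
      also have "\<dots> = (\<Sum>\<gamma><L. \<Sum>\<beta><L. - ([:0, 1:] * z \<gamma> * [:sys_a S k x y \<gamma> \<beta>:]) * v p \<beta>)"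
      proof (rule sum.cong[OF refl])
        fix \<gamma>
        have "z \<gamma> * ([:0, 1:] * h p \<gamma>) = - ([:0, 1:] * z \<gamma>) * (\<Sum>\<beta><L. [:sys_a S k x y \<gamma> \<beta>:] * v p \<beta>)"
          using ne by (simp add: h_def ac_simps del: mult_pCons_left mult_pCons_right)
        also have "\<dots> = (\<Sum>\<beta><L. - ([:0, 1:] * z \<gamma> * [:sys_a S k x y \<gamma> \<beta>:]) * v p \<beta>)"
          unfolding sum_distrib_left by (intro sum.cong refl) (simp only: mult.assoc mult_minus_left)
        finally show "z \<gamma> * ([:0, 1:] * h p \<gamma>) = (\<Sum>\<beta><L. - ([:0, 1:] * z \<gamma> * [:sys_a S k x y \<gamma> \<beta>:]) * v p \<beta>)" .
      qed
      also have "\<dots> = (\<Sum>\<beta><L. \<Sum>\<gamma><L. - ([:0, 1:] * z \<gamma> * [:sys_a S k x y \<gamma> \<beta>:]) * v p \<beta>)" by (rule sum.swap)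
      also have "\<dots> = (\<Sum>\<beta><L. g' p \<beta> * v p \<beta>)"
        by (simp only: g'_def simp_thms if_True sum_distrib_right sum_negf[symmetric])
      also have "\<dots> = (\<Sum>Q<m. \<Sum>\<beta><L. if Q = p then g' Q \<beta> * v Q \<beta> else 0)"
        unfolding sum2_delta[OF assms(2)] ..
      also have "\<dots> = (\<Sum>Q<m. \<Sum>\<beta><L. g' Q \<beta> * v Q \<beta>)"
        by (intro sum.cong refl) (simp add: g'_def)
      finally show ?thesis .
    qed
    ultimately show ?thesis using dvd0_mult_left_imp[of \<Delta> e] by simp
  qed
  ultimately show ?case by blast
qed

definition "bil w g h = (\<Sum>Q<m. \<Sum>\<beta><L. g Q \<beta> * (\<Sum>R<m. \<Sum>\<gamma><L. w Q \<beta> R \<gamma> * h R \<gamma>))"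

lemma bil_cong:
  assumes "\<And>Q \<beta> R \<gamma>. Q < m \<Longrightarrow> \<beta> < L \<Longrightarrow> R < m \<Longrightarrow> \<gamma> < L \<Longrightarrow> w Q \<beta> R \<gamma> = w' Q \<beta> R \<gamma>"
  shows "bil w g h = bil w' g h"
  unfolding bil_def
  by (intro sum.cong refl arg_cong2[where f = "(*)"] sum.cong) (simp add: assms)

lemma bil_scale: "bil (\<lambda>Q \<beta> R \<gamma>. c * w Q \<beta> R \<gamma>) g h = c * bil w g h" for c :: "'b::comm_semiring_1"
  unfolding bil_def sum_distrib_left by (intro sum.cong refl) (simp only: ac_simps)

lemma bil_add: "bil (\<lambda>Q \<beta> R \<gamma>. w Q \<beta> R \<gamma> + w' Q \<beta> R \<gamma>) g h = bil w g h + bil w' g h" for w :: "_ \<Rightarrow> _ \<Rightarrow> _ \<Rightarrow> _ \<Rightarrow> 'b::comm_semiring_1"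
  unfolding bil_def by (simp add: distrib_left distrib_right sum.distrib)

lemma bil_scale_right: "bil w g (\<lambda>R \<gamma>. c * h R \<gamma>) = c * bil w g h" for c :: "'b::comm_semiring_1"
  unfolding bil_def sum_distrib_left by (intro sum.cong refl) (simp only: ac_simps)

text \<open>The resolvent along \<open>Tc j\<close> is enclosed between vectors \<open>g\<close> and
  \<open>h\<close> that do not change with \<open>j\<close>. The leftover factor \<open>t\<close>
  comes from the corner entry through which the top block is driven.\<close>

lemma dvd0_bil:
  assumes "reach d s S h0" "p' < m" "coreach d s S g0" "p < m"
  shows "\<exists>g h. (\<forall>P<m. \<forall>\<alpha><L. poly (g P \<alpha>) 1 = (if P = p then g0 \<alpha> else 0)) \<and>
    (\<forall>P<m. \<forall>\<alpha><L. poly (h P \<alpha>) 1 = (if P = p' then h0 \<alpha> else 0)) \<and>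
    (\<forall>j\<ge>1. dvd0 (rp j \<Delta>) ([:0, 1:] * bil (\<lambda>Q \<beta> R \<gamma>. rp j (W Q \<beta> R \<gamma>)) g h))"
proof -
  obtain h where h: "\<And>P \<alpha>. P < m \<Longrightarrow> \<alpha> < L \<Longrightarrow> poly (h P \<alpha>) 1 = (if P = p' then h0 \<alpha> else 0)"
    and ex: "\<And>j. 1 \<le> j \<Longrightarrow> \<exists>K T cq cj e v. m \<le> cq \<and> solution K T cq cj (rp j \<Delta> * e) v \<and>
      (\<forall>Q<m. \<forall>\<beta><L. v Q \<beta> = (\<Sum>R<m. \<Sum>\<gamma><L. rp j (W Q \<beta> R \<gamma>) * ([:0, 1:] * h R \<gamma>)))"
    using reach_solutions[OF assms(1,2)] by auto
  obtain g where g: "\<And>P \<alpha>. P < m \<Longrightarrow> \<alpha> < L \<Longrightarrow> poly (g P \<alpha>) 1 = (if P = p then g0 \<alpha> else 0)"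
    and dvd: "\<And>K T cq cj e v. solution K T cq cj e v \<Longrightarrow> m \<le> cq \<Longrightarrow> dvd0 e (\<Sum>Q<m. \<Sum>\<beta><L. g Q \<beta> * v Q \<beta>)"
    using coreach_solutions[OF assms(3,4)] by auto
  have "dvd0 (rp j \<Delta>) ([:0, 1:] * bil (\<lambda>Q \<beta> R \<gamma>. rp j (W Q \<beta> R \<gamma>)) g h)" if j: "1 \<le> j" for j
  proof -
    obtain K T cq cj e v where *: "m \<le> cq" "solution K T cq cj (rp j \<Delta> * e) v"
      and v: "\<And>Q \<beta>. Q < m \<Longrightarrow> \<beta> < L \<Longrightarrow> v Q \<beta> = (\<Sum>R<m. \<Sum>\<gamma><L. rp j (W Q \<beta> R \<gamma>) * ([:0, 1:] * h R \<gamma>))"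
      using ex[OF j] by (elim exE conjE) (rule that, assumption, assumption, simp)
    have "(\<Sum>Q<m. \<Sum>\<beta><L. g Q \<beta> * v Q \<beta>) = bil (\<lambda>Q \<beta> R \<gamma>. rp j (W Q \<beta> R \<gamma>)) g (\<lambda>R \<gamma>. [:0, 1:] * h R \<gamma>)"
      unfolding bil_def by (intro sum.cong refl arg_cong2[where f = "(*)"]) (simp add: v del: mult_pCons_left mult_pCons_right)
    then have "dvd0 (e * rp j \<Delta>) ([:0, 1:] * bil (\<lambda>Q \<beta> R \<gamma>. rp j (W Q \<beta> R \<gamma>)) g h)"
      using dvd[OF *(2,1)] unfolding bil_scale_right by (simp only: mult.commute)
    then show ?thesis by (rule dvd0_mult_left_imp)
  qed
  then show ?thesis using g h by (intro exI[of _ g] exI[of _ h]) simp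
qed

lemma rp_monom_power: "rp j ([:0, 1:] ^ n) = [:0, 1:] ^ (j * n)"
proof -
  have "rp j [:0, 1:] = [:0, 1:] ^ j" by (simp add: rp_def monom_altdef pcompose_pCons)
  then show ?thesis by (simp add: rp.hom_power power_mult)
qed

text \<open>Suppose there is a pole at 0. The leading coefficient \<open>N\<close> of the adjugate
  at 0, paired with \<open>g\<close> and \<open>h\<close>, would have to be divisible by arbitrarily
  high powers of \<open>t\<close>, as \<Delta> along \<open>Tc j\<close> vanishes to higher and
  higher order. So the pairing vanishes identically, and at \<open>t = 1\<close> controllability and
  observability force \<open>N\<close> to vanish.\<close>

theorem resolvent_regular:
  assumes ctrl: "controllable d s S" and obs: "observable d s S"
  shows "den (\<lambda>c. c) d s m S X0 \<noteq> 0"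
proof
  assume "den (\<lambda>c. c) d s m S X0 = 0"
  then have \<Delta>0: "poly \<Delta> 0 = 0" using poly_den[OF T1(1), of S 0] by (simp add: \<Delta>_def T1)
  have "\<Delta> \<noteq> 0" using poly_\<Delta>_one by auto
  define cd where "cd \<kappa> \<longleftrightarrow> [:0, 1:] ^ \<kappa> dvd \<Delta> \<and> (\<forall>Q<m. \<forall>\<beta><L. \<forall>R<m. \<forall>\<gamma><L. [:0, 1:] ^ \<kappa> dvd W Q \<beta> R \<gamma>)" for \<kappa>
  have bnd: "\<kappa> \<le> degree \<Delta>" if "cd \<kappa>" for \<kappa>
  proof -
    have "degree ([:0, 1 :: 'a:] ^ \<kappa>) \<le> degree \<Delta>" using that \<open>\<Delta> \<noteq> 0\<close> by (intro dvd_imp_degree_le) (auto simp: cd_def)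
    then show ?thesis by (simp add: degree_power_eq)
  qed
  have "cd 0" by (simp add: cd_def)
  \<comment> \<open>The largest power of \<open>t\<close> common to \<Delta> and the whole adjugate.
    After removing it, some entry of the adjugate is nonzero at 0.\<close>
  define \<kappa> where "\<kappa> = Greatest cd"
  have "cd \<kappa>" unfolding \<kappa>_def by (rule GreatestI_nat[of cd, OF \<open>cd 0\<close> bnd])
  moreover have "\<kappa>' \<le> \<kappa>" if "cd \<kappa>'" for \<kappa>' unfolding \<kappa>_def by (rule Greatest_le_nat[of cd, OF that bnd])
  ultimately have \<kappa>: "cd \<kappa>" "\<And>\<kappa>'. cd \<kappa>' \<Longrightarrow> \<kappa>' \<le> \<kappa>" .
  obtain D' where D': "\<Delta> = [:0, 1:] ^ \<kappa> * D'" using \<kappa>(1) unfolding cd_def by (auto elim: dvdE)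
  define W' where "W' Q \<beta> R \<gamma> = (SOME w. W Q \<beta> R \<gamma> = [:0, 1:] ^ \<kappa> * w)" for Q \<beta> R \<gamma>
  have W': "W Q \<beta> R \<gamma> = [:0, 1:] ^ \<kappa> * W' Q \<beta> R \<gamma>" if "Q < m" "\<beta> < L" "R < m" "\<gamma> < L" for Q \<beta> R \<gamma>
    unfolding W'_def by (rule someI_ex) (use \<kappa>(1) that in \<open>auto simp: cd_def dvd_def\<close>)
  \<comment> \<open>A pole survives the cancellation: the pencil times the reduced adjugate is
    \<open>D'\<close> times the identity, and taking determinants shows that a power of
    \<open>D'\<close> is divisible by \<Delta>.\<close>
  have "poly D' 0 = 0"
  proof -
    let ?l = "lam (\<lambda>c. [:c:]) d s m S T1"
    define M where "M = mat (m * L) (m * L) (\<lambda>(i, j). W' (i div L) (i mod L) (j div L) (j mod L))"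
    have M: "M \<in> carrier_mat (m * L) (m * L)" by (simp add: M_def)
    have adj: "adj_mat ?l = [:0, 1:] ^ \<kappa> \<cdot>\<^sub>m M"
    proof (rule eq_mat_blockI[of _ m L m L])
      fix P x Q y assume *: "P < m" "x < L" "Q < m" "y < L"
      show "adj_mat ?l $$ (P * L + x, Q * L + y) = ([:0, 1:] ^ \<kappa> \<cdot>\<^sub>m M) $$ (P * L + x, Q * L + y)"
        using * W'[OF *] block_index_less[OF *(1,2)] block_index_less[OF *(3,4)] by (simp add: M_def W_def)
    qed (use M in simp_all)
    have lM: "?l * M \<in> carrier_mat (m * L) (m * L)" by (rule mult_carrier_mat[OF sys_carrier(1) M])
    have "[:0, 1:] ^ \<kappa> \<cdot>\<^sub>m (?l * M) = ?l * adj_mat ?l"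
      unfolding adj by (rule mult_smult_distrib[OF sys_carrier(1) M, symmetric])
    also have "\<dots> = [:0, 1:] ^ \<kappa> \<cdot>\<^sub>m (D' \<cdot>\<^sub>m 1\<^sub>m (m * L))"
      unfolding adj_mat(2)[OF sys_carrier(1)] den_def[symmetric] \<Delta>_def[symmetric] D' by (rule eq_matI) simp_all
    finally have eq: "[:0, 1:] ^ \<kappa> \<cdot>\<^sub>m (?l * M) = [:0, 1:] ^ \<kappa> \<cdot>\<^sub>m (D' \<cdot>\<^sub>m 1\<^sub>m (m * L))" .
    have "?l * M = D' \<cdot>\<^sub>m 1\<^sub>m (m * L)"
    proof (rule eq_matI)
      fix i j assume "i < dim_row (D' \<cdot>\<^sub>m 1\<^sub>m (m * L))" "j < dim_col (D' \<cdot>\<^sub>m 1\<^sub>m (m * L))"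
      then have ij: "i < m * L" "j < m * L" by simp_all
      have "([:0, 1:] ^ \<kappa> \<cdot>\<^sub>m (?l * M)) $$ (i, j) = ([:0, 1:] ^ \<kappa> \<cdot>\<^sub>m (D' \<cdot>\<^sub>m 1\<^sub>m (m * L))) $$ (i, j)" unfolding eq ..
      then have "[:0, 1:] ^ \<kappa> * (?l * M) $$ (i, j) = [:0, 1:] ^ \<kappa> * (D' \<cdot>\<^sub>m 1\<^sub>m (m * L)) $$ (i, j)"
        using ij carrier_matD[OF lM] by (simp del: index_mult_mat)
      then show "(?l * M) $$ (i, j) = (D' \<cdot>\<^sub>m 1\<^sub>m (m * L)) $$ (i, j)" by simp
    qed (use M carrier_matD[OF sys_carrier(1)[of "\<lambda>c. [:c:]" d s m S T1]] in simp_all)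
    then have "\<Delta> * det M = D' ^ (m * L)"
      using det_mult[of ?l "m * L" M, OF sys_carrier(1) M] by (simp add: \<Delta>_def den_def)
    moreover have "poly (\<Delta> * det M) 0 = 0" using \<Delta>0 by simp
    ultimately show ?thesis by (simp add: poly_power)
  qed
  then obtain D2 where D2: "D' = [:0, 1:] * D2" using poly_eq_0_iff_dvd[of D' 0] by (auto elim: dvdE)
  \<comment> \<open>The leading coefficient of the adjugate at 0; it is to be shown zero block by
    block.\<close>
  define N where "N Q \<beta> R \<gamma> = poly (W' Q \<beta> R \<gamma>) 0" for Q \<beta> R \<gamma>
  have zero: "N p \<beta> p' \<gamma> = 0" if b: "p < m" "\<beta> < L" "p' < m" "\<gamma> < L" for p \<beta> p' \<gamma>
  proof -
    have *: "(\<Sum>\<beta><L. g0 \<beta> * (\<Sum>\<gamma><L. N p \<beta> p' \<gamma> * h0 \<gamma>)) = 0" if rc: "reach d s S h0" and cr: "coreach d s S g0" for h0 g0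
    proof -
      obtain g h where g: "\<forall>P<m. \<forall>\<alpha><L. poly (g P \<alpha>) 1 = (if P = p then g0 \<alpha> else 0)"
        and h: "\<forall>P<m. \<forall>\<alpha><L. poly (h P \<alpha>) 1 = (if P = p' then h0 \<alpha> else 0)"
        and dvd: "\<forall>j\<ge>1. dvd0 (rp j \<Delta>) ([:0, 1:] * bil (\<lambda>Q \<beta> R \<gamma>. rp j (W Q \<beta> R \<gamma>)) g h)"
        using dvd0_bil[OF rc b(3) cr b(1)] by (elim exE conjE) (rule that)
      define Z where "Z = bil (\<lambda>Q \<beta> R \<gamma>. [:N Q \<beta> R \<gamma>:]) g h"
      \<comment> \<open>Along \<open>Tc j\<close> the reduced adjugate equals the constant
        \<open>N\<close> modulo \<open>t^j\<close>, while \<Delta> supplies at least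
        \<open>t^j\<close> beyond the common power; \<kappa> is scaled to
        \<open>j * \<kappa>\<close> on both sides and cancels.\<close>
      have "[:0, 1:] ^ j dvd [:0, 1:] * Z" for j
      proof (cases "1 \<le> j")
        case True
        define W2 where "W2 Q \<beta> R \<gamma> = (W' Q \<beta> R \<gamma> - [:N Q \<beta> R \<gamma>:]) div [:0, 1:]" for Q \<beta> R \<gamma>
        have W2: "W' Q \<beta> R \<gamma> = [:N Q \<beta> R \<gamma>:] + [:0, 1:] ^ 1 * W2 Q \<beta> R \<gamma>" for Q \<beta> R \<gamma>
        proof -
          have "[:0, 1:] dvd W' Q \<beta> R \<gamma> - [:N Q \<beta> R \<gamma>:]"
            using poly_eq_0_iff_dvd[of "W' Q \<beta> R \<gamma> - [:N Q \<beta> R \<gamma>:]" 0] by (simp add: N_def)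
          then show ?thesis by (simp add: W2_def del: mult_pCons_left mult_pCons_right)
        qed
        have rpW': "rp j (W' Q \<beta> R \<gamma>) = [:N Q \<beta> R \<gamma>:] + [:0, 1:] ^ j * rp j (W2 Q \<beta> R \<gamma>)" for Q \<beta> R \<gamma>
          unfolding W2[of Q \<beta> R \<gamma>] rp.hom_add rp.hom_mult rp_const rp_monom_power by simp
        have "bil (\<lambda>Q \<beta> R \<gamma>. rp j (W Q \<beta> R \<gamma>)) g h = bil (\<lambda>Q \<beta> R \<gamma>. [:0, 1:] ^ (j * \<kappa>) * rp j (W' Q \<beta> R \<gamma>)) g h"
          by (rule bil_cong) (simp only: W' rp.hom_mult rp_monom_power)
        then have "dvd0 (rp j \<Delta>) ([:0, 1:] ^ (j * \<kappa>) * ([:0, 1:] * bil (\<lambda>Q \<beta> R \<gamma>. rp j (W' Q \<beta> R \<gamma>)) g h))"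
          using dvd[rule_format, OF True] unfolding bil_scale by (simp only: mult.left_commute)
        moreover have "rp j \<Delta> = [:0, 1:] ^ (j * \<kappa>) * (rp j D2 * [:0, 1:] ^ j)"
        proof -
          have "\<Delta> = [:0, 1:] ^ \<kappa> * ([:0, 1:] ^ 1 * D2)" unfolding D' D2 by simp
          then have "rp j \<Delta> = [:0, 1:] ^ (j * \<kappa>) * ([:0, 1:] ^ (j * 1) * rp j D2)"
            by (simp only: rp.hom_mult rp_monom_power)
          then show ?thesis by (simp only: mult.commute mult_1)
        qed
        ultimately have "dvd0 ([:0, 1:] ^ (j * \<kappa>) * (rp j D2 * [:0, 1:] ^ j)) ([:0, 1:] ^ (j * \<kappa>) * ([:0, 1:] * bil (\<lambda>Q \<beta> R \<gamma>. rp j (W' Q \<beta> R \<gamma>)) g h))"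
          by simp
        then have "dvd0 (rp j D2 * [:0, 1:] ^ j) ([:0, 1:] * bil (\<lambda>Q \<beta> R \<gamma>. rp j (W' Q \<beta> R \<gamma>)) g h)"
          by (rule dvd0_cancel) simp
        then have "[:0, 1:] ^ j dvd [:0, 1:] * bil (\<lambda>Q \<beta> R \<gamma>. rp j (W' Q \<beta> R \<gamma>)) g h"
          by (rule dvd0_power_imp_dvd[OF dvd0_mult_left_imp])
        also have "[:0, 1:] * bil (\<lambda>Q \<beta> R \<gamma>. rp j (W' Q \<beta> R \<gamma>)) g h =
            [:0, 1:] * Z + [:0, 1:] ^ j * ([:0, 1:] * bil (\<lambda>Q \<beta> R \<gamma>. rp j (W2 Q \<beta> R \<gamma>)) g h)"
        proof -
          have "bil (\<lambda>Q \<beta> R \<gamma>. rp j (W' Q \<beta> R \<gamma>)) g h =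
              bil (\<lambda>Q \<beta> R \<gamma>. [:N Q \<beta> R \<gamma>:] + [:0, 1:] ^ j * rp j (W2 Q \<beta> R \<gamma>)) g h"
            by (rule bil_cong) (rule rpW')
          also have "\<dots> = Z + [:0, 1:] ^ j * bil (\<lambda>Q \<beta> R \<gamma>. rp j (W2 Q \<beta> R \<gamma>)) g h"
            by (simp only: bil_add bil_scale Z_def)
          finally show ?thesis by (simp only: distrib_left mult.left_commute)
        qed
        finally have "[:0, 1:] ^ j dvd [:0, 1:] * Z + [:0, 1:] ^ j * ([:0, 1:] * bil (\<lambda>Q \<beta> R \<gamma>. rp j (W2 Q \<beta> R \<gamma>)) g h)" .
        then show ?thesis using dvd_add_left_iff[OF dvd_triv_left] by blast
      qed (simp add: not_less_eq_eq One_nat_def)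
      then have "[:0, 1:] * Z = 0" by (rule zero_if_all_powers_dvd)
      \<comment> \<open>The polynomial \<open>Z\<close> is zero, and at \<open>t = 1\<close> the
        vectors \<open>g\<close> and \<open>h\<close> are \<open>g0\<close> and \<open>h0\<close>
        placed in single blocks.\<close>
      then have "poly Z 1 = 0" by simp
      also have "poly Z 1 = (\<Sum>Q<m. \<Sum>\<beta><L. if Q = p then g0 \<beta> * (\<Sum>R<m. \<Sum>\<gamma><L. if R = p' then N Q \<beta> R \<gamma> * h0 \<gamma> else 0) else 0)"
      proof -
        have "poly (\<Sum>R<m. \<Sum>\<gamma><L. [:N Q \<beta> R \<gamma>:] * h R \<gamma>) 1 = (\<Sum>R<m. \<Sum>\<gamma><L. if R = p' then N Q \<beta> R \<gamma> * h0 \<gamma> else 0)" for Q \<beta>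
          unfolding poly_sum poly_mult by (intro sum.cong refl) (simp add: h[rule_format])
        then show ?thesis
          unfolding Z_def bil_def poly_sum[of _ "{..<m}"] poly_sum[of _ "{..<L}"] poly_mult
          by (intro sum.cong refl) (simp add: g[rule_format])
      qed
      finally show ?thesis unfolding sum2_delta[OF b(1)] sum2_delta[OF b(3)] by simp
    qed
    \<comment> \<open>Observability removes the row vectors first; controllability then removes the
      reachable columns.\<close>
    have "(\<Sum>\<gamma><L. N p \<beta> p' \<gamma> * h0 \<gamma>) = 0" if "reach d s S h0" for h0
      using obs *[OF that] b(2) unfolding observable_def by meson
    then show ?thesis
      using ctrl b(4) unfolding controllable_def by meson
  qed
  have "cd (Suc \<kappa>)"
  proof -
    have "[:0, 1:] ^ Suc \<kappa> dvd W Q \<beta> R \<gamma>" if b: "Q < m" "\<beta> < L" "R < m" "\<gamma> < L" for Q \<beta> R \<gamma>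
    proof -
      have "[:0, 1:] dvd W' Q \<beta> R \<gamma>"
        using zero[OF b] poly_eq_0_iff_dvd[of "W' Q \<beta> R \<gamma>" 0] by (simp add: N_def)
      then show ?thesis unfolding W'[OF b] power_Suc2 by (rule mult_dvd_mono[OF dvd_refl])
    qed
    moreover have "[:0, 1:] ^ Suc \<kappa> dvd \<Delta>" unfolding D' D2 power_Suc2 by (rule mult_dvd_mono[OF dvd_refl]) (rule dvd_triv_left)
    ultimately show ?thesis by (simp add: cd_def del: power_Suc)
  qed
  then show False using \<kappa>(2)[of "Suc \<kappa>"] by simp
qed

end


lemma lam_index:
  assumes "P < M" "\<alpha> < sys_L S" "Q < M" "\<beta> < sys_L S"
  shows "lam \<phi> d s M S T $$ (P * sys_L S + \<alpha>, Q * sys_L S + \<beta>) = aff_entry \<phi> d s (sys_G S) (sys_a S) T P \<alpha> Q \<beta>"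
  using assms by (simp add: lam_def)

lemma rhs_index:
  assumes "P < M" "\<alpha> < sys_L S" "Q < M" "j < s"
  shows "rhs \<phi> d s M S T $$ (P * sys_L S + \<alpha>, Q * s + j) = aff_entry \<phi> d s (sys_B S) (sys_b S) T P \<alpha> Q j"
  using assms by (simp add: rhs_def)

lemma diagC_index:
  assumes "P < M" "i < s" "Q < M" "\<beta> < sys_L S"
  shows "diagC \<phi> s M S $$ (P * s + i, Q * sys_L S + \<beta>) = (if P = Q then \<phi> (sys_C S i \<beta>) else 0)"
  using assms by (simp add: diagC_def)


section \<open>Reduction to controllable and observable realizations\<close>

lemma det_nonzero_iff_kernel:
  fixes A :: "'a::field mat"
  assumes A: "A \<in> carrier_mat n n"
  shows "det A \<noteq> 0 \<longleftrightarrow> (\<forall>v \<in> carrier_vec n. A *\<^sub>v v = 0\<^sub>v n \<longrightarrow> v = 0\<^sub>v n)"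
  using det_0_iff_vec_prod_zero_field[OF A] by blast

lemma det_nonzero_iff_kernel_fun:
  fixes A :: "'a::field mat"
  assumes A: "A \<in> carrier_mat n n"
  shows "det A \<noteq> 0 \<longleftrightarrow> (\<forall>v. (\<forall>p<n. (\<Sum>q<n. A $$ (p, q) * v q) = 0) \<longrightarrow> (\<forall>q<n. v q = 0))"
proof -
  have e: "(A *\<^sub>v v) $ p = (\<Sum>q<n. A $$ (p, q) * v $ q)" if "v \<in> carrier_vec n" "p < n" for v p
    using A that by (auto simp: scalar_prod_def lessThan_atLeast0 intro!: sum.cong)
  have zero: "A *\<^sub>v v = 0\<^sub>v n \<longleftrightarrow> (\<forall>p<n. (\<Sum>q<n. A $$ (p, q) * v $ q) = 0)" if v: "v \<in> carrier_vec n" for v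
  proof
    assume z: "A *\<^sub>v v = 0\<^sub>v n"
    show "\<forall>p<n. (\<Sum>q<n. A $$ (p, q) * v $ q) = 0"
      using e[OF v, symmetric] by (simp add: z)
  next
    assume z: "\<forall>p<n. (\<Sum>q<n. A $$ (p, q) * v $ q) = 0"
    show "A *\<^sub>v v = 0\<^sub>v n"
      by (rule eq_vecI) (use e[OF v] z A in auto)
  qed
  show ?thesis
    unfolding det_nonzero_iff_kernel[OF A]
  proof (intro iffI allI impI ballI)
    fix v q assume h: "\<forall>v\<in>carrier_vec n. A *\<^sub>v v = 0\<^sub>v n \<longrightarrow> v = 0\<^sub>v n"
      and v: "\<forall>p<n. (\<Sum>q<n. A $$ (p, q) * v q) = 0" and q: "q < n"
    have "A *\<^sub>v vec n v = 0\<^sub>v n" using v by (subst zero) auto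
    then have z: "vec n v = 0\<^sub>v n" using h by auto
    have "vec n v $ q = 0" unfolding z using q by simp
    then show "v q = 0" using q by simp
  next
    fix v assume h: "\<forall>v. (\<forall>p<n. (\<Sum>q<n. A $$ (p, q) * v q) = 0) \<longrightarrow> (\<forall>q<n. v q = 0)"
      and v: "v \<in> carrier_vec n" "A *\<^sub>v v = 0\<^sub>v n"
    have "\<forall>q<n. v $ q = 0" using h[rule_format, of "\<lambda>q. v $ q"] zero[OF v(1)] v(2) by simp
    then show "v = 0\<^sub>v n" using v(1) by (intro eq_vecI) auto
  qed
qed

lemma det_nonzero_iff_left_kernel_fun:
  fixes A :: "'a::field mat"
  assumes A: "A \<in> carrier_mat n n"
  shows "det A \<noteq> 0 \<longleftrightarrow> (\<forall>v. (\<forall>q<n. (\<Sum>p<n. v p * A $$ (p, q)) = 0) \<longrightarrow> (\<forall>q<n. v q = 0))"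
proof -
  have c: "(\<Sum>p<n. transpose_mat A $$ (q, p) * v p) = (\<Sum>p<n. v p * A $$ (p, q))" if "q < n" for q v
    using A that by (intro sum.cong refl) (auto simp: mult.commute)
  have "det (transpose_mat A) \<noteq> 0 \<longleftrightarrow> (\<forall>v. (\<forall>q<n. (\<Sum>p<n. v p * A $$ (p, q)) = 0) \<longrightarrow> (\<forall>q<n. v q = 0))"
    unfolding det_nonzero_iff_kernel_fun[OF transpose_carrier_mat[THEN iffD2, OF A]] using c by simp
  then show ?thesis by (simp add: det_transpose[OF A])
qed

text \<open>Padding with zero rows gives a square matrix with an obvious left kernel vector, hence
  zero determinant and a right kernel vector.\<close>

lemma kernel_nontrivial:
  fixes A :: "nat \<Rightarrow> nat \<Rightarrow> 'a::field"
  assumes "n < m"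
  shows "\<exists>v. (\<exists>i<m. v i \<noteq> 0) \<and> (\<forall>p<n. (\<Sum>i<m. A p i * v i) = 0)"
proof -
  define M where "M = mat m m (\<lambda>(p, i). if p < n then A p i else 0)"
  have M: "M \<in> carrier_mat m m" by (simp add: M_def)
  have "\<exists>v. (\<forall>q<m. (\<Sum>p<m. v p * M $$ (p, q)) = 0) \<and> (\<exists>q<m. v q \<noteq> 0)"
  proof (intro exI[of _ "\<lambda>p. if p = n then 1 else 0"] conjI allI impI)
    fix q assume "q < m"
    then show "(\<Sum>p<m. (if p = n then 1 else 0) * M $$ (p, q)) = 0"
      by (intro sum.neutral) (auto simp: M_def)
  qed (use assms in auto)
  then have "\<not> det M \<noteq> 0" unfolding det_nonzero_iff_left_kernel_fun[OF M] by blast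
  then obtain v i where v: "\<forall>p<m. (\<Sum>q<m. M $$ (p, q) * v q) = 0" "i < m" "v i \<noteq> 0"
    unfolding det_nonzero_iff_kernel_fun[OF M] by blast
  have "(\<Sum>i<m. A p i * v i) = 0" if "p < n" for p
  proof -
    have "(\<Sum>i<m. A p i * v i) = (\<Sum>q<m. M $$ (p, q) * v q)"
      using that assms by (intro sum.cong refl) (auto simp: M_def)
    then show ?thesis using v(1) that assms by simp
  qed
  then show ?thesis using v(2,3) by blast
qed

text \<open>An independent family in \<open>W\<close> of the greatest possible size; a vector of
  \<open>W\<close> outside its span could be appended. Sizes are bounded by \<open>L\<close> because
  longer families are dependent.\<close>

lemma subspace_basis:
  fixes W :: "(nat \<Rightarrow> 'a::field) \<Rightarrow> bool"
  shows "\<exists>r J. r \<le> L \<and> (\<forall>i<r. W (\<lambda>\<alpha>. J \<alpha> i)) \<and>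
    (\<forall>c. (\<forall>\<alpha><L. (\<Sum>i<r. J \<alpha> i * c i) = 0) \<longrightarrow> (\<forall>i<r. c i = 0)) \<and>
    (\<forall>w. W w \<longrightarrow> (\<exists>c. \<forall>\<alpha><L. w \<alpha> = (\<Sum>i<r. J \<alpha> i * c i)))"
proof -
  define ok where "ok r J \<longleftrightarrow> (\<forall>i<r. W (\<lambda>\<alpha>. J \<alpha> i)) \<and>
    (\<forall>c. (\<forall>\<alpha><L. (\<Sum>i<r. J \<alpha> i * c i) = 0) \<longrightarrow> (\<forall>i<r. c i = 0))" for r :: nat and J :: "nat \<Rightarrow> nat \<Rightarrow> 'a"
  define r where "r = (GREATEST r. \<exists>J. ok r J)"
  have bnd: "r \<le> L" if ex: "\<exists>J. ok r J" for r
  proof (rule ccontr)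
    assume "\<not> r \<le> L"
    then have "L < r" by simp
    obtain J where J: "ok r J" using ex by blast
    show False using kernel_nontrivial[OF \<open>L < r\<close>, of J] J unfolding ok_def by blast
  qed
  have 0: "\<exists>J. ok 0 J" by (simp add: ok_def)
  have "\<exists>J. ok r J" unfolding r_def by (rule GreatestI_nat[of "\<lambda>r. \<exists>J. ok r J", OF 0 bnd])
  then obtain J where J: "ok r J" by blast
  have r_max: "r' \<le> r" if "\<exists>J. ok r' J" for r'
    unfolding r_def by (rule Greatest_le_nat[of "\<lambda>r. \<exists>J. ok r J", OF that bnd])
  have "\<exists>c. \<forall>\<alpha><L. w \<alpha> = (\<Sum>i<r. J \<alpha> i * c i)" if w: "W w" for w
  proof (rule ccontr)
    assume no: "\<not> ?thesis"
    define J' where "J' \<alpha> i = (if i < r then J \<alpha> i else w \<alpha>)" for \<alpha> i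
    have "W (\<lambda>\<alpha>. J' \<alpha> i)" if "i < Suc r" for i
      using J w that unfolding ok_def J'_def by (cases "i < r") auto
    moreover have "c i = 0" if z: "\<forall>\<alpha><L. (\<Sum>i<Suc r. J' \<alpha> i * c i) = 0" and i: "i < Suc r" for c i
    proof -
      have z': "(\<Sum>i<r. J \<alpha> i * c i) + w \<alpha> * c r = 0" if "\<alpha> < L" for \<alpha>
        using z that by (simp add: J'_def)
      have cr: "c r = 0"
      proof (rule ccontr)
        assume cr: "c r \<noteq> 0"
        have "w \<alpha> = (\<Sum>i<r. J \<alpha> i * (- c i / c r))" if "\<alpha> < L" for \<alpha>
        proof -
          have "(\<Sum>i<r. J \<alpha> i * (- c i / c r)) = (\<Sum>i<r. J \<alpha> i * c i) * (- 1 / c r)"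
            unfolding sum_distrib_right by (intro sum.cong refl) simp
          also have "(\<Sum>i<r. J \<alpha> i * c i) = - (w \<alpha> * c r)" using z'[OF that] by (simp add: eq_neg_iff_add_eq_0)
          finally show ?thesis using cr by simp
        qed
        then have "\<exists>c. \<forall>\<alpha><L. w \<alpha> = (\<Sum>i<r. J \<alpha> i * c i)"
          by (intro exI[of _ "\<lambda>i. - c i / c r"] allI impI)
        then show False by (rule notE[OF no])
      qed
      then have "\<forall>\<alpha><L. (\<Sum>i<r. J \<alpha> i * c i) = 0" using z' by simp
      then have "\<forall>i<r. c i = 0" using J unfolding ok_def by blast
      then show ?thesis using cr i by (cases "i < r") (auto simp: less_Suc_eq)
    qed
    ultimately have "\<exists>J. ok (Suc r) J" unfolding ok_def by blast
    then have "Suc r \<le> r" by (rule r_max)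
    then show False by simp
  qed
  then show ?thesis using J bnd[of r] unfolding ok_def by blast
qed

text \<open>With \<open>r = L\<close> the square matrix \<open>J\<close> would be invertible, and a
  nonzero functional could not annihilate all its columns.\<close>

lemma basis_of_proper_subspace:
  fixes J :: "nat \<Rightarrow> nat \<Rightarrow> 'a::field"
  assumes r: "r \<le> L" and inj: "\<forall>c. (\<forall>\<alpha><L. (\<Sum>i<r. J \<alpha> i * c i) = 0) \<longrightarrow> (\<forall>i<r. c i = 0)"
    and l: "\<And>i. i < r \<Longrightarrow> (\<Sum>\<alpha><L. l \<alpha> * J \<alpha> i) = 0" "\<alpha> < L" "l \<alpha> \<noteq> 0"
  shows "r < L"
proof (rule ccontr)
  assume "\<not> r < L"
  then have rL: "r = L" using r by simp
  define A where "A = mat L L (\<lambda>(\<alpha>, i). J \<alpha> i)"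
  have A: "A \<in> carrier_mat L L" by (simp add: A_def)
  have e: "(\<Sum>i<L. A $$ (\<alpha>, i) * c i) = (\<Sum>i<L. J \<alpha> i * c i)" if "\<alpha> < L" for \<alpha> c
    using that by (intro sum.cong refl) (simp add: A_def)
  have e': "(\<Sum>\<alpha><L. l \<alpha> * A $$ (\<alpha>, i)) = (\<Sum>\<alpha><L. l \<alpha> * J \<alpha> i)" if "i < L" for i
    using that by (intro sum.cong refl) (simp add: A_def)
  have "det A \<noteq> 0" unfolding det_nonzero_iff_kernel_fun[OF A] using inj e by (simp add: rL)
  then have "\<forall>v. (\<forall>q<L. (\<Sum>p<L. v p * A $$ (p, q)) = 0) \<longrightarrow> (\<forall>q<L. v q = 0)"
    unfolding det_nonzero_iff_left_kernel_fun[OF A] .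
  then show False using l e' by (auto simp: rL)
qed

text \<open>\<open>J\<close> maps the kernel of \<open>\<Lambda>'\<close> injectively into that of
  \<Lambda>.\<close>

lemma matrix_intertwine:
  fixes \<Lambda> \<Lambda>' J :: "'a::field mat"
  assumes c: "\<Lambda> \<in> carrier_mat n n" "\<Lambda>' \<in> carrier_mat m m" "J \<in> carrier_mat n m"
    and eq: "\<Lambda> * J = J * \<Lambda>'" and inj: "\<And>v. v \<in> carrier_vec m \<Longrightarrow> J *\<^sub>v v = 0\<^sub>v n \<Longrightarrow> v = 0\<^sub>v m" and nz: "det \<Lambda> \<noteq> 0"
  shows "det \<Lambda>' \<noteq> 0"
  unfolding det_nonzero_iff_kernel[OF c(2)]
proof (intro ballI impI)
  fix v assume v: "v \<in> carrier_vec m" "\<Lambda>' *\<^sub>v v = 0\<^sub>v m"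
  have "\<Lambda> *\<^sub>v (J *\<^sub>v v) = (J * \<Lambda>') *\<^sub>v v" unfolding eq[symmetric] by (rule assoc_mult_mat_vec[OF c(1,3) v(1), symmetric])
  also have "\<dots> = J *\<^sub>v 0\<^sub>v m" unfolding v(2)[symmetric] by (rule assoc_mult_mat_vec[OF c(3,2) v(1)])
  also have "\<dots> = 0\<^sub>v n" using c(3) by (intro eq_vecI) auto
  finally have "J *\<^sub>v v = 0\<^sub>v n"
    using nz c(3) v(1) unfolding det_nonzero_iff_kernel[OF c(1)] by auto
  then show "v = 0\<^sub>v m" by (rule inj[OF v(1)])
qed

lemma solution_unique:
  fixes \<Lambda> :: "'a::field mat"
  assumes c: "\<Lambda> \<in> carrier_mat n n" "U \<in> carrier_mat n k" "U' \<in> carrier_mat n k" and eq: "\<Lambda> * U = \<Lambda> * U'" and nz: "det \<Lambda> \<noteq> 0"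
  shows "U = U'"
proof -
  have "adj_mat \<Lambda> * (\<Lambda> * Z) = det \<Lambda> \<cdot>\<^sub>m Z" if "Z \<in> carrier_mat n k" for Z
    using assoc_mult_mat[OF adj_mat(1)[OF c(1)] c(1) that] adj_mat(3)[OF c(1)] that by (simp add: mult_smult_assoc_mat[OF one_carrier_mat that])
  then have "det \<Lambda> \<cdot>\<^sub>m U = det \<Lambda> \<cdot>\<^sub>m U'" using eq c by metis
  then have "inverse (det \<Lambda>) \<cdot>\<^sub>m (det \<Lambda> \<cdot>\<^sub>m U) = inverse (det \<Lambda>) \<cdot>\<^sub>m (det \<Lambda> \<cdot>\<^sub>m U')" by simp
  moreover have "inverse (det \<Lambda>) \<cdot>\<^sub>m (det \<Lambda> \<cdot>\<^sub>m Z) = Z" for Z :: "'a mat" using nz by (intro eq_matI) auto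
  ultimately show ?thesis by simp
qed

lemma sum_block_delta:
  fixes f :: "nat \<Rightarrow> nat \<Rightarrow> 'b::comm_ring_1"
  assumes "P < M"
  shows "(\<Sum>Q<M. \<Sum>x<n. (if P = Q then g x else 0) * f Q x) = (\<Sum>x<n. g x * f P x)"
    and "(\<Sum>Q<M. \<Sum>x<n. f Q x * (if Q = P then g x else 0)) = (\<Sum>x<n. f P x * g x)"
proof -
  have "(\<Sum>Q<M. \<Sum>x<n. (if P = Q then g x else 0) * f Q x) = (\<Sum>Q<M. if Q = P then \<Sum>x<n. g x * f Q x else 0)"
    by (intro sum.cong refl) auto
  then show "(\<Sum>Q<M. \<Sum>x<n. (if P = Q then g x else 0) * f Q x) = (\<Sum>x<n. g x * f P x)" using assms by simp
  have "(\<Sum>Q<M. \<Sum>x<n. f Q x * (if Q = P then g x else 0)) = (\<Sum>Q<M. if Q = P then \<Sum>x<n. f Q x * g x else 0)"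
    by (intro sum.cong refl) auto
  then show "(\<Sum>Q<M. \<Sum>x<n. f Q x * (if Q = P then g x else 0)) = (\<Sum>x<n. f P x * g x)" using assms by simp
qed

lemma block_diag_mult_left:
  assumes A: "A \<in> carrier_mat (M * n2) (M * n3)" and "P < M" "x < n1" "Q < M" "y < n3"
  shows "(block_diag (\<lambda>c. c) n1 n2 M G * A) $$ (P * n1 + x, Q * n3 + y) =
    (\<Sum>z<n2. G x z * (A $$ (P * n2 + z, Q * n3 + y) :: 'a::comm_ring_1))"
proof -
  have "(block_diag (\<lambda>c. c) n1 n2 M G * A) $$ (P * n1 + x, Q * n3 + y) =
      (\<Sum>R<M. \<Sum>z<n2. (if P = R then G x z else 0) * A $$ (R * n2 + z, Q * n3 + y))"
    unfolding mult_mat_block_index[OF block_diag_carrier A block_index_less[OF assms(2,3)] block_index_less[OF assms(4,5)]]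
    by (intro sum.cong refl) (simp add: assms(2,3))
  then show ?thesis unfolding sum_block_delta(1)[OF assms(2)] .
qed

lemma block_diag_mult_right:
  assumes A: "A \<in> carrier_mat (M * n1) (M * n2)" and "P < M" "x < n1" "Q < M" "y < n3"
  shows "(A * block_diag (\<lambda>c. c) n2 n3 M G) $$ (P * n1 + x, Q * n3 + y) =
    (\<Sum>z<n2. A $$ (P * n1 + x, Q * n2 + z) * (G z y :: 'a::comm_ring_1))"
proof -
  have "(A * block_diag (\<lambda>c. c) n2 n3 M G) $$ (P * n1 + x, Q * n3 + y) =
      (\<Sum>R<M. \<Sum>z<n2. A $$ (P * n1 + x, R * n2 + z) * (if R = Q then G z y else 0))"
    unfolding mult_mat_block_index[OF A block_diag_carrier block_index_less[OF assms(2,3)] block_index_less[OF assms(4,5)]]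
    by (intro sum.cong refl) (simp add: assms(4,5))
  then show ?thesis unfolding sum_block_delta(2)[OF assms(4)] .
qed

section \<open>Systems related by a constant map of state spaces\<close>

context
  fixes d s M :: nat and S S' :: "'a::field sys" and T :: "'a mat list" and J :: "nat \<Rightarrow> nat \<Rightarrow> 'a"
begin

abbreviation "LA U \<equiv> aff_entry (\<lambda>c. c) d s (sys_G U) (sys_a U) T"
abbreviation "RB U \<equiv> aff_entry (\<lambda>c. c) d s (sys_B U) (sys_b U) T"

text \<open>\<open>J\<close> embeds the states of \<open>S'\<close> as an invariant subspace that
  contains the columns of the right-hand side. The unique solution for \<open>S\<close> is therefore
  the image of the one for \<open>S'\<close>, and the outputs coincide.\<close>

lemma is_val_subsystem:
  assumes A: "\<And>P \<alpha> Q i. P < M \<Longrightarrow> Q < M \<Longrightarrow> \<alpha> < sys_L S \<Longrightarrow> i < sys_L S' \<Longrightarrow>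
      (\<Sum>\<beta><sys_L S. LA S P \<alpha> Q \<beta> * J \<beta> i) = (\<Sum>i'<sys_L S'. J \<alpha> i' * LA S' P i' Q i)"
    and B: "\<And>P \<alpha> Q j. P < M \<Longrightarrow> Q < M \<Longrightarrow> \<alpha> < sys_L S \<Longrightarrow> j < s \<Longrightarrow>
      RB S P \<alpha> Q j = (\<Sum>i<sys_L S'. J \<alpha> i * RB S' P i Q j)"
    and C: "\<And>i i'. i < s \<Longrightarrow> i' < sys_L S' \<Longrightarrow> sys_C S' i i' = (\<Sum>\<alpha><sys_L S. sys_C S i \<alpha> * J \<alpha> i')"
    and D: "\<And>i j. i < s \<Longrightarrow> j < s \<Longrightarrow> sys_D S' i j = sys_D S i j"
    and inj: "\<And>c. (\<forall>\<alpha><sys_L S. (\<Sum>i<sys_L S'. J \<alpha> i * c i) = 0) \<Longrightarrow> (\<forall>i<sys_L S'. c i = 0)"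
    and val: "is_val (\<lambda>c. c) d s M S T V"
  shows "is_val (\<lambda>c. c) d s M S' T V"
proof -
  let ?J = "block_diag (\<lambda>c. c) (sys_L S) (sys_L S') M J"
  let ?l = "lam (\<lambda>c. c) d s M S T" and ?l' = "lam (\<lambda>c. c) d s M S' T"
  let ?b = "rhs (\<lambda>c. c) d s M S T" and ?b' = "rhs (\<lambda>c. c) d s M S' T"
  note cs = sys_carrier(1)[of "\<lambda>c. c" d s M S T] sys_carrier(1)[of "\<lambda>c. c" d s M S' T]
    sys_carrier(2)[of "\<lambda>c. c" d s M S T] sys_carrier(2)[of "\<lambda>c. c" d s M S' T]
    sys_carrier(3)[of "\<lambda>c. c" s M S] sys_carrier(3)[of "\<lambda>c. c" s M S']
  have J: "?J \<in> carrier_mat (M * sys_L S) (M * sys_L S')" by simp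
  have lJ: "?l * ?J = ?J * ?l'"
    by (rule eq_mat_blockI[of _ M "sys_L S" M "sys_L S'"], rule mult_carrier_mat[OF cs(1) J], rule mult_carrier_mat[OF J cs(2)])
      (simp add: block_diag_mult_left[OF cs(2)] block_diag_mult_right[OF cs(1)] lam_index A)
  have bJ: "?b = ?J * ?b'"
    by (rule eq_mat_blockI[of _ M "sys_L S" M s], rule cs(3), rule mult_carrier_mat[OF J cs(4)])
      (simp add: block_diag_mult_left[OF cs(4)] rhs_index B)
  have CJ: "diagC (\<lambda>c. c) s M S * ?J = diagC (\<lambda>c. c) s M S'"
    by (rule eq_mat_blockI[of _ M s M "sys_L S'"], rule mult_carrier_mat[OF cs(5) J], rule cs(6))
      (simp add: block_diag_mult_right[OF cs(5)] diagC_index C if_distrib[of "\<lambda>c. c * _"] cong: if_cong)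
  have DD: "diagD (\<lambda>c. c) s M S = diagD (\<lambda>c. c) s M S'"
    by (rule eq_mat_blockI[of _ M s M s], rule sys_carrier(4), rule sys_carrier(4)) (simp add: diagD_def D)
  have injJ: "v = 0\<^sub>v (M * sys_L S')" if v: "v \<in> carrier_vec (M * sys_L S')" "?J *\<^sub>v v = 0\<^sub>v (M * sys_L S)" for v
  proof (rule eq_vecI)
    fix k assume "k < dim_vec (0\<^sub>v (M * sys_L S') :: 'a vec)"
    then have "k < M * sys_L S'" by simp
    then obtain P i where k: "P < M" "i < sys_L S'" "k = P * sys_L S' + i" by (rule block_indexE)
    define c where "c i = v $ (P * sys_L S' + i)" for i
    have vv: "v = vec (M * sys_L S') (\<lambda>k. v $ ((k div sys_L S') * sys_L S' + k mod sys_L S'))"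
      using v(1) by (intro eq_vecI) auto
    have "(\<Sum>i<sys_L S'. J \<alpha> i * c i) = 0" if \<alpha>: "\<alpha> < sys_L S" for \<alpha>
    proof -
      have "(?J *\<^sub>v v) $ (P * sys_L S + \<alpha>) =
          (\<Sum>Q<M. \<Sum>i<sys_L S'. ?J $$ (P * sys_L S + \<alpha>, Q * sys_L S' + i) * v $ (Q * sys_L S' + i))"
        using mult_vec_block_index[OF J k(1) \<alpha>, of "\<lambda>Q i. v $ (Q * sys_L S' + i)"] vv by simp
      also have "\<dots> = (\<Sum>Q<M. \<Sum>i<sys_L S'. (if P = Q then J \<alpha> i else 0) * v $ (Q * sys_L S' + i))"
        by (intro sum.cong refl) (simp add: k(1) \<alpha>)
      also have "\<dots> = (\<Sum>i<sys_L S'. J \<alpha> i * c i)" unfolding sum_block_delta(1)[OF k(1)] c_def ..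
      finally show ?thesis using v(2) block_index_less[OF k(1) \<alpha>] by simp
    qed
    then have "\<forall>i<sys_L S'. c i = 0" using inj[of c] by blast
    then show "v $ k = 0\<^sub>v (M * sys_L S') $ k" using k \<open>k < M * sys_L S'\<close> by (simp add: c_def)
  qed (use v in simp)
  obtain U where U: "U \<in> carrier_mat (M * sys_L S) (M * s)" "?l * U = ?b" "V = diagD (\<lambda>c. c) s M S + diagC (\<lambda>c. c) s M S * U"
    and nz: "den (\<lambda>c. c) d s M S T \<noteq> 0" using val by (auto simp: is_val_def)
  have nzl: "det ?l \<noteq> 0" using nz unfolding den_def .
  have "det ?l' \<noteq> 0" by (rule matrix_intertwine[OF cs(1,2) J lJ injJ nzl])
  then have nz': "den (\<lambda>c. c) d s M S' T \<noteq> 0" by (simp add: den_def)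
  obtain V' where V': "is_val (\<lambda>c. c) d s M S' T V'" using is_val_exists[OF nz'] by blast
  then obtain U' where U': "U' \<in> carrier_mat (M * sys_L S') (M * s)" "?l' * U' = ?b'" "V' = diagD (\<lambda>c. c) s M S' + diagC (\<lambda>c. c) s M S' * U'"
    by (auto simp: is_val_def)
  have "?l * (?J * U') = ?J * (?l' * U')"
    using assoc_mult_mat[OF cs(1) J U'(1)] assoc_mult_mat[OF J cs(2) U'(1)] lJ by simp
  then have "?l * U = ?l * (?J * U')" using U(2) U'(2) bJ by simp
  then have "U = ?J * U'"
    by (rule solution_unique[OF cs(1) U(1) mult_carrier_mat[OF J U'(1)]]) (rule nzl)
  then have "V = V'" using U(3) U'(3) DD CJ assoc_mult_mat[OF cs(5) J U'(1)] by simp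
  then show ?thesis using V' by simp
qed

text \<open>Here \<open>J\<close> maps the states of \<open>S\<close> onto those of
  \<open>S'\<close>, and the output factors through it. Invertibility of the new pencil is obtained
  from the transposed intertwining relation; the image of the old solution then solves the new
  system.\<close>

lemma is_val_quotient_system:
  assumes A: "\<And>P i Q \<beta>. P < M \<Longrightarrow> Q < M \<Longrightarrow> i < sys_L S' \<Longrightarrow> \<beta> < sys_L S \<Longrightarrow>
      (\<Sum>\<alpha><sys_L S. J i \<alpha> * LA S P \<alpha> Q \<beta>) = (\<Sum>i'<sys_L S'. LA S' P i Q i' * J i' \<beta>)"
    and B: "\<And>P i Q j. P < M \<Longrightarrow> Q < M \<Longrightarrow> i < sys_L S' \<Longrightarrow> j < s \<Longrightarrow>
      RB S' P i Q j = (\<Sum>\<alpha><sys_L S. J i \<alpha> * RB S P \<alpha> Q j)"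
    and C: "\<And>i \<beta>. i < s \<Longrightarrow> \<beta> < sys_L S \<Longrightarrow> sys_C S i \<beta> = (\<Sum>i'<sys_L S'. sys_C S' i i' * J i' \<beta>)"
    and D: "\<And>i j. i < s \<Longrightarrow> j < s \<Longrightarrow> sys_D S' i j = sys_D S i j"
    and inj: "\<And>c. (\<forall>\<alpha><sys_L S. (\<Sum>i<sys_L S'. J i \<alpha> * c i) = 0) \<Longrightarrow> (\<forall>i<sys_L S'. c i = 0)"
    and val: "is_val (\<lambda>c. c) d s M S T V"
  shows "is_val (\<lambda>c. c) d s M S' T V"
proof -
  let ?J = "block_diag (\<lambda>c. c) (sys_L S') (sys_L S) M J"
  let ?l = "lam (\<lambda>c. c) d s M S T" and ?l' = "lam (\<lambda>c. c) d s M S' T"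
  let ?b = "rhs (\<lambda>c. c) d s M S T" and ?b' = "rhs (\<lambda>c. c) d s M S' T"
  note cs = sys_carrier(1)[of "\<lambda>c. c" d s M S T] sys_carrier(1)[of "\<lambda>c. c" d s M S' T]
    sys_carrier(2)[of "\<lambda>c. c" d s M S T] sys_carrier(2)[of "\<lambda>c. c" d s M S' T]
    sys_carrier(3)[of "\<lambda>c. c" s M S] sys_carrier(3)[of "\<lambda>c. c" s M S']
  have J: "?J \<in> carrier_mat (M * sys_L S') (M * sys_L S)" by simp
  have lJ: "?J * ?l = ?l' * ?J"
    by (rule eq_mat_blockI[of _ M "sys_L S'" M "sys_L S"], rule mult_carrier_mat[OF J cs(1)], rule mult_carrier_mat[OF cs(2) J])
      (simp add: block_diag_mult_left[OF cs(1)] block_diag_mult_right[OF cs(2)] lam_index A)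
  have bJ: "?b' = ?J * ?b"
    by (rule eq_mat_blockI[of _ M "sys_L S'" M s], rule cs(4), rule mult_carrier_mat[OF J cs(3)])
      (simp add: block_diag_mult_left[OF cs(3)] rhs_index B)
  have CJ: "diagC (\<lambda>c. c) s M S' * ?J = diagC (\<lambda>c. c) s M S"
    by (rule eq_mat_blockI[of _ M s M "sys_L S"], rule mult_carrier_mat[OF cs(6) J], rule cs(5))
      (simp add: block_diag_mult_right[OF cs(6)] diagC_index C)
  have DD: "diagD (\<lambda>c. c) s M S = diagD (\<lambda>c. c) s M S'"
    by (rule eq_mat_blockI[of _ M s M s], rule sys_carrier(4), rule sys_carrier(4)) (simp add: diagD_def D)
  have tJ: "transpose_mat ?J = block_diag (\<lambda>c. c) (sys_L S) (sys_L S') M (\<lambda>\<alpha> i. J i \<alpha>)"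
    by (rule eq_matI) (auto simp: block_diag_def less_mult_imp_div_less)
  have injJ: "v = 0\<^sub>v (M * sys_L S')" if v: "v \<in> carrier_vec (M * sys_L S')" "transpose_mat ?J *\<^sub>v v = 0\<^sub>v (M * sys_L S)" for v
  proof (rule eq_vecI)
    fix k assume "k < dim_vec (0\<^sub>v (M * sys_L S') :: 'a vec)"
    then have "k < M * sys_L S'" by simp
    then obtain P i where k: "P < M" "i < sys_L S'" "k = P * sys_L S' + i" by (rule block_indexE)
    define c where "c i = v $ (P * sys_L S' + i)" for i
    have vv: "v = vec (M * sys_L S') (\<lambda>k. v $ ((k div sys_L S') * sys_L S' + k mod sys_L S'))"
      using v(1) by (intro eq_vecI) auto
    have "(\<Sum>i<sys_L S'. J i \<alpha> * c i) = 0" if \<alpha>: "\<alpha> < sys_L S" for \<alpha>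
    proof -
      have "(transpose_mat ?J *\<^sub>v v) $ (P * sys_L S + \<alpha>) =
          (\<Sum>Q<M. \<Sum>i<sys_L S'. transpose_mat ?J $$ (P * sys_L S + \<alpha>, Q * sys_L S' + i) * v $ (Q * sys_L S' + i))"
        using mult_vec_block_index[OF transpose_carrier_mat[THEN iffD2, OF J] k(1) \<alpha>, of "\<lambda>Q i. v $ (Q * sys_L S' + i)"] vv by simp
      also have "\<dots> = (\<Sum>Q<M. \<Sum>i<sys_L S'. (if P = Q then J i \<alpha> else 0) * v $ (Q * sys_L S' + i))"
        unfolding tJ by (intro sum.cong refl) (simp add: k(1) \<alpha>)
      also have "\<dots> = (\<Sum>i<sys_L S'. J i \<alpha> * c i)" unfolding sum_block_delta(1)[OF k(1)] c_def ..
      finally show ?thesis using v(2) block_index_less[OF k(1) \<alpha>] by simp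
    qed
    then have "\<forall>i<sys_L S'. c i = 0" using inj[of c] by blast
    then show "v $ k = 0\<^sub>v (M * sys_L S') $ k" using k \<open>k < M * sys_L S'\<close> by (simp add: c_def)
  qed (use v in simp)
  obtain U where U: "U \<in> carrier_mat (M * sys_L S) (M * s)" "?l * U = ?b" "V = diagD (\<lambda>c. c) s M S + diagC (\<lambda>c. c) s M S * U"
    and nz: "den (\<lambda>c. c) d s M S T \<noteq> 0" using val by (auto simp: is_val_def)
  have nzl: "det ?l \<noteq> 0" using nz unfolding den_def .
  have "det (transpose_mat ?l') \<noteq> 0"
  proof (rule matrix_intertwine[OF transpose_carrier_mat[THEN iffD2, OF cs(1)] transpose_carrier_mat[THEN iffD2, OF cs(2)] transpose_carrier_mat[THEN iffD2, OF J] _ injJ])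
    show "transpose_mat ?l * transpose_mat ?J = transpose_mat ?J * transpose_mat ?l'"
      unfolding transpose_mult[OF J cs(1), symmetric] transpose_mult[OF cs(2) J, symmetric] lJ ..
  qed (use nzl in \<open>simp_all add: det_transpose[OF cs(1)]\<close>)
  then have nz': "den (\<lambda>c. c) d s M S' T \<noteq> 0" by (simp add: den_def det_transpose[OF cs(2)])
  have "?l' * (?J * U) = ?J * (?l * U)"
    using assoc_mult_mat[OF cs(2) J U(1)] assoc_mult_mat[OF J cs(1) U(1)] lJ by simp
  then have "?l' * (?J * U) = ?b'" using U(2) bJ by simp
  moreover have "V = diagD (\<lambda>c. c) s M S' + diagC (\<lambda>c. c) s M S' * (?J * U)"
    using U(3) DD CJ assoc_mult_mat[OF cs(6) J U(1)] by simp
  ultimately show ?thesis unfolding is_val_def using nz' mult_carrier_mat[OF J U(1)] by blast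
qed

end

text \<open>Entry of \<open>T\<close> minus the amplified centre. In these coordinates the constant
  part of the pencil is the identity and that of the right-hand side is zero, which makes invariance
  of subspaces a condition on the linear coefficients alone.\<close>

definition cen :: "nat \<Rightarrow> 'a::field mat list \<Rightarrow> 'a mat list \<Rightarrow> nat \<Rightarrow> nat \<Rightarrow> nat \<Rightarrow> nat \<Rightarrow> nat \<Rightarrow> 'a" where
  "cen s Y T P Q k x y = (T ! k) $$ (P * s + x, Q * s + y) - (if P = Q then (Y ! k) $$ (x, y) else 0)"

lemma fm_lam_entry:
  assumes R: "is_fm_real d s R" and Y: "Y \<in> mat_tuples d s" and "\<alpha> < fm_L R" "\<beta> < fm_L R"
  shows "aff_entry (\<lambda>c. c) d s (sys_G (fm_sys d s Y R)) (sys_a (fm_sys d s Y R)) T P \<alpha> Q \<beta> =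
    (if P = Q \<and> \<alpha> = \<beta> then 1 else 0) + (\<Sum>k<d. \<Sum>x<s. \<Sum>y<s. cen s Y T P Q k x y * sys_a (fm_sys d s Y R) k x y \<alpha> \<beta>)"
proof -
  have "fm_A R k (Y ! k) $$ (\<alpha>, \<beta>) = (\<Sum>x<s. \<Sum>y<s. (Y ! k) $$ (x, y) * fm_A R k (unit_mat s x y) $$ (\<alpha>, \<beta>))" if "k < d" for k
    by (rule linear_mat_map_expand[OF fm_linear(1)[OF R Y that] mat_tuplesD(2)[OF Y that] assms(3,4)])
  then show ?thesis
    by (cases "P = Q") (simp_all add: aff_entry_def cen_def left_diff_distrib sum_subtractf sum_negf)
qed

lemma fm_rhs_entry:
  assumes R: "is_fm_real d s R" and Y: "Y \<in> mat_tuples d s" and "\<alpha> < fm_L R" "j < s"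
  shows "aff_entry (\<lambda>c. c) d s (sys_B (fm_sys d s Y R)) (sys_b (fm_sys d s Y R)) T P \<alpha> Q j =
    (\<Sum>k<d. \<Sum>x<s. \<Sum>y<s. cen s Y T P Q k x y * sys_b (fm_sys d s Y R) k x y \<alpha> j)"
proof -
  have "fm_B R k (Y ! k) $$ (\<alpha>, j) = (\<Sum>x<s. \<Sum>y<s. (Y ! k) $$ (x, y) * fm_B R k (unit_mat s x y) $$ (\<alpha>, j))" if "k < d" for k
    by (rule linear_mat_map_expand[OF fm_linear(2)[OF R Y that] mat_tuplesD(2)[OF Y that] assms(3,4)])
  then show ?thesis
    by (cases "P = Q") (simp_all add: aff_entry_def cen_def left_diff_distrib sum_subtractf)
qed

text \<open>Recovers a realization from prescribed coefficients; the sign in the first map is the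
  inverse of the convention in \<open>fm_sys\<close>.\<close>

definition fm_of :: "nat \<Rightarrow> nat \<Rightarrow> 'a::field mat \<Rightarrow> 'a mat \<Rightarrow> (nat \<Rightarrow> nat \<Rightarrow> nat \<Rightarrow> nat \<Rightarrow> nat \<Rightarrow> 'a) \<Rightarrow>
    (nat \<Rightarrow> nat \<Rightarrow> nat \<Rightarrow> nat \<Rightarrow> nat \<Rightarrow> 'a) \<Rightarrow> 'a fm_real" where
  "fm_of s L D C a b = FM L D C
     (\<lambda>k M. mat L L (\<lambda>(\<alpha>, \<beta>). - (\<Sum>x<s. \<Sum>y<s. M $$ (x, y) * a k x y \<alpha> \<beta>)))
     (\<lambda>k M. mat L s (\<lambda>(\<alpha>, j). \<Sum>x<s. \<Sum>y<s. M $$ (x, y) * b k x y \<alpha> j))"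

lemma fm_of_simps [simp]: "fm_L (fm_of s L D C a b) = L" "fm_D (fm_of s L D C a b) = D" "fm_C (fm_of s L D C a b) = C"
  by (simp_all add: fm_of_def)

lemma is_fm_real_fm_of:
  assumes "D \<in> carrier_mat s s" "C \<in> carrier_mat s L"
  shows "is_fm_real d s (fm_of s L D C a b)"
proof -
  have lin: "linear_mat_map s nr nc (\<lambda>M. mat nr nc (\<lambda>(i, j). e * (\<Sum>x<s. \<Sum>y<s. M $$ (x, y) * f x y i j)))" for nr nc e and f :: "nat \<Rightarrow> nat \<Rightarrow> nat \<Rightarrow> nat \<Rightarrow> 'a"
    unfolding linear_mat_map_def
  proof (intro conjI ballI allI)
    fix M N :: "'a mat" assume "M \<in> carrier_mat s s" "N \<in> carrier_mat s s"
    then show "mat nr nc (\<lambda>(i, j). e * (\<Sum>x<s. \<Sum>y<s. (M + N) $$ (x, y) * f x y i j)) =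
      mat nr nc (\<lambda>(i, j). e * (\<Sum>x<s. \<Sum>y<s. M $$ (x, y) * f x y i j)) + mat nr nc (\<lambda>(i, j). e * (\<Sum>x<s. \<Sum>y<s. N $$ (x, y) * f x y i j))"
      by (intro eq_matI) (auto simp: distrib_left distrib_right sum.distrib)
  next
    fix c and M :: "'a mat" assume "M \<in> carrier_mat s s"
    then show "mat nr nc (\<lambda>(i, j). e * (\<Sum>x<s. \<Sum>y<s. (c \<cdot>\<^sub>m M) $$ (x, y) * f x y i j)) =
      c \<cdot>\<^sub>m mat nr nc (\<lambda>(i, j). e * (\<Sum>x<s. \<Sum>y<s. M $$ (x, y) * f x y i j))"
      by (intro eq_matI) (auto simp: sum_distrib_left ac_simps intro!: sum.cong)
  qed simp
  show ?thesis
    using assms lin[of L L "- 1"] lin[of L s 1] by (simp add: is_fm_real_def fm_of_def)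
qed

lemma fm_of_coeffs:
  assumes "x < s" "y < s" "\<alpha> < L"
  shows "\<beta> < L \<Longrightarrow> sys_a (fm_sys d s Y (fm_of s L D C a b)) k x y \<alpha> \<beta> = a k x y \<alpha> \<beta>"
    and "j < s \<Longrightarrow> sys_b (fm_sys d s Y (fm_of s L D C a b)) k x y \<alpha> j = b k x y \<alpha> j"
proof -
  have e: "(\<Sum>x'<s. \<Sum>y'<s. unit_mat s x y $$ (x', y') * f x' y') = f x y" for f :: "nat \<Rightarrow> nat \<Rightarrow> 'a"
  proof -
    have "(\<Sum>x'<s. \<Sum>y'<s. unit_mat s x y $$ (x', y') * f x' y') = (\<Sum>x'<s. \<Sum>y'<s. if x' = x then if y' = y then f x' y' else 0 else 0)"
      by (intro sum.cong refl) (auto simp: unit_mat_def)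
    also have "\<dots> = (\<Sum>x'<s. if x' = x then \<Sum>y'<s. if y' = y then f x' y' else 0 else 0)"
      by (intro sum.cong refl) auto
    finally show ?thesis using assms by simp
  qed
  show "\<beta> < L \<Longrightarrow> sys_a (fm_sys d s Y (fm_of s L D C a b)) k x y \<alpha> \<beta> = a k x y \<alpha> \<beta>"
    and "j < s \<Longrightarrow> sys_b (fm_sys d s Y (fm_of s L D C a b)) k x y \<alpha> j = b k x y \<alpha> j"
    using assms e by (simp_all add: fm_of_def)
qed

text \<open>The states are restricted to the double annihilator of the reachable vectors. It
  contains the columns of \<open>B\<close>, is invariant under \<open>A\<close>, and is proper by
  assumption. All values of the old system persist, at every point where it is defined.\<close>

lemma reduce_uncontrollable:
  assumes R: "is_fm_real d s R" and Y: "Y \<in> mat_tuples d s" and nc: "\<not> controllable d s (fm_sys d s Y R)"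
  shows "\<exists>R'. is_fm_real d s R' \<and> fm_L R' < fm_L R \<and>
    (\<forall>M T V. is_val (\<lambda>c. c) d s M (fm_sys d s Y R) T V \<longrightarrow> is_val (\<lambda>c. c) d s M (fm_sys d s Y R') T V)"
proof -
  let ?S = "fm_sys d s Y R" and ?L = "fm_L R"
  let ?a = "sys_a ?S" and ?b = "sys_b ?S"
  define ann where "ann l \<longleftrightarrow> (\<forall>h. reach d s ?S h \<longrightarrow> (\<Sum>\<alpha><?L. l \<alpha> * h \<alpha>) = 0)" for l
  \<comment> \<open>The double annihilator plays the role of the span of the reachable vectors;
    invariance follows by letting \<open>A\<close> act on functionals.\<close>
  define W where "W w \<longleftrightarrow> (\<forall>l. ann l \<longrightarrow> (\<Sum>\<alpha><?L. l \<alpha> * w \<alpha>) = 0)" for w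
  have Wb: "W (\<lambda>\<alpha>. ?b k x y \<alpha> j)" if "k < d" "x < s" "y < s" "j < s" for k x y j
    unfolding W_def ann_def using reach.base[OF that, of ?S] by blast
  have swap: "(\<Sum>\<alpha><?L. l \<alpha> * (\<Sum>\<beta><?L. ?a k x y \<alpha> \<beta> * w \<beta>)) = (\<Sum>\<beta><?L. (\<Sum>\<alpha><?L. l \<alpha> * ?a k x y \<alpha> \<beta>) * w \<beta>)" for l w k x y
    unfolding sum_distrib_left sum_distrib_right by (subst sum.swap) (simp only: mult.assoc)
  have Wa: "W (\<lambda>\<alpha>. \<Sum>\<beta><?L. ?a k x y \<alpha> \<beta> * w \<beta>)" if w: "W w" and kxy: "k < d" "x < s" "y < s" for w k x y
    unfolding W_def
  proof (intro allI impI)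
    fix l assume l: "ann l"
    have "ann (\<lambda>\<beta>. \<Sum>\<alpha><?L. l \<alpha> * ?a k x y \<alpha> \<beta>)"
      unfolding ann_def
    proof (intro allI impI)
      fix h assume "reach d s ?S h"
      then have "reach d s ?S (\<lambda>\<alpha>. - (\<Sum>\<beta><?L. ?a k x y \<alpha> \<beta> * h \<beta>))"
        by (rule reach.step[of d s ?S h k x y, unfolded fm_sys_simps(1), OF _ kxy])
      then have "(\<Sum>\<alpha><?L. l \<alpha> * (- (\<Sum>\<beta><?L. ?a k x y \<alpha> \<beta> * h \<beta>))) = 0" using l unfolding ann_def by blast
      then have "(\<Sum>\<alpha><?L. l \<alpha> * (\<Sum>\<beta><?L. ?a k x y \<alpha> \<beta> * h \<beta>)) = 0"
        by (simp only: mult_minus_right sum_negf neg_equal_0_iff_equal)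
      then show "(\<Sum>\<beta><?L. (\<Sum>\<alpha><?L. l \<alpha> * ?a k x y \<alpha> \<beta>) * h \<beta>) = 0" unfolding swap .
    qed
    then have "(\<Sum>\<beta><?L. (\<Sum>\<alpha><?L. l \<alpha> * ?a k x y \<alpha> \<beta>) * w \<beta>) = 0" using w unfolding W_def by blast
    then show "(\<Sum>\<alpha><?L. l \<alpha> * (\<Sum>\<beta><?L. ?a k x y \<alpha> \<beta> * w \<beta>)) = 0" unfolding swap .
  qed
  from subspace_basis[of ?L W] obtain r J where rJ: "r \<le> ?L" "\<forall>i<r. W (\<lambda>\<alpha>. J \<alpha> i)"
    "\<forall>c. (\<forall>\<alpha><?L. (\<Sum>i<r. J \<alpha> i * c i) = 0) \<longrightarrow> (\<forall>i<r. c i = 0)"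
    "\<forall>w. W w \<longrightarrow> (\<exists>c. \<forall>\<alpha><?L. w \<alpha> = (\<Sum>i<r. J \<alpha> i * c i))" by (elim exE conjE) (rule that)
  obtain l \<alpha> where l: "ann l" "\<alpha> < ?L" "l \<alpha> \<noteq> 0" using nc unfolding controllable_def ann_def by auto
  have rL: "r < ?L"
    by (rule basis_of_proper_subspace[of r ?L J l \<alpha>, OF rJ(1,3) _ l(2,3)]) (use rJ(2) l(1) in \<open>auto simp: W_def\<close>)
  \<comment> \<open>Coordinates, in the basis \<open>J\<close>, of the coefficients applied to basis
    vectors.\<close>
  define a' where "a' k x y i' i = (SOME c. \<forall>\<alpha><?L. (\<Sum>\<beta><?L. ?a k x y \<alpha> \<beta> * J \<beta> i) = (\<Sum>i'<r. J \<alpha> i' * c i')) i'" for k x y i' i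
  define b' where "b' k x y i' j = (SOME c. \<forall>\<alpha><?L. ?b k x y \<alpha> j = (\<Sum>i'<r. J \<alpha> i' * c i')) i'" for k x y i' j
  have a': "(\<Sum>\<beta><?L. ?a k x y \<alpha> \<beta> * J \<beta> i) = (\<Sum>i'<r. J \<alpha> i' * a' k x y i' i)"
    if "k < d" "x < s" "y < s" "i < r" "\<alpha> < ?L" for k x y i \<alpha>
  proof -
    have "W (\<lambda>\<beta>. J \<beta> i)" using rJ(2) that(4) by blast
    then have "\<exists>c. \<forall>\<alpha><?L. (\<Sum>\<beta><?L. ?a k x y \<alpha> \<beta> * J \<beta> i) = (\<Sum>i'<r. J \<alpha> i' * c i')"
      by (intro rJ(4)[rule_format] Wa[OF _ that(1-3)])
    from someI_ex[OF this, rule_format, OF that(5)] show ?thesis unfolding a'_def .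
  qed
  have b': "?b k x y \<alpha> j = (\<Sum>i'<r. J \<alpha> i' * b' k x y i' j)"
    if "k < d" "x < s" "y < s" "j < s" "\<alpha> < ?L" for k x y j \<alpha>
  proof -
    have "\<exists>c. \<forall>\<alpha><?L. ?b k x y \<alpha> j = (\<Sum>i'<r. J \<alpha> i' * c i')"
      by (intro rJ(4)[rule_format] Wb[OF that(1-4)])
    from someI_ex[OF this, rule_format, OF that(5)] show ?thesis unfolding b'_def .
  qed
  define C' where "C' = mat s r (\<lambda>(i, i'). \<Sum>\<alpha><?L. fm_C R $$ (i, \<alpha>) * J \<alpha> i')"
  define R' where "R' = fm_of s r (fm_D R) C' a' b'"
  let ?S' = "fm_sys d s Y R'"
  have R': "is_fm_real d s R'"
    unfolding R'_def by (rule is_fm_real_fm_of) (use fm_linear(4)[OF R Y] in \<open>simp_all add: C'_def\<close>)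
  have L': "fm_L R' = r" by (simp add: R'_def)
  have co: "sys_a ?S' k x y i' i = a' k x y i' i" if "x < s" "y < s" "i' < r" "i < r" for k x y i' i
    unfolding R'_def by (rule fm_of_coeffs(1)[OF that])
  have co': "sys_b ?S' k x y i' j = b' k x y i' j" if "x < s" "y < s" "i' < r" "j < s" for k x y i' j
    unfolding R'_def by (rule fm_of_coeffs(2)[OF that])
  have "is_val (\<lambda>c. c) d s M ?S' T V" if val: "is_val (\<lambda>c. c) d s M ?S T V" for M T V
  proof (rule is_val_subsystem[where S = ?S and S' = ?S' and J = J, OF _ _ _ _ _ val], unfold fm_sys_simps(1) L')
    fix P \<alpha> Q i assume *: "\<alpha> < ?L" "i < r"
    have i': "i < fm_L R'" using * L' by simp
    have "(\<Sum>\<beta><?L. aff_entry (\<lambda>c. c) d s (sys_G ?S) ?a T P \<alpha> Q \<beta> * J \<beta> i) =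
        (\<Sum>\<beta><?L. (if P = Q \<and> \<beta> = \<alpha> then J \<beta> i else 0) + (\<Sum>k<d. \<Sum>x<s. \<Sum>y<s. cen s Y T P Q k x y * (?a k x y \<alpha> \<beta> * J \<beta> i)))"
    proof (rule sum.cong[OF refl])
      fix \<beta> assume "\<beta> \<in> {..<?L}"
      then show "aff_entry (\<lambda>c. c) d s (sys_G ?S) ?a T P \<alpha> Q \<beta> * J \<beta> i =
        (if P = Q \<and> \<beta> = \<alpha> then J \<beta> i else 0) + (\<Sum>k<d. \<Sum>x<s. \<Sum>y<s. cen s Y T P Q k x y * (?a k x y \<alpha> \<beta> * J \<beta> i))"
        unfolding fm_lam_entry[OF R Y *(1) \<open>\<beta> \<in> {..<?L}\<close>[unfolded lessThan_iff]] distrib_right sum_distrib_right mult.assoc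
        by (simp del: fm_sys_simps)
    qed
    also have "\<dots> = (if P = Q then J \<alpha> i else 0) + (\<Sum>k<d. \<Sum>x<s. \<Sum>y<s. cen s Y T P Q k x y * (\<Sum>\<beta><?L. ?a k x y \<alpha> \<beta> * J \<beta> i))"
    proof -
      have "(\<Sum>\<beta><?L. \<Sum>k<d. \<Sum>x<s. \<Sum>y<s. cen s Y T P Q k x y * (?a k x y \<alpha> \<beta> * J \<beta> i)) =
          (\<Sum>k<d. \<Sum>x<s. \<Sum>y<s. \<Sum>\<beta><?L. cen s Y T P Q k x y * (?a k x y \<alpha> \<beta> * J \<beta> i))"
        by (rule trans[OF sum.swap sum.cong[OF refl trans[OF sum.swap sum.cong[OF refl sum.swap]]]])
      then show ?thesis
        unfolding sum.distrib sum_distrib_left using *(1) by (cases "P = Q") (simp_all del: fm_sys_simps)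
    qed
    also have "\<dots> = (if P = Q then J \<alpha> i else 0) + (\<Sum>k<d. \<Sum>x<s. \<Sum>y<s. cen s Y T P Q k x y * (\<Sum>i'<r. J \<alpha> i' * a' k x y i' i))"
      using * by (simp add: a' del: fm_sys_simps)
    also have "\<dots> = (\<Sum>i'<r. (if P = Q \<and> i' = i then J \<alpha> i' else 0) + (\<Sum>k<d. \<Sum>x<s. \<Sum>y<s. cen s Y T P Q k x y * (J \<alpha> i' * a' k x y i' i)))"
    proof -
      have "(\<Sum>i'<r. \<Sum>k<d. \<Sum>x<s. \<Sum>y<s. cen s Y T P Q k x y * (J \<alpha> i' * a' k x y i' i)) =
          (\<Sum>k<d. \<Sum>x<s. \<Sum>y<s. \<Sum>i'<r. cen s Y T P Q k x y * (J \<alpha> i' * a' k x y i' i))"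
        by (rule trans[OF sum.swap sum.cong[OF refl trans[OF sum.swap sum.cong[OF refl sum.swap]]]])
      then show ?thesis
        unfolding sum.distrib sum_distrib_left using *(2) by (cases "P = Q") (simp_all del: fm_sys_simps)
    qed
    also have "\<dots> = (\<Sum>i'<r. J \<alpha> i' * aff_entry (\<lambda>c. c) d s (sys_G ?S') (sys_a ?S') T P i' Q i)"
    proof (rule sum.cong[OF refl])
      fix i' assume "i' \<in> {..<r}"
      then have i'r: "i' < r" "i' < fm_L R'" by (simp_all add: L')
      have "(\<Sum>k<d. \<Sum>x<s. \<Sum>y<s. cen s Y T P Q k x y * (J \<alpha> i' * a' k x y i' i)) =
          J \<alpha> i' * (\<Sum>k<d. \<Sum>x<s. \<Sum>y<s. cen s Y T P Q k x y * sys_a ?S' k x y i' i)"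
        unfolding sum_distrib_left using *(2) i'r(1) by (intro sum.cong refl) (simp add: co mult.left_commute del: fm_sys_simps)
      then show "(if P = Q \<and> i' = i then J \<alpha> i' else 0) + (\<Sum>k<d. \<Sum>x<s. \<Sum>y<s. cen s Y T P Q k x y * (J \<alpha> i' * a' k x y i' i)) =
          J \<alpha> i' * aff_entry (\<lambda>c. c) d s (sys_G ?S') (sys_a ?S') T P i' Q i"
        unfolding fm_lam_entry[OF R' Y i'r(2) i'] by (simp add: distrib_left del: fm_sys_simps)
    qed
    finally show "(\<Sum>\<beta><?L. aff_entry (\<lambda>c. c) d s (sys_G ?S) ?a T P \<alpha> Q \<beta> * J \<beta> i) =
        (\<Sum>i'<r. J \<alpha> i' * aff_entry (\<lambda>c. c) d s (sys_G ?S') (sys_a ?S') T P i' Q i)" .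
  next
    fix P \<alpha> Q j assume *: "\<alpha> < ?L" "j < s"
    have "aff_entry (\<lambda>c. c) d s (sys_B ?S) ?b T P \<alpha> Q j = (\<Sum>k<d. \<Sum>x<s. \<Sum>y<s. \<Sum>i'<r. J \<alpha> i' * (cen s Y T P Q k x y * b' k x y i' j))"
      unfolding fm_rhs_entry[OF R Y *]
      by (intro sum.cong refl) (simp add: b' * sum_distrib_left mult.left_commute del: fm_sys_simps)
    also have "\<dots> = (\<Sum>i'<r. \<Sum>k<d. \<Sum>x<s. \<Sum>y<s. J \<alpha> i' * (cen s Y T P Q k x y * b' k x y i' j))"
      by (rule sym) (rule trans[OF sum.swap sum.cong[OF refl trans[OF sum.swap sum.cong[OF refl sum.swap]]]])
    also have "\<dots> = (\<Sum>i<r. J \<alpha> i * aff_entry (\<lambda>c. c) d s (sys_B ?S') (sys_b ?S') T P i Q j)"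
    proof (rule sum.cong[OF refl])
      fix i assume "i \<in> {..<r}"
      then have i: "i < r" "i < fm_L R'" by (simp_all add: L')
      show "(\<Sum>k<d. \<Sum>x<s. \<Sum>y<s. J \<alpha> i * (cen s Y T P Q k x y * b' k x y i j)) = J \<alpha> i * aff_entry (\<lambda>c. c) d s (sys_B ?S') (sys_b ?S') T P i Q j"
        unfolding fm_rhs_entry[OF R' Y i(2) *(2)] sum_distrib_left using i(1) *(2) by (intro sum.cong refl) (simp add: co' del: fm_sys_simps)
    qed
    finally show "aff_entry (\<lambda>c. c) d s (sys_B ?S) ?b T P \<alpha> Q j = (\<Sum>i<r. J \<alpha> i * aff_entry (\<lambda>c. c) d s (sys_B ?S') (sys_b ?S') T P i Q j)" .
  next
    fix c assume "\<forall>\<alpha><?L. (\<Sum>i<r. J \<alpha> i * c i) = 0"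
    then show "\<forall>i<r. c i = 0" using rJ(3) by blast
  qed (simp_all add: R'_def C'_def)
  then show ?thesis using R' rL L' by blast
qed

text \<open>Dual reduction: the rows of \<open>J\<close> form a basis of the double annihilator of
  the coreachable row vectors, and the new states are the images under \<open>J\<close>. Invariance
  lets \<open>A\<close> descend, and the rows of \<open>C\<close> factor through
  \<open>J\<close>.\<close>

lemma reduce_unobservable:
  assumes R: "is_fm_real d s R" and Y: "Y \<in> mat_tuples d s" and nc: "\<not> observable d s (fm_sys d s Y R)"
  shows "\<exists>R'. is_fm_real d s R' \<and> fm_L R' < fm_L R \<and>
    (\<forall>M T V. is_val (\<lambda>c. c) d s M (fm_sys d s Y R) T V \<longrightarrow> is_val (\<lambda>c. c) d s M (fm_sys d s Y R') T V)"
proof -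
  let ?S = "fm_sys d s Y R" and ?L = "fm_L R"
  let ?a = "sys_a ?S" and ?b = "sys_b ?S"
  define ann where "ann l \<longleftrightarrow> (\<forall>g. coreach d s ?S g \<longrightarrow> (\<Sum>\<alpha><?L. g \<alpha> * l \<alpha>) = 0)" for l
  define W where "W w \<longleftrightarrow> (\<forall>l. ann l \<longrightarrow> (\<Sum>\<alpha><?L. w \<alpha> * l \<alpha>) = 0)" for w
  have WC: "W (\<lambda>\<alpha>. sys_C ?S i \<alpha>)" if "i < s" for i
    unfolding W_def ann_def using coreach.base[OF that, of d ?S] by blast
  have swap: "(\<Sum>\<beta><?L. (\<Sum>\<alpha><?L. w \<alpha> * ?a k x y \<alpha> \<beta>) * l \<beta>) = (\<Sum>\<alpha><?L. w \<alpha> * (\<Sum>\<beta><?L. ?a k x y \<alpha> \<beta> * l \<beta>))" for l w k x y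
    unfolding sum_distrib_left sum_distrib_right by (subst sum.swap) (simp only: mult.assoc)
  have Wa: "W (\<lambda>\<beta>. \<Sum>\<alpha><?L. w \<alpha> * ?a k x y \<alpha> \<beta>)" if w: "W w" and kxy: "k < d" "x < s" "y < s" for w k x y
    unfolding W_def
  proof (intro allI impI)
    fix l assume l: "ann l"
    have "ann (\<lambda>\<alpha>. \<Sum>\<beta><?L. ?a k x y \<alpha> \<beta> * l \<beta>)"
      unfolding ann_def
    proof (intro allI impI)
      fix g assume "coreach d s ?S g"
      then have "coreach d s ?S (\<lambda>\<beta>. - (\<Sum>\<alpha><?L. g \<alpha> * ?a k x y \<alpha> \<beta>))"
        by (rule coreach.step[of d s ?S g k x y, unfolded fm_sys_simps(1), OF _ kxy])
      then have "(\<Sum>\<beta><?L. - (\<Sum>\<alpha><?L. g \<alpha> * ?a k x y \<alpha> \<beta>) * l \<beta>) = 0" using l unfolding ann_def by blast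
      then have "(\<Sum>\<beta><?L. (\<Sum>\<alpha><?L. g \<alpha> * ?a k x y \<alpha> \<beta>) * l \<beta>) = 0"
        by (simp only: mult_minus_left sum_negf neg_equal_0_iff_equal)
      then show "(\<Sum>\<alpha><?L. g \<alpha> * (\<Sum>\<beta><?L. ?a k x y \<alpha> \<beta> * l \<beta>)) = 0" unfolding swap .
    qed
    then have "(\<Sum>\<alpha><?L. w \<alpha> * (\<Sum>\<beta><?L. ?a k x y \<alpha> \<beta> * l \<beta>)) = 0" using w unfolding W_def by blast
    then show "(\<Sum>\<beta><?L. (\<Sum>\<alpha><?L. w \<alpha> * ?a k x y \<alpha> \<beta>) * l \<beta>) = 0" unfolding swap .
  qed
  from subspace_basis[of ?L W] obtain r K where rJ: "r \<le> ?L" "\<forall>i<r. W (\<lambda>\<alpha>. K \<alpha> i)"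
    "\<forall>c. (\<forall>\<alpha><?L. (\<Sum>i<r. K \<alpha> i * c i) = 0) \<longrightarrow> (\<forall>i<r. c i = 0)"
    "\<forall>w. W w \<longrightarrow> (\<exists>c. \<forall>\<alpha><?L. w \<alpha> = (\<Sum>i<r. K \<alpha> i * c i))" by (elim exE conjE) (rule that)
  define J where "J i \<alpha> = K \<alpha> i" for i \<alpha>
  obtain l \<alpha> where l: "ann l" "\<alpha> < ?L" "l \<alpha> \<noteq> 0" using nc unfolding observable_def ann_def by auto
  have rL: "r < ?L"
    by (rule basis_of_proper_subspace[of r ?L K l \<alpha>, OF rJ(1,3) _ l(2,3)]) (use rJ(2) l(1) in \<open>auto simp: W_def mult.commute\<close>)
  define a' where "a' k x y i i' = (SOME c. \<forall>\<beta><?L. (\<Sum>\<alpha><?L. J i \<alpha> * ?a k x y \<alpha> \<beta>) = (\<Sum>i'<r. K \<beta> i' * c i')) i'" for k x y i' i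
  define b' where "b' k x y i j = (\<Sum>\<alpha><?L. J i \<alpha> * ?b k x y \<alpha> j)" for k x y i j
  define c' where "c' i i' = (SOME c. \<forall>\<beta><?L. sys_C ?S i \<beta> = (\<Sum>i'<r. K \<beta> i' * c i')) i'" for i i'
  have a': "(\<Sum>\<alpha><?L. J i \<alpha> * ?a k x y \<alpha> \<beta>) = (\<Sum>i'<r. a' k x y i i' * J i' \<beta>)"
    if "k < d" "x < s" "y < s" "i < r" "\<beta> < ?L" for k x y i \<beta>
  proof -
    have "W (J i)" using rJ(2) that(4) unfolding J_def by blast
    then have "\<exists>c. \<forall>\<beta><?L. (\<Sum>\<alpha><?L. J i \<alpha> * ?a k x y \<alpha> \<beta>) = (\<Sum>i'<r. K \<beta> i' * c i')"
      by (intro rJ(4)[rule_format] Wa[OF _ that(1-3)])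
    from someI_ex[OF this, rule_format, OF that(5)]
    have "(\<Sum>\<alpha><?L. J i \<alpha> * ?a k x y \<alpha> \<beta>) = (\<Sum>i'<r. K \<beta> i' * a' k x y i i')" unfolding a'_def .
    then show ?thesis unfolding J_def[symmetric] by (simp only: mult.commute)
  qed
  have c': "sys_C ?S i \<beta> = (\<Sum>i'<r. c' i i' * J i' \<beta>)" if "i < s" "\<beta> < ?L" for i \<beta>
  proof -
    have "\<exists>c. \<forall>\<beta><?L. sys_C ?S i \<beta> = (\<Sum>i'<r. K \<beta> i' * c i')"
      by (intro rJ(4)[rule_format] WC[OF that(1)])
    from someI_ex[OF this, rule_format, OF that(2)]
    have "sys_C ?S i \<beta> = (\<Sum>i'<r. K \<beta> i' * c' i i')" unfolding c'_def .
    then show ?thesis unfolding J_def[symmetric] by (simp only: mult.commute)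
  qed
  define C' where "C' = mat s r (\<lambda>(i, i'). c' i i')"
  define R' where "R' = fm_of s r (fm_D R) C' a' b'"
  let ?S' = "fm_sys d s Y R'"
  have R': "is_fm_real d s R'"
    unfolding R'_def by (rule is_fm_real_fm_of) (use fm_linear(4)[OF R Y] in \<open>simp_all add: C'_def\<close>)
  have L': "fm_L R' = r" by (simp add: R'_def)
  have co: "sys_a ?S' k x y i' i = a' k x y i' i" if "x < s" "y < s" "i' < r" "i < r" for k x y i' i
    unfolding R'_def by (rule fm_of_coeffs(1)[OF that])
  have co': "sys_b ?S' k x y i' j = b' k x y i' j" if "x < s" "y < s" "i' < r" "j < s" for k x y i' j
    unfolding R'_def by (rule fm_of_coeffs(2)[OF that])
  have "is_val (\<lambda>c. c) d s M ?S' T V" if val: "is_val (\<lambda>c. c) d s M ?S T V" for M T V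
  proof (rule is_val_quotient_system[where S = ?S and S' = ?S' and J = J, OF _ _ _ _ _ val], unfold fm_sys_simps(1) L')
    fix P i Q \<beta> assume *: "i < r" "\<beta> < ?L"
    have i: "i < fm_L R'" using * L' by simp
    have "(\<Sum>\<alpha><?L. J i \<alpha> * aff_entry (\<lambda>c. c) d s (sys_G ?S) ?a T P \<alpha> Q \<beta>) =
        (\<Sum>\<alpha><?L. (if P = Q \<and> \<alpha> = \<beta> then J i \<alpha> else 0) + (\<Sum>k<d. \<Sum>x<s. \<Sum>y<s. cen s Y T P Q k x y * (J i \<alpha> * ?a k x y \<alpha> \<beta>)))"
    proof (rule sum.cong[OF refl])
      fix \<alpha> assume "\<alpha> \<in> {..<?L}"
      then show "J i \<alpha> * aff_entry (\<lambda>c. c) d s (sys_G ?S) ?a T P \<alpha> Q \<beta> =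
        (if P = Q \<and> \<alpha> = \<beta> then J i \<alpha> else 0) + (\<Sum>k<d. \<Sum>x<s. \<Sum>y<s. cen s Y T P Q k x y * (J i \<alpha> * ?a k x y \<alpha> \<beta>))"
        unfolding fm_lam_entry[OF R Y \<open>\<alpha> \<in> {..<?L}\<close>[unfolded lessThan_iff] *(2)] distrib_left sum_distrib_left
        by (simp add: mult.left_commute del: fm_sys_simps)
    qed
    also have "\<dots> = (if P = Q then J i \<beta> else 0) + (\<Sum>k<d. \<Sum>x<s. \<Sum>y<s. cen s Y T P Q k x y * (\<Sum>\<alpha><?L. J i \<alpha> * ?a k x y \<alpha> \<beta>))"
    proof -
      have "(\<Sum>\<alpha><?L. \<Sum>k<d. \<Sum>x<s. \<Sum>y<s. cen s Y T P Q k x y * (J i \<alpha> * ?a k x y \<alpha> \<beta>)) =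
          (\<Sum>k<d. \<Sum>x<s. \<Sum>y<s. \<Sum>\<alpha><?L. cen s Y T P Q k x y * (J i \<alpha> * ?a k x y \<alpha> \<beta>))"
        by (rule trans[OF sum.swap sum.cong[OF refl trans[OF sum.swap sum.cong[OF refl sum.swap]]]])
      then show ?thesis
        unfolding sum.distrib sum_distrib_left using *(2) by (cases "P = Q") (simp_all del: fm_sys_simps)
    qed
    also have "\<dots> = (if P = Q then J i \<beta> else 0) + (\<Sum>k<d. \<Sum>x<s. \<Sum>y<s. cen s Y T P Q k x y * (\<Sum>i'<r. a' k x y i i' * J i' \<beta>))"
      using * by (simp add: a' del: fm_sys_simps)
    also have "\<dots> = (\<Sum>i'<r. (if P = Q \<and> i' = i then J i' \<beta> else 0) + (\<Sum>k<d. \<Sum>x<s. \<Sum>y<s. cen s Y T P Q k x y * (a' k x y i i' * J i' \<beta>)))"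
    proof -
      have "(\<Sum>i'<r. \<Sum>k<d. \<Sum>x<s. \<Sum>y<s. cen s Y T P Q k x y * (a' k x y i i' * J i' \<beta>)) =
          (\<Sum>k<d. \<Sum>x<s. \<Sum>y<s. \<Sum>i'<r. cen s Y T P Q k x y * (a' k x y i i' * J i' \<beta>))"
        by (rule trans[OF sum.swap sum.cong[OF refl trans[OF sum.swap sum.cong[OF refl sum.swap]]]])
      then show ?thesis
        unfolding sum.distrib sum_distrib_left using *(1) by (cases "P = Q") (simp_all del: fm_sys_simps)
    qed
    also have "\<dots> = (\<Sum>i'<r. aff_entry (\<lambda>c. c) d s (sys_G ?S') (sys_a ?S') T P i Q i' * J i' \<beta>)"
    proof (rule sum.cong[OF refl])
      fix i' assume "i' \<in> {..<r}"
      then have i'r: "i' < r" "i' < fm_L R'" by (simp_all add: L')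
      have "(\<Sum>k<d. \<Sum>x<s. \<Sum>y<s. cen s Y T P Q k x y * (a' k x y i i' * J i' \<beta>)) =
          (\<Sum>k<d. \<Sum>x<s. \<Sum>y<s. cen s Y T P Q k x y * sys_a ?S' k x y i i') * J i' \<beta>"
        unfolding sum_distrib_right using *(1) i'r(1) by (intro sum.cong refl) (simp add: co mult.assoc del: fm_sys_simps)
      then show "(if P = Q \<and> i' = i then J i' \<beta> else 0) + (\<Sum>k<d. \<Sum>x<s. \<Sum>y<s. cen s Y T P Q k x y * (a' k x y i i' * J i' \<beta>)) =
          aff_entry (\<lambda>c. c) d s (sys_G ?S') (sys_a ?S') T P i Q i' * J i' \<beta>"
        unfolding fm_lam_entry[OF R' Y i i'r(2)] by (simp add: distrib_right eq_commute[of i' i] del: fm_sys_simps)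
    qed
    finally show "(\<Sum>\<alpha><?L. J i \<alpha> * aff_entry (\<lambda>c. c) d s (sys_G ?S) ?a T P \<alpha> Q \<beta>) =
        (\<Sum>i'<r. aff_entry (\<lambda>c. c) d s (sys_G ?S') (sys_a ?S') T P i Q i' * J i' \<beta>)" .
  next
    fix P i Q j assume *: "i < r" "j < s"
    have i: "i < fm_L R'" using * L' by simp
    have "aff_entry (\<lambda>c. c) d s (sys_B ?S') (sys_b ?S') T P i Q j =
        (\<Sum>k<d. \<Sum>x<s. \<Sum>y<s. \<Sum>\<alpha><?L. J i \<alpha> * (cen s Y T P Q k x y * ?b k x y \<alpha> j))"
      unfolding fm_rhs_entry[OF R' Y i *(2)]
      by (intro sum.cong refl) (simp add: co' b'_def * sum_distrib_left mult.left_commute del: fm_sys_simps)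
    also have "\<dots> = (\<Sum>\<alpha><?L. \<Sum>k<d. \<Sum>x<s. \<Sum>y<s. J i \<alpha> * (cen s Y T P Q k x y * ?b k x y \<alpha> j))"
      by (rule sym) (rule trans[OF sum.swap sum.cong[OF refl trans[OF sum.swap sum.cong[OF refl sum.swap]]]])
    also have "\<dots> = (\<Sum>\<alpha><?L. J i \<alpha> * aff_entry (\<lambda>c. c) d s (sys_B ?S) ?b T P \<alpha> Q j)"
    proof (rule sum.cong[OF refl])
      fix \<alpha> assume "\<alpha> \<in> {..<?L}"
      then have \<alpha>: "\<alpha> < ?L" by simp
      show "(\<Sum>k<d. \<Sum>x<s. \<Sum>y<s. J i \<alpha> * (cen s Y T P Q k x y * ?b k x y \<alpha> j)) = J i \<alpha> * aff_entry (\<lambda>c. c) d s (sys_B ?S) ?b T P \<alpha> Q j"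
        unfolding fm_rhs_entry[OF R Y \<alpha> *(2)] sum_distrib_left ..
    qed
    finally show "aff_entry (\<lambda>c. c) d s (sys_B ?S') (sys_b ?S') T P i Q j = (\<Sum>\<alpha><?L. J i \<alpha> * aff_entry (\<lambda>c. c) d s (sys_B ?S) ?b T P \<alpha> Q j)" .
  next
    fix c assume "\<forall>\<alpha><?L. (\<Sum>i<r. J i \<alpha> * c i) = 0"
    then show "\<forall>i<r. c i = 0" using rJ(3) unfolding J_def by blast
  next
    fix i \<beta> assume *: "i < s" "\<beta> < ?L"
    then show "sys_C ?S i \<beta> = (\<Sum>i'<r. sys_C ?S' i i' * J i' \<beta>)"
      unfolding c'[OF *] by (intro sum.cong refl) (simp add: R'_def C'_def)
  qed (simp_all add: R'_def)
  then show ?thesis using R' rL L' by blast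
qed

lemma realizes_expr_mono:
  assumes "realizes_expr d s Y R r" "is_fm_real d s R'"
    "\<forall>M T V. is_val (\<lambda>c. c) d s M (fm_sys d s Y R) T V \<longrightarrow> is_val (\<lambda>c. c) d s M (fm_sys d s Y R') T V"
  shows "realizes_expr d s Y R' r"
  using assms unfolding realizes_expr_def by blast

text \<open>Either reduction keeps all values, so it would yield a realization of the same function
  with fewer states.\<close>

lemma minimal_controllable_observable:
  assumes F: "F \<in> nc_rat_funs d" and Y: "Y \<in> mat_tuples d s" and s: "1 \<le> s" and min: "fm_minimal d s Y R F"
  shows "controllable d s (fm_sys d s Y R) \<and> observable d s (fm_sys d s Y R)"
proof (rule ccontr)
  have real: "is_fm_real d s R" "\<forall>r\<in>F. realizes_expr d s Y R r"
    using min unfolding fm_minimal_def fm_realizes_iff[OF F Y s] by auto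
  assume "\<not> ?thesis"
  then obtain R' where R': "is_fm_real d s R'" "fm_L R' < fm_L R"
    "\<forall>M T V. is_val (\<lambda>c. c) d s M (fm_sys d s Y R) T V \<longrightarrow> is_val (\<lambda>c. c) d s M (fm_sys d s Y R') T V"
    using reduce_uncontrollable[OF real(1) Y] reduce_unobservable[OF real(1) Y] by blast
  then have "fm_realizes d s Y R' F"
    using real realizes_expr_mono unfolding fm_realizes_iff[OF F Y s] by blast
  then show False using min R'(2) unfolding fm_minimal_def by fastforce
qed

lemma controllable_observable_realization_exists:
  assumes Y: "Y \<in> mat_tuples d s" and R: "realizes_expr d s Y R r"
  shows "\<exists>R. realizes_expr d s Y R r \<and> controllable d s (fm_sys d s Y R) \<and> observable d s (fm_sys d s Y R)"
  using R
proof (induction "fm_L R" arbitrary: R rule: less_induct)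
  case less
  have real: "is_fm_real d s R" using less.prems by (simp add: realizes_expr_def)
  show ?case
  proof (cases "controllable d s (fm_sys d s Y R) \<and> observable d s (fm_sys d s Y R)")
    case False
    then obtain R' where R': "is_fm_real d s R'" "fm_L R' < fm_L R"
      "\<forall>M T V. is_val (\<lambda>c. c) d s M (fm_sys d s Y R) T V \<longrightarrow> is_val (\<lambda>c. c) d s M (fm_sys d s Y R') T V"
      using reduce_uncontrollable[OF real Y] reduce_unobservable[OF real Y] by blast
    show ?thesis by (rule less.hyps[OF R'(2) realizes_expr_mono[OF less.prems R'(1,3)]])
  qed (use less.prems in blast)
qed


section \<open>Expressions for the solution of a linear pencil\<close>

fun horner :: "nat \<Rightarrow> 'a::field mat \<Rightarrow> 'a list \<Rightarrow> 'a mat" where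
  "horner m A [] = 0\<^sub>m m m"
| "horner m A (c # cs) = c \<cdot>\<^sub>m 1\<^sub>m m + horner m A cs * A"

lemma horner_carrier [simp]: "A \<in> carrier_mat m m \<Longrightarrow> horner m A cs \<in> carrier_mat m m"
  by (induction cs) auto

lemma horner_index:
  assumes A: "A \<in> carrier_mat m m" and p: "p < m" "q < m"
  shows "horner m A (map c [0..<D]) $$ (p, q) = (\<Sum>i<D. c i * (A ^\<^sub>m i) $$ (p, q))"
  using p
proof (induction D arbitrary: c p q)
  case (Suc D)
  have e: "map c [0..<Suc D] = c 0 # map (\<lambda>i. c (Suc i)) [0..<D]"
    by (simp add: upt_conv_Cons map_Suc_upt[symmetric] del: upt_Suc)
  have "(horner m A (map (\<lambda>i. c (Suc i)) [0..<D]) * A) $$ (p, q) =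
      (\<Sum>l<m. (\<Sum>i<D. c (Suc i) * (A ^\<^sub>m i) $$ (p, l)) * A $$ (l, q))"
    unfolding mult_mat_index[OF horner_carrier[OF A] A Suc.prems]
    by (intro sum.cong refl) (simp only: Suc.IH Suc.prems lessThan_iff)
  also have "\<dots> = (\<Sum>i<D. c (Suc i) * (\<Sum>l<m. (A ^\<^sub>m i) $$ (p, l) * A $$ (l, q)))"
    unfolding sum_distrib_right sum_distrib_left by (subst sum.swap) (simp only: mult.assoc)
  also have "\<dots> = (\<Sum>i<D. c (Suc i) * (A ^\<^sub>m Suc i) $$ (p, q))"
    using A Suc.prems by (intro sum.cong refl) (simp add: mult_mat_index[OF pow_carrier_mat[OF A] A] del: index_mult_mat)
  finally have "(horner m A (map (\<lambda>i. c (Suc i)) [0..<D]) * A) $$ (p, q) = (\<Sum>i<D. c (Suc i) * (A ^\<^sub>m Suc i) $$ (p, q))" .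
  moreover have "horner m A (map c [0..<Suc D]) $$ (p, q) =
      (c 0 \<cdot>\<^sub>m 1\<^sub>m m) $$ (p, q) + (horner m A (map (\<lambda>i. c (Suc i)) [0..<D]) * A) $$ (p, q)"
    unfolding e horner.simps
    by (rule index_add_mat(1)) (use Suc.prems carrier_matD[OF horner_carrier[OF A]] carrier_matD[OF A] in \<open>simp_all del: index_mult_mat(1)\<close>)
  moreover have "(c 0 \<cdot>\<^sub>m 1\<^sub>m m) $$ (p, q) = c 0 * (A ^\<^sub>m 0) $$ (p, q)" using Suc.prems A by simp
  ultimately show ?case unfolding sum.lessThan_Suc_shift by simp
qed simp

text \<open>The inverse of a matrix is a polynomial in this matrix.\<close>

lemma inverse_in_subalgebra:
  fixes A :: "'a::field mat"
  assumes A: "A \<in> carrier_mat m m" "\<A> A" and nz: "det A \<noteq> 0"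
    and add: "\<And>B C. B \<in> carrier_mat m m \<Longrightarrow> C \<in> carrier_mat m m \<Longrightarrow> \<A> B \<Longrightarrow> \<A> C \<Longrightarrow> \<A> (B + C)"
    and mult: "\<And>B C. B \<in> carrier_mat m m \<Longrightarrow> C \<in> carrier_mat m m \<Longrightarrow> \<A> B \<Longrightarrow> \<A> C \<Longrightarrow> \<A> (B * C)"
    and scalar: "\<And>c. \<A> (c \<cdot>\<^sub>m 1\<^sub>m m)"
  shows "\<exists>W \<in> carrier_mat m m. \<A> W \<and> W * A = 1\<^sub>m m"
proof -
  have hA: "\<A> (horner m A cs)" for cs
  proof (induction cs)
    case Nil
    have "0\<^sub>m m m = (0 :: 'a) \<cdot>\<^sub>m 1\<^sub>m m" by (rule eq_matI) auto
    then show ?case using scalar[of 0] by simp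
  next
    case (Cons c cs)
    then show ?case
      unfolding horner.simps by (intro add scalar mult A) (use A mult_carrier_mat[OF horner_carrier[OF A(1)] A(1)] in auto)
  qed
  obtain A' where A': "A' \<in> carrier_mat m m" "A * A' = 1\<^sub>m m"
  proof -
    have "mat_inverse A \<noteq> None"
      using det_non_zero_imp_unit[OF A(1) nz, of "()"] mat_inverse(1)[OF A(1), of "()"] by auto
    then show thesis using that mat_inverse(2)[OF A(1)] by auto
  qed
  have cancel: "B = 0\<^sub>m m m" if "B \<in> carrier_mat m m" "B * A = 0\<^sub>m m m" for B
  proof -
    have "B * A * A' = B * (A * A')" by (rule assoc_mult_mat[OF that(1) A(1) A'(1)])
    then show ?thesis unfolding that(2) A'(2) using that(1) A'(1) by simp
  qed
  \<comment> \<open>A polynomial relation for \<open>A\<close>: zero constant terms are removed by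
    cancelling \<open>A\<close>, and a nonzero constant term exhibits the inverse as a polynomial in
    \<open>A\<close>.\<close>
  have "\<exists>W \<in> carrier_mat m m. \<A> W \<and> W * A = 1\<^sub>m m" if "horner m A cs = 0\<^sub>m m m" "\<exists>c \<in> set cs. c \<noteq> 0" for cs
    using that
  proof (induction cs)
    case (Cons c cs)
    note h = horner_carrier[OF A(1), of cs]
    have hA': "horner m A cs * A \<in> carrier_mat m m" by (rule mult_carrier_mat[OF h A(1)])
    show ?case
    proof (cases "c = 0")
      case True
      have "0 \<cdot>\<^sub>m 1\<^sub>m m = (0\<^sub>m m m :: 'a mat)" by (rule eq_matI) auto
      then have "horner m A cs * A = 0\<^sub>m m m" using Cons.prems(1) True hA' by simp
      then have "horner m A cs = 0\<^sub>m m m" by (rule cancel[OF h])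
      then show ?thesis using Cons True by auto
    next
      case False
      have "(- 1 / c) \<cdot>\<^sub>m (horner m A cs * A) = 1\<^sub>m m"
      proof (rule eq_matI)
        fix i j assume ij: "i < dim_row (1\<^sub>m m :: 'a mat)" "j < dim_col (1\<^sub>m m :: 'a mat)"
        have "(c \<cdot>\<^sub>m 1\<^sub>m m + horner m A cs * A) $$ (i, j) = 0" using Cons.prems(1) ij by simp
        then have "(horner m A cs * A) $$ (i, j) = - (c * 1\<^sub>m m $$ (i, j))"
          using ij carrier_matD[OF hA'] by (simp add: eq_neg_iff_add_eq_0 add.commute del: index_mult_mat(1))
        then show "((- 1 / c) \<cdot>\<^sub>m (horner m A cs * A)) $$ (i, j) = 1\<^sub>m m $$ (i, j)"
          using ij carrier_matD[OF hA'] False by (simp del: index_mult_mat(1))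
      qed (use carrier_matD[OF hA'] in simp_all)
      moreover have "(- 1 / c) \<cdot>\<^sub>m (horner m A cs * A) = ((- 1 / c) \<cdot>\<^sub>m horner m A cs) * A"
        by (rule mult_smult_assoc_mat[OF h A(1), symmetric])
      moreover have "(- 1 / c) \<cdot>\<^sub>m horner m A cs = ((- 1 / c) \<cdot>\<^sub>m 1\<^sub>m m) * horner m A cs"
        using mult_smult_assoc_mat[OF one_carrier_mat h, of "- 1 / c"] h by simp
      moreover have "\<A> (((- 1 / c) \<cdot>\<^sub>m 1\<^sub>m m) * horner m A cs)"
        by (rule mult[OF _ h scalar hA]) simp
      ultimately show ?thesis using h by (intro bexI[of _ "(- 1 / c) \<cdot>\<^sub>m horner m A cs"]) auto
    qed
  qed simp
  \<comment> \<open>The powers of \<open>A\<close> up to exponent \<open>m * m\<close> are one more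
    than the dimension of the matrix space, hence dependent.\<close>
  moreover obtain v where v: "\<exists>i<Suc (m * m). v i \<noteq> 0"
    "\<forall>p<m * m. (\<Sum>i<Suc (m * m). (A ^\<^sub>m i) $$ (p div m, p mod m) * v i) = 0"
    using kernel_nontrivial[of "m * m" "Suc (m * m)" "\<lambda>p i. (A ^\<^sub>m i) $$ (p div m, p mod m)"] by auto
  moreover have "horner m A (map v [0..<Suc (m * m)]) = 0\<^sub>m m m"
  proof (rule eq_matI)
    fix p q assume "p < dim_row (0\<^sub>m m m :: 'a mat)" "q < dim_col (0\<^sub>m m m :: 'a mat)"
    then have pq: "p < m" "q < m" by simp_all
    have "(\<Sum>i<Suc (m * m). (A ^\<^sub>m i) $$ (p, q) * v i) = 0"
      using v(2)[rule_format, OF block_index_less[OF pq]] pq by (simp del: sum.lessThan_Suc)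
    then show "horner m A (map v [0..<Suc (m * m)]) $$ (p, q) = 0\<^sub>m m m $$ (p, q)"
      unfolding horner_index[OF A(1) pq] using pq by (simp add: mult.commute del: sum.lessThan_Suc)
  qed (use horner_carrier[OF A(1), of "map v [0..<Suc (m * m)]"] in \<open>simp_all del: upt_Suc\<close>)
  moreover have "\<exists>c \<in> set (map v [0..<Suc (m * m)]). c \<noteq> 0"
    using v(1) by (auto simp del: upt_Suc)
  ultimately show ?thesis by blast
qed

section \<open>Sums of square matrices\<close>

definition msum :: "nat \<Rightarrow> (nat \<Rightarrow> 'a::comm_ring_1 mat) \<Rightarrow> nat \<Rightarrow> 'a mat" where
  "msum n f N = mat n n (\<lambda>ij. \<Sum>\<beta><N. f \<beta> $$ ij)"

lemma msum_carrier [simp]: "msum n f N \<in> carrier_mat n n"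
  by (simp add: msum_def)

lemma msum_index [simp]: "i < n \<Longrightarrow> j < n \<Longrightarrow> msum n f N $$ (i, j) = (\<Sum>\<beta><N. f \<beta> $$ (i, j))"
  by (simp add: msum_def)

lemma msum_Suc: "f N \<in> carrier_mat n n \<Longrightarrow> msum n f (Suc N) = msum n f N + f N"
  by (rule eq_matI) (auto simp: msum_def)

lemma msum_cong: "(\<And>\<beta>. \<beta> < N \<Longrightarrow> f \<beta> = g \<beta>) \<Longrightarrow> msum n f N = msum n g N"
  by (rule eq_matI) (auto simp: msum_def)

lemma msum_add:
  assumes "\<And>\<beta>. \<beta> < N \<Longrightarrow> f \<beta> \<in> carrier_mat n n" "\<And>\<beta>. \<beta> < N \<Longrightarrow> g \<beta> \<in> carrier_mat n n"
  shows "msum n (\<lambda>\<beta>. f \<beta> + g \<beta>) N = msum n f N + msum n g N"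
proof (rule eq_matI)
  fix i j assume "i < dim_row (msum n f N + msum n g N)" "j < dim_col (msum n f N + msum n g N)"
  then have ij: "i < n" "j < n" by (simp_all add: msum_def)
  have "(\<Sum>\<beta><N. (f \<beta> + g \<beta>) $$ (i, j)) = (\<Sum>\<beta><N. f \<beta> $$ (i, j) + g \<beta> $$ (i, j))"
    by (intro sum.cong refl) (use assms(2) ij in \<open>simp add: carrier_matD[OF assms(2)]\<close>)
  then show "msum n (\<lambda>\<beta>. f \<beta> + g \<beta>) N $$ (i, j) = (msum n f N + msum n g N) $$ (i, j)"
    using ij by (simp add: msum_def sum.distrib)
qed (simp_all add: msum_def)

lemma mult_msum:
  assumes A: "A \<in> carrier_mat n n" and f: "\<And>\<beta>. \<beta> < N \<Longrightarrow> f \<beta> \<in> carrier_mat n n"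
  shows "A * msum n f N = msum n (\<lambda>\<beta>. A * f \<beta>) N"
proof (rule eq_matI)
  fix i j assume "i < dim_row (msum n (\<lambda>\<beta>. A * f \<beta>) N)" "j < dim_col (msum n (\<lambda>\<beta>. A * f \<beta>) N)"
  then have ij: "i < n" "j < n" by (simp_all add: msum_def)
  have "(A * msum n f N) $$ (i, j) = (\<Sum>l<n. A $$ (i, l) * (\<Sum>\<beta><N. f \<beta> $$ (l, j)))"
    unfolding mult_mat_index[OF A msum_carrier ij] by (intro sum.cong refl) (simp add: ij)
  also have "\<dots> = (\<Sum>\<beta><N. \<Sum>l<n. A $$ (i, l) * f \<beta> $$ (l, j))"
    unfolding sum_distrib_left by (rule sum.swap)
  also have "\<dots> = (\<Sum>\<beta><N. (A * f \<beta>) $$ (i, j))"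
    by (intro sum.cong refl) (simp add: mult_mat_index[OF A f ij] del: index_mult_mat)
  finally show "(A * msum n f N) $$ (i, j) = msum n (\<lambda>\<beta>. A * f \<beta>) N $$ (i, j)" using ij by simp
qed (use A in \<open>simp_all add: msum_def\<close>)

lemma msum_mult:
  assumes A: "A \<in> carrier_mat n n" and f: "\<And>\<beta>. \<beta> < N \<Longrightarrow> f \<beta> \<in> carrier_mat n n"
  shows "msum n f N * A = msum n (\<lambda>\<beta>. f \<beta> * A) N"
proof (rule eq_matI)
  fix i j assume "i < dim_row (msum n (\<lambda>\<beta>. f \<beta> * A) N)" "j < dim_col (msum n (\<lambda>\<beta>. f \<beta> * A) N)"
  then have ij: "i < n" "j < n" by (simp_all add: msum_def)
  have "(msum n f N * A) $$ (i, j) = (\<Sum>l<n. (\<Sum>\<beta><N. f \<beta> $$ (i, l)) * A $$ (l, j))"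
    unfolding mult_mat_index[OF msum_carrier A ij] by (intro sum.cong refl) (simp add: ij)
  also have "\<dots> = (\<Sum>\<beta><N. \<Sum>l<n. f \<beta> $$ (i, l) * A $$ (l, j))"
    unfolding sum_distrib_right by (rule sum.swap)
  also have "\<dots> = (\<Sum>\<beta><N. (f \<beta> * A) $$ (i, j))"
    by (intro sum.cong refl) (simp add: mult_mat_index[OF f A ij] del: index_mult_mat)
  finally show "(msum n f N * A) $$ (i, j) = msum n (\<lambda>\<beta>. f \<beta> * A) N $$ (i, j)" using ij by simp
qed (use A in \<open>simp_all add: msum_def\<close>)

lemma msum_swap: "msum n (\<lambda>\<beta>. msum n (f \<beta>) M) N = msum n (\<lambda>\<gamma>. msum n (\<lambda>\<beta>. f \<beta> \<gamma>) N) M"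
proof (rule eq_matI)
  fix i j assume "i < dim_row (msum n (\<lambda>\<gamma>. msum n (\<lambda>\<beta>. f \<beta> \<gamma>) N) M)" "j < dim_col (msum n (\<lambda>\<gamma>. msum n (\<lambda>\<beta>. f \<beta> \<gamma>) N) M)"
  then have ij: "i < n" "j < n" by (simp_all add: msum_def)
  then show "msum n (\<lambda>\<beta>. msum n (f \<beta>) M) N $$ (i, j) = msum n (\<lambda>\<gamma>. msum n (\<lambda>\<beta>. f \<beta> \<gamma>) N) M $$ (i, j)"
    by simp (rule sum.swap)
qed (simp_all add: msum_def)

lemma mat_add_cancel:
  fixes A B C :: "'a::comm_ring_1 mat"
  assumes "A \<in> carrier_mat k l" "B \<in> carrier_mat k l"
  shows "A + B + - A = B" "A = A + B + - B" "- (A + - B) = - A + B"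
    and "C \<in> carrier_mat k l \<Longrightarrow> A + (- B + C) = A + C + - B"
    and "A + (B + - A) = B"
  using assms by (auto intro!: eq_matI)

lemma mult_uminus_mat:
  fixes A B :: "'a::comm_ring_1 mat"
  assumes "A \<in> carrier_mat n m" "B \<in> carrier_mat m k"
  shows "A * - B = - (A * B)"
  using assms by simp

section \<open>Functions given by expressions defined at a fixed point\<close>

locale eval_points =
  fixes d n :: nat and X :: "'a::field mat list"
  assumes X: "X \<in> mat_tuples d n"
begin

text \<open>\<Omega> collects the points where identities between functions are to hold, in all
  sizes; the distinguished \<open>X\<close> among them is where the expressions must be
  defined.\<close>

definition points :: "(nat \<times> 'a mat list) set \<Rightarrow> bool" where
  "points \<Omega> \<longleftrightarrow> (n, X) \<in> \<Omega> \<and> (\<forall>(n', Z) \<in> \<Omega>. Z \<in> mat_tuples d n')"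

text \<open>\<open>f\<close> is given, on \<open>\<Omega>\<close>, by an expression that is defined at \<open>X\<close>.\<close>

definition expressible :: "(nat \<times> 'a mat list) set \<Rightarrow> (nat \<Rightarrow> 'a mat list \<Rightarrow> 'a mat) \<Rightarrow> bool" where
  "expressible \<Omega> f \<longleftrightarrow> (\<forall>n' Z. (n', Z) \<in> \<Omega> \<longrightarrow> f n' Z \<in> carrier_mat n' n') \<and>
     (\<exists>r. nc_vars r \<subseteq> {..<d} \<and> nc_eval (\<lambda>c. c) n X r = Some (f n X) \<and>
        (\<forall>n' Z V. (n', Z) \<in> \<Omega> \<longrightarrow> nc_eval (\<lambda>c. c) n' Z r = Some V \<longrightarrow> V = f n' Z))"

lemma expressible_carrier: "expressible \<Omega> f \<Longrightarrow> (n', Z) \<in> \<Omega> \<Longrightarrow> f n' Z \<in> carrier_mat n' n'"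
  by (auto simp: expressible_def)

lemma expressibleI:
  assumes "nc_vars r \<subseteq> {..<d}" "nc_eval (\<lambda>c. c) n X r = Some (f n X)"
    and "\<And>n' Z V. (n', Z) \<in> \<Omega> \<Longrightarrow> nc_eval (\<lambda>c. c) n' Z r = Some V \<Longrightarrow> V = f n' Z"
    and "\<And>n' Z. (n', Z) \<in> \<Omega> \<Longrightarrow> f n' Z \<in> carrier_mat n' n'"
  shows "expressible \<Omega> f"
  unfolding expressible_def using assms by blast

lemma expressibleE:
  assumes "expressible \<Omega> f"
  obtains r where "nc_vars r \<subseteq> {..<d}" "nc_eval (\<lambda>c. c) n X r = Some (f n X)"
    "\<forall>n' Z V. (n', Z) \<in> \<Omega> \<longrightarrow> nc_eval (\<lambda>c. c) n' Z r = Some V \<longrightarrow> V = f n' Z"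
  using assms unfolding expressible_def by blast

lemma expressible_cong:
  assumes \<Omega>: "points \<Omega>" and f: "expressible \<Omega> f" and eq: "\<And>n' Z. (n', Z) \<in> \<Omega> \<Longrightarrow> f n' Z = g n' Z"
  shows "expressible \<Omega> g"
proof -
  obtain r where r: "nc_vars r \<subseteq> {..<d}" "nc_eval (\<lambda>c. c) n X r = Some (f n X)"
    "\<forall>n' Z V. (n', Z) \<in> \<Omega> \<longrightarrow> nc_eval (\<lambda>c. c) n' Z r = Some V \<longrightarrow> V = f n' Z"
    using f by (elim expressibleE) (rule that)
  show ?thesis
  proof (rule expressibleI[OF r(1)])
    show "nc_eval (\<lambda>c. c) n X r = Some (g n X)" using r(2) eq[of n X] \<Omega> by (simp add: points_def)
    fix n' Z assume z: "(n', Z) \<in> \<Omega>"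
    show "g n' Z \<in> carrier_mat n' n'" using expressible_carrier[OF f z] eq[OF z] by simp
    fix V assume "nc_eval (\<lambda>c. c) n' Z r = Some V"
    then show "V = g n' Z" using r(3)[rule_format, OF z] eq[OF z] by simp
  qed
qed

lemma expressible_subset: "expressible \<Omega> f \<Longrightarrow> \<Omega>' \<subseteq> \<Omega> \<Longrightarrow> expressible \<Omega>' f"
  unfolding expressible_def by (meson subsetD)

lemma expressible_const: "expressible \<Omega> (\<lambda>n' Z. c \<cdot>\<^sub>m 1\<^sub>m n')"
  by (rule expressibleI[of "Const c"]) auto

lemma expressible_var: "points \<Omega> \<Longrightarrow> k < d \<Longrightarrow> expressible \<Omega> (\<lambda>n' Z. Z ! k)"
  by (rule expressibleI[of "Var k"]) (auto simp: points_def intro: mat_tuplesD(2))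

lemma expressible_add:
  assumes f: "expressible \<Omega> f" and g: "expressible \<Omega> g"
  shows "expressible \<Omega> (\<lambda>n' Z. f n' Z + g n' Z)"
proof -
  obtain r1 where r1: "nc_vars r1 \<subseteq> {..<d}" "nc_eval (\<lambda>c. c) n X r1 = Some (f n X)"
    "\<forall>n' Z V. (n', Z) \<in> \<Omega> \<longrightarrow> nc_eval (\<lambda>c. c) n' Z r1 = Some V \<longrightarrow> V = f n' Z" using f by (elim expressibleE) (rule that)
  obtain r2 where r2: "nc_vars r2 \<subseteq> {..<d}" "nc_eval (\<lambda>c. c) n X r2 = Some (g n X)"
    "\<forall>n' Z V. (n', Z) \<in> \<Omega> \<longrightarrow> nc_eval (\<lambda>c. c) n' Z r2 = Some V \<longrightarrow> V = g n' Z" using g by (elim expressibleE) (rule that)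
  show ?thesis
  proof (rule expressibleI[of "Add r1 r2"])
    fix n' Z V assume z: "(n', Z) \<in> \<Omega>" and "nc_eval (\<lambda>c. c) n' Z (Add r1 r2) = Some V"
    then obtain V1 V2 where "nc_eval (\<lambda>c. c) n' Z r1 = Some V1" "nc_eval (\<lambda>c. c) n' Z r2 = Some V2" "V = V1 + V2"
      by (auto simp: bind_eq_Some_conv)
    then show "V = f n' Z + g n' Z" using r1(3)[rule_format, OF z] r2(3)[rule_format, OF z] by simp
  qed (use r1(1,2) r2(1,2) in \<open>auto intro: add_carrier_mat expressible_carrier[OF g]\<close>)
qed

lemma expressible_mult:
  assumes f: "expressible \<Omega> f" and g: "expressible \<Omega> g"
  shows "expressible \<Omega> (\<lambda>n' Z. f n' Z * g n' Z)"
proof -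
  obtain r1 where r1: "nc_vars r1 \<subseteq> {..<d}" "nc_eval (\<lambda>c. c) n X r1 = Some (f n X)"
    "\<forall>n' Z V. (n', Z) \<in> \<Omega> \<longrightarrow> nc_eval (\<lambda>c. c) n' Z r1 = Some V \<longrightarrow> V = f n' Z" using f by (elim expressibleE) (rule that)
  obtain r2 where r2: "nc_vars r2 \<subseteq> {..<d}" "nc_eval (\<lambda>c. c) n X r2 = Some (g n X)"
    "\<forall>n' Z V. (n', Z) \<in> \<Omega> \<longrightarrow> nc_eval (\<lambda>c. c) n' Z r2 = Some V \<longrightarrow> V = g n' Z" using g by (elim expressibleE) (rule that)
  show ?thesis
  proof (rule expressibleI[of "Mult r1 r2"])
    fix n' Z assume z: "(n', Z) \<in> \<Omega>"
    show "f n' Z * g n' Z \<in> carrier_mat n' n'"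
      by (rule mult_carrier_mat[OF expressible_carrier[OF f z] expressible_carrier[OF g z]])
    fix V assume "nc_eval (\<lambda>c. c) n' Z (Mult r1 r2) = Some V"
    then obtain V1 V2 where "nc_eval (\<lambda>c. c) n' Z r1 = Some V1" "nc_eval (\<lambda>c. c) n' Z r2 = Some V2" "V = V1 * V2"
      by (auto simp: bind_eq_Some_conv)
    then show "V = f n' Z * g n' Z" using r1(3)[rule_format, OF z] r2(3)[rule_format, OF z] by simp
  qed (use r1(1,2) r2(1,2) in auto)
qed

lemma expressible_inverse:
  assumes f: "expressible \<Omega> f" and inv: "\<And>n' Z. (n', Z) \<in> \<Omega> \<Longrightarrow> mat_inverse (f n' Z) \<noteq> None" and \<Omega>: "points \<Omega>"
  shows "expressible \<Omega> (\<lambda>n' Z. the (mat_inverse (f n' Z)))"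
proof -
  obtain r1 where r1: "nc_vars r1 \<subseteq> {..<d}" "nc_eval (\<lambda>c. c) n X r1 = Some (f n X)"
    "\<forall>n' Z V. (n', Z) \<in> \<Omega> \<longrightarrow> nc_eval (\<lambda>c. c) n' Z r1 = Some V \<longrightarrow> V = f n' Z" using f by (elim expressibleE) (rule that)
  have "mat_inverse (f n X) \<noteq> None" using inv[of n X] \<Omega> by (simp add: points_def)
  then obtain B where B: "mat_inverse (f n X) = Some B" by auto
  show ?thesis
  proof (rule expressibleI[of "Inv r1"])
    fix n' Z assume z: "(n', Z) \<in> \<Omega>"
    obtain B where B: "mat_inverse (f n' Z) = Some B" using inv[OF z] by auto
    show "the (mat_inverse (f n' Z)) \<in> carrier_mat n' n'"
      using mat_inverse(2)[OF expressible_carrier[OF f z] B] B by simp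
    fix V assume "nc_eval (\<lambda>c. c) n' Z (Inv r1) = Some V"
    then obtain V1 where "nc_eval (\<lambda>c. c) n' Z r1 = Some V1" "mat_inverse V1 = Some V" by (auto simp: bind_eq_Some_conv)
    then show "V = the (mat_inverse (f n' Z))" using r1(3)[rule_format, OF z] by simp
  qed (use r1(1,2) B in auto)
qed

text \<open>Adding \<open>0 * f^-1\<close> leaves the value alone but makes the expression undefined
  where \<open>f\<close> is singular. An identity known only where \<open>f\<close> is invertible
  thereby becomes one on all of \<Omega>.\<close>

lemma expressible_restrict:
  assumes \<Omega>: "points \<Omega>" and f: "expressible \<Omega> f" "mat_inverse (f n X) \<noteq> None"
    and g: "expressible {(n', Z) \<in> \<Omega>. mat_inverse (f n' Z) \<noteq> None} g"
    and c: "\<And>n' Z. (n', Z) \<in> \<Omega> \<Longrightarrow> g n' Z \<in> carrier_mat n' n'"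
  shows "expressible \<Omega> g"
proof -
  obtain r1 where r1: "nc_vars r1 \<subseteq> {..<d}" "nc_eval (\<lambda>c. c) n X r1 = Some (f n X)"
    "\<forall>n' Z V. (n', Z) \<in> \<Omega> \<longrightarrow> nc_eval (\<lambda>c. c) n' Z r1 = Some V \<longrightarrow> V = f n' Z" using f(1) by (elim expressibleE) (rule that)
  obtain r2 where r2: "nc_vars r2 \<subseteq> {..<d}" "nc_eval (\<lambda>c. c) n X r2 = Some (g n X)"
    "\<forall>n' Z V. (n', Z) \<in> {(n', Z) \<in> \<Omega>. mat_inverse (f n' Z) \<noteq> None} \<longrightarrow> nc_eval (\<lambda>c. c) n' Z r2 = Some V \<longrightarrow> V = g n' Z"
    using g by (elim expressibleE) (rule that)
  have pt: "(n, X) \<in> \<Omega>" using \<Omega> by (simp add: points_def)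
  have zero: "A + (0 \<cdot>\<^sub>m 1\<^sub>m k) * B = A" if "A \<in> carrier_mat k k" "B \<in> carrier_mat k k" for A B :: "'a mat" and k
    using that by (simp add: mult_smult_assoc_mat[OF one_carrier_mat that(2)]) (rule eq_matI; auto)
  obtain B where B: "mat_inverse (f n X) = Some B" using f(2) by auto
  have Bc: "B \<in> carrier_mat n n" using mat_inverse(2)[OF expressible_carrier[OF f(1) pt] B] by simp
  show ?thesis
  proof (rule expressibleI[of "Add r2 (Mult (Const 0) (Inv r1))"])
    show "nc_eval (\<lambda>c. c) n X (Add r2 (Mult (Const 0) (Inv r1))) = Some (g n X)"
      using r1(2) r2(2) B zero[OF c[OF pt] Bc] by simp
    fix n' Z V assume z: "(n', Z) \<in> \<Omega>" and V: "nc_eval (\<lambda>c. c) n' Z (Add r2 (Mult (Const 0) (Inv r1))) = Some V"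
    obtain V2 V1 V3 where *: "nc_eval (\<lambda>c. c) n' Z r2 = Some V2" "nc_eval (\<lambda>c. c) n' Z r1 = Some V1"
      "mat_inverse V1 = Some V3" "V = V2 + (0 \<cdot>\<^sub>m 1\<^sub>m n') * V3"
      using V by (auto simp: bind_eq_Some_conv)
    have V1: "V1 = f n' Z" by (rule r1(3)[rule_format, OF z *(2)])
    have V2: "V2 = g n' Z" by (rule r2(3)[rule_format, OF _ *(1)]) (use *(3) V1 z in simp)
    have "mat_inverse (f n' Z) = Some V3" using *(3) V1 by simp
    then have "V3 \<in> carrier_mat n' n'" using mat_inverse(2)[OF expressible_carrier[OF f(1) z]] by simp
    then show "V = g n' Z" unfolding *(4) V2 by (rule zero[OF c[OF z]])
  qed (use r1(1) r2(1) c in auto)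
qed

lemma expressible_msum:
  assumes \<Omega>: "points \<Omega>" and f: "\<And>\<beta>. \<beta> < N \<Longrightarrow> expressible \<Omega> (f \<beta>)"
  shows "expressible \<Omega> (\<lambda>n' Z. msum n' (\<lambda>\<beta>. f \<beta> n' Z) N)"
  using f
proof (induction N)
  case 0
  show ?case
    by (rule expressible_cong[OF \<Omega> expressible_const[of _ 0]]) (rule eq_matI; simp add: msum_def)
next
  case (Suc N)
  have "expressible \<Omega> (\<lambda>n' Z. msum n' (\<lambda>\<beta>. f \<beta> n' Z) N + f N n' Z)"
    by (rule expressible_add[OF Suc.IH Suc.prems]) (use Suc.prems in simp_all)
  then show ?case
    by (rule expressible_cong[OF \<Omega>]) (simp add: msum_Suc expressible_carrier[OF Suc.prems])
qed

abbreviation "neg n' A \<equiv> ((- 1) \<cdot>\<^sub>m 1\<^sub>m n') * (A :: 'a mat)"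

lemma neg_eq: "A \<in> carrier_mat k k \<Longrightarrow> neg k A = - A"
  by (simp add: mult_smult_assoc_mat[OF one_carrier_mat]) (rule eq_matI; auto)

lemma expressible_gauss:
  assumes "points \<Omega>"
    and "\<And>\<alpha> \<beta>. \<alpha> < N \<Longrightarrow> \<beta> < N \<Longrightarrow> expressible \<Omega> (E \<alpha> \<beta>)" "\<And>\<alpha>. \<alpha> < N \<Longrightarrow> expressible \<Omega> (f \<alpha>)"
    and "\<And>\<alpha> \<beta>. \<alpha> < N \<Longrightarrow> \<beta> < N \<Longrightarrow> E \<alpha> \<beta> n X = (if \<alpha> = \<beta> then 1\<^sub>m n else 0\<^sub>m n n)"
    and "\<And>\<beta> n' Z. \<beta> < N \<Longrightarrow> (n', Z) \<in> \<Omega> \<Longrightarrow> u \<beta> n' Z \<in> carrier_mat n' n'"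
    and "\<And>\<alpha> n' Z. \<alpha> < N \<Longrightarrow> (n', Z) \<in> \<Omega> \<Longrightarrow> msum n' (\<lambda>\<beta>. E \<alpha> \<beta> n' Z * u \<beta> n' Z) N = f \<alpha> n' Z"
    and "\<beta> < N"
  shows "expressible \<Omega> (u \<beta>)"
  using assms
proof (induction N arbitrary: \<Omega> E f \<beta>)
  case (Suc N)
  note pts = Suc.prems(1) and E = Suc.prems(2) and f = Suc.prems(3) and EX = Suc.prems(4) and u = Suc.prems(5) and eq = Suc.prems(6)
  define p where "p = E N N"
  define \<Omega>' where "\<Omega>' = {(n', Z) \<in> \<Omega>. mat_inverse (p n' Z) \<noteq> None}"
  have pE: "expressible \<Omega> p" using E[of N N] by (simp add: p_def)
  have "mat_inverse (1\<^sub>m n) = Some (1\<^sub>m n :: 'a mat)" by (simp add: mat_inverse_eq_Some_iff[OF one_carrier_mat])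
  then have pX: "mat_inverse (p n X) \<noteq> None" using EX[of N N] by (simp add: p_def)
  have sub: "\<Omega>' \<subseteq> \<Omega>" by (auto simp: \<Omega>'_def)
  have pts': "points \<Omega>'" using pts pX by (auto simp: points_def \<Omega>'_def)
  define I where "I n' Z = the (mat_inverse (p n' Z))" for n' Z
  have IE: "expressible \<Omega>' I"
    unfolding I_def by (rule expressible_inverse[OF expressible_subset[OF pE sub] _ pts']) (simp add: \<Omega>'_def)
  have Ip: "I n' Z * p n' Z = 1\<^sub>m n'" if z: "(n', Z) \<in> \<Omega>'" for n' Z
  proof -
    obtain B where B: "mat_inverse (p n' Z) = Some B" using z by (auto simp: \<Omega>'_def)
    have z': "(n', Z) \<in> \<Omega>" using z sub by auto
    show ?thesis using mat_inverse(2)[OF expressible_carrier[OF pE z'] B] by (simp add: I_def B)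
  qed
  \<comment> \<open>Schur complement of the pivot: the last unknown is eliminated from the other
    equations.\<close>
  define E' where "E' \<alpha> \<beta> n' Z = E \<alpha> \<beta> n' Z + neg n' (E \<alpha> N n' Z * (I n' Z * E N \<beta> n' Z))" for \<alpha> \<beta> n' Z
  define f' where "f' \<alpha> n' Z = f \<alpha> n' Z + neg n' (E \<alpha> N n' Z * (I n' Z * f N n' Z))" for \<alpha> n' Z
  have E\<Omega>': "expressible \<Omega>' (E \<alpha> \<beta>)" if "\<alpha> < Suc N" "\<beta> < Suc N" for \<alpha> \<beta> by (rule expressible_subset[OF E[OF that] sub])
  have f\<Omega>': "expressible \<Omega>' (f \<alpha>)" if "\<alpha> < Suc N" for \<alpha> by (rule expressible_subset[OF f[OF that] sub])
  have E'E: "expressible \<Omega>' (E' \<alpha> \<beta>)" if "\<alpha> < N" "\<beta> < N" for \<alpha> \<beta>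
    unfolding E'_def using that by (intro expressible_add expressible_mult expressible_const IE E\<Omega>') auto
  have f'E: "expressible \<Omega>' (f' \<alpha>)" if "\<alpha> < N" for \<alpha>
    unfolding f'_def using that by (intro expressible_add expressible_mult expressible_const IE E\<Omega>' f\<Omega>') auto
  have E'X: "E' \<alpha> \<beta> n X = (if \<alpha> = \<beta> then 1\<^sub>m n else 0\<^sub>m n n)" if "\<alpha> < N" "\<beta> < N" for \<alpha> \<beta>
  proof -
    have pt: "(n, X) \<in> \<Omega>'" using pts' by (simp add: points_def)
    have c: "I n X * E N \<beta> n X \<in> carrier_mat n n"
      by (rule mult_carrier_mat[OF expressible_carrier[OF IE pt] expressible_carrier[OF E\<Omega>' pt]]) (use that in auto)
    have "E \<alpha> N n X * (I n X * E N \<beta> n X) = 0\<^sub>m n n" using left_mult_zero_mat[OF c] EX[of \<alpha> N] that by simp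
    then have "E' \<alpha> \<beta> n X = E \<alpha> \<beta> n X + neg n (0\<^sub>m n n)" by (simp only: E'_def)
    also have "\<dots> = E \<alpha> \<beta> n X"
      using EX[of \<alpha> \<beta>] that by (subst neg_eq[OF zero_carrier_mat]) (auto intro!: eq_matI split: if_splits)
    finally show ?thesis using EX[of \<alpha> \<beta>] that by simp
  qed
  define S where "S \<alpha> n' Z = msum n' (\<lambda>\<beta>. E \<alpha> \<beta> n' Z * u \<beta> n' Z) N" for \<alpha> n' Z
  have S: "S \<alpha> n' Z + E \<alpha> N n' Z * u N n' Z = f \<alpha> n' Z" if "\<alpha> < Suc N" "(n', Z) \<in> \<Omega>'" for \<alpha> n' Z
  proof -
    have z: "(n', Z) \<in> \<Omega>" using that(2) sub by auto
    have "E \<alpha> N n' Z * u N n' Z \<in> carrier_mat n' n'"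
      by (rule mult_carrier_mat[OF expressible_carrier[OF E z] u[OF _ z]]) (use that in auto)
    then show ?thesis using eq[OF that(1) z] by (simp add: S_def msum_Suc)
  qed
  have uN: "u N n' Z = I n' Z * (f N n' Z + neg n' (S N n' Z))" and IS: "I n' Z * S N n' Z = I n' Z * f N n' Z + - u N n' Z"
    if z: "(n', Z) \<in> \<Omega>'" for n' Z
  proof -
    have z': "(n', Z) \<in> \<Omega>" using z sub by auto
    note Ic = expressible_carrier[OF IE z] and pc = expressible_carrier[OF pE z'] and uc = u[OF lessI z'] and fc = expressible_carrier[OF f[OF lessI] z']
    have Sc: "S N n' Z \<in> carrier_mat n' n'" by (simp add: S_def)
    have puc: "p n' Z * u N n' Z \<in> carrier_mat n' n'" by (rule mult_carrier_mat[OF pc uc])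
    have e: "S N n' Z + p n' Z * u N n' Z = f N n' Z" using S[OF lessI z] by (simp add: p_def)
    have Ipu: "I n' Z * (p n' Z * u N n' Z) = u N n' Z"
      using assoc_mult_mat[OF Ic pc uc] Ip[OF z] uc by simp
    have "f N n' Z + - S N n' Z = p n' Z * u N n' Z"
      unfolding e[symmetric] by (rule mat_add_cancel(1)[OF Sc puc])
    then show "u N n' Z = I n' Z * (f N n' Z + neg n' (S N n' Z))" using Ipu by (simp add: neg_eq[OF Sc])
    have "I n' Z * f N n' Z = I n' Z * S N n' Z + u N n' Z"
      unfolding e[symmetric] mult_add_distrib_mat[OF Ic Sc puc] Ipu ..
    then show "I n' Z * S N n' Z = I n' Z * f N n' Z + - u N n' Z"
      using mat_add_cancel(2)[OF mult_carrier_mat[OF Ic Sc] uc] by simp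
  qed
  have eq': "msum n' (\<lambda>\<beta>. E' \<alpha> \<beta> n' Z * u \<beta> n' Z) N = f' \<alpha> n' Z" if \<alpha>: "\<alpha> < N" and z: "(n', Z) \<in> \<Omega>'" for \<alpha> n' Z
  proof -
    have z': "(n', Z) \<in> \<Omega>" using z sub by auto
    have Ec: "E \<alpha> \<beta> n' Z \<in> carrier_mat n' n'" if "\<alpha> < Suc N" "\<beta> < Suc N" for \<alpha> \<beta> by (rule expressible_carrier[OF E[OF that] z'])
    have uc: "u \<beta> n' Z \<in> carrier_mat n' n'" if "\<beta> < Suc N" for \<beta> by (rule u[OF that z'])
    note Ic = expressible_carrier[OF IE z]
    have fc: "f N n' Z \<in> carrier_mat n' n'" by (rule expressible_carrier[OF f[OF lessI] z'])
    have ENc: "E \<alpha> N n' Z \<in> carrier_mat n' n'" using Ec \<alpha> by simp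
    have mc: "((- 1) \<cdot>\<^sub>m 1\<^sub>m n' :: 'a mat) \<in> carrier_mat n' n'" by simp
    have tm: "E' \<alpha> \<beta> n' Z * u \<beta> n' Z = E \<alpha> \<beta> n' Z * u \<beta> n' Z + neg n' (E \<alpha> N n' Z * (I n' Z * (E N \<beta> n' Z * u \<beta> n' Z)))"
      if "\<beta> < N" for \<beta>
    proof -
      have b: "\<alpha> < Suc N" "\<beta> < Suc N" "N < Suc N" using that \<alpha> by auto
      note c1 = mult_carrier_mat[OF Ic Ec[OF b(3,2)]]
      note c2 = mult_carrier_mat[OF ENc c1]
      note c3 = mult_carrier_mat[OF mc c2]
      show ?thesis
        unfolding E'_def add_mult_distrib_mat[OF Ec[OF b(1,2)] c3 uc[OF b(2)]] assoc_mult_mat[OF mc c2 uc[OF b(2)]]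
          assoc_mult_mat[OF ENc c1 uc[OF b(2)]] assoc_mult_mat[OF Ic Ec[OF b(3,2)] uc[OF b(2)]] ..
    qed
    have c: "E N \<beta> n' Z * u \<beta> n' Z \<in> carrier_mat n' n'" "E \<alpha> \<beta> n' Z * u \<beta> n' Z \<in> carrier_mat n' n'" if "\<beta> < N" for \<beta>
      using that \<alpha> by (auto intro!: mult_carrier_mat[OF Ec uc])
    have "msum n' (\<lambda>\<beta>. E' \<alpha> \<beta> n' Z * u \<beta> n' Z) N =
        msum n' (\<lambda>\<beta>. E \<alpha> \<beta> n' Z * u \<beta> n' Z + neg n' (E \<alpha> N n' Z * (I n' Z * (E N \<beta> n' Z * u \<beta> n' Z)))) N"
      by (rule msum_cong) (rule tm)
    also have "\<dots> = S \<alpha> n' Z + msum n' (\<lambda>\<beta>. neg n' (E \<alpha> N n' Z * (I n' Z * (E N \<beta> n' Z * u \<beta> n' Z)))) N"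
      unfolding S_def
      by (rule msum_add[OF c(2)]) (use c in \<open>auto intro!: mult_carrier_mat[OF mc] mult_carrier_mat[OF ENc] mult_carrier_mat[OF Ic]\<close>)
    also have "msum n' (\<lambda>\<beta>. neg n' (E \<alpha> N n' Z * (I n' Z * (E N \<beta> n' Z * u \<beta> n' Z)))) N = neg n' (E \<alpha> N n' Z * (I n' Z * S N n' Z))"
    proof -
      have 1: "I n' Z * S N n' Z = msum n' (\<lambda>\<beta>. I n' Z * (E N \<beta> n' Z * u \<beta> n' Z)) N"
        unfolding S_def by (rule mult_msum[OF Ic c(1)])
      have 2: "E \<alpha> N n' Z * (I n' Z * S N n' Z) = msum n' (\<lambda>\<beta>. E \<alpha> N n' Z * (I n' Z * (E N \<beta> n' Z * u \<beta> n' Z))) N"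
        unfolding 1 by (rule mult_msum[OF ENc mult_carrier_mat[OF Ic c(1)]])
      show ?thesis unfolding 2 by (rule mult_msum[OF mc mult_carrier_mat[OF ENc mult_carrier_mat[OF Ic c(1)]], symmetric])
    qed
    also have "\<dots> = neg n' (E \<alpha> N n' Z * (I n' Z * f N n' Z)) + E \<alpha> N n' Z * u N n' Z"
    proof -
      note c1 = mult_carrier_mat[OF Ic fc] and c2 = uc[OF lessI]
      have c2': "- u N n' Z \<in> carrier_mat n' n'" using c2 by simp
      note c3 = mult_carrier_mat[OF ENc c1] and c4 = mult_carrier_mat[OF ENc c2]
      have "E \<alpha> N n' Z * (I n' Z * S N n' Z) = E \<alpha> N n' Z * (I n' Z * f N n' Z) + - (E \<alpha> N n' Z * u N n' Z)"
        unfolding IS[OF z] mult_add_distrib_mat[OF ENc c1 c2'] mult_uminus_mat[OF ENc c2] ..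
      then have "neg n' (E \<alpha> N n' Z * (I n' Z * S N n' Z)) = - (E \<alpha> N n' Z * (I n' Z * f N n' Z) + - (E \<alpha> N n' Z * u N n' Z))"
        using neg_eq[of "E \<alpha> N n' Z * (I n' Z * f N n' Z) + - (E \<alpha> N n' Z * u N n' Z)" n'] c3 c4 by simp
      then show ?thesis unfolding neg_eq[OF c3] mat_add_cancel(3)[OF c3 c4] .
    qed
    also have "S \<alpha> n' Z + (neg n' (E \<alpha> N n' Z * (I n' Z * f N n' Z)) + E \<alpha> N n' Z * u N n' Z) = f' \<alpha> n' Z"
    proof -
      note c3 = mult_carrier_mat[OF ENc mult_carrier_mat[OF Ic fc]] and c4 = mult_carrier_mat[OF ENc uc[OF lessI]]
      have Sc: "S \<alpha> n' Z \<in> carrier_mat n' n'" by (simp add: S_def)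
      have e: "S \<alpha> n' Z + E \<alpha> N n' Z * u N n' Z = f \<alpha> n' Z" using S[OF _ z, of \<alpha>] \<alpha> by simp
      show ?thesis
        unfolding f'_def e[symmetric] neg_eq[OF c3] by (rule mat_add_cancel(4)[OF Sc c3 c4])
    qed
    finally show ?thesis .
  qed
  have IH: "expressible \<Omega>' (u \<beta>)" if "\<beta> < N" for \<beta>
    by (rule Suc.IH[OF pts' E'E f'E E'X _ eq' that]) (use u sub in auto)
  have "expressible \<Omega>' (u N)"
  proof (rule expressible_cong[OF pts'])
    have "expressible \<Omega>' (\<lambda>n' Z. msum n' (\<lambda>\<beta>. E N \<beta> n' Z * u \<beta> n' Z) N)"
      by (rule expressible_msum[OF pts']) (use IH E\<Omega>' in \<open>auto intro!: expressible_mult\<close>)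
    then show "expressible \<Omega>' (\<lambda>n' Z. I n' Z * (f N n' Z + neg n' (S N n' Z)))"
      unfolding S_def by (intro expressible_add expressible_mult expressible_const IE f\<Omega>' lessI)
  qed (simp add: uN)
  then have "expressible \<Omega>' (u \<beta>)" using IH Suc.prems(7) by (cases "\<beta> = N") auto
  then show ?case
    by (intro expressible_restrict[OF pts pE pX]) (use u Suc.prems(7) in \<open>simp_all add: \<Omega>'_def\<close>)
qed simp

text \<open>An invertible block matrix may have only singular blocks, so direct elimination could
  fail at \<open>X\<close>. Its inverse at \<open>X\<close> is a polynomial in it, hence has blocks
  that are values of expressible functions; multiplying the system by those functions makes it the
  identity at \<open>X\<close>.\<close>

theorem expressible_solution:
  assumes pts: "points \<Omega>"
    and E: "\<And>\<alpha> \<beta>. \<alpha> < N \<Longrightarrow> \<beta> < N \<Longrightarrow> expressible \<Omega> (E \<alpha> \<beta>)" and f: "\<And>\<alpha>. \<alpha> < N \<Longrightarrow> expressible \<Omega> (f \<alpha>)"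
    and u: "\<And>\<beta> n' Z. \<beta> < N \<Longrightarrow> (n', Z) \<in> \<Omega> \<Longrightarrow> u \<beta> n' Z \<in> carrier_mat n' n'"
    and eq: "\<And>\<alpha> n' Z. \<alpha> < N \<Longrightarrow> (n', Z) \<in> \<Omega> \<Longrightarrow> msum n' (\<lambda>\<beta>. E \<alpha> \<beta> n' Z * u \<beta> n' Z) N = f \<alpha> n' Z"
    and \<Lambda>: "\<Lambda> \<in> carrier_mat (n * N) (n * N)" "det \<Lambda> \<noteq> 0"
    and \<Lambda>E: "\<And>P Q \<alpha> \<beta>. P < n \<Longrightarrow> Q < n \<Longrightarrow> \<alpha> < N \<Longrightarrow> \<beta> < N \<Longrightarrow> \<Lambda> $$ (P * N + \<alpha>, Q * N + \<beta>) = E \<alpha> \<beta> n X $$ (P, Q)"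
    and \<beta>: "\<beta> < N"
  shows "expressible \<Omega> (u \<beta>)"
proof -
  have pt: "(n, X) \<in> \<Omega>" using pts by (simp add: points_def)
  \<comment> \<open>The subalgebra of matrices whose blocks are values at \<open>X\<close> of
    expressible functions.\<close>
  define \<A> where "\<A> B \<longleftrightarrow> (\<exists>g. (\<forall>\<alpha><N. \<forall>\<beta><N. expressible \<Omega> (g \<alpha> \<beta>)) \<and>
    (\<forall>P<n. \<forall>Q<n. \<forall>\<alpha><N. \<forall>\<beta><N. B $$ (P * N + \<alpha>, Q * N + \<beta>) = g \<alpha> \<beta> n X $$ (P, Q)))" for B
  have "\<exists>W \<in> carrier_mat (n * N) (n * N). \<A> W \<and> W * \<Lambda> = 1\<^sub>m (n * N)"
  proof (rule inverse_in_subalgebra[OF \<Lambda>(1) _ \<Lambda>(2)])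
    show "\<A> \<Lambda>" unfolding \<A>_def by (intro exI[of _ E]) (simp add: E \<Lambda>E)
  next
    fix B C assume BC: "B \<in> carrier_mat (n * N) (n * N)" "C \<in> carrier_mat (n * N) (n * N)" and "\<A> B" "\<A> C"
    obtain g where g': "\<forall>\<alpha><N. \<forall>\<beta><N. expressible \<Omega> (g \<alpha> \<beta>)"
      "\<forall>P<n. \<forall>Q<n. \<forall>\<alpha><N. \<forall>\<beta><N. B $$ (P * N + \<alpha>, Q * N + \<beta>) = g \<alpha> \<beta> n X $$ (P, Q)"
      using \<open>\<A> B\<close> unfolding \<A>_def by (elim exE conjE) (rule that)
    note g = g'[rule_format]
    obtain h where h': "\<forall>\<alpha><N. \<forall>\<beta><N. expressible \<Omega> (h \<alpha> \<beta>)"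
      "\<forall>P<n. \<forall>Q<n. \<forall>\<alpha><N. \<forall>\<beta><N. C $$ (P * N + \<alpha>, Q * N + \<beta>) = h \<alpha> \<beta> n X $$ (P, Q)"
      using \<open>\<A> C\<close> unfolding \<A>_def by (elim exE conjE) (rule that)
    note h = h'[rule_format]
    note gc = expressible_carrier[OF g(1) pt] and hc = expressible_carrier[OF h(1) pt]
    show "\<A> (B + C)"
      unfolding \<A>_def
    proof (intro exI[of _ "\<lambda>\<alpha> \<beta> n' Z. g \<alpha> \<beta> n' Z + h \<alpha> \<beta> n' Z"] conjI allI impI)
      fix P Q \<alpha> \<beta> assume *: "P < n" "Q < n" "\<alpha> < N" "\<beta> < N"
      show "(B + C) $$ (P * N + \<alpha>, Q * N + \<beta>) = (g \<alpha> \<beta> n X + h \<alpha> \<beta> n X) $$ (P, Q)"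
        using BC block_index_less[OF *(1,3)] block_index_less[OF *(2,4)] * carrier_matD[OF hc[OF *(3,4)]]
        by (simp add: g(2) h(2))
    qed (intro expressible_add g h)
    show "\<A> (B * C)"
      unfolding \<A>_def
    proof (intro exI[of _ "\<lambda>\<alpha> \<beta> n' Z. msum n' (\<lambda>\<gamma>. g \<alpha> \<gamma> n' Z * h \<gamma> \<beta> n' Z) N"] conjI allI impI)
      fix P Q \<alpha> \<beta> assume *: "P < n" "Q < n" "\<alpha> < N" "\<beta> < N"
      have "(B * C) $$ (P * N + \<alpha>, Q * N + \<beta>) = (\<Sum>R<n. \<Sum>\<gamma><N. g \<alpha> \<gamma> n X $$ (P, R) * h \<gamma> \<beta> n X $$ (R, Q))"
        unfolding mult_mat_block_index[OF BC block_index_less[OF *(1,3)] block_index_less[OF *(2,4)]]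
        by (intro sum.cong refl) (simp add: g(2) h(2) *)
      also have "\<dots> = (\<Sum>\<gamma><N. \<Sum>R<n. g \<alpha> \<gamma> n X $$ (P, R) * h \<gamma> \<beta> n X $$ (R, Q))" by (rule sum.swap)
      also have "\<dots> = (\<Sum>\<gamma><N. (g \<alpha> \<gamma> n X * h \<gamma> \<beta> n X) $$ (P, Q))"
        by (intro sum.cong refl) (simp add: mult_mat_index[OF gc hc *(1,2)] * del: index_mult_mat)
      finally show "(B * C) $$ (P * N + \<alpha>, Q * N + \<beta>) = msum n (\<lambda>\<gamma>. g \<alpha> \<gamma> n X * h \<gamma> \<beta> n X) N $$ (P, Q)"
        using * by simp
    qed (intro expressible_msum[OF pts] expressible_mult g h)
  next
    fix c
    show "\<A> (c \<cdot>\<^sub>m 1\<^sub>m (n * N))"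
      unfolding \<A>_def
    proof (intro exI[of _ "\<lambda>\<alpha> \<beta> n' Z. (if \<alpha> = \<beta> then c else 0) \<cdot>\<^sub>m 1\<^sub>m n'"] conjI allI impI)
      fix P Q \<alpha> \<beta> assume *: "P < n" "Q < n" "\<alpha> < N" "\<beta> < N"
      have "P * N + \<alpha> = Q * N + \<beta> \<longleftrightarrow> P = Q \<and> \<alpha> = \<beta>" using * by (metis block_index_div_mod)
      then show "(c \<cdot>\<^sub>m 1\<^sub>m (n * N)) $$ (P * N + \<alpha>, Q * N + \<beta>) = ((if \<alpha> = \<beta> then c else 0) \<cdot>\<^sub>m 1\<^sub>m n) $$ (P, Q)"
        using * block_index_less[OF *(1,3)] block_index_less[OF *(2,4)] by auto
    qed (rule expressible_const)
  qed
  then obtain W where W: "W \<in> carrier_mat (n * N) (n * N)" "W * \<Lambda> = 1\<^sub>m (n * N)" and "\<A> W" by blast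
  obtain g where g': "\<forall>\<alpha><N. \<forall>\<beta><N. expressible \<Omega> (g \<alpha> \<beta>)"
      "\<forall>P<n. \<forall>Q<n. \<forall>\<alpha><N. \<forall>\<beta><N. W $$ (P * N + \<alpha>, Q * N + \<beta>) = g \<alpha> \<beta> n X $$ (P, Q)"
    using \<open>\<A> W\<close> unfolding \<A>_def by (elim exE conjE) (rule that)
  note g = g'[rule_format]
  \<comment> \<open>The coefficients of \<open>W\<close> are reused as functions on all of \<Omega>;
    only at \<open>X\<close> do they invert the system.\<close>
  define E' where "E' \<alpha> \<beta> n' Z = msum n' (\<lambda>\<gamma>. g \<alpha> \<gamma> n' Z * E \<gamma> \<beta> n' Z) N" for \<alpha> \<beta> n' Z
  define f' where "f' \<alpha> n' Z = msum n' (\<lambda>\<gamma>. g \<alpha> \<gamma> n' Z * f \<gamma> n' Z) N" for \<alpha> n' Z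
  show ?thesis
  proof (rule expressible_gauss[OF pts, of N E' f' u, OF _ _ _ u _ \<beta>])
    fix \<alpha> \<beta> assume *: "\<alpha> < N" "\<beta> < N"
    show "expressible \<Omega> (E' \<alpha> \<beta>)"
      unfolding E'_def by (intro expressible_msum[OF pts] expressible_mult g E *)
    show "E' \<alpha> \<beta> n X = (if \<alpha> = \<beta> then 1\<^sub>m n else 0\<^sub>m n n)"
    proof (rule eq_matI)
      fix P Q assume "P < dim_row (if \<alpha> = \<beta> then 1\<^sub>m n else 0\<^sub>m n n :: 'a mat)" "Q < dim_col (if \<alpha> = \<beta> then 1\<^sub>m n else 0\<^sub>m n n :: 'a mat)"
      then have PQ: "P < n" "Q < n" by (auto split: if_splits)
      have "E' \<alpha> \<beta> n X $$ (P, Q) = (\<Sum>\<gamma><N. \<Sum>R<n. g \<alpha> \<gamma> n X $$ (P, R) * E \<gamma> \<beta> n X $$ (R, Q))"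
        unfolding E'_def msum_index[OF PQ]
        by (intro sum.cong refl) (simp add: mult_mat_index[OF expressible_carrier[OF g(1) pt] expressible_carrier[OF E pt] PQ] * del: index_mult_mat)
      also have "\<dots> = (\<Sum>R<n. \<Sum>\<gamma><N. g \<alpha> \<gamma> n X $$ (P, R) * E \<gamma> \<beta> n X $$ (R, Q))" by (rule sum.swap)
      also have "\<dots> = (W * \<Lambda>) $$ (P * N + \<alpha>, Q * N + \<beta>)"
        unfolding mult_mat_block_index[OF W(1) \<Lambda>(1) block_index_less[OF PQ(1) *(1)] block_index_less[OF PQ(2) *(2)]]
        by (intro sum.cong refl) (simp add: g(2) \<Lambda>E * PQ)
      also have "\<dots> = (if \<alpha> = \<beta> then 1\<^sub>m n else 0\<^sub>m n n) $$ (P, Q)"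
      proof -
        have "P * N + \<alpha> = Q * N + \<beta> \<longleftrightarrow> P = Q \<and> \<alpha> = \<beta>" using * by (metis block_index_div_mod)
        then show ?thesis unfolding W(2) using PQ block_index_less[OF PQ(1) *(1)] block_index_less[OF PQ(2) *(2)] by auto
      qed
      finally show "E' \<alpha> \<beta> n X $$ (P, Q) = (if \<alpha> = \<beta> then 1\<^sub>m n else 0\<^sub>m n n) $$ (P, Q)" .
    qed (auto simp: E'_def msum_def)
  next
    fix \<alpha> assume "\<alpha> < N"
    then show "expressible \<Omega> (f' \<alpha>)"
      unfolding f'_def by (intro expressible_msum[OF pts] expressible_mult g f)
  next
    fix \<alpha> n' Z assume \<alpha>: "\<alpha> < N" and z: "(n', Z) \<in> \<Omega>"
    note c = expressible_carrier[OF g(1) z] expressible_carrier[OF E z] u[OF _ z]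
    have "msum n' (\<lambda>\<beta>. E' \<alpha> \<beta> n' Z * u \<beta> n' Z) N = msum n' (\<lambda>\<beta>. msum n' (\<lambda>\<gamma>. g \<alpha> \<gamma> n' Z * (E \<gamma> \<beta> n' Z * u \<beta> n' Z)) N) N"
    proof (rule msum_cong)
      fix \<beta> assume \<beta>: "\<beta> < N"
      have "E' \<alpha> \<beta> n' Z * u \<beta> n' Z = msum n' (\<lambda>\<gamma>. g \<alpha> \<gamma> n' Z * E \<gamma> \<beta> n' Z * u \<beta> n' Z) N"
        unfolding E'_def by (rule msum_mult[OF c(3)[OF \<beta>] mult_carrier_mat[OF c(1)[OF \<alpha>] c(2)[OF _ \<beta>]]])
      also have "\<dots> = msum n' (\<lambda>\<gamma>. g \<alpha> \<gamma> n' Z * (E \<gamma> \<beta> n' Z * u \<beta> n' Z)) N"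
        by (rule msum_cong) (rule assoc_mult_mat[OF c(1)[OF \<alpha>] c(2)[OF _ \<beta>] c(3)[OF \<beta>]])
      finally show "E' \<alpha> \<beta> n' Z * u \<beta> n' Z = msum n' (\<lambda>\<gamma>. g \<alpha> \<gamma> n' Z * (E \<gamma> \<beta> n' Z * u \<beta> n' Z)) N" .
    qed
    also have "\<dots> = msum n' (\<lambda>\<gamma>. msum n' (\<lambda>\<beta>. g \<alpha> \<gamma> n' Z * (E \<gamma> \<beta> n' Z * u \<beta> n' Z)) N) N" by (rule msum_swap)
    also have "\<dots> = f' \<alpha> n' Z"
      unfolding f'_def
    proof (rule msum_cong)
      fix \<gamma> assume \<gamma>: "\<gamma> < N"
      show "msum n' (\<lambda>\<beta>. g \<alpha> \<gamma> n' Z * (E \<gamma> \<beta> n' Z * u \<beta> n' Z)) N = g \<alpha> \<gamma> n' Z * f \<gamma> n' Z"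
        unfolding eq[OF \<gamma> z, symmetric] by (rule mult_msum[OF c(1)[OF \<alpha> \<gamma>] mult_carrier_mat[OF c(2)[OF \<gamma>] c(3)], symmetric])
    qed
    finally show "msum n' (\<lambda>\<beta>. E' \<alpha> \<beta> n' Z * u \<beta> n' Z) N = f' \<alpha> n' Z" .
  qed
qed

end


section \<open>Existence of realizations\<close>

lemma mat_inverse_exists:
  assumes A: "A \<in> carrier_mat n n" and "det A \<noteq> (0 :: 'a::field)"
  shows "\<exists>W \<in> carrier_mat n n. A * W = 1\<^sub>m n \<and> W * A = 1\<^sub>m n"
proof -
  have "mat_inverse A \<noteq> None"
    using det_non_zero_imp_unit[OF assms, of "()"] mat_inverse(1)[OF A, of "()"] by auto
  then show ?thesis using mat_inverse(2)[OF A] by auto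
qed

lemma det_block_diag_nonzero:
  fixes A :: "'a::field mat"
  assumes A: "A \<in> carrier_mat k k" and nz: "det A \<noteq> 0"
  shows "det (block_diag (\<lambda>c. c) k k K (\<lambda>p q. A $$ (p, q))) \<noteq> 0"
proof -
  obtain W where W: "W \<in> carrier_mat k k" "A * W = 1\<^sub>m k" using mat_inverse_exists[OF assms] by blast
  let ?A = "block_diag (\<lambda>c. c) k k K (\<lambda>p q. A $$ (p, q))" and ?W = "block_diag (\<lambda>c. c) k k K (\<lambda>p q. W $$ (p, q))"
  have c: "?A \<in> carrier_mat (K * k) (K * k)" "?W \<in> carrier_mat (K * k) (K * k)" by simp_all
  have "?A * ?W = 1\<^sub>m (K * k)"
  proof (rule eq_mat_blockI[of _ K k K k])
    fix P x Q y assume *: "P < K" "x < k" "Q < K" "y < k"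
    have e: "P * k + x = Q * k + y \<longleftrightarrow> P = Q \<and> x = y" using * by (metis block_index_div_mod)
    have "(?A * ?W) $$ (P * k + x, Q * k + y) = (\<Sum>z<k. A $$ (x, z) * (if P = Q then W $$ (z, y) else 0))"
      unfolding block_diag_mult_left[OF c(2) *] by (intro sum.cong refl) (simp add: *)
    also have "\<dots> = (if P = Q then (A * W) $$ (x, y) else 0)"
      unfolding mult_mat_index[OF A W(1) *(2,4)] by simp
    also have "\<dots> = 1\<^sub>m (K * k) $$ (P * k + x, Q * k + y)"
      unfolding W(2) using * e block_index_less[OF *(1,2)] block_index_less[OF *(3,4)] by simp
    finally show "(?A * ?W) $$ (P * k + x, Q * k + y) = 1\<^sub>m (K * k) $$ (P * k + x, Q * k + y)" .
  qed (rule mult_carrier_mat[OF c], simp)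
  then have "det ?A * det ?W = 1" using det_mult[OF c] by simp
  then show ?thesis by auto
qed

lemma aff_entry_scalar_blocks:
  "aff_entry \<phi> d 1 G a T P \<alpha> Q \<beta> = (if P = Q then \<phi> (G \<alpha> \<beta>) else 0) + (\<Sum>k<d. (T ! k) $$ (P, Q) * \<phi> (a k 0 0 \<alpha> \<beta>))"
  by (simp add: aff_entry_def One_nat_def)

lemma lin_sys_simps:
  "sys_b (lin_sys r) = (\<lambda>_ _ _ _ _. 0)" "sys_D (lin_sys r) = (\<lambda>_ _. 0)"
  "sys_B (lin_sys r) \<alpha> j = sys_B (lin_sys r) \<alpha> 0" "sys_C (lin_sys r) i \<alpha> = sys_C (lin_sys r) 0 \<alpha>"
  by (simp_all add: lin_sys_def Let_def)

text \<open>The linearization is normalized at the centre: its pencil is multiplied by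
  \<open>V\<close>, the inverse of its value at \<open>Y\<close>, which makes the constant part the
  identity, and the amplified state \<open>U0\<close> at \<open>Y\<close> is subtracted from the
  solution, which makes the right-hand side vanish at the centre. Hence \<open>s * N\<close> states
  suffice for a linearization of size \<open>N\<close>.\<close>

lemma realization_exists:
  assumes Y: "Y \<in> expr_dom d s r" and vars: "nc_vars r \<subseteq> {..<d}"
  shows "\<exists>R. realizes_expr d s Y R r"
proof -
  let ?S = "lin_sys r"
  define N where "N = sys_L ?S"
  let ?L = "s * N"
  have Yt: "Y \<in> mat_tuples d s" using Y by (simp add: expr_dom_def)
  define \<Lambda> where "\<Lambda> = lam (\<lambda>c. c) d 1 s ?S Y"
  define \<beta>Y where "\<beta>Y = rhs (\<lambda>c. c) d 1 s ?S Y"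
  have \<Lambda>: "\<Lambda> \<in> carrier_mat ?L ?L" and \<beta>Y: "\<beta>Y \<in> carrier_mat ?L s"
    using sys_carrier(1)[of "\<lambda>c. c" d 1 s ?S Y] sys_carrier(2)[of "\<lambda>c. c" d 1 s ?S Y] by (simp_all add: \<Lambda>_def \<beta>Y_def N_def)
  have nz: "det \<Lambda> \<noteq> 0" using Y expr_dom_iff[OF Yt vars] by (simp add: den_def \<Lambda>_def)
  obtain V where V: "V \<in> carrier_mat ?L ?L" "\<Lambda> * V = 1\<^sub>m ?L" "V * \<Lambda> = 1\<^sub>m ?L" using mat_inverse_exists[OF \<Lambda> nz] by blast
  have nzV: "det V \<noteq> 0"
    using det_mult[OF \<Lambda> V(1)] V(2) by auto
  define U0 where "U0 = V * \<beta>Y"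
  have U0: "U0 \<in> carrier_mat ?L s" unfolding U0_def by (rule mult_carrier_mat[OF V(1) \<beta>Y])
  \<comment> \<open>The matrix unit \<open>(x, y)\<close> in variable \<open>k\<close> sends the
    sub-block \<open>y\<close> of the state to the sub-block \<open>x\<close> by the coefficient of
    the linearization; then \<open>V\<close> is applied.\<close>
  define a where "a k x y p q = (\<Sum>\<alpha><N. V $$ (p, x * N + \<alpha>) * (if q div N = y then sys_a ?S k 0 0 \<alpha> (q mod N) else 0))" for k x y p q
  \<comment> \<open>Chosen so that the new right-hand side is the identity minus the new pencil,
    applied to the amplified state \<open>U0\<close>.\<close>
  define b where "b k x y p j = - (\<Sum>q<?L. a k x y p q * U0 $$ (q, j))" for k x y :: nat and p j
  define C where "C = diagC (\<lambda>c. c) 1 s ?S"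
  have C: "C \<in> carrier_mat s ?L" using sys_carrier(3)[of "\<lambda>c. c" 1 s ?S] by (simp add: C_def N_def)
  have D: "C * U0 \<in> carrier_mat s s" by (rule mult_carrier_mat[OF C U0])
  define R where "R = fm_of s ?L (C * U0) C a b"
  have R: "is_fm_real d s R" unfolding R_def by (rule is_fm_real_fm_of[OF D C])
  let ?S' = "fm_sys d s Y R"
  have L': "fm_L R = ?L" "fm_C R = C" "fm_D R = C * U0" by (simp_all add: R_def)
  have co: "sys_a ?S' k x y p q = a k x y p q" if "x < s" "y < s" "p < ?L" "q < ?L" for k x y p q
    unfolding R_def by (rule fm_of_coeffs(1)[OF that])
  have co': "sys_b ?S' k x y p j = b k x y p j" if "x < s" "y < s" "p < ?L" "j < s" for k x y p j
    unfolding R_def by (rule fm_of_coeffs(2)[OF that])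
  have "\<exists>W. nc_eval (\<lambda>c. c) (s * m) X r = Some W \<and> is_val (\<lambda>c. c) d s m ?S' X W"
    if X: "X \<in> expr_dom d (s * m) r" for m X
  proof -
    have Xt: "X \<in> mat_tuples d (m * s)" using X by (simp add: expr_dom_def mult.commute)
    obtain W where W: "nc_eval (\<lambda>c. c) (m * s) X r = Some W" using X by (auto simp: expr_dom_def mult.commute)
    then have val: "is_val (\<lambda>c. c) d 1 (m * s) ?S X W" using nc_eval_iff[OF Xt vars] by simp
    define LX where "LX = lam (\<lambda>c. c) d 1 (m * s) ?S X"
    define BX where "BX = rhs (\<lambda>c. c) d 1 (m * s) ?S X"
    have LX: "LX \<in> carrier_mat (m * ?L) (m * ?L)" and BX: "BX \<in> carrier_mat (m * ?L) (m * s)"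
      using sys_carrier(1)[of "\<lambda>c. c" d 1 "m * s" ?S X] sys_carrier(2)[of "\<lambda>c. c" d 1 "m * s" ?S X]
      by (simp_all add: LX_def BX_def N_def mult.assoc)
    obtain U where U: "U \<in> carrier_mat (m * ?L) (m * s)" "LX * U = BX"
      "W = diagD (\<lambda>c. c) 1 (m * s) ?S + diagC (\<lambda>c. c) 1 (m * s) ?S * U" and nzX: "det LX \<noteq> 0"
      using val unfolding is_val_def den_def LX_def BX_def N_def by (auto simp: mult.assoc)
    have idx: "P * ?L + (x * N + \<alpha>) = (P * s + x) * N + \<alpha>" for P x \<alpha> by (simp add: algebra_simps)
    have LXe: "LX $$ (P * ?L + (x * N + \<alpha>), Q * ?L + (y * N + \<beta>)) =
        (if P = Q then \<Lambda> $$ (x * N + \<alpha>, y * N + \<beta>) else 0) + (\<Sum>k<d. cen s Y X P Q k x y * sys_a ?S k 0 0 \<alpha> \<beta>)"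
      if "P < m" "Q < m" "x < s" "y < s" "\<alpha> < N" "\<beta> < N" for P Q x y \<alpha> \<beta>
    proof -
      have eq: "P * s + x = Q * s + y \<longleftrightarrow> P = Q \<and> x = y" using that by (metis block_index_div_mod)
      have "LX $$ (P * ?L + (x * N + \<alpha>), Q * ?L + (y * N + \<beta>)) = aff_entry (\<lambda>c. c) d 1 (sys_G ?S) (sys_a ?S) X (P * s + x) \<alpha> (Q * s + y) \<beta>"
        unfolding idx LX_def by (rule lam_index[where S = ?S, folded N_def]) (use that in \<open>auto intro: block_index_less\<close>)
      moreover have "\<Lambda> $$ (x * N + \<alpha>, y * N + \<beta>) = aff_entry (\<lambda>c. c) d 1 (sys_G ?S) (sys_a ?S) Y x \<alpha> y \<beta>"
        unfolding \<Lambda>_def by (rule lam_index[where S = ?S, folded N_def]) (use that in auto)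
      ultimately show ?thesis
        unfolding aff_entry_scalar_blocks eq
        by (cases "P = Q") (simp_all add: cen_def left_diff_distrib sum_subtractf)
    qed
    define KV where "KV = block_diag (\<lambda>c. c) ?L ?L m (\<lambda>p q. V $$ (p, q))"
    define KU where "KU = block_diag (\<lambda>c. c) ?L s m (\<lambda>p q. U0 $$ (p, q))"
    have KV: "KV \<in> carrier_mat (m * ?L) (m * ?L)" and KU: "KU \<in> carrier_mat (m * ?L) (m * s)" by (simp_all add: KV_def KU_def)
    let ?l' = "lam (\<lambda>c. c) d s m ?S' X" and ?b' = "rhs (\<lambda>c. c) d s m ?S' X"
    have l': "?l' \<in> carrier_mat (m * ?L) (m * ?L)" and b': "?b' \<in> carrier_mat (m * ?L) (m * s)"
      using sys_carrier(1)[of "\<lambda>c. c" d s m ?S' X] sys_carrier(2)[of "\<lambda>c. c" d s m ?S' X] by (simp_all add: L')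
    have l'e: "?l' $$ (P * ?L + p, Q * ?L + q) = (if P = Q \<and> p = q then 1 else 0) +
        (\<Sum>k<d. \<Sum>x<s. \<Sum>y<s. cen s Y X P Q k x y * a k x y p q)" if "P < m" "p < ?L" "Q < m" "q < ?L" for P p Q q
    proof -
      have "?l' $$ (P * ?L + p, Q * ?L + q) = aff_entry (\<lambda>c. c) d s (sys_G ?S') (sys_a ?S') X P p Q q"
        using lam_index[of P m p ?S' Q q "\<lambda>c. c" d s X] that by (simp add: L' del: fm_sys_simps(2-))
      also have "\<dots> = (if P = Q \<and> p = q then 1 else 0) + (\<Sum>k<d. \<Sum>x<s. \<Sum>y<s. cen s Y X P Q k x y * sys_a ?S' k x y p q)"
        by (rule fm_lam_entry[OF R Yt]) (use that L' in simp_all)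
      also have "(\<Sum>k<d. \<Sum>x<s. \<Sum>y<s. cen s Y X P Q k x y * sys_a ?S' k x y p q) = (\<Sum>k<d. \<Sum>x<s. \<Sum>y<s. cen s Y X P Q k x y * a k x y p q)"
        using that by (intro sum.cong refl) (simp add: co del: fm_sys_simps)
      finally show ?thesis .
    qed
    have lV: "?l' = KV * LX"
    proof (rule eq_mat_blockI[of _ m ?L m ?L, OF l' mult_carrier_mat[OF KV LX]])
      fix P p Q q assume *: "P < m" "p < ?L" "Q < m" "q < ?L"
      obtain y \<beta> where q: "y < s" "\<beta> < N" "q = y * N + \<beta>" using *(4) by (rule block_indexE)
      have "(KV * LX) $$ (P * ?L + p, Q * ?L + q) = (\<Sum>z<?L. V $$ (p, z) * LX $$ (P * ?L + z, Q * ?L + q))"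
        unfolding KV_def by (rule block_diag_mult_left[OF LX *])
      also have "\<dots> = (\<Sum>x<s. \<Sum>\<alpha><N. V $$ (p, x * N + \<alpha>) * ((if P = Q then \<Lambda> $$ (x * N + \<alpha>, q) else 0) + (\<Sum>k<d. cen s Y X P Q k x y * sys_a ?S k 0 0 \<alpha> \<beta>)))"
        unfolding sum_block_index q(3) by (intro sum.cong refl) (simp add: LXe * q)
      also have "\<dots> = (\<Sum>x<s. \<Sum>\<alpha><N. V $$ (p, x * N + \<alpha>) * (if P = Q then \<Lambda> $$ (x * N + \<alpha>, q) else 0)) +
          (\<Sum>x<s. \<Sum>\<alpha><N. \<Sum>k<d. V $$ (p, x * N + \<alpha>) * (cen s Y X P Q k x y * sys_a ?S k 0 0 \<alpha> \<beta>))"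
        by (simp only: distrib_left sum.distrib sum_distrib_left)
      also have "(\<Sum>x<s. \<Sum>\<alpha><N. V $$ (p, x * N + \<alpha>) * (if P = Q then \<Lambda> $$ (x * N + \<alpha>, q) else 0)) = (if P = Q then (V * \<Lambda>) $$ (p, q) else 0)"
        unfolding mult_mat_block_index[OF V(1) \<Lambda> *(2,4)] by simp
      also have "\<dots> = (if P = Q \<and> p = q then 1 else 0)" unfolding V(3) using * by simp
      also have "(\<Sum>x<s. \<Sum>\<alpha><N. \<Sum>k<d. V $$ (p, x * N + \<alpha>) * (cen s Y X P Q k x y * sys_a ?S k 0 0 \<alpha> \<beta>)) =
          (\<Sum>k<d. \<Sum>x<s. \<Sum>\<alpha><N. V $$ (p, x * N + \<alpha>) * (cen s Y X P Q k x y * sys_a ?S k 0 0 \<alpha> \<beta>))"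
        by (rule trans[OF sum.cong[OF refl sum.swap] sum.swap])
      also have "\<dots> = (\<Sum>k<d. \<Sum>x<s. \<Sum>y'<s. cen s Y X P Q k x y' * a k x y' p q)"
      proof (rule sum.cong[OF refl], rule sum.cong[OF refl])
        fix k x
        have "(\<Sum>y'<s. cen s Y X P Q k x y' * a k x y' p q) = (\<Sum>y'<s. if y' = y then cen s Y X P Q k x y * (\<Sum>\<alpha><N. V $$ (p, x * N + \<alpha>) * sys_a ?S k 0 0 \<alpha> \<beta>) else 0)"
          by (intro sum.cong refl) (use q in \<open>auto simp: a_def\<close>)
        also have "\<dots> = cen s Y X P Q k x y * (\<Sum>\<alpha><N. V $$ (p, x * N + \<alpha>) * sys_a ?S k 0 0 \<alpha> \<beta>)" using q(1) by simp
        finally show "(\<Sum>\<alpha><N. V $$ (p, x * N + \<alpha>) * (cen s Y X P Q k x y * sys_a ?S k 0 0 \<alpha> \<beta>)) = (\<Sum>y'<s. cen s Y X P Q k x y' * a k x y' p q)"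
          by (simp add: sum_distrib_left mult.left_commute)
      qed
      finally show "?l' $$ (P * ?L + p, Q * ?L + q) = (KV * LX) $$ (P * ?L + p, Q * ?L + q)" unfolding l'e[OF *] by simp
    qed
    have nz': "det ?l' \<noteq> 0"
      unfolding lV det_mult[OF KV LX] using nzX det_block_diag_nonzero[OF V(1) nzV, of m] by (simp add: KV_def)
    have BXe: "BX $$ (P * ?L + p, Q * s + j) = (if P = Q then \<beta>Y $$ (p, j) else 0)" if PQ: "P < m" "p < ?L" "Q < m" "j < s" for P p Q j
    proof -
      obtain x \<alpha> where p: "x < s" "\<alpha> < N" "p = x * N + \<alpha>" using PQ(2) by (rule block_indexE)
      note that = PQ
      have eq: "P * s + x = Q * s + j \<longleftrightarrow> P = Q \<and> x = j" using that p by (metis block_index_div_mod)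
      have "BX $$ ((P * s + x) * N + \<alpha>, (Q * s + j) * 1 + 0) = aff_entry (\<lambda>c. c) d 1 (sys_B ?S) (sys_b ?S) X (P * s + x) \<alpha> (Q * s + j) 0"
        unfolding BX_def by (rule rhs_index[where S = ?S, folded N_def]) (use that p in \<open>auto intro: block_index_less\<close>)
      moreover have "\<beta>Y $$ (x * N + \<alpha>, j * 1 + 0) = aff_entry (\<lambda>c. c) d 1 (sys_B ?S) (sys_b ?S) Y x \<alpha> j 0"
        unfolding \<beta>Y_def by (rule rhs_index[where S = ?S, folded N_def]) (use that p in auto)
      ultimately show ?thesis
        unfolding p(3) idx aff_entry_scalar_blocks eq by (cases "P = Q") (simp_all add: lin_sys_simps(1))
    qed
    have VB: "KV * BX = KU"
    proof (rule eq_mat_blockI[of _ m ?L m s, OF mult_carrier_mat[OF KV BX] KU])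
      fix P p Q j assume *: "P < m" "p < ?L" "Q < m" "j < s"
      have "(KV * BX) $$ (P * ?L + p, Q * s + j) = (\<Sum>z<?L. V $$ (p, z) * (if P = Q then \<beta>Y $$ (z, j) else 0))"
        unfolding KV_def block_diag_mult_left[OF BX *] by (intro sum.cong refl) (simp add: BXe *)
      also have "\<dots> = (if P = Q then U0 $$ (p, j) else 0)"
        unfolding U0_def mult_mat_index[OF V(1) \<beta>Y *(2,4)] by simp
      finally show "(KV * BX) $$ (P * ?L + p, Q * s + j) = KU $$ (P * ?L + p, Q * s + j)" using * by (simp add: KU_def)
    qed
    have KUb: "KU = ?l' * KU + ?b'"
    proof (rule eq_mat_blockI[of _ m ?L m s, OF KU add_carrier_mat[OF b']])
      fix P p Q j assume *: "P < m" "p < ?L" "Q < m" "j < s"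
      have b'e: "?b' $$ (P * ?L + p, Q * s + j) = (\<Sum>k<d. \<Sum>x<s. \<Sum>y<s. cen s Y X P Q k x y * b k x y p j)"
      proof -
        have "?b' $$ (P * ?L + p, Q * s + j) = aff_entry (\<lambda>c. c) d s (sys_B ?S') (sys_b ?S') X P p Q j"
          using rhs_index[of P m p ?S' Q j s "\<lambda>c. c" d X] * by (simp add: L' del: fm_sys_simps(2-))
        also have "\<dots> = (\<Sum>k<d. \<Sum>x<s. \<Sum>y<s. cen s Y X P Q k x y * sys_b ?S' k x y p j)"
          by (rule fm_rhs_entry[OF R Yt]) (use * L' in simp_all)
        also have "\<dots> = (\<Sum>k<d. \<Sum>x<s. \<Sum>y<s. cen s Y X P Q k x y * b k x y p j)"
          using * by (intro sum.cong refl) (simp add: co' del: fm_sys_simps)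
        finally show ?thesis .
      qed
      have "(?l' * KU) $$ (P * ?L + p, Q * s + j) = (\<Sum>q<?L. ?l' $$ (P * ?L + p, Q * ?L + q) * U0 $$ (q, j))"
        unfolding KU_def by (rule block_diag_mult_right[OF l' *])
      also have "\<dots> = (\<Sum>q<?L. (if q = p then if P = Q then U0 $$ (q, j) else 0 else 0) + (\<Sum>k<d. \<Sum>x<s. \<Sum>y<s. cen s Y X P Q k x y * a k x y p q) * U0 $$ (q, j))"
        by (intro sum.cong refl) (auto simp: l'e * distrib_right)
      also have "\<dots> = (if P = Q then U0 $$ (p, j) else 0) + (\<Sum>q<?L. (\<Sum>k<d. \<Sum>x<s. \<Sum>y<s. cen s Y X P Q k x y * a k x y p q) * U0 $$ (q, j))"
        unfolding sum.distrib using *(2) by simp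
      also have "(\<Sum>q<?L. (\<Sum>k<d. \<Sum>x<s. \<Sum>y<s. cen s Y X P Q k x y * a k x y p q) * U0 $$ (q, j)) =
          (\<Sum>k<d. \<Sum>x<s. \<Sum>y<s. \<Sum>q<?L. cen s Y X P Q k x y * (a k x y p q * U0 $$ (q, j)))"
        unfolding sum_distrib_right mult.assoc
        by (rule trans[OF sum.swap sum.cong[OF refl trans[OF sum.swap sum.cong[OF refl sum.swap]]]])
      also have "\<dots> = - ?b' $$ (P * ?L + p, Q * s + j)"
        unfolding b'e by (simp add: b_def sum_distrib_left sum_negf)
      finally have "(?l' * KU) $$ (P * ?L + p, Q * s + j) = (if P = Q then U0 $$ (p, j) else 0) + - ?b' $$ (P * ?L + p, Q * s + j)" .
      moreover have "KU $$ (P * ?L + p, Q * s + j) = (if P = Q then U0 $$ (p, j) else 0)" using * by (simp add: KU_def)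
      moreover have "(?l' * KU + ?b') $$ (P * ?L + p, Q * s + j) = (?l' * KU) $$ (P * ?L + p, Q * s + j) + ?b' $$ (P * ?L + p, Q * s + j)"
        by (rule index_add_mat(1)) (use carrier_matD[OF b'] block_index_less[OF *(1,2)] block_index_less[OF *(3,4)] in \<open>simp_all add: L'\<close>)
      ultimately show "KU $$ (P * ?L + p, Q * s + j) = (?l' * KU + ?b') $$ (P * ?L + p, Q * s + j)" by simp
    qed
    \<comment> \<open>Subtracting the state at the centre solves the normalized system, and the
      constant term \<open>C * U0\<close> restores the output.\<close>
    define U' where "U' = U + - KU"
    have U': "U' \<in> carrier_mat (m * ?L) (m * s)" using U(1) KU by (simp add: U'_def)
    note lKU = mult_carrier_mat[OF l' KU]
    have "?l' * U = KU" using assoc_mult_mat[OF KV LX U(1)] by (simp add: lV U(2) VB)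
    then have "?l' * U' = KU + - (?l' * KU)"
      unfolding U'_def mult_add_distrib_mat[OF l' U(1) uminus_carrier_mat[OF KU]] mult_uminus_mat[OF l' KU] by simp
    also have "\<dots> = (?l' * KU + ?b') + - (?l' * KU)" using KUb by simp
    also have "\<dots> = ?b'" by (rule mat_add_cancel(1)[OF lKU b'])
    finally have sol: "?l' * U' = ?b'" .
    let ?C' = "diagC (\<lambda>c. c) s m ?S'" and ?D' = "diagD (\<lambda>c. c) s m ?S'"
    have C'b: "?C' = block_diag (\<lambda>c. c) s ?L m (\<lambda>i q. C $$ (i, q))" by (simp add: diagC_def L')
    have C': "?C' \<in> carrier_mat (m * s) (m * ?L)" by (simp add: C'b)
    have CKU: "?C' * KU = ?D'"
    proof (rule eq_mat_blockI[of _ m s m s, OF mult_carrier_mat[OF C' KU] sys_carrier(4)])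
      fix P i Q j assume *: "P < m" "i < s" "Q < m" "j < s"
      have "(?C' * KU) $$ (P * s + i, Q * s + j) = (\<Sum>z<?L. C $$ (i, z) * (if P = Q then U0 $$ (z, j) else 0))"
        unfolding C'b block_diag_mult_left[OF KU *] by (intro sum.cong refl) (simp add: KU_def *)
      also have "\<dots> = (if P = Q then (C * U0) $$ (i, j) else 0)" unfolding mult_mat_index[OF C U0 *(2,4)] by simp
      finally show "(?C' * KU) $$ (P * s + i, Q * s + j) = ?D' $$ (P * s + i, Q * s + j)"
        using * by (simp add: diagD_def L' del: index_mult_mat(1))
    qed
    have CC: "?C' = diagC (\<lambda>c. c) 1 (m * s) ?S"
    proof (rule eq_mat_blockI[of _ m s m ?L, OF C'])
      show "diagC (\<lambda>c. c) 1 (m * s) ?S \<in> carrier_mat (m * s) (m * ?L)"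
        using sys_carrier(3)[of "\<lambda>c. c" 1 "m * s" ?S] by (simp add: N_def mult.assoc)
      fix P i Q q assume *: "P < m" "i < s" "Q < m" "q < ?L"
      obtain y \<beta> where q: "y < s" "\<beta> < N" "q = y * N + \<beta>" using *(4) by (rule block_indexE)
      have eq: "P * s + i = Q * s + y \<longleftrightarrow> P = Q \<and> i = y" using * q by (metis block_index_div_mod)
      have "diagC (\<lambda>c. c) 1 (m * s) ?S $$ ((P * s + i) * 1 + 0, (Q * s + y) * N + \<beta>) = (if P * s + i = Q * s + y then sys_C ?S 0 \<beta> else 0)"
        by (rule diagC_index[where S = ?S, folded N_def]) (use * q in \<open>auto intro: block_index_less\<close>)
      moreover have "C $$ (i * 1 + 0, y * N + \<beta>) = (if i = y then sys_C ?S 0 \<beta> else 0)"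
        unfolding C_def by (rule diagC_index[where S = ?S, folded N_def]) (use * q in auto)
      ultimately show "?C' $$ (P * s + i, Q * ?L + q) = diagC (\<lambda>c. c) 1 (m * s) ?S $$ (P * s + i, Q * ?L + q)"
        unfolding C'b block_diag_index[OF *] unfolding q(3) idx eq by (cases "P = Q"; cases "i = y") simp_all
    qed
    have D0: "diagD (\<lambda>c. c) 1 (m * s) ?S = 0\<^sub>m (m * s) (m * s)"
      by (rule eq_matI) (auto simp: diagD_def block_diag_def lin_sys_simps(2))
    note CU = mult_carrier_mat[OF C' U(1)] and CKUc = mult_carrier_mat[OF C' KU]
    have "?D' + ?C' * U' = ?C' * KU + (?C' * U + - (?C' * KU))"
      unfolding U'_def CKU[symmetric] mult_add_distrib_mat[OF C' U(1) uminus_carrier_mat[OF KU]] mult_uminus_mat[OF C' KU] ..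
    also have "\<dots> = ?C' * U" by (rule mat_add_cancel(5)[OF CKUc CU])
    also have "\<dots> = W" using U(3) CU unfolding D0 CC[symmetric] by simp
    finally have "W = ?D' + ?C' * U'" by simp
    then have "is_val (\<lambda>c. c) d s m ?S' X W"
      unfolding is_val_def den_def using nz' sol U' by (auto simp: L')
    then show ?thesis using W by (auto simp: mult.commute)
  qed
  then show ?thesis using R unfolding realizes_expr_def by blast
qed


section \<open>The domain of a rational function\<close>

lemma amplify_index:
  assumes Z: "Z \<in> mat_tuples d n" and "k < d" "P < m" "x < n" "Q < m" "y < n"
  shows "(amplify m Z ! k) $$ (P * n + x, Q * n + y) = (if P = Q then (Z ! k) $$ (x, y) else 0)"
  using kronecker_index[OF one_carrier_mat mat_tuplesD(2)[OF Z assms(2)] assms(3-6)] assms mat_tuples_dims(1)[OF Z]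
  by (simp add: amplify_def)

lemma amplify_right_index:
  assumes Z: "Z \<in> mat_tuples d n" and "k < d" "P < n" "x < s" "Q < n" "y < s"
  shows "(amplify_right s Z ! k) $$ (P * s + x, Q * s + y) = (if x = y then (Z ! k) $$ (P, Q) else 0)"
  using kronecker_index[OF mat_tuplesD(2)[OF Z assms(2)] one_carrier_mat assms(3-6)] assms mat_tuples_dims(1)[OF Z]
  by (simp add: amplify_right_def)

lemma amplify_amplify:
  assumes Z: "Z \<in> mat_tuples d n"
  shows "amplify K (amplify s Z) = amplify (K * s) Z"
proof (rule mat_tuples_eqI[of _ d "K * s * n"])
  show "amplify K (amplify s Z) \<in> mat_tuples d (K * s * n)"
    using amplify_tuples[OF amplify_tuples[OF Z], of K s] by (simp add: mult.assoc)
  show "amplify (K * s) Z \<in> mat_tuples d (K * s * n)" by (rule amplify_tuples[OF Z])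
  fix k i j assume k: "k < d" and "i < K * s * n" "j < K * s * n"
  obtain i' x where i: "i' < K * s" "x < n" "i = i' * n + x" using \<open>i < K * s * n\<close> by (rule block_indexE)
  obtain j' y where j: "j' < K * s" "y < n" "j = j' * n + y" using \<open>j < K * s * n\<close> by (rule block_indexE)
  obtain P p where P: "P < K" "p < s" "i' = P * s + p" using i(1) by (rule block_indexE)
  obtain Q q where Q: "Q < K" "q < s" "j' = Q * s + q" using j(1) by (rule block_indexE)
  have idx: "(A * s + a) * n + b = A * (s * n) + (a * n + b)" for A a b by (simp add: algebra_simps)
  have eq: "P * s + p = Q * s + q \<longleftrightarrow> P = Q \<and> p = q" using P Q by (metis block_index_div_mod)
  have "(amplify K (amplify s Z) ! k) $$ (i, j) = (if P = Q then if p = q then (Z ! k) $$ (x, y) else 0 else 0)"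
    unfolding i(3) j(3) P(3) Q(3) idx
    by (simp add: amplify_index[OF amplify_tuples[OF Z] k P(1) block_index_less[OF P(2) i(2)] Q(1) block_index_less[OF Q(2) j(2)]]
      amplify_index[OF Z k P(2) i(2) Q(2) j(2)])
  moreover have "(amplify (K * s) Z ! k) $$ (i, j) = (if i' = j' then (Z ! k) $$ (x, y) else 0)"
    unfolding i(3) j(3) by (rule amplify_index[OF Z k i(1,2) j(1,2)])
  ultimately show "(amplify K (amplify s Z) ! k) $$ (i, j) = (amplify (K * s) Z ! k) $$ (i, j)"
    unfolding P(3) Q(3) eq by simp
qed

text \<open>The pencil at an amplified tuple is block diagonal with equal blocks.\<close>

lemma den_amplify:
  fixes Z :: "'a::field mat list"
  assumes Z: "Z \<in> mat_tuples d (M * s)" and nz: "den (\<lambda>c. c) d s M S Z \<noteq> 0"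
  shows "den (\<lambda>c. c) d s (K * M) S (amplify K Z) \<noteq> 0"
proof -
  let ?l = "lam (\<lambda>c. c) d s M S Z" and ?k = "M * sys_L S"
  let ?m = "lam (\<lambda>c. c) d s (K * M) S (amplify K Z)"
  have m: "?m \<in> carrier_mat (K * ?k) (K * ?k)" using sys_carrier(1)[of "\<lambda>c. c" d s "K * M" S "amplify K Z"] by (simp add: mult.assoc)
  have "?m = block_diag (\<lambda>c. c) ?k ?k K (\<lambda>p q. ?l $$ (p, q))"
  proof (rule eq_mat_blockI[of _ K ?k K ?k, OF m block_diag_carrier])
    fix A p B q assume *: "A < K" "p < ?k" "B < K" "q < ?k"
    obtain P \<alpha> where p: "P < M" "\<alpha> < sys_L S" "p = P * sys_L S + \<alpha>" using *(2) by (rule block_indexE)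
    obtain Q \<beta> where q: "Q < M" "\<beta> < sys_L S" "q = Q * sys_L S + \<beta>" using *(4) by (rule block_indexE)
    have idx: "A * ?k + (P * sys_L S + \<alpha>) = (A * M + P) * sys_L S + \<alpha>" for A P \<alpha> by (simp add: algebra_simps)
    have idx': "(A * M + P) * s + x = A * (M * s) + (P * s + x)" for A P x by (simp add: algebra_simps)
    have eq: "A * M + P = B * M + Q \<longleftrightarrow> A = B \<and> P = Q" using p q by (metis block_index_div_mod)
    have Zi: "(amplify K Z ! k) $$ ((A * M + P) * s + x, (B * M + Q) * s + y) = (if A = B then (Z ! k) $$ (P * s + x, Q * s + y) else 0)"
      if "k < d" "x < s" "y < s" for k x y
      unfolding idx' by (rule amplify_index[OF Z that(1) *(1) block_index_less[OF p(1) that(2)] *(3) block_index_less[OF q(1) that(3)]])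
    have "?m $$ (A * ?k + p, B * ?k + q) = aff_entry (\<lambda>c. c) d s (sys_G S) (sys_a S) (amplify K Z) (A * M + P) \<alpha> (B * M + Q) \<beta>"
      unfolding p(3) q(3) idx by (rule lam_index) (use * p q in \<open>auto intro: block_index_less\<close>)
    also have "\<dots> = (if A = B then aff_entry (\<lambda>c. c) d s (sys_G S) (sys_a S) Z P \<alpha> Q \<beta> else 0)"
    proof -
      have "(\<Sum>k<d. \<Sum>x<s. \<Sum>y<s. (amplify K Z ! k) $$ ((A * M + P) * s + x, (B * M + Q) * s + y) * sys_a S k x y \<alpha> \<beta>) =
          (\<Sum>k<d. \<Sum>x<s. \<Sum>y<s. (if A = B then (Z ! k) $$ (P * s + x, Q * s + y) else 0) * sys_a S k x y \<alpha> \<beta>)"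
        by (intro sum.cong refl) (simp only: Zi lessThan_iff)
      then show ?thesis unfolding aff_entry_def eq by (cases "A = B") simp_all
    qed
    also have "aff_entry (\<lambda>c. c) d s (sys_G S) (sys_a S) Z P \<alpha> Q \<beta> = ?l $$ (p, q)"
      unfolding p(3) q(3) by (rule lam_index[symmetric]) (use p q in auto)
    finally show "?m $$ (A * ?k + p, B * ?k + q) = block_diag (\<lambda>c. c) ?k ?k K (\<lambda>p q. ?l $$ (p, q)) $$ (A * ?k + p, B * ?k + q)"
      using * by simp
  qed
  then show ?thesis using det_block_diag_nonzero[OF sys_carrier(1), of "\<lambda>c. c" d s M S Z K] nz by (simp add: den_def)
qed

section \<open>Invariance under reordering of coordinates\<close>

definition permute_mat :: "nat \<Rightarrow> (nat \<Rightarrow> nat) \<Rightarrow> 'a mat \<Rightarrow> 'a mat" where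
  "permute_mat N \<pi> A = mat N N (\<lambda>(i, j). A $$ (\<pi> i, \<pi> j))"

lemma permute_mat_carrier [simp]: "permute_mat N \<pi> A \<in> carrier_mat N N"
  by (simp add: permute_mat_def)

lemma permute_tuples: "T \<in> mat_tuples d N \<Longrightarrow> map (permute_mat N \<pi>) T \<in> mat_tuples d N"
  by (auto simp: mat_tuples_def)

lemma nc_eval_permute:
  fixes \<phi> :: "'a::field \<Rightarrow> 'b::field"
  assumes X: "X \<in> mat_tuples d N" and vars: "nc_vars r \<subseteq> {..<d}" and V: "nc_eval \<phi> N X r = Some V"
    and \<pi>: "bij_betw \<pi> {..<N} {..<N}"
  shows "nc_eval \<phi> N (map (permute_mat N \<pi>) X) r = Some (permute_mat N \<pi> V)"
proof (rule nc_eval_hom[OF X vars _ _ _ _ _ V])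
  have \<pi>N: "\<pi> i < N" if "i < N" for i using bij_betwE[OF \<pi>] that by auto
  have \<pi>eq: "\<pi> i = \<pi> j \<longleftrightarrow> i = j" if "i < N" "j < N" for i j
    using bij_betw_imp_inj_on[OF \<pi>] that by (auto simp: inj_on_def)
  show one: "permute_mat N \<pi> (1\<^sub>m N) = (1\<^sub>m N :: 'b mat)"
    by (rule eq_matI) (auto simp: permute_mat_def \<pi>N \<pi>eq)
  show "permute_mat N \<pi> (\<phi> c \<cdot>\<^sub>m 1\<^sub>m N) = \<phi> c \<cdot>\<^sub>m 1\<^sub>m N" for c
    by (rule eq_matI) (auto simp: permute_mat_def \<pi>N \<pi>eq)
  fix A B :: "'b mat" assume AB: "A \<in> carrier_mat N N" "B \<in> carrier_mat N N"
  show "permute_mat N \<pi> (A + B) = permute_mat N \<pi> A + permute_mat N \<pi> B"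
    by (rule eq_matI) (use AB in \<open>auto simp: permute_mat_def \<pi>N\<close>)
  show "permute_mat N \<pi> (A * B) = permute_mat N \<pi> A * permute_mat N \<pi> B"
  proof (rule eq_matI)
    fix i j assume "i < dim_row (permute_mat N \<pi> A * permute_mat N \<pi> B)" "j < dim_col (permute_mat N \<pi> A * permute_mat N \<pi> B)"
    then have ij: "i < N" "j < N" by (simp_all add: permute_mat_def)
    have "permute_mat N \<pi> (A * B) $$ (i, j) = (\<Sum>l<N. A $$ (\<pi> i, l) * B $$ (l, \<pi> j))"
      using ij mult_mat_index[OF AB \<pi>N[OF ij(1)] \<pi>N[OF ij(2)]] by (simp add: permute_mat_def del: index_mult_mat)
    also have "\<dots> = (\<Sum>l<N. A $$ (\<pi> i, \<pi> l) * B $$ (\<pi> l, \<pi> j))"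
      by (rule sum.reindex_bij_betw[OF \<pi>, symmetric])
    also have "\<dots> = (permute_mat N \<pi> A * permute_mat N \<pi> B) $$ (i, j)"
      unfolding mult_mat_index[OF permute_mat_carrier permute_mat_carrier ij]
      by (intro sum.cong refl) (simp add: permute_mat_def ij)
    finally show "permute_mat N \<pi> (A * B) $$ (i, j) = (permute_mat N \<pi> A * permute_mat N \<pi> B) $$ (i, j)" .
  qed (simp_all add: permute_mat_def)
qed simp_all

lemma nc_eval_fract_iff:
  fixes T :: "'a::field poly mat list"
  assumes T: "T \<in> mat_tuples d N" and vars: "nc_vars r \<subseteq> {..<d}"
  shows "nc_eval (\<lambda>c. Fract [:c:] 1) N (map (map_mat (\<lambda>p. Fract p 1)) T) r = Some V \<longleftrightarrow> pden d N r T \<noteq> 0 \<and> V \<in> carrier_mat N N \<and>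
    (\<forall>i<N. \<forall>j<N. Fract (pnum d N r T $$ (i, j)) 1 = Fract (pden d N r T) 1 * V $$ (i, j))"
proof -
  interpret F: comm_ring_hom "\<lambda>p :: 'a poly. Fract p 1" by (rule comm_ring_hom_Fract)
  have hom: "comm_ring_hom (\<lambda>c :: 'a. Fract [:c:] 1)" by (rule comm_ring_hom_compose[OF comm_ring_hom_Fract comm_ring_hom_const_poly])
  have T1: "T \<in> mat_tuples d (1 * N)" using T by simp
  have den: "den (\<lambda>c. Fract [:c:] 1) d 1 N (lin_sys r) (map (map_mat (\<lambda>p. Fract p 1)) T) = Fract (pden d N r T) 1"
    by (rule F.den_hom[OF T1])
  have num: "num (\<lambda>c. Fract [:c:] 1) d 1 N (lin_sys r) (map (map_mat (\<lambda>p. Fract p 1)) T) = map_mat (\<lambda>p. Fract p 1) (pnum d N r T)"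
    by (rule F.num_hom[OF T1])
  have pn: "pnum d N r T \<in> carrier_mat N N" using num_carrier[of "\<lambda>c. [:c:]" d 1 N "lin_sys r" T] by simp
  have z: "Fract p 1 = 0 \<longleftrightarrow> p = 0" for p :: "'a poly" using eq_fract(1)[of 1 1 p 0] by (simp flip: F.hom_zero)
  have "map_mat (\<lambda>p. Fract p 1) (pnum d N r T) = Fract (pden d N r T) 1 \<cdot>\<^sub>m V \<longleftrightarrow>
      (\<forall>i<N. \<forall>j<N. Fract (pnum d N r T $$ (i, j)) 1 = Fract (pden d N r T) 1 * V $$ (i, j))" (is "?A = ?B \<longleftrightarrow> ?R")
    if V: "V \<in> carrier_mat N N"
  proof
    assume eq: "?A = ?B"
    show ?R
    proof (intro allI impI)
      fix i j assume ij: "i < N" "j < N"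
      have "?A $$ (i, j) = ?B $$ (i, j)" unfolding eq ..
      then show "Fract (pnum d N r T $$ (i, j)) 1 = Fract (pden d N r T) 1 * V $$ (i, j)"
        using ij carrier_matD[OF pn] carrier_matD[OF V] by simp
    qed
  next
    assume ?R
    then show "?A = ?B" using carrier_matD[OF pn] carrier_matD[OF V] by (intro eq_matI) simp_all
  qed
  then show ?thesis
    unfolding nc_eval_iff_is_val[OF hom F.map_mat_tuples[OF T] vars] is_val_iff den num z by auto
qed

text \<open>Over the field of fractions of \<open>K[t]\<close> the values along the two curves are
  conjugate by the permutation, so each entry of one is an entry of the other. Cross-multiplying
  transfers regularity without comparing the two determinants themselves.\<close>

lemma regular_permute:
  fixes T :: "'a::field poly mat list"
  assumes T: "T \<in> mat_tuples d N" and vars: "nc_vars r \<subseteq> {..<d}" and nz: "pden d N r T \<noteq> 0" and \<pi>: "bij_betw \<pi> {..<N} {..<N}"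
    and reg: "\<And>i j. i < N \<Longrightarrow> j < N \<Longrightarrow> dvd0 (pden d N r (map (permute_mat N \<pi>) T)) (pnum d N r (map (permute_mat N \<pi>) T) $$ (i, j))"
    and ij: "i < N" "j < N"
  shows "dvd0 (pden d N r T) (pnum d N r T $$ (i, j))"
proof -
  interpret F: comm_ring_hom "\<lambda>p :: 'a poly. Fract p 1" by (rule comm_ring_hom_Fract)
  let ?T = "map (permute_mat N \<pi>) T" and ?F = "map (map_mat (\<lambda>p :: 'a poly. Fract p 1))"
  have T': "?T \<in> mat_tuples d N" by (rule permute_tuples[OF T])
  have \<pi>N: "\<pi> i < N" if "i < N" for i using bij_betwE[OF \<pi>] that by auto
  obtain V where V: "nc_eval (\<lambda>c. Fract [:c:] 1) N (?F T) r = Some V"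
  proof -
    define V where "V = mat N N (\<lambda>(i, j). Fract (pnum d N r T $$ (i, j)) (pden d N r T))"
    have "nc_eval (\<lambda>c. Fract [:c:] 1) N (?F T) r = Some V"
      unfolding nc_eval_fract_iff[OF T vars] using nz by (auto simp: V_def eq_fract)
    then show thesis by (rule that)
  qed
  have FT: "?F ?T = map (permute_mat N \<pi>) (?F T)"
    by (rule mat_tuples_eqI[OF F.map_mat_tuples[OF T'] permute_tuples[OF F.map_mat_tuples[OF T]]])
      (use mat_tuples_dims[OF T] \<pi>N in \<open>simp add: permute_mat_def\<close>)
  have V': "nc_eval (\<lambda>c. Fract [:c:] 1) N (?F ?T) r = Some (permute_mat N \<pi> V)"
    unfolding FT by (rule nc_eval_permute[OF F.map_mat_tuples[OF T] vars V \<pi>])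
  obtain i' where i': "i' < N" "\<pi> i' = i" using bij_betw_imp_surj_on[OF \<pi>] ij(1) by (metis imageE lessThan_iff)
  obtain j' where j': "j' < N" "\<pi> j' = j" using bij_betw_imp_surj_on[OF \<pi>] ij(2) by (metis imageE lessThan_iff)
  let ?n = "pnum d N r T $$ (i, j)" and ?d = "pden d N r T" and ?n' = "pnum d N r ?T $$ (i', j')" and ?d' = "pden d N r ?T"
  have 1: "Fract ?n 1 = Fract ?d 1 * V $$ (i, j)" using V ij unfolding nc_eval_fract_iff[OF T vars] by blast
  have nz': "?d' \<noteq> 0" using V' unfolding nc_eval_fract_iff[OF T' vars] by blast
  have "Fract ?n' 1 = Fract ?d' 1 * permute_mat N \<pi> V $$ (i', j')" using V' i'(1) j'(1) unfolding nc_eval_fract_iff[OF T' vars] by blast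
  then have 2: "Fract ?n' 1 = Fract ?d' 1 * V $$ (i, j)" using i' j' by (simp add: permute_mat_def)
  have "Fract (?n * ?d') 1 = Fract (?n' * ?d) 1"
    unfolding F.hom_mult 1 2 by (simp only: ac_simps)
  then have eq: "?n * ?d' = ?n' * ?d" by (simp add: eq_fract)
  obtain q p where q: "poly q 0 \<noteq> 0" "q * ?n' = ?d' * p" using reg[OF i'(1) j'(1)] by (auto simp: dvd0_def)
  have "?d' * (q * ?n) = q * (?n * ?d')" by (simp only: ac_simps)
  also have "\<dots> = (q * ?n') * ?d" unfolding eq by (simp only: ac_simps)
  also have "\<dots> = ?d' * (?d * p)" unfolding q(2) by (simp only: ac_simps)
  finally have "q * ?n = ?d * p" using nz' by simp
  then show ?thesis using q(1) unfolding dvd0_def by blast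
qed

text \<open>On triples it sends \<open>(\<kappa>, \<sigma>, p)\<close> to
  \<open>(\<kappa>, p, \<sigma>)\<close>: the tensor factors of dimension \<open>s\<close> and
  \<open>n\<close> are exchanged and the outermost index is kept.\<close>

definition swap_index :: "nat \<Rightarrow> nat \<Rightarrow> nat \<Rightarrow> nat" where
  "swap_index s n i = ((i div n) div s * n + i mod n) * s + (i div n) mod s"

lemma swap_index_eq: "p < n \<Longrightarrow> \<sigma> < s \<Longrightarrow> swap_index s n ((\<kappa> * s + \<sigma>) * n + p) = (\<kappa> * n + p) * s + \<sigma>"
  by (simp add: swap_index_def)

lemma bij_swap_index: "bij_betw (swap_index s n) {..<K * s * n} {..<K * s * n}"
proof -
  have c: "\<exists>\<kappa> \<sigma> p. \<kappa> < K \<and> \<sigma> < s \<and> p < n \<and> i = (\<kappa> * s + \<sigma>) * n + p" if i: "i < K * s * n" for i s n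
  proof -
    obtain i' p where i': "i' < K * s" "p < n" "i = i' * n + p" using i by (rule block_indexE)
    obtain \<kappa> \<sigma> where "\<kappa> < K" "\<sigma> < s" "i' = \<kappa> * s + \<sigma>" using i'(1) by (rule block_indexE)
    then show ?thesis using i' by blast
  qed
  have sw: "swap_index s n i < K * s * n \<and> swap_index n s (swap_index s n i) = i" if i: "i < K * s * n" for i s n
  proof -
    obtain \<kappa> \<sigma> p where *: "\<kappa> < K" "\<sigma> < s" "p < n" "i = (\<kappa> * s + \<sigma>) * n + p" using c[OF i] by blast
    have "(\<kappa> * n + p) * s + \<sigma> < K * n * s" using * by (intro block_index_less)
    then have "(\<kappa> * n + p) * s + \<sigma> < K * s * n" by (simp only: ac_simps)
    then show ?thesis unfolding *(4) swap_index_eq[OF *(3,2)] swap_index_eq[OF *(2,3)] by simp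
  qed
  have com: "K * s * n = K * n * s" by simp
  show ?thesis
  proof (rule bij_betw_byWitness[where f' = "swap_index n s"])
    show "\<forall>i\<in>{..<K * s * n}. swap_index n s (swap_index s n i) = i" using sw by simp
    show "\<forall>i\<in>{..<K * s * n}. swap_index s n (swap_index n s i) = i" unfolding com using sw[of _ n s] by simp
    show "swap_index s n ` {..<K * s * n} \<subseteq> {..<K * s * n}" using sw by auto
    show "swap_index n s ` {..<K * s * n} \<subseteq> {..<K * s * n}" unfolding com using sw[of _ n s] by auto
  qed
qed

lemma permute_amplify:
  assumes X: "X \<in> mat_tuples d n"
  shows "map (permute_mat (K * s * n) (swap_index s n)) (amplify K (amplify_right s X)) = amplify (K * s) X"
proof (rule mat_tuples_eqI[of _ d "K * s * n"])
  have A: "amplify K (amplify_right s X) \<in> mat_tuples d (K * s * n)"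
    using amplify_tuples[OF amplify_right_tuples[OF X], of K s] by (simp add: ac_simps)
  then show "map (permute_mat (K * s * n) (swap_index s n)) (amplify K (amplify_right s X)) \<in> mat_tuples d (K * s * n)"
    by (rule permute_tuples)
  show "amplify (K * s) X \<in> mat_tuples d (K * s * n)" by (rule amplify_tuples[OF X])
  fix k i j assume k: "k < d" and ij: "i < K * s * n" "j < K * s * n"
  obtain i' p where i: "i' < K * s" "p < n" "i = i' * n + p" using ij(1) by (rule block_indexE)
  obtain j' q where j: "j' < K * s" "q < n" "j = j' * n + q" using ij(2) by (rule block_indexE)
  obtain P x where P: "P < K" "x < s" "i' = P * s + x" using i(1) by (rule block_indexE)
  obtain Q y where Q: "Q < K" "y < s" "j' = Q * s + y" using j(1) by (rule block_indexE)
  have idx: "(A * n + a) * s + b = A * (n * s) + (a * s + b)" for A a b by (simp add: algebra_simps)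
  have eq: "P * s + x = Q * s + y \<longleftrightarrow> P = Q \<and> x = y" using P Q by (metis block_index_div_mod)
  have "(map (permute_mat (K * s * n) (swap_index s n)) (amplify K (amplify_right s X)) ! k) $$ (i, j) =
      (amplify K (amplify_right s X) ! k) $$ (swap_index s n i, swap_index s n j)"
    using ij k mat_tuples_dims(1)[OF A] by (simp add: permute_mat_def)
  also have "\<dots> = (amplify K (amplify_right s X) ! k) $$ (P * (n * s) + (p * s + x), Q * (n * s) + (q * s + y))"
    unfolding i(3) j(3) P(3) Q(3) swap_index_eq[OF i(2) P(2)] swap_index_eq[OF j(2) Q(2)] idx ..
  also have "\<dots> = (if P = Q then if x = y then (X ! k) $$ (p, q) else 0 else 0)"
    by (simp add: amplify_index[OF amplify_right_tuples[OF X] k P(1) block_index_less[OF i(2) P(2)] Q(1) block_index_less[OF j(2) Q(2)]]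
      amplify_right_index[OF X k i(2) P(2) j(2) Q(2)])
  also have "\<dots> = (amplify (K * s) X ! k) $$ (i, j)"
    unfolding i(3) j(3) amplify_index[OF X k i(1,2) j(1,2)] unfolding P(3) Q(3) eq by simp
  finally show "(map (permute_mat (K * s * n) (swap_index s n)) (amplify K (amplify_right s X)) ! k) $$ (i, j) = (amplify (K * s) X ! k) $$ (i, j)" .
qed

text \<open>At points over the field, of every size \<open>e * N\<close>, the realization takes the
  value of the expression by definition; the identity along the curve follows through the matrix
  points of quotients of \<open>K[t]\<close>.\<close>

lemma realizes_agree:
  assumes real: "realizes_expr d s Y R r" and vars: "nc_vars r \<subseteq> {..<d}" and M: "1 \<le> M" and N: "N = s * M"
    and T: "T \<in> mat_tuples d N" and nz: "pden d N r T \<noteq> 0" "den (\<lambda>c. [:c:]) d s M (fm_sys d s Y R) T \<noteq> 0" and ij: "i < N" "j < N"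
  shows "pnum d N r T $$ (i, j) * den (\<lambda>c. [:c:]) d s M (fm_sys d s Y R) T =
    num (\<lambda>c. [:c:]) d s M (fm_sys d s Y R) T $$ (i, j) * pden d N r T"
proof (rule num_den_eq_if_agree[OF T _ N nz _ ij])
  show "N = 1 * N" by simp
  fix e X V W assume e: "1 \<le> e" and X: "X \<in> mat_tuples d (e * N)" and V: "is_val (\<lambda>c. c) d 1 (e * N) (lin_sys r) X V"
    and W: "is_val (\<lambda>c. c) d s (e * M) (fm_sys d s Y R) X W"
  have eN: "e * N = s * (e * M)" using N by simp
  have eM: "1 \<le> e * M" using e M by (simp add: One_nat_def Suc_le_eq)
  have V': "nc_eval (\<lambda>c. c) (s * (e * M)) X r = Some V" using V nc_eval_iff[OF X vars] eN by simp
  have "X \<in> expr_dom d (s * (e * M)) r" using V' X eN by (simp add: expr_dom_def)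
  then have "is_val (\<lambda>c. c) d s (e * M) (fm_sys d s Y R) X V" using real eM V' unfolding realizes_expr_def by fastforce
  then show "V = W" using W by (rule is_val_unique)
qed

text \<open>The end point at \<open>t = 1\<close> lies in the domain of the expression, so neither
  determinant vanishes there.\<close>

lemma realizes_den_nonzero:
  assumes real: "realizes_expr d s Y R r" and vars: "nc_vars r \<subseteq> {..<d}" and M: "1 \<le> M" and N: "N = s * M"
    and T: "T \<in> mat_tuples d N" "eval_at 1 T \<in> expr_dom d N r"
  shows "pden d N r T \<noteq> 0" "den (\<lambda>c. [:c:]) d s M (fm_sys d s Y R) T \<noteq> 0"
proof -
  have "kden d N r (eval_at 1 T) \<noteq> 0" using T expr_dom_iff[OF eval_at_tuples[OF T(1)] vars] by blast
  then have "poly (pden d N r T) 1 \<noteq> 0" using poly_den[of T d 1 N "lin_sys r" 1] T(1) by simp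
  then show "pden d N r T \<noteq> 0" by auto
  have "den (\<lambda>c. c) d s M (fm_sys d s Y R) (eval_at 1 T) \<noteq> 0"
    using real T(2) M N unfolding realizes_expr_def is_val_iff by blast
  then have "poly (den (\<lambda>c. [:c:]) d s M (fm_sys d s Y R) T) 1 \<noteq> 0" using poly_den[of T d s M "fm_sys d s Y R" 1] T(1) N by simp
  then show "den (\<lambda>c. [:c:]) d s M (fm_sys d s Y R) T \<noteq> 0" by auto
qed

text \<open>Instance of \<open>curves\<close> with the amplified centre as end point and
  \<open>X \<otimes> I_s\<close> as the point under study. Hypothesis \<open>H\<close> speaks of
  \<open>I \<otimes> X\<close> and of the expression: the coordinate swap changes the order of the
  factors, and the cross-multiplied identity passes from the expression to its realization.\<close>

lemma resolvent_regular_at: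
  assumes vars: "nc_vars r \<subseteq> {..<d}" and n: "1 \<le> n" and s: "1 \<le> s" and X: "X \<in> mat_tuples d n"
    and Y: "Y \<in> expr_dom d s r" and real: "realizes_expr d s Y R r"
    and ctrl: "controllable d s (fm_sys d s Y R)" and obs: "observable d s (fm_sys d s Y R)"
    and H: "\<And>K T i j. 1 \<le> K \<Longrightarrow> T \<in> mat_tuples d (K * s * n) \<Longrightarrow> eval_at 0 T = amplify (K * s) X \<Longrightarrow>
      eval_at 1 T \<in> expr_dom d (K * s * n) r \<Longrightarrow> i < K * s * n \<Longrightarrow> j < K * s * n \<Longrightarrow>
      dvd0 (pden d (K * s * n) r T) (pnum d (K * s * n) r T $$ (i, j))"
  shows "den (\<lambda>c. c) d s n (fm_sys d s Y R) (amplify_right s X) \<noteq> 0"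
proof -
  let ?S = "fm_sys d s Y R"
  have Yt: "Y \<in> mat_tuples d s" using Y by (simp add: expr_dom_def)
  have R: "is_fm_real d s R" using real by (simp add: realizes_expr_def)
  \<comment> \<open>At the amplified centre all increments vanish, so the pencil is the identity and
    the right-hand side is zero there.\<close>
  have cen0: "cen s Y (amplify n Y) P Q k x y = 0" if "k < d" "P < n" "Q < n" "x < s" "y < s" for P Q k x y
    using amplify_index[OF Yt that(1,2,4,3,5)] by (simp add: cen_def)
  interpret curves d s n ?S "amplify_right s X" "amplify n Y" r
  proof
    show "nc_vars r \<subseteq> {..<d}" "1 \<le> n" by fact+
    show "amplify_right s X \<in> mat_tuples d (n * s)" by (rule amplify_right_tuples[OF X])
    obtain V where "nc_eval (\<lambda>c. c) s Y r = Some V" using Y by (auto simp: expr_dom_def)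
    from nc_eval_amplify[OF Yt vars this, of n] show "amplify n Y \<in> expr_dom d (n * s) r"
      using amplify_tuples[OF Yt, of n] by (simp add: expr_dom_def)
  next
    fix P \<alpha> Q \<beta> assume *: "P < n" "\<alpha> < sys_L ?S" "Q < n" "\<beta> < sys_L ?S"
    show "aff_entry (\<lambda>c. c) d s (sys_G ?S) (sys_a ?S) (amplify n Y) P \<alpha> Q \<beta> = (if P = Q \<and> \<alpha> = \<beta> then 1 else 0)"
      unfolding fm_lam_entry[OF R Yt *(2,4)[unfolded fm_sys_simps(1)]] using *(1,3) by (simp add: cen0)
  next
    fix P \<alpha> Q j assume *: "P < n" "\<alpha> < sys_L ?S" "Q < n" "j < s"
    show "aff_entry (\<lambda>c. c) d s (sys_B ?S) (sys_b ?S) (amplify n Y) P \<alpha> Q j = 0"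
      unfolding fm_rhs_entry[OF R Yt *(2)[unfolded fm_sys_simps(1)] *(4)] using *(1,3) by (simp add: cen0)
  next
    fix K T i j assume K: "1 \<le> K" and T: "T \<in> mat_tuples d (K * n * s)" and T0: "eval_at 0 T = amplify K (amplify_right s X)"
      and T1: "eval_at 1 T \<in> expr_dom d (K * n * s) r" and ij: "i < K * n * s" "j < K * n * s"
    let ?N = "K * s * n" and ?\<pi> = "swap_index s n"
    have com: "K * n * s = ?N" by simp
    note T = T[unfolded com] and T1 = T1[unfolded com] and ij = ij[unfolded com]
    have M: "1 \<le> K * n" using K n by (simp add: One_nat_def Suc_le_eq)
    have N: "?N = s * (K * n)" by simp
    note nz = realizes_den_nonzero[OF real vars M N T T1]
    let ?T = "map (permute_mat ?N ?\<pi>) T"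
    have \<pi>N: "?\<pi> i < ?N" if "i < ?N" for i using bij_betwE[OF bij_swap_index[of s n K]] that by auto
    have ev: "eval_at t ?T = map (permute_mat ?N ?\<pi>) (eval_at t T)" for t
      by (rule mat_tuples_eqI[OF eval_at_tuples[OF permute_tuples[OF T]] permute_tuples[OF eval_at_tuples[OF T]]])
        (use mat_tuples_dims[OF T] \<pi>N in \<open>simp add: permute_mat_def eval_at_def\<close>)
    have "dvd0 (pden d ?N r T) (pnum d ?N r T $$ (i, j))"
    proof (rule regular_permute[OF T vars nz(1) bij_swap_index _ ij])
      fix i j assume ij: "i < ?N" "j < ?N"
      show "dvd0 (pden d ?N r ?T) (pnum d ?N r ?T $$ (i, j))"
      proof (rule H[OF K permute_tuples[OF T] _ _ ij])
        show "eval_at 0 ?T = amplify (K * s) X" unfolding ev T0 by (rule permute_amplify[OF X])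
        obtain V where "nc_eval (\<lambda>c. c) ?N (eval_at 1 T) r = Some V" using T1 by (auto simp: expr_dom_def)
        from nc_eval_permute[OF eval_at_tuples[OF T] vars this bij_swap_index]
        show "eval_at 1 ?T \<in> expr_dom d ?N r"
          unfolding ev using permute_tuples[OF eval_at_tuples[OF T]] by (simp add: expr_dom_def)
      qed
    qed
    then obtain q p where q: "poly q 0 \<noteq> 0" "q * pnum d ?N r T $$ (i, j) = pden d ?N r T * p" by (auto simp: dvd0_def)
    have eq: "pnum d ?N r T $$ (i, j) * den (\<lambda>c. [:c:]) d s (K * n) ?S T = num (\<lambda>c. [:c:]) d s (K * n) ?S T $$ (i, j) * pden d ?N r T"
      by (rule realizes_agree[OF real vars M N T nz ij])
    have "pden d ?N r T * (q * num (\<lambda>c. [:c:]) d s (K * n) ?S T $$ (i, j)) = q * (pnum d ?N r T $$ (i, j) * den (\<lambda>c. [:c:]) d s (K * n) ?S T)"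
      unfolding eq by (simp only: ac_simps)
    also have "\<dots> = (q * pnum d ?N r T $$ (i, j)) * den (\<lambda>c. [:c:]) d s (K * n) ?S T" by (simp only: ac_simps)
    also have "\<dots> = pden d ?N r T * (den (\<lambda>c. [:c:]) d s (K * n) ?S T * p)" unfolding q(2) by (simp only: ac_simps)
    finally have "q * num (\<lambda>c. [:c:]) d s (K * n) ?S T $$ (i, j) = den (\<lambda>c. [:c:]) d s (K * n) ?S T * p" using nz(1) by simp
    then show "den (\<lambda>c. [:c:]) d s (K * n) ?S T \<noteq> 0 \<and> dvd0 (den (\<lambda>c. [:c:]) d s (K * n) ?S T) (num (\<lambda>c. [:c:]) d s (K * n) ?S T $$ (i, j))"
      using nz(2) q(1) unfolding dvd0_def by blast
  qed
  show ?thesis by (rule resolvent_regular[OF ctrl obs])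
qed

text \<open>At \<open>Z \<otimes> I\<close> the resolvent becomes a pencil in \<open>Z\<close> over the ground field, which is inverted by expressions.\<close>

lemma expr_defined_at:
  assumes vars: "nc_vars r \<subseteq> {..<d}" and s: "1 \<le> s" and X: "X \<in> mat_tuples d n"
    and real: "realizes_expr d s Y R r" and nz: "den (\<lambda>c. c) d s n (fm_sys d s Y R) (amplify_right s X) \<noteq> 0"
  shows "\<exists>r'. nc_vars r' \<subseteq> {..<d} \<and> X \<in> expr_dom d n r' \<and>
    (\<forall>n' Z V W. 1 \<le> n' \<longrightarrow> Z \<in> mat_tuples d n' \<longrightarrow> nc_eval (\<lambda>c. c) n' Z r = Some V \<longrightarrow> nc_eval (\<lambda>c. c) n' Z r' = Some W \<longrightarrow> V = W)"
proof -
  interpret eval_points d n X by unfold_locales (rule X)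
  let ?S = "fm_sys d s Y R"
  define L where "L = fm_L R"
  have L: "sys_L ?S = L" by (simp add: L_def)
  let ?am = "amplify_right s"
  let ?l = "\<lambda>n' Z. lam (\<lambda>c. c) d s n' ?S (?am Z)" and ?b = "\<lambda>n' Z. rhs (\<lambda>c. c) d s n' ?S (?am Z)"
  have lc: "?l n' Z \<in> carrier_mat (n' * L) (n' * L)" and bc: "?b n' Z \<in> carrier_mat (n' * L) (n' * s)" for n' Z
    using sys_carrier(1)[of "\<lambda>c. c" d s n' ?S "?am Z"] sys_carrier(2)[of "\<lambda>c. c" d s n' ?S "?am Z"] by (simp_all add: L_def)
  \<comment> \<open>The domain of \<open>r\<close>, where the new expression has to agree with it,
    together with \<open>X\<close>; the pencil is invertible at all these points.\<close>
  define \<Omega> where "\<Omega> = insert (n, X) {(n', Z). 1 \<le> n' \<and> Z \<in> expr_dom d n' r}"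
  have pts: "points \<Omega>" using X by (auto simp: points_def \<Omega>_def expr_dom_def)
  have tup: "Z \<in> mat_tuples d n'" if "(n', Z) \<in> \<Omega>" for n' Z using pts that by (auto simp: points_def)
  have val: "is_val (\<lambda>c. c) d s n' ?S (?am Z) (kronecker V (1\<^sub>m s))"
    if h: "1 \<le> n'" "Z \<in> mat_tuples d n'" "nc_eval (\<lambda>c. c) n' Z r = Some V" for n' Z V
  proof -
    have e: "nc_eval (\<lambda>c. c) (s * n') (?am Z) r = Some (kronecker V (1\<^sub>m s))"
      using nc_eval_amplify_right[OF h(2) vars h(3), of s] by (simp add: mult.commute)
    then have "?am Z \<in> expr_dom d (s * n') r" using amplify_right_tuples[OF h(2), of s] by (simp add: expr_dom_def mult.commute)
    then show ?thesis using real h(1) e unfolding realizes_expr_def by fastforce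
  qed
  have nzZ: "den (\<lambda>c. c) d s n' ?S (?am Z) \<noteq> 0" if z: "(n', Z) \<in> \<Omega>" for n' Z
  proof (cases "(n', Z) = (n, X)")
    case False
    then have z: "1 \<le> n'" "Z \<in> expr_dom d n' r" using z by (auto simp: \<Omega>_def)
    then obtain V where V: "nc_eval (\<lambda>c. c) n' Z r = Some V" by (auto simp: expr_dom_def)
    show ?thesis using val[OF z(1) _ V] z(2) by (auto simp: expr_dom_def is_val_iff)
  qed (use nz in simp)
  define U where "U n' Z = (SOME U. U \<in> carrier_mat (n' * L) (n' * s) \<and> ?l n' Z * U = ?b n' Z)" for n' Z
  have U: "U n' Z \<in> carrier_mat (n' * L) (n' * s) \<and> ?l n' Z * U n' Z = ?b n' Z" if z: "(n', Z) \<in> \<Omega>" for n' Z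
  proof -
    obtain V where "is_val (\<lambda>c. c) d s n' ?S (?am Z) V" using is_val_exists[OF nzZ[OF z]] by blast
    then have "\<exists>U. U \<in> carrier_mat (n' * L) (n' * s) \<and> ?l n' Z * U = ?b n' Z" unfolding is_val_def L by blast
    then show ?thesis unfolding U_def by (rule someI_ex)
  qed
  \<comment> \<open>One column per block is enough: the value at \<open>Z \<otimes> I_s\<close> is
    \<open>V \<otimes> I_s\<close>, and the entry \<open>(0, 0)\<close> of each block is the entry
    of \<open>V\<close>.\<close>
  define u where "u \<beta> n' Z = mat n' n' (\<lambda>(P, Q). U n' Z $$ (P * L + \<beta>, Q * s + 0))" for \<beta> n' Z
  define E where "E G a \<alpha> j n' Z = mat n' n' (\<lambda>(P, Q). aff_entry (\<lambda>c. c) d s G a (?am Z) P \<alpha> Q j)"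
    for G :: "nat \<Rightarrow> nat \<Rightarrow> 'a" and a :: "nat \<Rightarrow> nat \<Rightarrow> nat \<Rightarrow> nat \<Rightarrow> nat \<Rightarrow> 'a" and \<alpha> j n' :: nat and Z :: "'a mat list"
  have s0: "0 < s" using s by simp
  have expE: "expressible \<Omega> (E G a \<alpha> j)" for G a \<alpha> j
  proof (rule expressible_cong[OF pts])
    \<comment> \<open>Blocks of \<open>Z \<otimes> I_s\<close> are scalar, so only coefficients of
      diagonal matrix units survive, and they add up to one coefficient for each variable.\<close>
    show "expressible \<Omega> (\<lambda>n' Z. G \<alpha> j \<cdot>\<^sub>m 1\<^sub>m n' + msum n' (\<lambda>k. ((\<Sum>x<s. a k x x \<alpha> j) \<cdot>\<^sub>m 1\<^sub>m n') * Z ! k) d)"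
      by (intro expressible_add expressible_const expressible_msum[OF pts] expressible_mult expressible_var[OF pts])
    fix n' Z assume z: "(n', Z) \<in> \<Omega>"
    note Zc = mat_tuplesD(2)[OF tup[OF z]]
    show "G \<alpha> j \<cdot>\<^sub>m 1\<^sub>m n' + msum n' (\<lambda>k. ((\<Sum>x<s. a k x x \<alpha> j) \<cdot>\<^sub>m 1\<^sub>m n') * Z ! k) d = E G a \<alpha> j n' Z"
    proof (rule eq_matI)
      fix P Q assume "P < dim_row (E G a \<alpha> j n' Z)" "Q < dim_col (E G a \<alpha> j n' Z)"
      then have PQ: "P < n'" "Q < n'" by (simp_all add: E_def)
      have "(\<Sum>k<d. \<Sum>x<s. \<Sum>y<s. (?am Z ! k) $$ (P * s + x, Q * s + y) * a k x y \<alpha> j) =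
          (\<Sum>k<d. \<Sum>x<s. \<Sum>y<s. if y = x then (Z ! k) $$ (P, Q) * a k x x \<alpha> j else 0)"
        by (intro sum.cong refl) (auto simp: amplify_right_index[OF tup[OF z]] PQ)
      also have "\<dots> = (\<Sum>k<d. (((\<Sum>x<s. a k x x \<alpha> j) \<cdot>\<^sub>m 1\<^sub>m n') * Z ! k) $$ (P, Q))"
      proof (rule sum.cong[OF refl])
        fix k assume "k \<in> {..<d}"
        then have Zk: "Z ! k \<in> carrier_mat n' n'" using Zc by simp
        have "(\<Sum>x<s. \<Sum>y<s. if y = x then (Z ! k) $$ (P, Q) * a k x x \<alpha> j else 0) = (\<Sum>x<s. (Z ! k) $$ (P, Q) * a k x x \<alpha> j)"
          by (intro sum.cong refl) simp
        moreover have "((\<Sum>x<s. a k x x \<alpha> j) \<cdot>\<^sub>m 1\<^sub>m n') * Z ! k = (\<Sum>x<s. a k x x \<alpha> j) \<cdot>\<^sub>m Z ! k"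
          using mult_smult_assoc_mat[OF one_carrier_mat Zk] Zk by simp
        ultimately show "(\<Sum>x<s. \<Sum>y<s. if y = x then (Z ! k) $$ (P, Q) * a k x x \<alpha> j else 0) = (((\<Sum>x<s. a k x x \<alpha> j) \<cdot>\<^sub>m 1\<^sub>m n') * Z ! k) $$ (P, Q)"
          using PQ carrier_matD[OF Zk] by (simp add: sum_distrib_left mult.commute)
      qed
      finally show "(G \<alpha> j \<cdot>\<^sub>m 1\<^sub>m n' + msum n' (\<lambda>k. ((\<Sum>x<s. a k x x \<alpha> j) \<cdot>\<^sub>m 1\<^sub>m n') * Z ! k) d) $$ (P, Q) = E G a \<alpha> j n' Z $$ (P, Q)"
        using PQ by (simp add: E_def aff_entry_def msum_def)
    qed (simp_all add: E_def msum_def)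
  qed
  have expu: "expressible \<Omega> (u \<beta>)" if "\<beta> < L" for \<beta>
  proof (rule expressible_solution[OF pts, of L "E (sys_G ?S) (sys_a ?S)" "\<lambda>\<alpha>. E (sys_B ?S) (sys_b ?S) \<alpha> 0" u "?l n X" \<beta>])
    fix \<alpha> n' Z assume \<alpha>: "\<alpha> < L" and z: "(n', Z) \<in> \<Omega>"
    show "msum n' (\<lambda>\<beta>. E (sys_G ?S) (sys_a ?S) \<alpha> \<beta> n' Z * u \<beta> n' Z) L = E (sys_B ?S) (sys_b ?S) \<alpha> 0 n' Z"
    proof (rule eq_matI)
      fix P Q assume "P < dim_row (E (sys_B ?S) (sys_b ?S) \<alpha> 0 n' Z)" "Q < dim_col (E (sys_B ?S) (sys_b ?S) \<alpha> 0 n' Z)"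
      then have PQ: "P < n'" "Q < n'" by (simp_all add: E_def)
      have Ec: "E (sys_G ?S) (sys_a ?S) \<alpha> \<beta> n' Z \<in> carrier_mat n' n'" "u \<beta> n' Z \<in> carrier_mat n' n'" for \<beta> by (simp_all add: E_def u_def)
      have "msum n' (\<lambda>\<beta>. E (sys_G ?S) (sys_a ?S) \<alpha> \<beta> n' Z * u \<beta> n' Z) L $$ (P, Q) =
          (\<Sum>\<beta><L. \<Sum>R'<n'. ?l n' Z $$ (P * L + \<alpha>, R' * L + \<beta>) * U n' Z $$ (R' * L + \<beta>, Q * s + 0))"
        unfolding msum_index[OF PQ] mult_mat_index[OF Ec PQ]
        by (intro sum.cong refl) (simp add: lam_index[where S = ?S, unfolded L] PQ \<alpha> E_def u_def del: fm_sys_simps)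
      also have "\<dots> = (\<Sum>R'<n'. \<Sum>\<beta><L. ?l n' Z $$ (P * L + \<alpha>, R' * L + \<beta>) * U n' Z $$ (R' * L + \<beta>, Q * s + 0))" by (rule sum.swap)
      also have "\<dots> = (?l n' Z * U n' Z) $$ (P * L + \<alpha>, Q * s + 0)"
        by (rule mult_mat_block_index[OF lc U[OF z, THEN conjunct1] block_index_less[OF PQ(1) \<alpha>] block_index_less[OF PQ(2) s0], symmetric])
      also have "\<dots> = E (sys_B ?S) (sys_b ?S) \<alpha> 0 n' Z $$ (P, Q)"
        unfolding U[OF z, THEN conjunct2] using rhs_index[where S = ?S, unfolded L, OF PQ(1) \<alpha> PQ(2) s0] PQ by (simp add: E_def del: fm_sys_simps)
      finally show "msum n' (\<lambda>\<beta>. E (sys_G ?S) (sys_a ?S) \<alpha> \<beta> n' Z * u \<beta> n' Z) L $$ (P, Q) = E (sys_B ?S) (sys_b ?S) \<alpha> 0 n' Z $$ (P, Q)" .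
    qed (simp_all add: E_def msum_def)
  next
    fix P Q \<alpha> \<beta> assume "P < n" "Q < n" "\<alpha> < L" "\<beta> < L"
    then show "?l n X $$ (P * L + \<alpha>, Q * L + \<beta>) = E (sys_G ?S) (sys_a ?S) \<alpha> \<beta> n X $$ (P, Q)"
      using lam_index[where S = ?S, unfolded L] by (simp add: E_def del: fm_sys_simps)
  qed (use expE lc nz that in \<open>simp_all add: u_def den_def\<close>)
  define \<psi> where "\<psi> n' Z = sys_D ?S 0 0 \<cdot>\<^sub>m 1\<^sub>m n' + msum n' (\<lambda>\<alpha>. (sys_C ?S 0 \<alpha> \<cdot>\<^sub>m 1\<^sub>m n') * u \<alpha> n' Z) L" for n' Z
  have "expressible \<Omega> \<psi>"
    unfolding \<psi>_def by (intro expressible_add expressible_const expressible_msum[OF pts] expressible_mult expu)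
  then obtain r' where r': "nc_vars r' \<subseteq> {..<d}" "nc_eval (\<lambda>c. c) n X r' = Some (\<psi> n X)"
    "\<forall>n' Z V. (n', Z) \<in> \<Omega> \<longrightarrow> nc_eval (\<lambda>c. c) n' Z r' = Some V \<longrightarrow> V = \<psi> n' Z"
    by (elim expressibleE) (rule that)
  have "V = W" if h: "1 \<le> n'" "Z \<in> mat_tuples d n'" and V: "nc_eval (\<lambda>c. c) n' Z r = Some V" and W: "nc_eval (\<lambda>c. c) n' Z r' = Some W" for n' Z V W
  proof -
    have z: "(n', Z) \<in> \<Omega>" using h V by (auto simp: \<Omega>_def expr_dom_def)
    have W': "W = \<psi> n' Z" using r'(3) z W by blast
    have Vc: "V \<in> carrier_mat n' n'" by (rule nc_eval_carrier[OF h(2) vars V])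
    note Uz = U[OF z, THEN conjunct1] U[OF z, THEN conjunct2]
    let ?D = "diagD (\<lambda>c. c) s n' ?S" and ?C = "diagC (\<lambda>c. c) s n' ?S"
    have C: "?C \<in> carrier_mat (n' * s) (n' * L)" using sys_carrier(3)[of "\<lambda>c. c" s n' ?S] by (simp add: L_def)
    obtain U' where U': "U' \<in> carrier_mat (n' * L) (n' * s)" "?l n' Z * U' = ?b n' Z" "kronecker V (1\<^sub>m s) = ?D + ?C * U'"
      using val[OF h V] unfolding is_val_def L by blast
    have "U' = U n' Z"
      by (rule solution_unique[OF lc U'(1) Uz(1)]) (use U'(2) Uz(2) nzZ[OF z] in \<open>simp_all add: den_def\<close>)
    then have kV: "kronecker V (1\<^sub>m s) = ?D + ?C * U n' Z" using U'(3) by simp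
    show "V = W"
      unfolding W'
    proof (rule eq_matI)
      fix P Q assume "P < dim_row (\<psi> n' Z)" "Q < dim_col (\<psi> n' Z)"
      then have PQ: "P < n'" "Q < n'" by (simp_all add: \<psi>_def msum_def)
      note CUc = mult_carrier_mat[OF C Uz(1)]
      have uc: "u \<alpha> n' Z \<in> carrier_mat n' n'" for \<alpha> by (simp add: u_def)
      have "V $$ (P, Q) = kronecker V (1\<^sub>m s) $$ (P * s + 0, Q * s + 0)"
        using kronecker_index[OF Vc one_carrier_mat PQ(1) s0 PQ(2) s0] s0 by simp
      also have "\<dots> = ?D $$ (P * s + 0, Q * s + 0) + (?C * U n' Z) $$ (P * s + 0, Q * s + 0)"
        unfolding kV by (rule index_add_mat(1)) (use carrier_matD[OF CUc] block_index_less[OF PQ(1) s0] block_index_less[OF PQ(2) s0] in simp_all)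
      also have "?D $$ (P * s + 0, Q * s + 0) = (if P = Q then sys_D ?S 0 0 else 0)"
        unfolding diagD_def by (rule block_diag_index[OF PQ(1) s0 PQ(2) s0])
      also have "(?C * U n' Z) $$ (P * s + 0, Q * s + 0) = (\<Sum>\<alpha><L. sys_C ?S 0 \<alpha> * U n' Z $$ (P * L + \<alpha>, Q * s + 0))"
        unfolding diagC_def L by (rule block_diag_mult_left[OF Uz(1) PQ(1) s0 PQ(2) s0])
      also have "\<dots> = msum n' (\<lambda>\<alpha>. (sys_C ?S 0 \<alpha> \<cdot>\<^sub>m 1\<^sub>m n') * u \<alpha> n' Z) L $$ (P, Q)"
        unfolding msum_index[OF PQ]
      proof (rule sum.cong[OF refl])
        fix \<alpha>
        have "(sys_C ?S 0 \<alpha> \<cdot>\<^sub>m 1\<^sub>m n') * u \<alpha> n' Z = sys_C ?S 0 \<alpha> \<cdot>\<^sub>m u \<alpha> n' Z"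
          using mult_smult_assoc_mat[OF one_carrier_mat uc, of "sys_C ?S 0 \<alpha>" \<alpha>] uc[of \<alpha>] by simp
        then show "sys_C ?S 0 \<alpha> * U n' Z $$ (P * L + \<alpha>, Q * s + 0) = ((sys_C ?S 0 \<alpha> \<cdot>\<^sub>m 1\<^sub>m n') * u \<alpha> n' Z) $$ (P, Q)"
          using PQ by (simp add: u_def del: fm_sys_simps)
      qed
      finally show "V $$ (P, Q) = \<psi> n' Z $$ (P, Q)" using PQ by (simp add: \<psi>_def msum_def del: fm_sys_simps)
    qed (use Vc in \<open>simp_all add: \<psi>_def msum_def\<close>)
  qed
  moreover have "X \<in> expr_dom d n r'" using r'(2) X by (simp add: expr_dom_def)
  ultimately show ?thesis using r'(1) by blast
qed

text \<open>The expression built from the resolvent is defined at \<open>X\<close>, so it is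
  nondegenerate; agreeing with \<open>r\<close> wherever both are defined, it belongs to the same
  class.\<close>

lemma mem_nc_dom:
  assumes F: "F \<in> nc_rat_funs d" and r: "r \<in> F" and n: "1 \<le> n" and s: "1 \<le> s" and X: "X \<in> mat_tuples d n"
    and real: "realizes_expr d s Y R r" and nz: "den (\<lambda>c. c) d s n (fm_sys d s Y R) (amplify_right s X) \<noteq> 0"
  shows "X \<in> nc_dom_n d n F"
proof -
  obtain r' where r': "nc_vars r' \<subseteq> {..<d}" "X \<in> expr_dom d n r'"
    "\<forall>n' Z V W. 1 \<le> n' \<longrightarrow> Z \<in> mat_tuples d n' \<longrightarrow> nc_eval (\<lambda>c. c) n' Z r = Some V \<longrightarrow> nc_eval (\<lambda>c. c) n' Z r' = Some W \<longrightarrow> V = W"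
    using expr_defined_at[OF nc_rat_fun_equiv(3)[OF F r] s X real nz] by (elim exE conjE) (rule that)
  have "r' \<in> nondegenerate_exprs d" using r'(1,2) n by (auto simp: nondegenerate_exprs_def)
  moreover have "r \<in> nondegenerate_exprs d" using nc_equiv_nondegenerate[OF nc_rat_fun_equiv(1)[OF F r r]] by blast
  moreover have "nc_eval (\<lambda>c. c) n' Z r = nc_eval (\<lambda>c. c) n' Z r'" if n': "1 \<le> n'" and Z: "Z \<in> expr_dom d n' r \<inter> expr_dom d n' r'" for n' Z
  proof -
    obtain V W where "nc_eval (\<lambda>c. c) n' Z r = Some V" "nc_eval (\<lambda>c. c) n' Z r' = Some W" "Z \<in> mat_tuples d n'"
      using Z by (auto simp: expr_dom_def)
    then show ?thesis using r'(3) n' by simp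
  qed
  ultimately have "(r, r') \<in> nc_equiv d" unfolding nc_equiv_def by blast
  then have "r' \<in> F" by (rule nc_rat_fun_equiv(2)[OF F r])
  then show ?thesis using r'(2) by (auto simp: nc_dom_n_def)
qed

lemma nc_edom_st_subset_dom:
  assumes F: "F \<in> nc_rat_funs d" and n: "1 \<le> n"
  shows "nc_edom_st_n d n F \<subseteq> nc_dom_n d n F"
proof
  fix X assume "X \<in> nc_edom_st_n d n F"
  then have X: "X \<in> mat_tuples d n" and ed: "\<And>m. 1 \<le> m \<Longrightarrow> amplify m X \<in> nc_edom_n d (m * n) F"
    by (auto simp: nc_edom_st_n_def)
  \<comment> \<open>Taking \<open>m = 1\<close> in the stable domain shows that the function has
    points of size \<open>n\<close>; one of them serves as the centre, so \<open>s = n\<close>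
    here.\<close>
  have "nc_dom_n d (1 * n) F \<noteq> {}" using ed[of 1] by (auto simp: nc_edom_n_def split: if_splits)
  then obtain Y r where r: "r \<in> F" and Y: "Y \<in> expr_dom d n r" by (auto simp: nc_dom_n_def)
  note vars = nc_rat_fun_equiv(3)[OF F r]
  have Yt: "Y \<in> mat_tuples d n" using Y by (simp add: expr_dom_def)
  obtain R0 where "realizes_expr d n Y R0 r" using realization_exists[OF Y vars] by blast
  then obtain R where real: "realizes_expr d n Y R r"
    and co: "controllable d n (fm_sys d n Y R)" "observable d n (fm_sys d n Y R)"
    using controllable_observable_realization_exists[OF Yt] by blast
  have "den (\<lambda>c. c) d n n (fm_sys d n Y R) (amplify_right n X) \<noteq> 0"
  proof (rule resolvent_regular_at[OF vars n n X Y real co])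
    fix K T i j assume K: "1 \<le> K" and T: "T \<in> mat_tuples d (K * n * n)" "eval_at 0 T = amplify (K * n) X"
      "eval_at 1 T \<in> expr_dom d (K * n * n) r" and ij: "i < K * n * n" "j < K * n * n"
    have Kn: "1 \<le> K * n" "1 \<le> K * n * n" using K n by (simp_all add: One_nat_def Suc_le_eq)
    have nz: "pden d (K * n * n) r T \<noteq> 0"
      by (rule realizes_den_nonzero(1)[OF real vars Kn(1) _ T(1,3)]) simp
    have "eval_at 0 T \<in> nc_edom_n d (K * n * n) F" using ed[OF Kn(1)] T(2) by simp
    then show "dvd0 (pden d (K * n * n) r T) (pnum d (K * n * n) r T $$ (i, j))"
      unfolding dvd0_def using nc_edom_curve[OF F r Kn(2) _ T(1) _ nz ij] T(3) by blast
  qed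
  then show "X \<in> nc_dom_n d n F" by (rule mem_nc_dom[OF F r n n X real])
qed

lemma nc_edom_st_eq_dom:
  assumes "F \<in> nc_rat_funs d" "1 \<le> n"
  shows "nc_edom_st_n d n F = nc_dom_n d n F"
  using nc_edom_st_subset_dom[OF assms] nc_dom_subset_edom_st[OF assms] by blast

text \<open>One inclusion is part of being a realization. For the other, a nonzero denominator of
  the realization at \<open>t = 0\<close> makes the expression regular along curves, and minimality
  supplies controllability and observability.\<close>

lemma nc_dom_eq_fm_domain:
  assumes F: "F \<in> nc_rat_funs d" and n: "1 \<le> n" and s: "1 \<le> s" and Y: "Y \<in> nc_dom_n d s F" and min: "fm_minimal d s Y R F"
  shows "nc_dom_n d n F = {X \<in> mat_tuples d n. amplify s X \<in> fm_domain d s Y R n}"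
proof (intro equalityI subsetI)
  obtain r where r: "r \<in> F" and Yr: "Y \<in> expr_dom d s r" using Y by (auto simp: nc_dom_n_def)
  note vars = nc_rat_fun_equiv(3)[OF F r]
  have Yt: "Y \<in> mat_tuples d s" using Yr by (simp add: expr_dom_def)
  have rz: "fm_realizes d s Y R F" using min by (simp add: fm_minimal_def)
  have R: "is_fm_real d s R" and real: "realizes_expr d s Y R r"
    using rz r unfolding fm_realizes_iff[OF F Yt s] by auto
  fix X
  show "X \<in> {X \<in> mat_tuples d n. amplify s X \<in> fm_domain d s Y R n}" if X: "X \<in> nc_dom_n d n F"
  proof -
    obtain r1 V where r1: "r1 \<in> F" "X \<in> mat_tuples d n" "nc_eval (\<lambda>c. c) n X r1 = Some V"
      using X by (auto simp: nc_dom_n_def expr_dom_def)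
    have "amplify s X \<in> nc_dom_n d (s * n) F"
      using nc_eval_amplify[OF r1(2) nc_rat_fun_equiv(3)[OF F r1(1)] r1(3), of s] amplify_tuples[OF r1(2), of s] r1(1)
      by (auto simp: nc_dom_n_def expr_dom_def)
    then show ?thesis using rz n r1(2) unfolding fm_realizes_def by blast
  qed
  show "X \<in> nc_dom_n d n F" if X': "X \<in> {X \<in> mat_tuples d n. amplify s X \<in> fm_domain d s Y R n}"
  proof -
    let ?S = "fm_sys d s Y R"
    have X: "X \<in> mat_tuples d n" and dX: "den (\<lambda>c. c) d s n ?S (amplify s X) \<noteq> 0"
      using X' fm_domain_iff[OF R Yt] by auto
    have aX: "amplify s X \<in> mat_tuples d (n * s)" using amplify_tuples[OF X, of s] by (simp add: mult.commute)
    have co: "controllable d s ?S" "observable d s ?S" using minimal_controllable_observable[OF F Yt s min] by auto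
    \<comment> \<open>Swapping coordinates breaks up the \<open>s\<close> by \<open>s\<close>
      blocks, so the pencils at \<open>I_s \<otimes> X\<close> and \<open>X \<otimes> I_s\<close>
      are not simply conjugate. The passage goes through the value of \<open>r\<close>, which is
      compatible with conjugation.\<close>
    have "den (\<lambda>c. c) d s n ?S (amplify_right s X) \<noteq> 0"
    proof (rule resolvent_regular_at[OF vars n s X Yr real co])
      fix K T i j assume K: "1 \<le> K" and T: "T \<in> mat_tuples d (K * s * n)" "eval_at 0 T = amplify (K * s) X"
        "eval_at 1 T \<in> expr_dom d (K * s * n) r" and ij: "i < K * s * n" "j < K * s * n"
      have M: "1 \<le> K * n" using K n by (simp add: One_nat_def Suc_le_eq)
      have N: "K * s * n = s * (K * n)" by simp
      note nz = realizes_den_nonzero[OF real vars M N T(1,3)]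
      \<comment> \<open>The denominator of the realization along the curve becomes the multiplier
        required by \<open>dvd0\<close>.\<close>
      have "den (\<lambda>c. c) d s (K * n) ?S (eval_at 0 T) \<noteq> 0"
        unfolding T(2) amplify_amplify[OF X, symmetric] by (rule den_amplify[OF aX dX])
      then have "poly (den (\<lambda>c. [:c:]) d s (K * n) ?S T) 0 \<noteq> 0" using poly_den[of T d s "K * n" ?S 0] T(1) N by simp
      moreover have "den (\<lambda>c. [:c:]) d s (K * n) ?S T * pnum d (K * s * n) r T $$ (i, j) =
          pden d (K * s * n) r T * num (\<lambda>c. [:c:]) d s (K * n) ?S T $$ (i, j)"
        using realizes_agree[OF real vars M N T(1) nz ij] by (simp only: mult.commute)
      ultimately show "dvd0 (pden d (K * s * n) r T) (pnum d (K * s * n) r T $$ (i, j))" unfolding dvd0_def by blast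
    qed
    then show ?thesis by (rule mem_nc_dom[OF F r n s X real])
  qed
qed

theorem theorem5:
  fixes d :: nat and F :: "'a::field ncexpr set"
  assumes "F \<in> nc_rat_funs d"
  shows "nc_edom_st d F = nc_dom d F \<and>
    (\<forall>n s Y R. 1 \<le> n \<longrightarrow> 1 \<le> s \<longrightarrow> Y \<in> nc_dom_n d s F \<longrightarrow> fm_minimal d s Y R F \<longrightarrow>
       nc_edom_st_n d n F = nc_dom_n d n F \<and>
       nc_dom_n d n F = {X \<in> mat_tuples d n. amplify s X \<in> fm_domain d s Y R n})"
proof (intro conjI allI impI)
  show "nc_edom_st d F = nc_dom d F"
    unfolding nc_edom_st_def nc_dom_def by (rule Sigma_cong) (auto simp: nc_edom_st_eq_dom[OF assms])
next
  fix n s :: nat and Y R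
  assume "1 \<le> n" "1 \<le> s" "Y \<in> nc_dom_n d s F" "fm_minimal d s Y R F"
  then show "nc_edom_st_n d n F = nc_dom_n d n F"
    and "nc_dom_n d n F = {X \<in> mat_tuples d n. amplify s X \<in> fm_domain d s Y R n}"
    using nc_edom_st_eq_dom[OF assms] nc_dom_eq_fm_domain[OF assms] by blast+
qed

end
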